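(* Let $G$ be a finite non-cyclic nilpotent group and $p$ the smallest prime divisor of $|G|$. Then $$\beta(G)\le \frac{|G|}{p}+p-1,$$ except if $p=2$ and $G$ is a dicyclic group, in which case $\beta(G)=\frac{1}{2}|G|+2$.
   Context: For a finite group $G$ and a field $\mathbb F$ whose characteristic does not divide $|G|$, and a finite-dimensional $G$-module $V$ over $\mathbb F$, let $\mathbb F[V]$ be the polynomial algebra on $V$ with the induced $G$-action and $\mathbb F[V]^G$ its subalgebra of invariants. $\beta(G,V)$ is the smallest $s$ such that $\mathbb F[V]^G$ is generated as an algebra by invariants of degree at most $s$, and the Noether number is $\beta(G)=\sup_V\beta(G,V)$ over all finite-dimensional $G$-modules $V$ over the fixed base field $\mathbb F$. The dicyclic group of order $4n$ ($n>1$) is $Dic_{4n}=\langle a,b\mid a^{2n}=1,\ b^2=a^n,\ bab^{-1}=a^{-1}\rangle$. *)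

theory Defs
  imports
    "HOL-Algebra.Algebra"
    "HOL-Library.Poly_Mapping"
    "HOL-Library.Extended_Nat"
    "Jordan_Normal_Form.Matrix"
begin

section \<open>Polynomial algebras and invariants\<close>

text \<open>Formal multivariate polynomials in the variables $x_0, x_1, \ldots$: finitely supported
  maps from exponent vectors to coefficients. (Polynomial functions would be the wrong notion
  over a finite field.)\<close>

type_synonym 'k mpolynomial = "(nat \<Rightarrow>\<^sub>0 nat) \<Rightarrow>\<^sub>0 'k"

definition mvar :: "nat \<Rightarrow> 'k::comm_ring_1 mpolynomial" where
  "mvar i = Poly_Mapping.single (Poly_Mapping.single i 1) 1"

definition mconst :: "'k::comm_ring_1 \<Rightarrow> 'k mpolynomial" where
  "mconst c = Poly_Mapping.single 0 c"

definition poly_algebra :: "nat \<Rightarrow> 'k::comm_ring_1 mpolynomial set" where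
  "poly_algebra n = {f. \<forall>m \<in> Poly_Mapping.keys f. Poly_Mapping.keys m \<subseteq> {..<n}}"

definition total_degree :: "'k::comm_ring_1 mpolynomial \<Rightarrow> nat" where
  "total_degree f =
     Max (insert 0 ((\<lambda>m. \<Sum>i \<in> Poly_Mapping.keys m. Poly_Mapping.lookup m i) ` Poly_Mapping.keys f))"

definition poly_subst ::
  "(nat \<Rightarrow> 'k::comm_ring_1 mpolynomial) \<Rightarrow> 'k mpolynomial \<Rightarrow> 'k mpolynomial" where
  "poly_subst \<sigma> f =
     (\<Sum>m \<in> Poly_Mapping.keys f. mconst (Poly_Mapping.lookup f m) *
        (\<Prod>i \<in> Poly_Mapping.keys m. \<sigma> i ^ Poly_Mapping.lookup m i))"

inductive_set subalgebra_generated ::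
  "'k::comm_ring_1 mpolynomial set \<Rightarrow> 'k mpolynomial set" for S where
  const: "mconst c \<in> subalgebra_generated S"
| gen: "f \<in> S \<Longrightarrow> f \<in> subalgebra_generated S"
| add: "f \<in> subalgebra_generated S \<Longrightarrow> g \<in> subalgebra_generated S \<Longrightarrow>
    f + g \<in> subalgebra_generated S"
| mult: "f \<in> subalgebra_generated S \<Longrightarrow> g \<in> subalgebra_generated S \<Longrightarrow>
    f * g \<in> subalgebra_generated S"

text \<open>A $G$-module structure on $V = k^n$ is a homomorphism from $G$ to the unit group $GL_n(k)$ of
  the matrix ring; up to isomorphism these are all the finite-dimensional $G$-modules over $k$.\<close>

definition representations ::
  "('g, 'b) monoid_scheme \<Rightarrow> nat \<Rightarrow> ('g \<Rightarrow> 'k::field mat) set" where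
  "representations G n = hom G (units_of (ring_mat TYPE('k) n ()))"

text \<open>The induced action on $k[V]$ is $(g \cdot f)(v) = f(g^{-1} v)$; here $x_i$ is the $i$-th
  coordinate function on $V$.\<close>

definition poly_action ::
  "('g, 'b) monoid_scheme \<Rightarrow> nat \<Rightarrow> ('g \<Rightarrow> 'k::field mat) \<Rightarrow> 'g \<Rightarrow>
     'k mpolynomial \<Rightarrow> 'k mpolynomial" where
  "poly_action G n \<rho> g =
     poly_subst (\<lambda>i. \<Sum>j<n. mconst (\<rho> (inv\<^bsub>G\<^esub> g) $$ (i, j)) * mvar j)"

definition invariants ::
  "('g, 'b) monoid_scheme \<Rightarrow> nat \<Rightarrow> ('g \<Rightarrow> 'k::field mat) \<Rightarrow> 'k mpolynomial set" where
  "invariants G n \<rho> =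
     {f \<in> poly_algebra n. \<forall>g \<in> carrier G. poly_action G n \<rho> g f = f}"

section \<open>Noether numbers\<close>

text \<open>An infimum or supremum in \<^typ>\<open>enat\<close>, so that the value is \<open>\<infinity>\<close> whenever no finite degree
  bound exists.\<close>

definition noether_number_rep ::
  "('g, 'b) monoid_scheme \<Rightarrow> nat \<Rightarrow> ('g \<Rightarrow> 'k::field mat) \<Rightarrow> enat" where
  "noether_number_rep G n \<rho> =
     Inf {enat s |s. subalgebra_generated {f \<in> invariants G n \<rho>. total_degree f \<le> s}
                       = invariants G n \<rho>}"

definition noether_number :: "'k::field itself \<Rightarrow> ('g, 'b) monoid_scheme \<Rightarrow> enat" where
  "noether_number T G =
     Sup {noether_number_rep G n \<rho> |n (\<rho> :: 'g \<Rightarrow> 'k mat). \<rho> \<in> representations G n}"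

section \<open>Nilpotent groups\<close>

fun lower_central :: "('g, 'b) monoid_scheme \<Rightarrow> nat \<Rightarrow> 'g set" where
  "lower_central G 0 = carrier G"
| "lower_central G (Suc i) =
     generate G {x \<otimes>\<^bsub>G\<^esub> y \<otimes>\<^bsub>G\<^esub> inv\<^bsub>G\<^esub> x \<otimes>\<^bsub>G\<^esub> inv\<^bsub>G\<^esub> y |x y.
                   x \<in> lower_central G i \<and> y \<in> carrier G}"

definition nilpotent_group :: "('g, 'b) monoid_scheme \<Rightarrow> bool" where
  "nilpotent_group G \<longleftrightarrow> group G \<and> (\<exists>c. lower_central G c = {\<one>\<^bsub>G\<^esub>})"

section \<open>Presentations and dicyclic groups\<close>

text \<open>A letter \<open>(x, True)\<close> stands for the generator \<open>x\<close>, and \<open>(x, False)\<close> for its inverse; a pair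
  \<open>(u, v)\<close> in \<open>R\<close> is the defining relation \<open>u = v\<close>.\<close>

type_synonym 'x word = "('x \<times> bool) list"

inductive word_eq :: "('x word \<times> 'x word) set \<Rightarrow> 'x word \<Rightarrow> 'x word \<Rightarrow> bool" for R where
  relation: "(u, v) \<in> R \<Longrightarrow> word_eq R u v"
| cancel: "word_eq R [(x, s), (x, \<not> s)] []"
| refl: "word_eq R u u"
| sym: "word_eq R u v \<Longrightarrow> word_eq R v u"
| trans: "word_eq R u v \<Longrightarrow> word_eq R v w \<Longrightarrow> word_eq R u w"
| append: "word_eq R u v \<Longrightarrow> word_eq R u' v' \<Longrightarrow> word_eq R (u @ u') (v @ v')"

definition presented_group :: "('x word \<times> 'x word) set \<Rightarrow> 'x word set monoid" where
  "presented_group R =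
     \<lparr>carrier = UNIV // {(u, v). word_eq R u v},
      monoid.mult = (\<lambda>A B. \<Union>u \<in> A. \<Union>v \<in> B. {w. word_eq R (u @ v) w}),
      one = {w. word_eq R [] w}\<rparr>"

lemma presented_group_class:
  "A \<in> carrier (presented_group R) \<longleftrightarrow> (\<exists>u. A = {w. word_eq R u w})"
  by (auto simp: presented_group_def quotient_def)

lemma presented_group_mult:
  "{w. word_eq R u w} \<otimes>\<^bsub>presented_group R\<^esub> {w. word_eq R v w} = {w. word_eq R (u @ v) w}"
  by (auto simp: presented_group_def intro: word_eq.intros)

lemma word_eq_inverse: "\<exists>v. word_eq R (v @ u) []"
proof (induction u)
  case Nil
  show ?case by (metis append_Nil word_eq.refl)
next
  case (Cons l u)
  then obtain v where v: "word_eq R (v @ u) []" by blast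
  obtain x s where l: "l = (x, s)" by (cases l)
  have "word_eq R [(x, \<not> s), (x, s)] []"
    using word_eq.cancel[of R x "\<not> s"] by simp
  then have "word_eq R (v @ [(x, \<not> s), (x, s)] @ u) (v @ [] @ u)"
    by (intro word_eq.append word_eq.refl)
  then have "word_eq R ((v @ [(x, \<not> s)]) @ l # u) []"
    using v l by (auto intro: word_eq.trans)
  then show ?case by blast
qed

lemma group_presented_group: "group (presented_group R)"
proof (rule groupI)
  have one: "\<one>\<^bsub>presented_group R\<^esub> = {w. word_eq R [] w}"
    by (simp add: presented_group_def)
  fix A assume A: "A \<in> carrier (presented_group R)"
  then obtain u where u: "A = {w. word_eq R u w}"
    by (auto simp: presented_group_class)
  show "\<one>\<^bsub>presented_group R\<^esub> \<otimes>\<^bsub>presented_group R\<^esub> A = A"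
    by (simp add: one u presented_group_mult)
  obtain v where "word_eq R (v @ u) []" using word_eq_inverse by blast
  then have "{w. word_eq R (v @ u) w} = {w. word_eq R [] w}"
    by (auto intro: word_eq.sym word_eq.trans)
  then show "\<exists>B \<in> carrier (presented_group R).
      B \<otimes>\<^bsub>presented_group R\<^esub> A = \<one>\<^bsub>presented_group R\<^esub>"
    by (metis one presented_group_class presented_group_mult u)
qed (auto simp: presented_group_class presented_group_mult, auto simp: presented_group_def)

datatype dic_generator = Dic_a | Dic_b

definition dicyclic :: "nat \<Rightarrow> dic_generator word set monoid" where
  "dicyclic n =
     (let a = (Dic_a, True); a' = (Dic_a, False); b = (Dic_b, True); b' = (Dic_b, False)
      in presented_group {(replicate (2 * n) a, []), ([b, b], replicate n a), ([b, a, b'], [a'])})"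

definition is_dicyclic :: "('g, 'b) monoid_scheme \<Rightarrow> bool" where
  "is_dicyclic G \<longleftrightarrow> (\<exists>n>1. G \<cong> dicyclic n)"

end

theory Submission
  imports Defs "HOL-Number_Theory.Number_Theory" "HOL-Computational_Algebra.Computational_Algebra"
    "HOL-Algebra.Algebraic_Closure_Type"
begin

text \<open>Over an algebraic closure, let \<open>M\<close> be the ideal of polynomials without constant term; the
  Noether number of a module is at most \<open>d\<close> once \<open>d\<close>-fold products of elements of \<open>M\<close> lie in the
  ideal generated by the positive-degree invariants. Benson's argument shows that products of
  \<open>[G : H]\<close> many \<open>H\<close>-invariants lie there for every subgroup \<open>H\<close>, so it is enough to study a
  small subgroup \<open>H\<close> acting on \<open>M\<close>. For \<open>H\<close> elementary abelian of rank 2 this is a zero-sum problem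
  for eigenvectors; for the quaternion group, and its product with a cyclic group of odd prime order,
  one exchanges factors between the eigenspaces of an element of order 4.

  A non-cyclic nilpotent group has a subgroup of the first kind, or else its maximal abelian normal
  subgroup is cyclic and self-centralizing; arithmetic with the exponents of the conjugation action
  then yields a quaternion subgroup, and either an element of odd prime order commuting with it
  or the relations of a dicyclic group. For the dicyclic group of order \<open>4 N\<close>, the regular module is
  restricted to a two-dimensional module with coordinates \<open>x, y\<close>: invariants of degree at most
  \<open>2 N + 1\<close> become symmetric in \<open>x, y\<close>, but \<open>x y (x\<^sup>2\<^sup>N - y\<^sup>2\<^sup>N)\<close> is the restriction of an invariant of
  degree \<open>2 N + 2\<close>.\<close>

section \<open>Powers of ideals\<close>

text \<open>Benson's argument consumes [G : H] invariants of H at once, so a degree bound for H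
  alone is too weak: for every k one needs a number d(k) such that d(k)-fold products of elements of
  M lie in the k-th power of the ideal generated by the H-invariants in M. The values obtained are k
  q + q - 1 for C_q x C_q, 4 k + 2 for the quaternion group Q8, and 4 r k + 1 for Q8 x C_r with r an
  odd prime. With k = [G : H] and |H| at least q^2, 8, 8 r they become |G|/q + q - 1, |G|/2 + 2 and
  |G|/2 + 1. The bound from Q8 alone is one too large for a group that is not dicyclic, and
  composing it with the bound r k for C_r only gives 4 r k + 2. Saving that single factor is the
  hardest part: the weights of the factors under C_r are used to form an invariant earlier than
  counting factors promises. Eigenvectors require the algebraic closure, but generation has to be
  proved over the given field; a linear retraction of the closure onto the field transports it
  back.\<close>

global_interpretation ideal: Modules.module "(*) :: 'r::comm_ring_1 \<Rightarrow> 'r \<Rightarrow> 'r"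
  by unfold_locales (simp_all add: algebra_simps)

declare ideal.scale_scale [simp del]

text \<open>With the ring as a module over itself, \<open>ideal.span\<close> is the generated ideal,
  so this is the \<open>s\<close>-th power of the ideal generated by \<open>S\<close>.
  \<open>S\<close> is an arbitrary set, so that eigenvectors or invariants can serve as generators
  directly; for \<open>s = 0\<close> the empty product gives the whole ring.\<close>

definition ideal_power :: "'r::comm_ring_1 set \<Rightarrow> nat \<Rightarrow> 'r set" where
  "ideal_power S s = ideal.span {\<Prod>i<s. f i |f. \<forall>i<s. f i \<in> S}"

lemma ideal_power_prod:
  assumes "finite I" "card I = s" "\<And>i. i \<in> I \<Longrightarrow> f i \<in> S"
  shows "prod f I \<in> ideal_power S s"
proof -
  obtain h where h: "bij_betw h {..<s} I"
    using assms(1,2) ex_bij_betw_nat_finite by (metis atLeast0LessThan)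
  have "prod f I = (\<Prod>i<s. f (h i))"
    using prod.reindex_bij_betw[OF h, of f] by simp
  moreover have "\<forall>i<s. f (h i) \<in> S"
    using h assms(3) by (auto simp: bij_betw_def)
  ultimately show ?thesis unfolding ideal_power_def
    by (intro ideal.span_base) blast
qed

lemma ideal_power_subspace: "ideal.subspace (ideal_power S s)"
  by (simp add: ideal_power_def)

lemma ideal_power_add: "x \<in> ideal_power S s \<Longrightarrow> y \<in> ideal_power S s \<Longrightarrow> x + y \<in> ideal_power S s"
  and ideal_power_diff: "x \<in> ideal_power S s \<Longrightarrow> y \<in> ideal_power S s \<Longrightarrow> x - y \<in> ideal_power S s"
  and ideal_power_scale: "x \<in> ideal_power S s \<Longrightarrow> r * x \<in> ideal_power S s"
  and ideal_power_uminus: "x \<in> ideal_power S s \<Longrightarrow> - x \<in> ideal_power S s"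
  and ideal_power_zero: "0 \<in> ideal_power S s"
  unfolding ideal_power_def
  by (rule ideal.span_add ideal.span_diff ideal.span_scale ideal.span_neg ideal.span_zero; assumption)+

lemma ideal_power_scale2: "x \<in> ideal_power S s \<Longrightarrow> x * r \<in> ideal_power S s"
  using ideal_power_scale[of x S s r] by (simp add: mult.commute)

lemma ideal_power_sum:
  "(\<And>i. i \<in> I \<Longrightarrow> f i \<in> ideal_power S s) \<Longrightarrow> sum f I \<in> ideal_power S s"
  unfolding ideal_power_def by (rule ideal.span_sum)

lemma ideal_power_least:
  assumes "ideal.subspace J" "\<And>f. (\<And>i. i < s \<Longrightarrow> f i \<in> S) \<Longrightarrow> (\<Prod>i<s. f i) \<in> J"
  shows "ideal_power S s \<subseteq> J"
  unfolding ideal_power_def using assms by (intro ideal.span_minimal) auto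

lemma subspace_mult_left: "ideal.subspace J \<Longrightarrow> ideal.subspace {x. (y::'r::comm_ring_1) * x \<in> J}"
  unfolding ideal.subspace_def by (auto simp: distrib_left mult.left_commute)

lemma ideal_power_0: "ideal_power S 0 = UNIV"
proof -
  have "1 \<in> ideal_power S 0"
    using ideal_power_prod[of "{}" 0 "\<lambda>_. 0" S] by simp
  then show ?thesis using ideal_power_scale by (metis UNIV_eq_I mult.right_neutral)
qed

lemma ideal_power_base: "x \<in> S \<Longrightarrow> x \<in> ideal_power S 1"
  using ideal_power_prod[of "{0::nat}" 1 "\<lambda>_. x" S] by simp

lemma ideal_power_mult:
  assumes "x \<in> ideal_power S a" "y \<in> ideal_power S b"
  shows "x * y \<in> ideal_power S (a + b)"
proof -
  have *: "(\<Prod>i<a. f i) * (\<Prod>i<b. g i) \<in> ideal_power S (a + b)"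
    if f: "\<And>i. i < a \<Longrightarrow> f i \<in> S" and g: "\<And>i. i < b \<Longrightarrow> g i \<in> S" for f g :: "nat \<Rightarrow> 'a"
  proof -
    have "(\<Prod>i<a. f i) * (\<Prod>i<b. g i) = prod (case_sum f g) ({..<a} <+> {..<b})"
      by (subst prod.Plus) auto
    also have "\<dots> \<in> ideal_power S (a + b)"
      using f g by (intro ideal_power_prod) (auto simp: card_Plus)
    finally show ?thesis .
  qed
  have "(\<Prod>i<a. f i) * y \<in> ideal_power S (a + b)" if f: "\<And>i. i < a \<Longrightarrow> f i \<in> S" for f
  proof -
    have "ideal_power S b \<subseteq> {y. (\<Prod>i<a. f i) * y \<in> ideal_power S (a + b)}"
      by (intro ideal_power_least subspace_mult_left ideal_power_subspace) (auto intro: * f)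
    then show ?thesis using assms(2) by blast
  qed
  then have "ideal_power S a \<subseteq> {x. y * x \<in> ideal_power S (a + b)}"
    by (intro ideal_power_least subspace_mult_left ideal_power_subspace)
      (auto simp: mult.commute)
  then show ?thesis using assms(1) by (auto simp: mult.commute)
qed

lemma ideal_power_antimono: "a \<le> b \<Longrightarrow> ideal_power S b \<subseteq> ideal_power S a"
proof (rule ideal_power_least[OF ideal_power_subspace])
  fix f assume ab: "a \<le> b" and f: "\<And>i. i < b \<Longrightarrow> f i \<in> S"
  have "(\<Prod>i<b. f i) = (\<Prod>i<a. f i) * prod f {a..<b}"
    using ab by (metis atLeast0LessThan prod.atLeastLessThan_concat zero_le)
  moreover have "(\<Prod>i<a. f i) \<in> ideal_power S a"
    using f ab by (intro ideal_power_prod) auto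
  ultimately show "(\<Prod>i<b. f i) \<in> ideal_power S a"
    using ideal_power_scale2 by metis
qed

lemma ideal_power_mult_ge:
  "x \<in> ideal_power S a \<Longrightarrow> y \<in> ideal_power S b \<Longrightarrow> c \<le> a + b \<Longrightarrow> x * y \<in> ideal_power S c"
  using ideal_power_mult ideal_power_antimono by blast

lemma ideal_power_prod_mult:
  assumes "S \<subseteq> ideal_power T a" "finite I" "card I = s" "\<And>i. i \<in> I \<Longrightarrow> f i \<in> S"
  shows "prod f I \<in> ideal_power T (a * s)"
  using assms(2,3,4)
proof (induction I arbitrary: s rule: finite_induct)
  case empty
  then show ?case by (simp add: ideal_power_0)
next
  case (insert x F)
  have "f x * prod f F \<in> ideal_power T (a + a * card F)"
    using insert assms(1) by (intro ideal_power_mult) auto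
  then show ?case using insert.hyps insert.prems(1) by auto
qed

lemma ideal_power_subset_mult:
  assumes "S \<subseteq> ideal_power T a"
  shows "ideal_power S s \<subseteq> ideal_power T (a * s)"
  by (intro ideal_power_least ideal_power_subspace ideal_power_prod_mult[OF assms]) auto

text \<open>Reduces products of arbitrary elements to products of members of a spanning set; below,
  the spanning set consists of eigenvectors.\<close>

lemma ideal_power_mono_span: "S \<subseteq> ideal.span T \<Longrightarrow> ideal_power S s \<subseteq> ideal_power T s"
proof -
  assume "S \<subseteq> ideal.span T"
  moreover have "ideal.span T \<subseteq> ideal_power T 1"
    by (intro ideal.span_minimal ideal_power_subspace subsetI ideal_power_base)
  ultimately show ?thesis using ideal_power_subset_mult[of S T 1 s] by auto
qed

lemma ideal_power_mono: "S \<subseteq> T \<Longrightarrow> ideal_power S s \<subseteq> ideal_power T s"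
  using ideal_power_mono_span ideal.span_superset by blast

text \<open>A product of \<open>a * k\<close> factors is cut into \<open>k\<close> blocks of length
  \<open>a\<close>, so that a statement about one invariant yields the one about \<open>k\<close>
  invariants.\<close>

lemma ideal_power_times:
  assumes "ideal_power S a \<subseteq> ideal_power T b"
  shows "ideal_power S (a * k) \<subseteq> ideal_power T (b * k)"
proof (induction k)
  case 0
  then show ?case by (simp add: ideal_power_0)
next
  case (Suc k)
  show ?case
  proof (rule ideal_power_least[OF ideal_power_subspace])
    fix f assume f: "\<And>i. i < a * Suc k \<Longrightarrow> f i \<in> S"
    have "(\<Prod>i<a * Suc k. f i) = (\<Prod>i<a. f i) * prod f {a..<a * Suc k}"
      by (metis atLeast0LessThan prod.atLeastLessThan_concat zero_le le_add1 mult_Suc_right)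
    also have "\<dots> \<in> ideal_power T (b + b * k)"
    proof (rule ideal_power_mult)
      show "(\<Prod>i<a. f i) \<in> ideal_power T b"
        using f assms by (intro subsetD[OF assms] ideal_power_prod) auto
      show "prod f {a..<a * Suc k} \<in> ideal_power T (b * k)"
        using f by (intro subsetD[OF Suc] ideal_power_prod) auto
    qed
    finally show "(\<Prod>i<a * Suc k. f i) \<in> ideal_power T (b * Suc k)" by simp
  qed
qed

section \<open>Zero-sum subsequences\<close>

text \<open>Expanding one linear factor forces one more element of \<open>A\<close> into
  \<open>S\<close>, so after all \<open>D\<close> factors at most \<open>card B + D\<close> elements
  are forced. Some element of \<open>A\<close> is still free, and putting it in or out cancels the
  terms in pairs. The set \<open>B\<close> records the forced elements for the induction.\<close>

lemma alternating_sum_supersets_prod: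
  fixes c :: "nat \<Rightarrow> 'i \<Rightarrow> int"
  assumes "finite A" "B \<subseteq> A" "card B + D < card A"
  shows "(\<Sum>S | B \<subseteq> S \<and> S \<subseteq> A. (-1) ^ card S * (\<Prod>t<D. \<Sum>i\<in>S. c t i)) = 0"
  using assms(2,3)
proof (induction D arbitrary: B)
  case 0
  then obtain x where x: "x \<in> A" "x \<notin> B" by (metis add_0_right less_irrefl subsetI subset_antisym)
  let ?P = "{S. B \<subseteq> S \<and> S \<subseteq> A - {x}}"
  have fin: "finite ?P" using assms(1) by (auto intro: finite_subset[of _ "Pow A"])
  have eq: "{S. B \<subseteq> S \<and> S \<subseteq> A} = ?P \<union> insert x ` ?P"
  proof (intro equalityI subsetI)
    fix S assume S: "S \<in> {S. B \<subseteq> S \<and> S \<subseteq> A}"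
    show "S \<in> ?P \<union> insert x ` ?P"
    proof (cases "x \<in> S")
      case True
      then have "S = insert x (S - {x})" "S - {x} \<in> ?P" using S x by auto
      then show ?thesis by blast
    qed (use S in auto)
  qed (use 0 x in auto)
  have "(\<Sum>S | B \<subseteq> S \<and> S \<subseteq> A. (-1::int) ^ card S)
      = (\<Sum>S\<in>?P. (-1) ^ card S) + (\<Sum>S\<in>insert x ` ?P. (-1) ^ card S)"
    unfolding eq using fin by (intro sum.union_disjoint) auto
  also have "(\<Sum>S\<in>insert x ` ?P. (-1::int) ^ card S) = (\<Sum>S\<in>?P. (-1) ^ card (insert x S))"
    by (rule sum.reindex_cong[of "insert x"]) (auto simp: inj_on_def)
  also have "\<dots> = (\<Sum>S\<in>?P. - ((-1) ^ card S))"
  proof (rule sum.cong[OF HOL.refl])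
    fix S assume "S \<in> ?P"
    then have "finite S" "x \<notin> S" using assms(1) by (auto intro: finite_subset)
    then show "(-1::int) ^ card (insert x S) = - ((-1) ^ card S)" by simp
  qed
  finally show ?case by (simp add: sum_negf)
next
  case (Suc D)
  have fin: "finite {S. B \<subseteq> S \<and> S \<subseteq> A}"
    using assms(1) by (auto intro: finite_subset[of _ "Pow A"])
  \<comment> \<open>The last factor is written as a sum over all \<open>i\<close> in
    \<open>A\<close> subject to \<open>i \<in> S\<close>; after the sums are swapped, this condition
    enlarges \<open>B\<close> to \<open>insert i B\<close>.\<close>
  have "(\<Sum>S | B \<subseteq> S \<and> S \<subseteq> A. (-1) ^ card S * (\<Prod>t<Suc D. \<Sum>i\<in>S. c t i))
     = (\<Sum>S | B \<subseteq> S \<and> S \<subseteq> A. \<Sum>i\<in>A. if i \<in> S then c D i * ((-1) ^ card S * (\<Prod>t<D. \<Sum>i\<in>S. c t i)) else 0)"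
  proof (rule sum.cong[OF HOL.refl])
    fix S assume "S \<in> {S. B \<subseteq> S \<and> S \<subseteq> A}"
    then have "A \<inter> S = S" by auto
    then show "(-1) ^ card S * (\<Prod>t<Suc D. \<Sum>i\<in>S. c t i) =
      (\<Sum>i\<in>A. if i \<in> S then c D i * ((-1) ^ card S * (\<Prod>t<D. \<Sum>i\<in>S. c t i)) else 0)"
      using assms(1) by (subst sum.inter_restrict[symmetric])
        (auto simp: sum_distrib_right sum_distrib_left mult_ac)
  qed
  also have "\<dots> = (\<Sum>i\<in>A. \<Sum>S | B \<subseteq> S \<and> S \<subseteq> A.
      if i \<in> S then c D i * ((-1) ^ card S * (\<Prod>t<D. \<Sum>i\<in>S. c t i)) else 0)"
    by (rule sum.swap)
  also have "\<dots> = (\<Sum>i\<in>A. c D i * (\<Sum>S | insert i B \<subseteq> S \<and> S \<subseteq> A.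
      (-1) ^ card S * (\<Prod>t<D. \<Sum>i\<in>S. c t i)))"
  proof (rule sum.cong[OF HOL.refl])
    fix i
    have "(\<Sum>S | B \<subseteq> S \<and> S \<subseteq> A. if S \<in> {S. i \<in> S} then c D i * ((-1) ^ card S * (\<Prod>t<D. \<Sum>i\<in>S. c t i)) else 0)
       = (\<Sum>S\<in>{S. B \<subseteq> S \<and> S \<subseteq> A} \<inter> {S. i \<in> S}. c D i * ((-1) ^ card S * (\<Prod>t<D. \<Sum>i\<in>S. c t i)))"
      using sum.inter_restrict[OF fin, of _ "{S. i \<in> S}", symmetric] by fast
    moreover have "{S. B \<subseteq> S \<and> S \<subseteq> A} \<inter> {S. i \<in> S} = {S. insert i B \<subseteq> S \<and> S \<subseteq> A}" by auto
    ultimately show "(\<Sum>S | B \<subseteq> S \<and> S \<subseteq> A. if i \<in> S then c D i * ((-1) ^ card S * (\<Prod>t<D. \<Sum>i\<in>S. c t i)) else 0)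
       = c D i * (\<Sum>S | insert i B \<subseteq> S \<and> S \<subseteq> A. (-1) ^ card S * (\<Prod>t<D. \<Sum>i\<in>S. c t i))"
      by (simp add: sum_distrib_left)
  qed
  also have "\<dots> = 0"
  proof (rule sum.neutral, intro ballI)
    fix i assume i: "i \<in> A"
    have "card (insert i B) \<le> Suc (card B)" by (rule card_insert_le_m1) auto
    then show "c D i * (\<Sum>S | insert i B \<subseteq> S \<and> S \<subseteq> A.
      (-1) ^ card S * (\<Prod>t<D. \<Sum>i\<in>S. c t i)) = 0"
      using Suc.prems i by (subst Suc.IH) auto
  qed
  finally show ?case .
qed

text \<open>The Chevalley--Warning type argument: modulo \<open>q\<close>, the function
  \<open>S \<mapsto> \<Prod>\<^sub>j (1 - (\<Sum>\<^sub>i\<^sub>\<in>\<^sub>S e\<^sub>j i) ^ (q - 1))\<close> is the indicator of the zero sums, and it is a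
  polynomial of degree \<open>d (q - 1)\<close> in the indicator variables of \<open>S\<close>.\<close>

lemma zero_sum_subset_elementary_abelian:
  fixes e :: "nat \<Rightarrow> 'i \<Rightarrow> int"
  assumes q: "Factorial_Ring.prime (q::nat)" and I: "finite I" "d * (q - 1) < card I"
  shows "\<exists>S\<subseteq>I. S \<noteq> {} \<and> (\<forall>j<d. int q dvd (\<Sum>i\<in>S. e j i))"
proof (rule ccontr)
  assume no: "\<not> ?thesis"
  define w where "w j S = (\<Sum>i\<in>S. e j i)" for j S
  have q1: "q > 1" using q by (rule prime_gt_1_nat)
  define g where "g T S = (\<Prod>j\<in>T. - (w j S ^ (q - 1)))" for T S
  have expand: "(\<Prod>j<d. 1 - w j S ^ (q - 1)) = (\<Sum>T\<in>Pow {..<d}. g T S)" for S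
  proof -
    have "(\<Prod>j<d. - (w j S ^ (q - 1)) + 1) = (\<Sum>T\<in>Pow {..<d}. (\<Prod>j\<in>T. - (w j S ^ (q - 1))) * (\<Prod>j\<in>{..<d} - T. 1))"
      by (rule prod_add) simp
    then show ?thesis by (simp add: g_def)
  qed
  have zero: "(\<Sum>S\<in>Pow I. (-1) ^ card S * g T S) = 0" if T: "T \<subseteq> {..<d}" for T
  proof -
    have fT: "finite T" using T finite_subset by blast
    have cT: "card T \<le> d" using card_mono[OF _ T] by simp
    define m where "m = card T * (q - 1)"
    obtain h where h: "bij_betw h {..<m} (T \<times> {..<q - 1})"
      using ex_bij_betw_nat_finite[of "T \<times> {..<q - 1}"] fT
      by (auto simp: m_def card_cartesian_product atLeast0LessThan)
    have gT: "g T S = (-1) ^ card T * (\<Prod>t<m. \<Sum>i\<in>S. e (fst (h t)) i)" for S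
    proof -
      have "(\<Prod>t<m. w (fst (h t)) S) = (\<Prod>p\<in>T \<times> {..<q - 1}. w (fst p) S)"
        using prod.reindex_bij_betw[OF h, of "\<lambda>p. w (fst p) S"] by simp
      also have "\<dots> = (\<Prod>j\<in>T. \<Prod>u\<in>{..<q - 1}. w j S)"
        by (simp only: prod.cartesian_product case_prod_unfold)
      also have "\<dots> = (\<Prod>j\<in>T. w j S ^ (q - 1))" by simp
      finally have "(\<Prod>t<m. w (fst (h t)) S) = (\<Prod>j\<in>T. w j S ^ (q - 1))" .
      moreover have "g T S = (\<Prod>j\<in>T. (-1) * (w j S ^ (q - 1)))" by (simp add: g_def)
      ultimately show ?thesis
        by (simp only: prod.distrib w_def prod_constant)
    qed
    have "m \<le> d * (q - 1)" unfolding m_def using cT by simp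
    then have "(\<Sum>S | {} \<subseteq> S \<and> S \<subseteq> I. (-1) ^ card S * (\<Prod>t<m. \<Sum>i\<in>S. e (fst (h t)) i)) = 0"
      using I by (intro alternating_sum_supersets_prod) auto
    then have "(\<Sum>S\<in>Pow I. (-1) ^ card S * (\<Prod>t<m. \<Sum>i\<in>S. e (fst (h t)) i)) = 0"
      by (simp add: Pow_def)
    then have "(-1) ^ card T * (\<Sum>S\<in>Pow I. (-1) ^ card S * (\<Prod>t<m. \<Sum>i\<in>S. e (fst (h t)) i)) = 0"
      by simp
    then show ?thesis unfolding gT by (simp add: sum_distrib_left mult_ac)
  qed
  have "(\<Sum>S\<in>Pow I. (-1) ^ card S * (\<Prod>j<d. 1 - w j S ^ (q - 1)))
      = (\<Sum>T\<in>Pow {..<d}. \<Sum>S\<in>Pow I. (-1) ^ card S * g T S)"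
    unfolding expand sum_distrib_left by (rule sum.swap)
  also have "\<dots> = 0" using zero by (intro sum.neutral) auto
  finally have total: "(\<Sum>S\<in>Pow I. (-1) ^ card S * (\<Prod>j<d. 1 - w j S ^ (q - 1))) = 0" .
  have fermat: "int q dvd 1 - x ^ (q - 1)" if "\<not> int q dvd x" for x
  proof -
    have "[x ^ (q - 1) = 1] (mod int q)"
    proof -
      define y where "y = nat (x mod int q)"
      have y: "int y = x mod int q" using q1 by (simp add: y_def)
      have "\<not> q dvd y"
        using that by (simp add: y dvd_mod_iff flip: int_dvd_int_iff)
      then have "[y ^ (q - 1) = 1] (mod q)" using q fermat_theorem by blast
      then have "[int (y ^ (q - 1)) = int 1] (mod int q)"
        by (simp only: cong_int_iff)
      then show ?thesis by (simp add: y cong_def power_mod)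
    qed
    then have "[1 = x ^ (q - 1)] (mod int q)" by (rule cong_sym)
    then show ?thesis by (simp only: cong_iff_dvd_diff)
  qed
  have rest: "int q dvd (-1) ^ card S * (\<Prod>j<d. 1 - w j S ^ (q - 1))" if "S \<in> Pow I - {{}}" for S
  proof -
    have "S \<subseteq> I" "S \<noteq> {}" using that by auto
    then have "\<not> (\<forall>j<d. int q dvd w j S)" using no unfolding w_def by metis
    then obtain j where j: "j < d" "\<not> int q dvd w j S" by auto
    then have "1 - w j S ^ (q - 1) dvd (\<Prod>j<d. 1 - w j S ^ (q - 1))"
      by (intro dvd_prodI) auto
    then have "int q dvd (\<Prod>j<d. 1 - w j S ^ (q - 1))"
      using fermat[OF j(2)] by (rule dvd_trans[rotated])
    then show ?thesis by simp
  qed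
  have "(\<Sum>S\<in>Pow I. (-1) ^ card S * (\<Prod>j<d. 1 - w j S ^ (q - 1)))
     = 1 + (\<Sum>S\<in>Pow I - {{}}. (-1) ^ card S * (\<Prod>j<d. 1 - w j S ^ (q - 1)))"
    using I q1 by (subst sum.remove[of _ "{}"]) (auto simp: w_def power_0_left)
  moreover have "int q dvd (\<Sum>S\<in>Pow I - {{}}. (-1) ^ card S * (\<Prod>j<d. 1 - w j S ^ (q - 1)))"
    using rest by (rule dvd_sum)
  ultimately have "int q dvd 1" using total
    by (simp add: dvd_minus_iff add_eq_0_iff)
  then show False using q1 by simp
qed

text \<open>\<open>2 * (q - 1) + 1\<close> is the Davenport constant of C_q x C_q.\<close>

lemma zero_sum_pair:
  fixes e e' :: "'i \<Rightarrow> int"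
  assumes "Factorial_Ring.prime (q::nat)" and I: "finite I" "2 * (q - 1) < card I"
  shows "\<exists>S\<subseteq>I. S \<noteq> {} \<and> int q dvd sum e S \<and> int q dvd sum e' S"
proof -
  define c where "c j = (if j = 0 then e else e')" for j :: nat
  obtain S where "S \<subseteq> I \<and> S \<noteq> {} \<and> (\<forall>j<2. int q dvd sum (c j) S)"
    using zero_sum_subset_elementary_abelian[OF assms, of c] ..
  then have "S \<subseteq> I" "S \<noteq> {}" "int q dvd sum (c 0) S" "int q dvd sum (c 1) S" by auto
  then show ?thesis unfolding c_def by auto
qed

text \<open>A third coordinate that is constantly \<open>1\<close> makes the length of the zero sum
  divisible by \<open>q\<close>; within \<open>3 * (q - 1) + 1\<close> elements that length is
  \<open>q\<close> or \<open>2 * q\<close>. In the second case the zero sum splits into two, one of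
  which has length at most \<open>q\<close>.\<close>

lemma short_zero_sum_pair:
  fixes e e' :: "'i \<Rightarrow> int"
  assumes q: "Factorial_Ring.prime (q::nat)" and I: "finite I" "3 * (q - 1) < card I"
  shows "\<exists>S\<subseteq>I. S \<noteq> {} \<and> card S \<le> q \<and> int q dvd sum e S \<and> int q dvd sum e' S"
proof -
  have q1: "q > 1" using q by (rule prime_gt_1_nat)
  obtain I' where I': "I' \<subseteq> I" "card I' = 3 * (q - 1) + 1"
    using I by (metis Suc_eq_plus1 Suc_leI obtain_subset_with_card_n)
  have fI': "finite I'" using I' I finite_subset by blast
  define c where "c j = (if j = 0 then e else if j = 1 then e' else (\<lambda>_. 1))" for j :: nat
  obtain S where "S \<subseteq> I' \<and> S \<noteq> {} \<and> (\<forall>j<3. int q dvd sum (c j) S)"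
    using zero_sum_subset_elementary_abelian[OF q fI', of 3 c] I' by auto
  then have S: "S \<subseteq> I'" "S \<noteq> {}" and *: "\<forall>j<3. int q dvd sum (c j) S" by auto
  have e: "int q dvd sum e S" "int q dvd sum e' S"
    using *[rule_format, of 0] *[rule_format, of 1] by (auto simp: c_def)
  have "int q dvd int (card S)" using *[rule_format, of 2] by (simp add: c_def)
  then have "q dvd card S" by (simp only: int_dvd_int_iff)
  then obtain u where u: "card S = q * u" by (rule dvdE)
  have fS: "finite S" using S fI' finite_subset by blast
  have "card S \<le> 3 * (q - 1) + 1" using S fI' I' card_mono by metis
  also have "\<dots> < q * 3" using q1 by simp
  finally have "q * u < q * 3" unfolding u .
  then have "u < 3" by (rule mult_less_cancel1[THEN iffD1, THEN conjunct2])
  moreover have "u \<noteq> 0" using u S fS by auto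
  ultimately consider "u = 1" | "u = 2" by linarith
  then show ?thesis
  proof cases
    case 1
    then show ?thesis using S I' e u by (intro exI[of _ S]) simp
  next
    case 2
    \<comment> \<open>Discarding one element leaves \<open>2 * q - 1\<close>, still enough for a
      zero sum \<open>T\<close>, and keeps the complement \<open>S - T\<close> nonempty.\<close>
    obtain x where x: "x \<in> S" using S by auto
    have "2 * (q - 1) < card (S - {x})" using u 2 x fS q1 by simp
    then obtain T where T: "T \<subseteq> S - {x}" "T \<noteq> {}" "int q dvd sum e T" "int q dvd sum e' T"
      using zero_sum_pair[OF q, of "S - {x}" e e'] fS by auto
    have TS: "T \<subseteq> S" using T by auto
    have fT: "finite T" using TS fS finite_subset by blast
    show ?thesis
    proof (cases "card T \<le> q")
      case True
      then show ?thesis using T TS S I' by (intro exI[of _ T]) simp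
    next
      case False
      have "card (S - T) = card S - card T" using TS fT by (simp add: card_Diff_subset)
      then have "card (S - T) \<le> q" using False u 2 by simp
      moreover have "sum h (S - T) = sum h S - sum h T" for h :: "'i \<Rightarrow> int"
        using TS fS by (simp add: sum_diff)
      moreover have "x \<in> S - T" "S - T \<subseteq> I" using x T(1) S(1) I'(1) by auto
      ultimately show ?thesis using T e
        by (intro exI[of _ "S - T"]) (auto simp: dvd_diff)
    qed
  qed
qed

text \<open>Zero sums of length at most \<open>q\<close> are split off while more than one is still
  wanted; at least \<open>3 * q - 1\<close> elements are then available. The last one is taken
  without a length bound from \<open>2 * q - 1\<close> elements, which accounts for the summand
  \<open>q - 1\<close>.\<close>

lemma prod_in_ideal_power_of_zero_sums:
  fixes f :: "'i \<Rightarrow> 'r::comm_ring_1" and e e' :: "'i \<Rightarrow> int"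
  assumes q: "Factorial_Ring.prime (q::nat)"
    and T: "\<And>S. finite S \<Longrightarrow> S \<noteq> {} \<Longrightarrow> S \<subseteq> I \<Longrightarrow> int q dvd sum e S \<Longrightarrow> int q dvd sum e' S \<Longrightarrow> prod f S \<in> T"
    and "finite I" "k * q + q - 1 \<le> card I"
  shows "prod f I \<in> ideal_power T k"
  using assms(2-)
proof (induction k arbitrary: I)
  case 0
  then show ?case by (simp add: ideal_power_0)
next
  case (Suc k)
  have q1: "q > 1" using q by (rule prime_gt_1_nat)
  have ex: "\<exists>S\<subseteq>I. S \<noteq> {} \<and> (k > 0 \<longrightarrow> card S \<le> q) \<and> int q dvd sum e S \<and> int q dvd sum e' S"
  proof (cases "k = 0")
    case True
    then have "2 * (q - 1) < card I" using Suc.prems(3) q1 by (simp add: algebra_simps)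
    then show ?thesis using zero_sum_pair[OF q, of I e e'] Suc.prems True by auto
  next
    case False
    then obtain l where "k = Suc l" using not0_implies_Suc by blast
    then have "3 * (q - 1) < card I" using Suc.prems(3) q1 by (simp add: algebra_simps)
    then show ?thesis using short_zero_sum_pair[OF q, of I e e'] Suc.prems by auto
  qed
  then obtain S where S: "S \<subseteq> I" "S \<noteq> {}" "k > 0 \<longrightarrow> card S \<le> q" "int q dvd sum e S" "int q dvd sum e' S"
    by blast
  have fS: "finite S" using S Suc.prems finite_subset by blast
  have "prod f (I - S) \<in> ideal_power T k"
  proof (cases "k = 0")
    case False
    have "card (I - S) = card I - card S" using S fS by (simp add: card_Diff_subset)
    then show ?thesis using Suc.prems S False
      by (intro Suc.IH) (auto simp: algebra_simps intro: Suc.prems(1))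
  qed (simp add: ideal_power_0)
  moreover have "prod f S \<in> ideal_power T 1"
    using Suc.prems S fS by (intro ideal_power_base) auto
  ultimately have "prod f S * prod f (I - S) \<in> ideal_power T (1 + k)" by (rule ideal_power_mult[rotated])
  then show ?case using prod.subset_diff[OF S(1) Suc.prems(2), of f] by (simp add: mult.commute)
qed

section \<open>Eigenvector decompositions\<close>

lemma roots_of_unity_card:
  assumes "r > 0"
  shows "finite {x::'k::field. x ^ r = 1}" "card {x::'k. x ^ r = 1} \<le> r"
proof -
  let ?P = "Polynomial.monom 1 r - 1 :: 'k poly"
  have "poly.coeff ?P r = 1" using assms by (simp add: coeff_1)
  then have P0: "?P \<noteq> 0" by (metis Polynomial.coeff_0 zero_neq_one)
  have eq: "{x::'k. x ^ r = 1} = {x. poly ?P x = 0}" by (simp add: poly_monom)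
  show "finite {x::'k. x ^ r = 1}" unfolding eq by (rule poly_roots_finite[OF P0])
  have "card {x. poly ?P x = 0} \<le> Polynomial.degree ?P" by (rule card_poly_roots_bound[OF P0])
  also have "\<dots> \<le> r" by (intro degree_diff_le) (auto simp: degree_monom_le)
  finally show "card {x::'k. x ^ r = 1} \<le> r" unfolding eq .
qed

text \<open>If no nonempty subproduct is \<open>1\<close>, multiplication by a further
  \<open>t x\<close> cannot map the set of subproducts to itself, since then \<open>1\<close> would
  be \<open>t x\<close> times a subproduct. So each further element contributes a new subproduct,
  and there are at most \<open>r\<close> roots of unity to accommodate them.\<close>

lemma prod_roots_of_unity_growth:
  fixes t :: "'i \<Rightarrow> 'k::field"
  assumes "finite I" "\<And>i. i \<in> I \<Longrightarrow> t i ^ r = 1" "r > 0" "I0 \<subseteq> I"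
    and no: "\<And>S. S \<subseteq> I \<Longrightarrow> S \<noteq> {} \<Longrightarrow> prod t S \<noteq> 1"
  shows "card (prod t ` Pow I0) + card (I - I0) \<le> r"
proof -
  have grow: "card (prod t ` Pow I0) + card J \<le> card (prod t ` Pow (I0 \<union> J))"
    if "finite J" "J \<subseteq> I - I0" for J
    using that
  proof (induction J rule: finite_induct)
    case (insert x J)
    let ?I = "I0 \<union> J"
    let ?X = "prod t ` Pow ?I"
    have fin: "finite ?I" using insert.prems assms(1,4) by (auto intro: finite_subset[of _ I])
    have x: "x \<notin> ?I" "x \<in> I" using insert by auto
    have tx: "t x \<noteq> 0" using assms(2,3) x by (metis power_0_left less_not_refl zero_neq_one)
    have "(\<lambda>y. t x * y) ` ?X \<noteq> ?X"
    proof
      assume eq: "(\<lambda>y. t x * y) ` ?X = ?X"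
      have "prod t {} \<in> ?X" by blast
      then have "1 \<in> (\<lambda>y. t x * y) ` ?X" using eq by simp
      then obtain S where S: "S \<subseteq> ?I" "t x * prod t S = 1" by auto
      have "finite S" "x \<notin> S" using S fin x finite_subset by auto
      then have "prod t (insert x S) = 1" using S by simp
      moreover have "insert x S \<subseteq> I" using S x insert.prems assms(4) by auto
      ultimately show False using no by blast
    qed
    moreover have "card ((\<lambda>y. t x * y) ` ?X) = card ?X"
      using tx by (intro card_image) (auto simp: inj_on_def)
    ultimately have "\<not> (\<lambda>y. t x * y) ` ?X \<subseteq> ?X"
      using fin card_subset_eq[of ?X "(\<lambda>y. t x * y) ` ?X"] by auto
    then obtain S where S: "S \<subseteq> ?I" "t x * prod t S \<notin> ?X" by auto
    have "finite S" "x \<notin> S" using S fin x finite_subset by auto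
    then have "t x * prod t S = prod t (insert x S)" by simp
    then have "t x * prod t S \<in> prod t ` Pow (I0 \<union> insert x J)" using S by blast
    then have "insert (t x * prod t S) ?X \<subseteq> prod t ` Pow (I0 \<union> insert x J)" by auto
    then have "card (insert (t x * prod t S) ?X) \<le> card (prod t ` Pow (I0 \<union> insert x J))"
      using fin by (intro card_mono) auto
    then have "Suc (card ?X) \<le> card (prod t ` Pow (I0 \<union> insert x J))" using S fin by simp
    then show ?case using insert by auto
  qed simp
  have "card (prod t ` Pow I0) + card (I - I0) \<le> card (prod t ` Pow (I0 \<union> (I - I0)))"
    using assms by (intro grow) auto
  also have "\<dots> \<le> card {x::'k. x ^ r = 1}"
  proof (rule card_mono[OF roots_of_unity_card(1)[OF assms(3)]], clarify)
    fix S assume "S \<subseteq> I0 \<union> (I - I0)"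
    then have "\<forall>i\<in>S. t i ^ r = 1" using assms(2,4) by blast
    then show "prod t S ^ r = 1" by (simp add: prod_power_distrib)
  qed
  also have "\<dots> \<le> r" by (rule roots_of_unity_card(2)[OF assms(3)])
  finally show ?thesis .
qed

lemma exists_prod_eq_1:
  fixes t :: "'i \<Rightarrow> 'k::field"
  assumes "finite I" "\<And>i. i \<in> I \<Longrightarrow> t i ^ r = 1" "r > 0" "r \<le> card I"
  shows "\<exists>S\<subseteq>I. S \<noteq> {} \<and> prod t S = 1"
proof (rule ccontr)
  assume "\<not> ?thesis"
  then have "card (prod t ` Pow {}) + card (I - {}) \<le> r"
    using assms(1,2,3) by (intro prod_roots_of_unity_growth) blast+
  then show False using assms(4) by simp
qed

text \<open>Two different values have the four subproducts \<open>1\<close>, \<open>t i\<close>,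
  \<open>t j\<close>, \<open>t i * t j\<close>, one more than the three that two elements give in
  general. This saves one element compared with \<open>exists_prod_eq_1\<close>, and it is the
  source of the factor saved for Q8 x C_r.\<close>

lemma exists_prod_eq_1_nonconstant:
  fixes t :: "'i \<Rightarrow> 'k::field"
  assumes "finite I" "\<And>i. i \<in> I \<Longrightarrow> t i ^ r = 1" "r > 0" "r \<le> Suc (card I)"
    and ij: "i \<in> I" "j \<in> I" "t i \<noteq> t j"
  shows "\<exists>S\<subseteq>I. S \<noteq> {} \<and> prod t S = 1"
proof (rule ccontr)
  assume "\<not> ?thesis"
  then have no: "\<And>S. S \<subseteq> I \<Longrightarrow> S \<noteq> {} \<Longrightarrow> prod t S \<noteq> 1" by blast
  have ne: "i \<noteq> j" using ij by auto
  have t1: "t i \<noteq> 1" "t j \<noteq> 1" "t i * t j \<noteq> 1"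
    using no[of "{i}"] no[of "{j}"] no[of "{i, j}"] ij ne by auto
  have t0: "t i \<noteq> 0" "t j \<noteq> 0" using assms(2,3) ij
    by (metis power_0_left less_not_refl zero_neq_one)+
  have "{1, t i, t j, t i * t j} \<subseteq> prod t ` Pow {i, j}"
  proof -
    have "prod t {} \<in> prod t ` Pow {i, j}" "prod t {i} \<in> prod t ` Pow {i, j}"
      "prod t {j} \<in> prod t ` Pow {i, j}" "prod t {i, j} \<in> prod t ` Pow {i, j}" by blast+
    then show ?thesis using ne by simp
  qed
  then have "card {1, t i, t j, t i * t j} \<le> card (prod t ` Pow {i, j})"
    by (intro card_mono) auto
  moreover have "card {1, t i, t j, t i * t j} = 4"
    using t1 t0 ij(3) by (auto simp: card_insert_if)
  moreover have "card (prod t ` Pow {i, j}) + card (I - {i, j}) \<le> r"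
    using assms(1,2,3) ij no by (intro prod_roots_of_unity_growth) auto
  moreover have "card (I - {i, j}) = card I - 2"
    using ij ne assms(1) by (simp add: card_Diff_subset)
  ultimately show False using assms(4) by linarith
qed

definition algebra_endo :: "('k \<Rightarrow> 'r::comm_ring_1) \<Rightarrow> ('r \<Rightarrow> 'r) \<Rightarrow> bool" where
  "algebra_endo sc \<phi> \<longleftrightarrow> (\<forall>x y. \<phi> (x + y) = \<phi> x + \<phi> y) \<and> (\<forall>x y. \<phi> (x * y) = \<phi> x * \<phi> y) \<and>
     (\<forall>c. \<phi> (sc c) = sc c)"

definition linear_closed :: "('k \<Rightarrow> 'r::comm_ring_1) \<Rightarrow> 'r set \<Rightarrow> bool" where
  "linear_closed sc S \<longleftrightarrow> 0 \<in> S \<and> (\<forall>x\<in>S. \<forall>y\<in>S. x + y \<in> S) \<and> (\<forall>c. \<forall>x\<in>S. sc c * x \<in> S)"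

lemma linear_closed_sum:
  "linear_closed sc S \<Longrightarrow> (\<And>i. i \<in> I \<Longrightarrow> f i \<in> S) \<Longrightarrow> sum f I \<in> S"
  by (induction I rule: infinite_finite_induct) (auto simp: linear_closed_def)

lemma prod_in_mult_closed:
  assumes "finite I" "I \<noteq> {}" "\<And>i. i \<in> I \<Longrightarrow> f i \<in> S" "\<And>x y. x \<in> S \<Longrightarrow> y \<in> S \<Longrightarrow> x * y \<in> (S::'r::comm_ring_1 set)"
  shows "prod f I \<in> S"
  using assms(1-3) by (induction I rule: finite_ne_induct) (auto intro: assms(4))

locale scalars =
  fixes sc :: "'k::field \<Rightarrow> 'r::comm_ring_1"
  assumes sc_zero [simp]: "sc 0 = 0" and sc_one [simp]: "sc 1 = 1"
    and sc_add: "sc (x + y) = sc x + sc y" and sc_mult: "sc (x * y) = sc x * sc y"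
begin

lemma sc_minus: "sc (- x) = - sc x"
  using sc_add[of x "- x"] by (simp add: add_eq_0_iff)

lemma sc_sum: "sc (sum f I) = (\<Sum>i\<in>I. sc (f i))"
  by (induction I rule: infinite_finite_induct) (auto simp: sc_add)

lemma sc_prod: "sc (prod f I) = (\<Prod>i\<in>I. sc (f i))"
  by (induction I rule: infinite_finite_induct) (auto simp: sc_mult)

lemma endo_zero: "algebra_endo sc \<phi> \<Longrightarrow> \<phi> 0 = 0"
  and endo_one: "algebra_endo sc \<phi> \<Longrightarrow> \<phi> 1 = 1"
  unfolding algebra_endo_def by (metis sc_zero, metis sc_one)

lemma endo_sum: "algebra_endo sc \<phi> \<Longrightarrow> \<phi> (sum f I) = (\<Sum>i\<in>I. \<phi> (f i))"
  by (induction I rule: infinite_finite_induct) (auto simp: endo_zero algebra_endo_def)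

lemma endo_prod: "algebra_endo sc \<phi> \<Longrightarrow> \<phi> (prod f I) = (\<Prod>i\<in>I. \<phi> (f i))"
  by (induction I rule: infinite_finite_induct) (auto simp: endo_one algebra_endo_def)

lemma endo_minus: "algebra_endo sc \<phi> \<Longrightarrow> \<phi> (- x) = - \<phi> x"
  using endo_zero[of \<phi>] unfolding algebra_endo_def by (metis add.right_inverse add_eq_0_iff)

lemma endo_diff: "algebra_endo sc \<phi> \<Longrightarrow> \<phi> (x - y) = \<phi> x - \<phi> y"
  using endo_minus[of \<phi> y] unfolding algebra_endo_def by (metis diff_conv_add_uminus)

lemma endo_scale: "algebra_endo sc \<phi> \<Longrightarrow> \<phi> (sc c * x) = sc c * \<phi> x"
  by (simp add: algebra_endo_def)

text \<open>Discrete Fourier transform: \<open>y i\<close> is the component of \<open>x\<close> for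
  the inverse of \<open>\<omega> ^ i\<close>, written with exponent \<open>(q - 1) * i\<close> to
  remain in the natural numbers, and the \<open>y i\<close> add up to \<open>x\<close>. As
  \<open>S\<close> is a subspace stable under \<open>\<phi>\<close>, the components stay in
  \<open>S\<close>, so the lemma can be iterated on eigenspaces.\<close>

lemma eigen_decomposition:
  assumes endo: "algebra_endo sc \<phi>" and S: "linear_closed sc S" and inv: "\<And>x. x \<in> S \<Longrightarrow> \<phi> x \<in> S"
    and per: "\<And>x. x \<in> S \<Longrightarrow> (\<phi> ^^ q) x = x"
    and q: "of_nat q \<noteq> (0::'k)" and w: "\<omega> ^ q = 1" "\<And>i. 0 < i \<Longrightarrow> i < q \<Longrightarrow> \<omega> ^ i \<noteq> (1::'k)"
  shows "S \<subseteq> ideal.span {f \<in> S. \<exists>z. z ^ q = 1 \<and> \<phi> f = sc z * f}"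
proof
  fix x assume x: "x \<in> S"
  have q0: "q > 0" using q by (cases q) auto
  define y where "y i = sc (1 / of_nat q) * (\<Sum>s<q. sc (\<omega> ^ (i * s)) * (\<phi> ^^ s) x)" for i
  have pow: "(\<phi> ^^ s) x \<in> S" for s using x inv by (induction s) auto
  have yS: "y i \<in> S" for i
  proof -
    have "(\<Sum>s<q. sc (\<omega> ^ (i * s)) * (\<phi> ^^ s) x) \<in> S"
      using pow S by (intro linear_closed_sum[OF S]) (auto simp: linear_closed_def)
    then show ?thesis using S by (auto simp: y_def linear_closed_def)
  qed
  have eig: "\<phi> (y i) = sc (\<omega> ^ ((q - 1) * i)) * y i" for i
  proof -
    define h where "h s = sc (\<omega> ^ (i * (s + (q - 1)))) * (\<phi> ^^ s) x" for s
    have wq: "\<omega> ^ (i * (s + q)) = \<omega> ^ (i * s)" for s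
      using w(1) by (simp add: power_add distrib_left power_mult mult.commute[of i q])
    have shift: "h (Suc s) = sc (\<omega> ^ (i * s)) * (\<phi> ^^ Suc s) x" for s
      using wq[of s] q0 by (simp add: h_def)
    have "h q = h 0"
      using per[OF x] wq[of "q - 1"] q0 by (simp add: h_def add.commute)
    then have "(\<Sum>s<q. h (Suc s)) = (\<Sum>s<q. h s)"
      using sum.lessThan_Suc_shift[of h q] by simp
    moreover have "\<phi> (\<Sum>s<q. sc (\<omega> ^ (i * s)) * (\<phi> ^^ s) x) = (\<Sum>s<q. h (Suc s))"
      by (simp add: endo_sum[OF endo] endo_scale[OF endo] shift)
    moreover have "(\<Sum>s<q. h s) = sc (\<omega> ^ ((q - 1) * i)) * (\<Sum>s<q. sc (\<omega> ^ (i * s)) * (\<phi> ^^ s) x)"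
      unfolding sum_distrib_left
    proof (intro sum.cong HOL.refl)
      fix s
      have "\<omega> ^ (i * (s + (q - 1))) = \<omega> ^ ((q - 1) * i) * \<omega> ^ (i * s)"
        unfolding distrib_left power_add by (simp add: mult.commute)
      then show "h s = sc (\<omega> ^ ((q - 1) * i)) * (sc (\<omega> ^ (i * s)) * (\<phi> ^^ s) x)"
        by (simp only: h_def sc_mult mult.assoc)
    qed
    ultimately show ?thesis
      by (simp add: y_def endo_scale[OF endo] mult_ac)
  qed
  have "y i \<in> ideal.span {f \<in> S. \<exists>z. z ^ q = 1 \<and> \<phi> f = sc z * f}" for i
  proof (rule ideal.span_base)
    have "(\<omega> ^ ((q - 1) * i)) ^ q = 1" using w(1) by (metis mult.commute power_mult power_one)
    then show "y i \<in> {f \<in> S. \<exists>z. z ^ q = 1 \<and> \<phi> f = sc z * f}" using yS eig by blast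
  qed
  then have "(\<Sum>i<q. y i) \<in> ideal.span {f \<in> S. \<exists>z. z ^ q = 1 \<and> \<phi> f = sc z * f}"
    by (intro ideal.span_sum)
  moreover have "(\<Sum>i<q. y i) = x"
  proof -
    have geo: "(\<Sum>i<q. \<omega> ^ (i * s)) = (if s = 0 then of_nat q else 0)" if "s < q" for s
    proof (cases "s = 0")
      case False
      then have ne: "\<omega> ^ s \<noteq> 1" using w(2) that by simp
      have "(\<Sum>i<q. (\<omega> ^ s) ^ i) = (1 - (\<omega> ^ s) ^ q) / (1 - \<omega> ^ s)"
        using ne by (simp add: sum_gp_strict)
      moreover have "(\<omega> ^ s) ^ q = 1" using w(1) by (metis power_mult mult.commute power_one)
      ultimately show ?thesis using False by (simp add: mult.commute flip: power_mult)
    qed simp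
    have "(\<Sum>i<q. y i) = sc (1 / of_nat q) * (\<Sum>s<q. \<Sum>i<q. sc (\<omega> ^ (i * s)) * (\<phi> ^^ s) x)"
      unfolding y_def sum_distrib_left[symmetric] by (subst sum.swap) (rule HOL.refl)
    also have "(\<Sum>s<q. \<Sum>i<q. sc (\<omega> ^ (i * s)) * (\<phi> ^^ s) x) = (\<Sum>s<q. sc (\<Sum>i<q. \<omega> ^ (i * s)) * (\<phi> ^^ s) x)"
      by (simp add: sc_sum sum_distrib_right)
    also have "\<dots> = (\<Sum>s<q. if s = 0 then sc (of_nat q) * x else 0)"
      by (intro sum.cong HOL.refl) (auto simp: geo)
    also have "\<dots> = sc (of_nat q) * x" using q0 by simp
    finally show ?thesis using q by (simp add: mult.assoc[symmetric] flip: sc_mult)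
  qed
  ultimately show "x \<in> ideal.span {f \<in> S. \<exists>z. z ^ q = 1 \<and> \<phi> f = sc z * f}" by simp
qed

lemma linear_closed_eigenspace:
  assumes "algebra_endo sc \<phi>" "linear_closed sc S"
  shows "linear_closed sc {f \<in> S. \<phi> f = sc z * f}"
  using assms unfolding linear_closed_def
  by (auto simp: endo_zero endo_scale algebra_endo_def distrib_left mult.left_commute)

lemma linear_closed_fixed:
  assumes "algebra_endo sc \<phi>" "linear_closed sc S"
  shows "linear_closed sc {f \<in> S. \<phi> f = f}"
  using linear_closed_eigenspace[OF assms, of 1] by simp

lemma primitive_root_prime:
  assumes q: "Factorial_Ring.prime (q::nat)" and w: "\<omega> ^ q = (1::'k)" "\<omega> \<noteq> 1" and i: "0 < i" "i < q"
  shows "\<omega> ^ i \<noteq> 1"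
proof
  assume "\<omega> ^ i = 1"
  have "coprime i q" using q i prime_imp_coprime[of q i] coprime_commute nat_dvd_not_less by blast
  then obtain u v where "i * u = Suc (q * v)"
    using i coprime_bezout_strong[of i q] prime_gt_1_nat[OF q] by (metis Suc_eq_plus1 less_irrefl)
  then have "\<omega> ^ (i * u) = \<omega> * \<omega> ^ (q * v)" by simp
  then show False using \<open>\<omega> ^ i = 1\<close> w by (simp add: power_mult)
qed

lemma power_eq_1_of_dvd: "\<omega> ^ q = (1::'k) \<Longrightarrow> q dvd n \<Longrightarrow> \<omega> ^ n = 1"
  by (auto simp: dvd_def power_mult)

lemma root_of_unity_is_power:
  assumes q: "q > 0" and w: "\<omega> ^ q = (1::'k)" "\<And>i. 0 < i \<Longrightarrow> i < q \<Longrightarrow> \<omega> ^ i \<noteq> 1" and z: "z ^ q = 1"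
  shows "\<exists>e. z = \<omega> ^ e"
proof (rule ccontr)
  assume no: "\<not> ?thesis"
  have w0: "\<omega> \<noteq> 0" using w(1) q by (auto simp: power_0_left)
  have inj: "inj_on (\<lambda>i. \<omega> ^ i) {..<q}"
  proof (rule linorder_inj_onI)
    fix i j assume ij: "i < j" "i \<in> {..<q}" "j \<in> {..<q}"
    have "\<omega> ^ j = \<omega> ^ i * \<omega> ^ (j - i)" using ij by (simp flip: power_add)
    then show "\<omega> ^ i \<noteq> \<omega> ^ j" using w(2)[of "j - i"] w0 ij by auto
  qed (auto)
  have "(\<omega> ^ i) ^ q = 1" for i using w(1) by (metis mult.commute power_mult power_one)
  then have "insert z ((\<lambda>i. \<omega> ^ i) ` {..<q}) \<subseteq> {x. x ^ q = 1}"
    using z by auto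
  then have "card (insert z ((\<lambda>i. \<omega> ^ i) ` {..<q})) \<le> card {x::'k. x ^ q = 1}"
    using roots_of_unity_card(1)[OF q] by (intro card_mono)
  also have "\<dots> \<le> q" by (rule roots_of_unity_card(2)[OF q])
  finally show False using no card_image[OF inj] by (subst (asm) card_insert_disjoint) auto
qed

text \<open>\<open>S\<close> is spanned by joint eigenvectors of \<open>g\<close> and
  \<open>h\<close>. Their eigenvalues are powers of \<open>\<omega>\<close>, and a product is fixed
  by both operators once the two sums of exponents are divisible by \<open>q\<close>: a zero-sum
  problem in C_q x C_q.\<close>

lemma ideal_power_commuting_pair:
  assumes g: "algebra_endo sc g" and h: "algebra_endo sc h"
    and S: "linear_closed sc S" and mult: "\<And>x y. x \<in> S \<Longrightarrow> y \<in> S \<Longrightarrow> x * y \<in> S"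
    and inv: "\<And>x. x \<in> S \<Longrightarrow> g x \<in> S" "\<And>x. x \<in> S \<Longrightarrow> h x \<in> S"
    and per: "\<And>x. x \<in> S \<Longrightarrow> (g ^^ q) x = x" "\<And>x. x \<in> S \<Longrightarrow> (h ^^ q) x = x"
    and comm: "\<And>x. x \<in> S \<Longrightarrow> g (h x) = h (g x)"
    and q: "Factorial_Ring.prime (q::nat)" "of_nat q \<noteq> (0::'k)" and w: "\<omega> ^ q = (1::'k)" "\<omega> \<noteq> 1"
  shows "ideal_power S (k * q + q - 1) \<subseteq> ideal_power {f \<in> S. g f = f \<and> h f = f} k"
proof -
  define W where "W = {f \<in> S. \<exists>e e'::nat. g f = sc (\<omega> ^ e) * f \<and> h f = sc (\<omega> ^ e') * f}"
  have prim: "\<And>i. 0 < i \<Longrightarrow> i < q \<Longrightarrow> \<omega> ^ i \<noteq> 1" using primitive_root_prime[OF q(1) w] by blast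
  have q0: "q > 0" using q(1) prime_gt_0_nat by blast
  have "{f \<in> S. \<exists>z. z ^ q = 1 \<and> g f = sc z * f} \<subseteq> ideal.span W"
  proof clarify
    fix f z assume f: "f \<in> S" "z ^ q = 1" "g f = sc z * f"
    obtain e where e: "z = \<omega> ^ e" using root_of_unity_is_power[OF q0 w(1) prim f(2)] by blast
    \<comment> \<open>As \<open>h\<close> commutes with \<open>g\<close> it preserves this
      eigenspace, which can therefore be decomposed under \<open>h\<close>.\<close>
    let ?S = "{f \<in> S. g f = sc z * f}"
    have "?S \<subseteq> ideal.span {f \<in> ?S. \<exists>z. z ^ q = 1 \<and> h f = sc z * f}"
    proof (rule eigen_decomposition[OF h linear_closed_eigenspace[OF g S] _ _ q(2) w(1) prim])
      fix x assume x: "x \<in> ?S"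
      then have "g (h x) = h (sc z * x)" using comm by auto
      then show "h x \<in> ?S" using x inv by (simp add: endo_scale[OF h])
    qed (auto simp: per)
    also have "\<dots> \<subseteq> ideal.span W"
    proof (rule ideal.span_mono, clarify)
      fix f z' assume f: "f \<in> S" "z' ^ q = 1" "g f = sc z * f" "h f = sc z' * f"
      obtain e' where "z' = \<omega> ^ e'" using root_of_unity_is_power[OF q0 w(1) prim f(2)] by blast
      then show "f \<in> W" using f e unfolding W_def by blast
    qed
    finally show "f \<in> ideal.span W" using f by blast
  qed
  then have "ideal.span {f \<in> S. \<exists>z. z ^ q = 1 \<and> g f = sc z * f} \<subseteq> ideal.span W"
    by (intro ideal.span_minimal) auto
  then have "S \<subseteq> ideal.span W"
    using eigen_decomposition[OF g S inv(1) per(1) q(2) w(1) prim] by blast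
  then have "ideal_power S (k * q + q - 1) \<subseteq> ideal_power W (k * q + q - 1)"
    by (rule ideal_power_mono_span)
  also have "\<dots> \<subseteq> ideal_power {f \<in> S. g f = f \<and> h f = f} k"
  proof (rule ideal_power_least[OF ideal_power_subspace])
    fix f assume f: "\<And>i. i < k * q + q - 1 \<Longrightarrow> f i \<in> W"
    let ?I = "{..<k * q + q - 1}"
    have "\<forall>i\<in>?I. \<exists>e e'::nat. g (f i) = sc (\<omega> ^ e) * f i \<and> h (f i) = sc (\<omega> ^ e') * f i"
      using f by (auto simp: W_def)
    then obtain e e' where ee: "\<And>i. i \<in> ?I \<Longrightarrow> g (f i) = sc (\<omega> ^ e i) * f i"
       "\<And>i. i \<in> ?I \<Longrightarrow> h (f i) = sc (\<omega> ^ e' i) * f i"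
      by metis
    have fixed: "\<phi> (prod f A) = prod f A" if "algebra_endo sc \<phi>" "\<And>i. i \<in> A \<Longrightarrow> \<phi> (f i) = sc (\<omega> ^ d i) * f i"
      "int q dvd sum (\<lambda>i. int (d i)) A" for \<phi> A and d :: "nat \<Rightarrow> nat"
    proof -
      have "\<phi> (prod f A) = (\<Prod>i\<in>A. sc (\<omega> ^ d i) * f i)"
        using that(2) by (simp add: endo_prod[OF that(1)])
      also have "\<dots> = sc (\<omega> ^ (sum d A)) * prod f A"
        by (simp add: prod.distrib sc_prod power_sum)
      also have "\<omega> ^ sum d A = 1" using that(3)
        by (intro power_eq_1_of_dvd[OF w(1)]) (simp flip: of_nat_sum)
      finally show ?thesis by simp
    qed
    show "(\<Prod>i\<in>?I. f i) \<in> ideal_power {f \<in> S. g f = f \<and> h f = f} k"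
    proof (rule prod_in_ideal_power_of_zero_sums[OF q(1), where e = "\<lambda>i. int (e i)" and e' = "\<lambda>i. int (e' i)"])
      fix A assume A: "finite A" "A \<noteq> {}" "A \<subseteq> ?I" "int q dvd (\<Sum>i\<in>A. int (e i))" "int q dvd (\<Sum>i\<in>A. int (e' i))"
      have "prod f A \<in> S" using A f by (intro prod_in_mult_closed mult) (auto simp: W_def)
      moreover have "g (prod f A) = prod f A" using ee A by (intro fixed[OF g, of A e]) auto
      moreover have "h (prod f A) = prod f A" using ee A by (intro fixed[OF h, of A e']) auto
      ultimately show "prod f A \<in> {f \<in> S. g f = f \<and> h f = f}" by simp
    qed auto
  qed
  finally show ?thesis .
qed

end

section \<open>The quaternion group of order 8\<close>

text \<open>\<open>I\<close> and \<open>T\<close> satisfy the relations of the quaternion group of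
  order 8. \<open>M\<close> is kept abstract, so that the fixed points of a further commuting
  operator can later take its place.\<close>

locale quaternion_ops = scalars sc for sc :: "'k::field \<Rightarrow> 'r::comm_ring_1" +
  fixes M :: "'r set" and I T :: "'r \<Rightarrow> 'r"
  assumes two: "(2::'k) \<noteq> 0"
    and endoI: "algebra_endo sc I" and endoT: "algebra_endo sc T"
    and M_lin: "linear_closed sc M" and M_mult: "\<And>x y. x \<in> M \<Longrightarrow> y \<in> M \<Longrightarrow> x * y \<in> M"
    and M_I: "\<And>x. x \<in> M \<Longrightarrow> I x \<in> M" and M_T: "\<And>x. x \<in> M \<Longrightarrow> T x \<in> M"
    and TT: "\<And>x. T (T x) = I (I x)" and IT: "\<And>x. I (T x) = T (I (I (I x)))"
    and I4: "\<And>x. I (I (I (I x))) = x"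
begin

lemma I_simps: "I (x + y) = I x + I y" "I (x - y) = I x - I y" "I (x * y) = I x * I y"
    "I (- x) = - I x" "I (sc c) = sc c"
  and T_simps: "T (x + y) = T x + T y" "T (x - y) = T x - T y" "T (x * y) = T x * T y"
    "T (- x) = - T x" "T (sc c) = sc c"
  using endoI endoT endo_minus[OF endoI] endo_minus[OF endoT] endo_diff[OF endoI] endo_diff[OF endoT]
  by (simp_all add: algebra_endo_def)

lemma M_add: "x \<in> M \<Longrightarrow> y \<in> M \<Longrightarrow> x + y \<in> M" and M_sc: "x \<in> M \<Longrightarrow> sc c * x \<in> M"
  using M_lin by (auto simp: linear_closed_def)

lemma M_minus: "x \<in> M \<Longrightarrow> - x \<in> M"
  using M_sc[of x "-1"] by (simp add: sc_minus)

lemma M_diff: "x \<in> M \<Longrightarrow> y \<in> M \<Longrightarrow> x - y \<in> M"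
  using M_add[of x "- y"] M_minus by simp

definition MQ :: "'r set" where "MQ = {f \<in> M. I f = f \<and> T f = f}"
text \<open>On \<open>Ev\<close> the group acts through its Klein four quotient; \<open>Od\<close>
  is the part on which the central involution acts as \<open>- 1\<close>.\<close>

definition Ev :: "'r set" where "Ev = {f \<in> M. I (I f) = f}"
definition Od :: "'r set" where "Od = {f \<in> M. I (I f) = - f}"
definition Mi :: "'r set" where "Mi = {f \<in> M. I f = f}"
text \<open>On \<open>Ev\<close> the maps \<open>pl\<close> and \<open>mi\<close> are the
  projections to the eigenvalues \<open>1\<close> and \<open>- 1\<close> of \<open>T\<close>. The
  identities \<open>pl f + mi f = f\<close> and \<open>pl f - mi f = T f\<close> hold for every
  \<open>f\<close>.\<close>

definition pl :: "'r \<Rightarrow> 'r" where "pl f = sc (1 / 2) * (f + T f)"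
definition mi :: "'r \<Rightarrow> 'r" where "mi f = sc (1 / 2) * (f - T f)"

lemma half: "sc (1 / 2) * x + sc (1 / 2) * x = x"
proof -
  have "sc (1 / 2) * x + sc (1 / 2) * x = sc (1 / 2 + 1 / 2) * x"
    by (simp only: sc_add distrib_right)
  also have "1 / 2 + 1 / 2 = (1::'k)" using two by (simp add: field_simps)
  finally show ?thesis by simp
qed

lemma half_double: "sc (1 / 2) * (x + x) = x"
  by (simp only: distrib_left half)

lemma pl_plus_mi: "pl f + mi f = f" and pl_minus_mi: "pl f - mi f = T f"
  using half[of f] half[of "T f"] by (auto simp: pl_def mi_def algebra_simps)

lemma pl_pl: "pl f + pl f = f + T f" and mi_mi: "mi f + mi f = f - T f"
  unfolding pl_def mi_def by (rule half)+

lemma pl_M: "f \<in> M \<Longrightarrow> pl f \<in> M" and mi_M: "f \<in> M \<Longrightarrow> mi f \<in> M"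
  by (auto simp: pl_def mi_def intro!: M_sc M_add M_diff M_T)

lemma T_pl: "I (I f) = f \<Longrightarrow> T (pl f) = pl f" and T_mi: "I (I f) = f \<Longrightarrow> T (mi f) = - mi f"
  by (simp_all add: pl_def mi_def T_simps TT algebra_simps)

lemma I_pl: "I f = f \<Longrightarrow> I (pl f) = pl f" "I f = - f \<Longrightarrow> I (pl f) = - pl f"
  and I_mi: "I f = f \<Longrightarrow> I (mi f) = mi f" "I f = - f \<Longrightarrow> I (mi f) = - mi f"
  by (simp_all add: pl_def mi_def I_simps IT T_simps algebra_simps)

lemma pl_mi_mult: "pl (p * q) = pl p * pl q + mi p * mi q" "mi (p * q) = pl p * mi q + mi p * pl q"
proof -
  have p: "p = pl p + mi p" "T p = pl p - mi p" and q: "q = pl q + mi q" "T q = pl q - mi q"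
    by (simp_all only: pl_plus_mi pl_minus_mi)
  have "p * q + T p * T q = (pl p + mi p) * (pl q + mi q) + (pl p - mi p) * (pl q - mi q)"
    and "p * q - T p * T q = (pl p + mi p) * (pl q + mi q) - (pl p - mi p) * (pl q - mi q)"
    using p q by metis+
  then have "p * q + T p * T q = (pl p * pl q + mi p * mi q) + (pl p * pl q + mi p * mi q)"
    and "p * q - T p * T q = (pl p * mi q + mi p * pl q) + (pl p * mi q + mi p * pl q)"
    by (simp_all add: algebra_simps)
  then show "pl (p * q) = pl p * pl q + mi p * mi q" "mi (p * q) = pl p * mi q + mi p * pl q"
    unfolding pl_def[of "p * q"] mi_def[of "p * q"] T_simps by (simp_all only: half_double)
qed

lemma pl_MQ: "f \<in> Mi \<Longrightarrow> pl f \<in> MQ"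
  by (auto simp: Mi_def MQ_def pl_M T_pl I_pl)

lemma mi_mi_MQ: "f \<in> Mi \<Longrightarrow> g \<in> Mi \<Longrightarrow> mi f * mi g \<in> MQ"
  by (auto simp: Mi_def MQ_def mi_M M_mult I_simps T_simps T_mi I_mi)

lemma ideal_power_Mi: "ideal_power Mi (2 * s) \<subseteq> ideal_power MQ s"
proof -
  have "ideal_power Mi 2 \<subseteq> ideal_power MQ 1"
  proof (rule ideal_power_least[OF ideal_power_subspace])
    fix f :: "nat \<Rightarrow> 'r" assume f: "\<And>i. i < 2 \<Longrightarrow> f i \<in> Mi"
    have "(\<Prod>i<2. f i) = f 0 * f 1" by (simp add: numeral_2_eq_2)
    also have "\<dots> = (pl (f 0) + mi (f 0)) * (pl (f 1) + mi (f 1))" by (simp only: pl_plus_mi)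
    also have "\<dots> = pl (f 0) * (pl (f 1) + mi (f 1)) + (mi (f 0) * pl (f 1) + mi (f 0) * mi (f 1))"
      by (simp add: algebra_simps)
    also have "\<dots> \<in> ideal_power MQ 1"
      using f[of 0] f[of 1]
      by (intro ideal_power_add ideal_power_scale ideal_power_scale2 ideal_power_base pl_MQ mi_mi_MQ) auto
    finally show "(\<Prod>i<2. f i) \<in> ideal_power MQ 1" .
  qed
  from ideal_power_times[OF this, of s] show ?thesis by simp
qed

text \<open>On \<open>Ev\<close> the operators \<open>I\<close> and \<open>T\<close> are commuting
  involutions, so this is the rank two case with \<open>q = 2\<close> and root of unity
  \<open>- 1\<close>.\<close>

lemma ideal_power_Ev: "ideal_power Ev (2 * s + 1) \<subseteq> ideal_power MQ s"
proof -
  have "ideal_power Ev (s * 2 + 2 - 1) \<subseteq> ideal_power {f \<in> Ev. I f = f \<and> T f = f} s"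
  proof (rule ideal_power_commuting_pair[OF endoI endoT])
    show "linear_closed sc Ev" using M_lin
      by (auto simp: linear_closed_def Ev_def I_simps endo_zero[OF endoI])
    show "(- 1) ^ 2 = (1::'k)" by simp
    show "- 1 \<noteq> (1::'k)" using two by (metis add.right_inverse one_add_one)
    show "Factorial_Ring.prime (2::nat)" by simp
    show "of_nat 2 \<noteq> (0::'k)" using two by simp
  qed (auto simp: Ev_def M_mult I_simps M_I M_T numeral_2_eq_2 TT IT I4)
  also have "\<dots> \<subseteq> ideal_power MQ s" by (rule ideal_power_mono) (auto simp: Ev_def MQ_def)
  finally show ?thesis by (simp add: mult.commute)
qed

lemma ideal_power_Od_Ev: "ideal_power Od (2 * s) \<subseteq> ideal_power Ev s"
proof -
  have "ideal_power Od 2 \<subseteq> ideal_power Ev 1"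
  proof (rule ideal_power_least[OF ideal_power_subspace])
    fix f :: "nat \<Rightarrow> 'r" assume f: "\<And>i. i < 2 \<Longrightarrow> f i \<in> Od"
    have "f 0 * f 1 \<in> Ev" using f[of 0] f[of 1] by (auto simp: Od_def Ev_def M_mult I_simps)
    then show "(\<Prod>i<2. f i) \<in> ideal_power Ev 1"
      by (simp add: numeral_2_eq_2 ideal_power_base[simplified])
  qed
  from ideal_power_times[OF this, of s] show ?thesis by simp
qed

text \<open>Two factors from \<open>Od\<close> multiply to one from \<open>Ev\<close>, so the
  product counts as \<open>u + v div 2\<close> factors from \<open>Ev\<close>.\<close>

lemma Ev_Od_MQ:
  assumes "e \<in> ideal_power Ev u" "z \<in> ideal_power Od v" "2 * s + 1 \<le> u + v div 2"
  shows "e * z \<in> ideal_power MQ s"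
proof -
  have "z \<in> ideal_power Od (2 * (v div 2))"
    using assms(2) ideal_power_antimono[of "2 * (v div 2)" v Od] by auto
  then have "z \<in> ideal_power Ev (v div 2)" using ideal_power_Od_Ev by blast
  then have "e * z \<in> ideal_power Ev (2 * s + 1)"
    using assms(1,3) by (intro ideal_power_mult_ge)
  then show ?thesis using ideal_power_Ev by blast
qed

lemma Od_MQ: "z \<in> ideal_power Od v \<Longrightarrow> 4 * s + 2 \<le> v \<Longrightarrow> z \<in> ideal_power MQ s"
  using Ev_Od_MQ[of 1 0 z v s] by (simp add: ideal_power_0)

lemma M_split: "M \<subseteq> ideal.span (Ev \<union> Od)"
proof
  fix f assume f: "f \<in> M"
  have "f = sc (1 / 2) * (f + I (I f)) + sc (1 / 2) * (f - I (I f))"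
    using half[of f] by (simp add: algebra_simps)
  moreover have "f + I (I f) \<in> Ev" "f - I (I f) \<in> Od"
    using f by (auto simp: Ev_def Od_def M_add M_diff M_I I_simps I4)
  ultimately show "f \<in> ideal.span (Ev \<union> Od)"
    by (metis ideal.span_add ideal.span_base ideal.span_scale UnCI)
qed

lemma prod_split_MQ:
  assumes "finite A" "\<And>i. i \<in> A \<Longrightarrow> f i \<in> Ev \<union> Od"
    and "2 * s + 1 \<le> card {i \<in> A. f i \<in> Ev} + card {i \<in> A. f i \<notin> Ev} div 2"
  shows "prod f A \<in> ideal_power MQ s"
proof -
  have "prod f {i \<in> A. f i \<in> Ev} * prod f {i \<in> A. f i \<notin> Ev} \<in> ideal_power MQ s"
    using assms by (intro Ev_Od_MQ[OF _ _ assms(3)] ideal_power_prod) auto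
  moreover have "prod f A = prod f ({i \<in> A. f i \<in> Ev} \<union> {i \<in> A. f i \<notin> Ev})"
    by (rule prod.cong) auto
  ultimately show ?thesis using assms(1) by (simp add: prod.union_disjoint disjoint_iff)
qed

text \<open>The worst case is that all \<open>4 * s + 2\<close> factors lie in \<open>Od\<close>;
  they form \<open>2 * s + 1\<close> pairs, exactly what \<open>Ev\<close> requires.\<close>

theorem quaternion_ideal_power: "ideal_power M (4 * s + 2) \<subseteq> ideal_power MQ s"
proof -
  have "ideal_power (Ev \<union> Od) (4 * s + 2) \<subseteq> ideal_power MQ s"
  proof (rule ideal_power_least[OF ideal_power_subspace])
    fix f assume f: "\<And>i. i < 4 * s + 2 \<Longrightarrow> f i \<in> Ev \<union> Od"
    let ?A = "{..<4 * s + 2}"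
    have "card {i \<in> ?A. f i \<in> Ev} + card {i \<in> ?A. f i \<notin> Ev} = card ({i \<in> ?A. f i \<in> Ev} \<union> {i \<in> ?A. f i \<notin> Ev})"
      by (subst card_Un_disjoint) auto
    also have "{i \<in> ?A. f i \<in> Ev} \<union> {i \<in> ?A. f i \<notin> Ev} = ?A" by auto
    finally show "prod f ?A \<in> ideal_power MQ s" using f by (intro prod_split_MQ) auto
  qed
  then show ?thesis using ideal_power_mono_span[OF M_split] by blast
qed

text \<open>Products of \<open>4n\<close> eigenvectors of \<open>I\<close> with the same primitive eigenvalue: grouped into pairs
  \<open>p\<close> with \<open>I p = - p\<close>, the terms with an even number of factors \<open>mi p\<close> pair up to invariants.\<close>

lemma prod_plus_T_prod:
  assumes b: "b * b = (-1::'k)" and "finite K" "card K = 4 * n" "\<And>i. i \<in> K \<Longrightarrow> f i \<in> M \<and> I (f i) = sc b * f i"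
  shows "prod f K + T (prod f K) \<in> ideal_power MQ n \<and>
    (\<forall>g h. g \<in> M \<longrightarrow> I g = - g \<longrightarrow> T g = g \<longrightarrow> h \<in> M \<longrightarrow> I h = - h \<longrightarrow> T h = - h \<longrightarrow>
       (prod f K - T (prod f K)) * g * h \<in> ideal_power MQ (n + 1))"
  using assms(2-)
proof (induction n arbitrary: K)
  case 0
  then have "K = {}" by simp
  then show ?case by (simp add: ideal_power_0 endo_one[OF endoT] ideal_power_zero)
next
  case (Suc n)
  \<comment> \<open>Four factors are split off and grouped into the pairs \<open>?p\<close> and
    \<open>?q\<close>. Since \<open>b * b = -1\<close>, the operator \<open>I\<close> acts on each
    pair as \<open>- 1\<close>; there \<open>T\<close> is an involution with eigenprojections
    \<open>pl\<close> and \<open>mi\<close>.\<close>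
  have "4 \<le> card K" using Suc.prems by simp
  then obtain L where L: "L \<subseteq> K" "card L = 4" by (metis obtain_subset_with_card_n)
  then obtain i1 i2 i3 i4 where i: "L = {i1, i2, i3, i4}" "distinct [i1, i2, i3, i4]"
    by (auto simp: card_Suc_eq numeral_eq_Suc)
  let ?A = "prod f (K - L)" and ?p = "f i1 * f i2" and ?q = "f i3 * f i4"
  have fin: "finite (K - L)" using Suc.prems by auto
  have "card (K - L) = 4 * n" using L Suc.prems finite_subset[OF L(1)] by (simp add: card_Diff_subset)
  then have IH1: "?A + T ?A \<in> ideal_power MQ n" and
    IH2: "\<And>g h. g \<in> M \<Longrightarrow> I g = - g \<Longrightarrow> T g = g \<Longrightarrow> h \<in> M \<Longrightarrow> I h = - h \<Longrightarrow> T h = - h \<Longrightarrow>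
       (?A - T ?A) * g * h \<in> ideal_power MQ (n + 1)"
    using Suc.IH[OF fin] Suc.prems(3) by auto
  have "prod f K = ?A * prod f L" using L(1) Suc.prems(1) by (rule prod.subset_diff)
  also have "prod f L = ?p * ?q" using i by (simp add: mult.assoc)
  finally have P: "prod f K = ?A * (?p * ?q)" .
  have pM: "?p \<in> M" "?q \<in> M" using i L Suc.prems(3) by (auto intro!: M_mult)
  have "sc b * sc b = - 1" using b by (metis sc_minus sc_mult sc_one)
  then have neg: "sc b * x * (sc b * y) = - (x * y)" for x y
    by (metis mult.assoc mult.commute mult.left_commute mult_minus1)
  have pI: "I ?p = - ?p" "I ?q = - ?q" using i L Suc.prems(3) by (auto simp: I_simps neg)
  have pII: "I (I ?p) = ?p" "I (I ?q) = ?q" using pI by (auto simp: I_simps)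
  note props = pl_M[OF pM(1)] pl_M[OF pM(2)] mi_M[OF pM(1)] mi_M[OF pM(2)]
    T_pl[OF pII(1)] T_pl[OF pII(2)] T_mi[OF pII(1)] T_mi[OF pII(2)]
    I_pl(2)[OF pI(1)] I_pl(2)[OF pI(2)] I_mi(2)[OF pI(1)] I_mi(2)[OF pI(2)]
  have plQ: "pl (?p * ?q) \<in> ideal_power MQ 1"
    unfolding pl_mi_mult(1)[of ?p ?q]
    by (intro ideal_power_add ideal_power_base) (auto simp: MQ_def M_mult props I_simps T_simps)
  \<comment> \<open>The sum for \<open>K\<close> contains the difference for \<open>K - L\<close>
    times \<open>mi (?p * ?q)\<close>, which is a sum of products of one \<open>pl\<close> and one
    \<open>mi\<close> part. This is why the induction also carries the statement about the
    difference times \<open>g * h\<close>.\<close>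
  have sum: "prod f K + T (prod f K) = (?A + T ?A) * pl (?p * ?q) + (?A - T ?A) * mi (?p * ?q)"
  proof -
    have "prod f K + T (prod f K) = ?A * (pl (?p * ?q) + mi (?p * ?q)) + T ?A * (pl (?p * ?q) - mi (?p * ?q))"
      unfolding pl_plus_mi pl_minus_mi P by (simp add: T_simps)
    then show ?thesis by (simp add: algebra_simps)
  qed
  have diff: "prod f K - T (prod f K) = (?A - T ?A) * pl (?p * ?q) + (?A + T ?A) * mi (?p * ?q)"
  proof -
    have "prod f K - T (prod f K) = ?A * (pl (?p * ?q) + mi (?p * ?q)) - T ?A * (pl (?p * ?q) - mi (?p * ?q))"
      unfolding pl_plus_mi pl_minus_mi P by (simp add: T_simps)
    then show ?thesis by (simp add: algebra_simps)
  qed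
  have "(?A + T ?A) * pl (?p * ?q) \<in> ideal_power MQ (n + 1)"
    using IH1 plQ by (rule ideal_power_mult)
  moreover have "(?A - T ?A) * mi (?p * ?q) \<in> ideal_power MQ (n + 1)"
  proof -
    have "(?A - T ?A) * mi (?p * ?q) = (?A - T ?A) * pl ?p * mi ?q + (?A - T ?A) * pl ?q * mi ?p"
      unfolding pl_mi_mult(2)[of ?p ?q] by (simp add: algebra_simps)
    then show ?thesis using IH2 props by (auto intro!: ideal_power_add)
  qed
  ultimately have 1: "prod f K + T (prod f K) \<in> ideal_power MQ (Suc n)"
    unfolding sum by (auto intro: ideal_power_add)
  have 2: "(prod f K - T (prod f K)) * g * h \<in> ideal_power MQ (Suc n + 1)"
    if g: "g \<in> M" "I g = - g" "T g = g" and h: "h \<in> M" "I h = - h" "T h = - h" for g h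
  proof -
    have "(prod f K - T (prod f K)) * g * h
       = ((?A - T ?A) * g * h) * pl (?p * ?q) + (?A + T ?A) * (mi (?p * ?q) * g * h)"
      unfolding diff by (simp add: algebra_simps)
    also have "mi (?p * ?q) * g * h = (pl ?p * g) * (mi ?q * h) + (pl ?q * g) * (mi ?p * h)"
      unfolding pl_mi_mult(2)[of ?p ?q] by (simp add: algebra_simps)
    finally have eq: "(prod f K - T (prod f K)) * g * h = ((?A - T ?A) * g * h) * pl (?p * ?q)
      + (?A + T ?A) * ((pl ?p * g) * (mi ?q * h) + (pl ?q * g) * (mi ?p * h))" .
    have "pl ?p * g \<in> MQ" "mi ?q * h \<in> MQ" "pl ?q * g \<in> MQ" "mi ?p * h \<in> MQ"
      using g h props by (auto simp: MQ_def M_mult I_simps T_simps)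
    then have "(pl ?p * g) * (mi ?q * h) + (pl ?q * g) * (mi ?p * h) \<in> ideal_power MQ (1 + 1)"
      by (intro ideal_power_add ideal_power_mult ideal_power_base)
    then have "(?A + T ?A) * ((pl ?p * g) * (mi ?q * h) + (pl ?q * g) * (mi ?p * h)) \<in> ideal_power MQ (n + (1 + 1))"
      using IH1 by (intro ideal_power_mult)
    moreover have "((?A - T ?A) * g * h) * pl (?p * ?q) \<in> ideal_power MQ (n + 1 + 1)"
      using IH2[OF g h] plQ by (rule ideal_power_mult)
    ultimately show ?thesis unfolding eq by (intro ideal_power_add) auto
  qed
  show ?case using 1 2 by blast
qed

end

section \<open>The direct product of the quaternion group with a cyclic group of odd order\<close>

text \<open>Take disjoint \<open>A\<close> and \<open>B\<close> of size \<open>m\<close> that avoid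
  \<open>i\<close> and \<open>j\<close>. If all the products agreed, comparing
  \<open>insert i A\<close> with \<open>insert j B\<close>, and \<open>insert j A\<close> with
  \<open>insert i B\<close>, would give \<open>(t i / t j) ^ 2 = 1\<close>, hence
  \<open>t i = t j\<close> because \<open>r\<close> is odd.\<close>

lemma exists_disjoint_prods_neq:
  fixes t :: "'i \<Rightarrow> 'k::field"
  assumes D: "finite D" "2 * Suc m \<le> card D" and t: "\<And>i. i \<in> D \<Longrightarrow> t i ^ r = 1" "odd r"
    and ij: "i \<in> D" "j \<in> D" "t i \<noteq> t j"
  shows "\<exists>V V'. V \<subseteq> D \<and> V' \<subseteq> D \<and> V \<inter> V' = {} \<and> card V = Suc m \<and> card V' = Suc m \<and> prod t V \<noteq> prod t V'"
proof -
  have ne: "i \<noteq> j" using ij by auto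
  have r0: "r > 0" using t(2) by (cases r) auto
  have t0: "t l \<noteq> 0" if "l \<in> D" for l
    using t(1)[OF that] r0 by (auto simp: power_0_left)
  have "card (D - {i, j}) = card D - 2" using ij ne D by (simp add: card_Diff_subset)
  then have "2 * m \<le> card (D - {i, j})" using D by simp
  then obtain W where W: "W \<subseteq> D - {i, j}" "card W = 2 * m" by (metis obtain_subset_with_card_n)
  then obtain A where A: "A \<subseteq> W" "card A = m" by (metis le_add1 mult_2 obtain_subset_with_card_n)
  define B where "B = W - A"
  have fin: "finite W" "finite A" "finite B" using W A D B_def finite_subset by (metis finite_Diff)+
  have B: "card B = m" using W A fin by (simp add: B_def card_Diff_subset)
  have sub: "A \<subseteq> D" "B \<subseteq> D" "A \<inter> B = {}" "i \<notin> A" "i \<notin> B" "j \<notin> A" "j \<notin> B"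
    using W A B_def by auto
  show ?thesis
  proof (rule ccontr)
    assume no: "\<not> ?thesis"
    have same: "prod t V = prod t V'"
      if "V \<subseteq> D" "V' \<subseteq> D" "V \<inter> V' = {}" "card V = Suc m" "card V' = Suc m" for V V'
      using no that by blast
    have "prod t (insert i A) = prod t (insert j B)" "prod t (insert j A) = prod t (insert i B)"
      by (rule same; use sub ij ne fin A B in auto)+
    then have eq: "t i * prod t A = t j * prod t B" "t j * prod t A = t i * prod t B"
      using sub fin by simp_all
    have nz: "prod t A \<noteq> 0" "prod t B \<noteq> 0" using sub t0 fin by (auto simp: prod_zero_iff)
    have "(t i * t i) * (prod t A * prod t B) = (t j * t j) * (prod t A * prod t B)"
    proof -
      have "(t i * t i) * (prod t A * prod t B) = (t i * prod t A) * (t i * prod t B)" by (simp add: mult_ac)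
      also have "\<dots> = (t j * prod t B) * (t j * prod t A)" using eq by simp
      finally show ?thesis by (simp add: mult_ac)
    qed
    then have sq: "(t i / t j) ^ 2 = 1" using nz t0[OF ij(2)] by (simp add: power2_eq_square)
    have "(t i / t j) ^ r = 1" using t(1) ij by (simp add: power_divide)
    moreover have "(t i / t j) ^ r = t i / t j"
      using t(2) sq by (auto elim!: oddE simp: power_add power_mult)
    ultimately show False using ij t0[OF ij(2)] by simp
  qed
qed

lemma exists_same_class_pair:
  assumes "finite S" "3 \<le> card S"
  shows "\<exists>p\<in>S. \<exists>q\<in>S. p \<noteq> q \<and> (p \<in> Q \<longleftrightarrow> q \<in> Q)"
proof -
  obtain R where "R \<subseteq> S" "card R = 3" using assms(2) by (metis obtain_subset_with_card_n)
  then obtain a b c where "{a, b, c} \<subseteq> S" "a \<noteq> b" "a \<noteq> c" "b \<noteq> c"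
    by (auto simp: card_Suc_eq numeral_3_eq_3)
  then show ?thesis by (cases "a \<in> Q"; cases "b \<in> Q"; cases "c \<in> Q") auto
qed

locale quaternion_cyclic_ops = quaternion_ops sc M I T
  for sc :: "'k::field \<Rightarrow> 'r::comm_ring_1" and M I T +
  fixes C :: "'r \<Rightarrow> 'r" and r :: nat and \<omega> :: 'k
  assumes endoC: "algebra_endo sc C" and M_C: "\<And>x. x \<in> M \<Longrightarrow> C x \<in> M"
    and CI: "\<And>x. C (I x) = I (C x)" and CT: "\<And>x. C (T x) = T (C x)"
    and Cr: "\<And>x. (C ^^ r) x = x" and r: "odd r" "r > 1" "of_nat r \<noteq> (0::'k)"
    and \<omega>: "\<omega> ^ r = 1" "\<And>i. 0 < i \<Longrightarrow> i < r \<Longrightarrow> \<omega> ^ i \<noteq> 1"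
begin

lemma sc_power: "sc (x ^ n) = sc x ^ n"
  by (induction n) (simp_all add: sc_mult)

lemma C_simps: "C (x + y) = C x + C y" "C (x - y) = C x - C y" "C (x * y) = C x * C y"
    "C (- x) = - C x" "C (sc c) = sc c"
  using endoC endo_minus[OF endoC] endo_diff[OF endoC] by (simp_all add: algebra_endo_def)

text \<open>Weight spaces of the additional cyclic group inside the quaternion invariants;
  \<open>MH\<close> consists of the invariants of the whole product.\<close>

definition B :: "'k \<Rightarrow> 'r set" where "B z = {f \<in> MQ. C f = sc z * f}"
definition MH :: "'r set" where "MH = {f \<in> MQ. C f = f}"

lemma r3: "3 \<le> r" using r by (cases "r = 2") auto

lemma MQ_lin: "linear_closed sc MQ"
  using M_lin by (auto simp: linear_closed_def MQ_def I_simps T_simps endo_zero[OF endoI] endo_zero[OF endoT])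

lemma MQ_span: "MQ \<subseteq> ideal.span (\<Union>z\<in>{z. z ^ r = 1}. B z)"
proof -
  have "MQ \<subseteq> ideal.span {f \<in> MQ. \<exists>z. z ^ r = 1 \<and> C f = sc z * f}"
    by (rule eigen_decomposition[OF endoC MQ_lin _ Cr r(3) \<omega>])
      (auto simp: MQ_def M_C simp flip: CI CT)
  also have "{f \<in> MQ. \<exists>z. z ^ r = 1 \<and> C f = sc z * f} = (\<Union>z\<in>{z. z ^ r = 1}. B z)"
    by (auto simp: B_def)
  finally show ?thesis .
qed

lemma C_prod:
  assumes "\<And>i. i \<in> A \<Longrightarrow> C (f i) = sc (t i) * f i"
  shows "C (prod f A) = sc (prod t A) * prod f A"
  using assms by (simp add: endo_prod[OF endoC] prod.distrib sc_prod)

lemma prod_MH: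
  assumes "finite A" "A \<noteq> {}" "\<And>i. i \<in> A \<Longrightarrow> f i \<in> B (t i)" "prod t A = 1"
  shows "prod f A \<in> MH"
proof -
  have "prod f A \<in> MQ"
    using assms by (intro prod_in_mult_closed) (auto simp: MQ_def B_def M_mult I_simps T_simps)
  moreover have "C (prod f A) = prod f A"
    using C_prod[of A f t] assms by (auto simp: B_def)
  ultimately show ?thesis by (simp add: MH_def)
qed

text \<open>Among \<open>r\<close> weight vectors some nonempty subproduct has weight
  \<open>1\<close>. Combined with \<open>quaternion_ideal_power\<close> this alone gives
  \<open>4 * (r * k) + 2\<close>, one more than wanted.\<close>

lemma MQ_power_MH: "ideal_power MQ (r * s) \<subseteq> ideal_power MH s"
proof -
  have "ideal_power (\<Union>z\<in>{z. z ^ r = 1}. B z) r \<subseteq> ideal_power MH 1"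
  proof (rule ideal_power_least[OF ideal_power_subspace])
    fix f assume "\<And>i. i < r \<Longrightarrow> f i \<in> (\<Union>z\<in>{z. z ^ r = 1}. B z)"
    then obtain t where t: "\<And>i. i < r \<Longrightarrow> t i ^ r = 1 \<and> f i \<in> B (t i)" by (auto, metis)
    obtain S where S: "S \<subseteq> {..<r}" "S \<noteq> {}" "prod t S = 1"
      using exists_prod_eq_1[of "{..<r}" t r] t r by auto
    have "prod f S \<in> MH" using S t by (intro prod_MH[of S f t]) (auto intro: finite_subset)
    then show "(\<Prod>i<r. f i) \<in> ideal_power MH 1"
      unfolding prod.subset_diff[OF S(1) finite_lessThan] by (intro ideal_power_scale ideal_power_base)
  qed
  from ideal_power_times[OF this, of s] show ?thesis
    using ideal_power_mono_span[OF MQ_span] by auto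
qed

end

section \<open>Saving one factor: families of 4 N + 1 odd joint eigenvectors\<close>

locale quaternion_cyclic_family = quaternion_cyclic_ops sc M I T C r \<omega>
  for sc :: "'k::field \<Rightarrow> 'r::comm_ring_1" and M I T C r \<omega> +
  fixes k N :: nat and D :: "nat set" and t :: "nat \<Rightarrow> 'k"
  assumes k: "k > 0" and N: "N = r * k" and D: "finite D" "card D = 4 * N + 1"
    and tr: "\<And>i. i \<in> D \<Longrightarrow> t i ^ r = 1"
begin

abbreviation J :: "'r set" where "J \<equiv> ideal_power MH k"

definition F :: "'k \<Rightarrow> 'k \<Rightarrow> 'r set" where "F a z = {f \<in> M. I f = sc a * f \<and> C f = sc z * f}"

text \<open>\<open>Q\<close> is the set of those factors with \<open>I\<close>-eigenvalue \<open>a\<close>; the others have eigenvalue \<open>- a\<close>.\<close>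

definition fam :: "'k \<Rightarrow> nat set \<Rightarrow> (nat \<Rightarrow> 'r) \<Rightarrow> bool" where
  "fam a Q f \<longleftrightarrow> (\<forall>i\<in>D. f i \<in> F (if i \<in> Q then a else - a) (t i))"

text \<open>All families with the given signs are quantified over, because the argument varies the
  signs: applying \<open>T\<close> to a factor negates its \<open>I\<close>-eigenvalue and keeps its
  weight, which yields another family of this shape.\<close>

definition good :: "'k \<Rightarrow> nat set \<Rightarrow> bool" where
  "good a Q \<longleftrightarrow> (\<forall>f. fam a Q f \<longrightarrow> prod f D \<in> J)"

lemma N3: "3 \<le> N"
proof -
  have "3 * 1 \<le> r * k" using r3 k by (intro mult_le_mono) auto
  then show ?thesis by (simp add: N)
qed

lemma good_complement: "good a Q \<longleftrightarrow> good (- a) (D - Q)"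
proof -
  have "fam a Q f \<longleftrightarrow> fam (- a) (D - Q) f" for f
    by (auto simp: fam_def)
  then show ?thesis by (simp add: good_def)
qed

lemma MQ_J: "z \<in> ideal_power MQ N \<Longrightarrow> z \<in> J"
  using MQ_power_MH[of k] by (auto simp: N)

text \<open>Together with \<open>r - 3\<close> more weight vectors, two invariants of different
  weight contain a nonempty subproduct of weight \<open>1\<close> by
  \<open>exists_prod_eq_1_nonconstant\<close>; the other \<open>r * (k - 1)\<close> factors give
  \<open>k - 1\<close> more. So \<open>N - 1\<close> factors from \<open>MQ\<close> do the work of
  \<open>N\<close>.\<close>

lemma distinct_weights_J:
  assumes b: "b1 \<in> B z1" "b2 \<in> B z2" "z1 \<noteq> z2" "z1 ^ r = 1" "z2 ^ r = 1" and x: "x \<in> ideal_power MQ (N - 3)"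
  shows "b1 * b2 * x \<in> J"
proof -
  let ?W = "\<Union>z\<in>{z. z ^ r = 1}. B z"
  have "ideal_power MQ (N - 3) \<subseteq> ideal_power ?W (N - 3)" by (rule ideal_power_mono_span[OF MQ_span])
  also have "\<dots> \<subseteq> {x. b1 * b2 * x \<in> J}"
  proof (rule ideal_power_least[OF subspace_mult_left[OF ideal_power_subspace]], clarify)
    fix f assume f: "\<And>i. i < N - 3 \<Longrightarrow> f i \<in> ?W"
    then have "\<forall>i\<in>{..<N - 3}. \<exists>z. z ^ r = 1 \<and> f i \<in> B z" by blast
    then obtain u where u: "\<And>i. i < N - 3 \<Longrightarrow> u i ^ r = 1 \<and> f i \<in> B (u i)"
      by (metis lessThan_iff)
    have "r \<le> r * k" using k by (cases k) auto
    then have le: "r - 3 \<le> N - 3" unfolding N by (rule diff_le_mono)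
    \<comment> \<open>The indices \<open>N\<close> and \<open>Suc N\<close> lie outside the range
      used for \<open>f\<close> and serve as names of the two extra factors.\<close>
    let ?g = "\<lambda>i. if i = N then b1 else if i = Suc N then b2 else f i"
    let ?w = "\<lambda>i. if i = N then z1 else if i = Suc N then z2 else u i"
    let ?A = "insert N (insert (Suc N) {..<r - 3})"
    have A: "?g i \<in> B (?w i) \<and> ?w i ^ r = 1" if "i \<in> ?A" for i using that u le b by auto
    have nin: "N \<notin> insert (Suc N) {..<r - 3}" "Suc N \<notin> {..<r - 3}" using le by auto
    then have cA: "card ?A = r - 1" using r3 by simp
    have ex: "\<exists>S\<subseteq>?A. S \<noteq> {} \<and> prod ?w S = 1"
    proof (rule exists_prod_eq_1_nonconstant[of _ _ r N "Suc N"])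
      show "?w i ^ r = 1" if "i \<in> ?A" for i using A[OF that] by blast
      show "r \<le> Suc (card ?A)" unfolding cA by simp
      show "?w N \<noteq> ?w (Suc N)" using b(3) by simp
    qed (use r3 in simp_all)
    then obtain S where S: "S \<subseteq> ?A" "S \<noteq> {}" "prod ?w S = 1" by blast
    have "prod ?g S \<in> MH"
    proof (rule prod_MH[of S ?g ?w])
      show "finite S" using S(1) by (rule finite_subset) simp
      show "?g i \<in> B (?w i)" if "i \<in> S" for i using A S(1) that by blast
    qed (fact S(2,3))+
    moreover have "prod ?g ?A = prod ?g (?A - S) * prod ?g S"
      by (rule prod.subset_diff[OF S(1)]) simp
    ultimately have "prod ?g ?A \<in> ideal_power MH 1"
      by (simp only: ideal_power_scale ideal_power_base)
    moreover have "prod ?g ?A = b1 * (b2 * (\<Prod>i<r - 3. f i))"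
    proof -
      have "prod ?g {..<r - 3} = (\<Prod>i<r - 3. f i)" using le by (intro prod.cong) auto
      moreover have "prod ?g ?A = ?g N * (?g (Suc N) * prod ?g {..<r - 3})"
        using nin by simp
      ultimately show ?thesis by simp
    qed
    moreover have "(\<Prod>i<N - 3. f i) = (\<Prod>i<r - 3. f i) * prod f {r - 3..<N - 3}"
      using le by (metis atLeast0LessThan prod.atLeastLessThan_concat zero_le)
    moreover have "prod f {r - 3..<N - 3} \<in> ideal_power MH (k - 1)"
    proof -
      have "N - 3 - (r - 3) = r * (k - 1)" using r3 le by (simp add: N diff_mult_distrib2)
      then have "prod f {r - 3..<N - 3} \<in> ideal_power MQ (r * (k - 1))"
        using u by (intro ideal_power_prod) (auto simp: B_def)
      then show ?thesis using MQ_power_MH by blast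
    qed
    ultimately have "b1 * (b2 * (\<Prod>i<r - 3. f i)) * prod f {r - 3..<N - 3} \<in> ideal_power MH (1 + (k - 1))"
      by (intro ideal_power_mult) simp_all
    then show "b1 * b2 * (\<Prod>i<N - 3. f i) \<in> J"
      using k \<open>(\<Prod>i<N - 3. f i) = (\<Prod>i<r - 3. f i) * prod f {r - 3..<N - 3}\<close> by (simp add: mult.assoc)
  qed
  finally show ?thesis using x by blast
qed

text \<open>Typically \<open>p\<close> is made of two of the \<open>4 * N + 1\<close> factors. The
  other \<open>4 * N - 1\<close> suffice for \<open>N - 1\<close> quaternion invariants, so that
  \<open>N\<close> are reached.\<close>

lemma MQ_Od_J: "p \<in> MQ \<Longrightarrow> z \<in> ideal_power Od n \<Longrightarrow> 4 * N - 1 \<le> n \<Longrightarrow> p * z \<in> J"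
proof -
  assume p: "p \<in> MQ" and z: "z \<in> ideal_power Od n" "4 * N - 1 \<le> n"
  have "z \<in> ideal_power MQ (N - 1)" using z N3 by (intro Od_MQ) auto
  then have "p * z \<in> ideal_power MQ (1 + (N - 1))" by (intro ideal_power_mult ideal_power_base p)
  then show ?thesis using N3 MQ_J by simp
qed

context
  fixes a :: 'k
  assumes a: "a * a = - 1"
begin

lemma sign_square: "b = a \<or> b = - a \<Longrightarrow> b * b = - 1"
  using a by auto

lemma F_T: "b = a \<or> b = - a \<Longrightarrow> f \<in> F b z \<Longrightarrow> T f \<in> F (- b) z"
proof -
  assume b: "b = a \<or> b = - a" and f: "f \<in> F b z"
  have "I (I (I f)) = sc (b * (b * b)) * f"
    using f by (simp add: F_def I_simps sc_mult mult.assoc)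
  also have "b * (b * b) = - b" using sign_square[OF b] by simp
  finally show ?thesis using f
    by (simp add: F_def IT T_simps M_T CT sc_minus)
qed

lemma fam_Od: "fam a Q f \<Longrightarrow> i \<in> D \<Longrightarrow> f i \<in> Od"
proof -
  assume "fam a Q f" "i \<in> D"
  then obtain b where b: "b = a \<or> b = - a" "f i \<in> F b (t i)" unfolding fam_def by (metis (full_types))
  then have "I (I (f i)) = sc (b * b) * f i" by (simp add: F_def I_simps sc_mult mult.assoc)
  then show ?thesis using b sign_square[OF b(1)] by (simp add: Od_def F_def sc_minus)
qed

lemma fam_C: "fam a Q f \<Longrightarrow> A \<subseteq> D \<Longrightarrow> C (prod f A) = sc (prod t A) * prod f A"
  by (rule C_prod) (auto simp: fam_def F_def)

lemma prod_t_power: "A \<subseteq> D \<Longrightarrow> prod t A ^ r = 1"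
  using tr by (auto simp: prod_power_distrib intro!: prod.neutral)

lemma fam_prod_Od: "fam a Q f \<Longrightarrow> A \<subseteq> D \<Longrightarrow> prod f A \<in> ideal_power Od (card A)"
  using fam_Od D by (intro ideal_power_prod) (auto intro: finite_subset)

definition flip_at :: "nat set \<Rightarrow> (nat \<Rightarrow> 'r) \<Rightarrow> nat \<Rightarrow> 'r" where
  "flip_at V f = (\<lambda>i. if i \<in> V then T (f i) else f i)"

lemma fam_flip: "fam a Q f \<Longrightarrow> V \<subseteq> D \<Longrightarrow> fam a ((Q - V) \<union> (V - Q)) (flip_at V f)"
  using F_T[of a] F_T[of "- a"] by (auto simp: fam_def flip_at_def split: if_splits)

lemma prod_flip: "A \<subseteq> D \<Longrightarrow> prod (flip_at D f) A = T (prod f A)"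
  by (auto simp: flip_at_def endo_prod[OF endoT] intro!: prod.cong)

lemma fam_T_prod_Od: "fam a Q f \<Longrightarrow> A \<subseteq> D \<Longrightarrow> T (prod f A) \<in> ideal_power Od (card A)"
  using fam_prod_Od[OF fam_flip[of Q f D], of A] prod_flip[of A f] by simp

lemma fam_pl_Od: "fam a Q f \<Longrightarrow> A \<subseteq> D \<Longrightarrow> pl (prod f A) \<in> ideal_power Od (card A)"
  and fam_mi_Od: "fam a Q f \<Longrightarrow> A \<subseteq> D \<Longrightarrow> mi (prod f A) \<in> ideal_power Od (card A)"
  unfolding pl_def mi_def
  by (intro ideal_power_scale ideal_power_add ideal_power_diff fam_prod_Od fam_T_prod_Od; assumption)+

text \<open>For \<open>x = prod f V\<close> both \<open>2 * pl x - T x\<close> and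
  \<open>2 * mi x + T x\<close> equal \<open>x\<close>. So either alternative lets \<open>x\<close>
  be replaced by \<open>T x\<close> up to sign modulo \<open>J\<close>, which flips the signs on
  \<open>V\<close>.\<close>

lemma flip_cases:
  assumes V: "V \<subseteq> D" and "good a ((Q - V) \<union> (V - Q))"
    and *: "\<And>f. fam a Q f \<Longrightarrow> pl (prod f V) * prod f (D - V) \<in> J \<or> mi (prod f V) * prod f (D - V) \<in> J"
  shows "good a Q"
  unfolding good_def
proof (intro allI impI)
  fix f assume f: "fam a Q f"
  have "prod (flip_at V f) D = prod (flip_at V f) (D - V) * prod (flip_at V f) V"
    using V D by (intro prod.subset_diff)
  also have "prod (flip_at V f) (D - V) = prod f (D - V)" by (rule prod.cong) (auto simp: flip_at_def)
  also have "prod (flip_at V f) V = T (prod f V)"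
    by (auto simp: flip_at_def endo_prod[OF endoT] intro!: prod.cong)
  finally have flip: "prod (flip_at V f) D = prod f (D - V) * T (prod f V)" .
  have "prod (flip_at V f) D \<in> J"
    using assms(2) fam_flip[OF f V] unfolding good_def by blast
  then have T: "prod f (D - V) * T (prod f V) \<in> J" unfolding flip .
  have P: "prod f D = prod f (D - V) * prod f V" using V D by (intro prod.subset_diff)
  have "prod f V = pl (prod f V) + pl (prod f V) - T (prod f V)" "prod f V = mi (prod f V) + mi (prod f V) + T (prod f V)"
    unfolding pl_pl mi_mi by simp_all
  then have 1: "prod f D = pl (prod f V) * prod f (D - V) + pl (prod f V) * prod f (D - V) - prod f (D - V) * T (prod f V)"
    and 2: "prod f D = mi (prod f V) * prod f (D - V) + mi (prod f V) * prod f (D - V) + prod f (D - V) * T (prod f V)"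
    unfolding P by (metis (no_types, lifting) distrib_left left_diff_distrib mult.commute)
      (metis \<open>prod f V = mi (prod f V) + mi (prod f V) + T (prod f V)\<close> distrib_left mult.commute)
  show "prod f D \<in> J"
    using *[OF f]
  proof
    assume "pl (prod f V) * prod f (D - V) \<in> J"
    then show ?thesis using T unfolding 1 by (intro ideal_power_diff ideal_power_add)
  next
    assume "mi (prod f V) * prod f (D - V) \<in> J"
    then show ?thesis using T unfolding 2 by (intro ideal_power_add)
  qed
qed

lemma fam_pair_Mi:
  assumes f: "fam a Q f" and "x \<in> Q" "x \<in> D" "y \<in> D" "y \<notin> Q"
  shows "f x * f y \<in> Mi"
proof -
  have "f x \<in> F a (t x)" "f y \<in> F (- a) (t y)" using assms by (auto simp: fam_def)
  then have "f x * f y \<in> M" and I: "I (f x * f y) = (sc a * sc (- a)) * (f x * f y)"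
    by (auto simp: F_def M_mult I_simps mult_ac)
  moreover have "sc a * sc (- a) = 1" using a by (simp flip: sc_mult)
  ultimately show ?thesis by (simp add: Mi_def)
qed

lemma fam_four_Mi:
  assumes f: "fam a Q f" and V: "V \<subseteq> D - Q" "card V = 4"
  shows "prod f V \<in> Mi"
proof -
  have F: "f i \<in> F (- a) (t i)" if "i \<in> V" for i
  proof -
    have "i \<in> D" "i \<notin> Q" using V that by auto
    then show ?thesis using f by (auto simp: fam_def dest: bspec[of D _ i])
  qed
  have fV: "finite V" "V \<noteq> {}" using V by (auto intro: card_ge_0_finite)
  have "prod f V \<in> M" using F fV by (intro prod_in_mult_closed M_mult) (auto simp: F_def)
  moreover have "I (prod f V) = sc ((- a) ^ 4) * prod f V"
  proof -
    have "I (prod f V) = (\<Prod>i\<in>V. sc (- a) * f i)"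
      using F by (simp add: endo_prod[OF endoI] F_def)
    also have "\<dots> = sc (- a) ^ card V * prod f V" by (simp add: prod.distrib)
    also have "sc (- a) ^ card V = sc ((- a) ^ 4)" unfolding V(2) by (rule sc_power[symmetric])
    finally show ?thesis .
  qed
  moreover have "(- a) ^ 4 = (a * a) * (a * a)" by (simp add: power4_eq_xxxx mult.assoc)
  then have "(- a) ^ 4 = 1" using a by simp
  ultimately show ?thesis by (simp add: Mi_def)
qed

lemma pl_B: "f \<in> Mi \<Longrightarrow> C f = sc z * f \<Longrightarrow> pl f \<in> B z"
  using pl_MQ[of f] by (simp add: B_def pl_def C_simps CT T_simps algebra_simps)

lemma C_mi: "C f = sc z * f \<Longrightarrow> C (mi f) = sc z * mi f"
  by (simp add: mi_def C_simps CT T_simps algebra_simps)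

lemma mi_mi_B: "f \<in> Mi \<Longrightarrow> C f = sc z * f \<Longrightarrow> g \<in> Mi \<Longrightarrow> C g = sc w * g \<Longrightarrow> mi f * mi g \<in> B (z * w)"
  using mi_mi_MQ[of f g] C_mi[of f z] C_mi[of g w] by (simp add: B_def C_simps sc_mult mult_ac)

lemma fam_pair_C: "fam a Q f \<Longrightarrow> x \<in> D \<Longrightarrow> y \<in> D \<Longrightarrow> C (f x * f y) = sc (t x * t y) * (f x * f y)"
  by (auto simp: fam_def F_def C_simps sc_mult mult_ac)

text \<open>Factors of opposite sign have their product in \<open>Mi\<close>, so its
  \<open>pl\<close> part is an invariant and the rest is long enough for \<open>MQ_Od_J\<close>.
  Flipping both factors exchanges their roles.\<close>

lemma exchange:
  assumes "x \<in> Q" "x \<in> D" "y \<in> D" "y \<notin> Q" "good a (insert y (Q - {x}))"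
  shows "good a Q"
proof (rule flip_cases[of "{x, y}"])
  have "(Q - {x, y}) \<union> ({x, y} - Q) = insert y (Q - {x})" using assms by auto
  then show "good a ((Q - {x, y}) \<union> ({x, y} - Q))" using assms by simp
  fix f assume f: "fam a Q f"
  have ne: "x \<noteq> y" using assms by auto
  have "pl (f x * f y) * prod f (D - {x, y}) \<in> J"
  proof (rule MQ_Od_J)
    show "pl (f x * f y) \<in> MQ" using fam_pair_Mi[OF f] assms by (intro pl_MQ) auto
    show "prod f (D - {x, y}) \<in> ideal_power Od (card (D - {x, y}))" by (intro fam_prod_Od[OF f]) auto
    show "4 * N - 1 \<le> card (D - {x, y})" using assms ne D by (simp add: card_Diff_subset)
  qed
  then show "pl (prod f {x, y}) * prod f (D - {x, y}) \<in> J \<or> mi (prod f {x, y}) * prod f (D - {x, y}) \<in> J"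
    using ne by simp
qed (use assms in auto)

text \<open>Repeated exchanges lead from \<open>Q\<close> to any set of the same size, so from here
  on \<open>Q\<close> may be placed conveniently relative to the weights.\<close>

lemma good_card:
  assumes "Q \<subseteq> D" "Q' \<subseteq> D" "card Q = card Q'" "good a Q'"
  shows "good a Q"
  using assms(1,3)
proof (induction "card (Q - Q')" arbitrary: Q)
  case 0
  then have "Q \<subseteq> Q'" using D finite_subset by (metis Diff_eq_empty_iff card_0_eq finite_Diff)
  then have "Q = Q'" using 0 assms(2) D finite_subset by (metis card_subset_eq)
  then show ?case using assms(4) by simp
next
  case (Suc n)
  have fin: "finite Q" "finite Q'" using Suc.prems assms(2) D finite_subset by auto
  obtain x where x: "x \<in> Q" "x \<notin> Q'" using Suc.hyps(2) by (metis Diff_iff card.empty equals0I nat.distinct(1))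
  have "\<not> Q' \<subseteq> Q"
    using Suc.prems(2) x fin card_subset_eq by metis
  then obtain y where y: "y \<in> Q'" "y \<notin> Q" by auto
  let ?Y = "insert y (Q - {x})"
  have "?Y - Q' = (Q - Q') - {x}" using x y by auto
  then have "card (?Y - Q') = n" using Suc.hyps(2) x fin by simp
  moreover have "card ?Y = Suc (card (Q - {x}))" using y fin by simp
  then have "card ?Y = card Q'" using x fin Suc.prems(2) by (simp add: card_Suc_Diff1 del: card_Diff_insert)
  ultimately have "good a ?Y" using Suc.hyps(1)[of ?Y] Suc.prems assms(2) y by auto
  then show ?case using exchange[of x Q y] x y Suc.prems assms(2) by auto
qed

text \<open>Expand \<open>f x * f y\<close> and \<open>prod f V'\<close> into \<open>pl\<close> and
  \<open>mi\<close> parts. Terms with the \<open>pl\<close> part of the pair fall under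
  \<open>MQ_Od_J\<close>. Each of the other two contains a pair of invariants, whose weights differ
  by the hypotheses \<open>ne\<close>; the remaining \<open>4 * N - 9\<close> factors give the
  \<open>N - 3\<close> invariants that \<open>distinct_weights_J\<close> asks for.\<close>

lemma nonconstant_core:
  assumes f: "fam a Q f" and x: "x \<in> Q" "x \<in> D" and y: "y \<in> D" "y \<notin> Q" "y \<notin> V" "y \<notin> V'"
    and V: "V \<subseteq> D - Q" "V' \<subseteq> D - Q" "V \<inter> V' = {}" "card V = 4" "card V' = 4"
    and ne: "prod t V \<noteq> prod t V'" "prod t V \<noteq> t x * t y * prod t V'"
  shows "pl (prod f V) * prod f (D - V) \<in> J"
proof -
  have fin: "finite V" "finite V'" using V D by (auto intro: card_ge_0_finite)
  define R where "R = D - V - V' - {x, y}"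
  have xy: "x \<noteq> y" "x \<notin> V" "x \<notin> V'" using x y V by auto
  have DV: "D - V = {x, y} \<union> (V' \<union> R)" using x y V R_def by auto
  have fR: "finite R" using D by (simp add: R_def)
  have "prod f (D - V) = prod f {x, y} * prod f (V' \<union> R)"
    unfolding DV using fin fR xy y R_def by (intro prod.union_disjoint) auto
  also have "prod f (V' \<union> R) = prod f V' * prod f R"
    using fin fR R_def by (intro prod.union_disjoint) auto
  finally have P: "prod f (D - V) = (f x * f y) * (prod f V' * prod f R)" using xy by simp
  have "card (V' \<union> R) = card V' + card R" using fin fR R_def by (intro card_Un_disjoint) auto
  moreover have "card (D - V) = card {x, y} + card (V' \<union> R)"
    unfolding DV using fin fR xy y R_def by (intro card_Un_disjoint) auto
  moreover have "card (D - V) = card D - card V" using V fin by (intro card_Diff_subset) auto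
  ultimately have cR: "card R = 4 * N - 9" using V D xy by simp
  let ?u = "f x * f y" and ?v = "prod f V" and ?w = "prod f V'" and ?R = "prod f R"
  have R: "?R \<in> ideal_power Od (4 * N - 9)" using fam_prod_Od[OF f, of R] cR by (auto simp: R_def)
  then have RQ: "?R \<in> ideal_power MQ (N - 3)" using N3 by (intro Od_MQ) auto
  have plv: "pl ?v \<in> ideal_power Od 4" using fam_pl_Od[OF f, of V] V by auto
  have w: "?w \<in> ideal_power Od 4" using fam_prod_Od[OF f, of V'] V by auto
  have Mi: "?u \<in> Mi" "?v \<in> Mi" "?w \<in> Mi"
    using fam_pair_Mi[OF f] fam_four_Mi[OF f] x y V by auto
  have Cu: "C ?u = sc (t x * t y) * ?u" by (rule fam_pair_C[OF f x(2) y(1)])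
  have Cv: "C ?v = sc (prod t V) * ?v" and Cw: "C ?w = sc (prod t V') * ?w"
    using V by (auto intro!: fam_C[OF f])
  have pw: "prod t V ^ r = 1" "prod t V' ^ r = 1" "(t x * t y * prod t V') ^ r = 1"
    using V x y tr prod_t_power[of V] prod_t_power[of V'] by (auto simp: power_mult_distrib)
  have 1: "pl ?u * (pl ?v * (?w * ?R)) \<in> J"
  proof (rule MQ_Od_J)
    show "pl ?u \<in> MQ" using Mi by (intro pl_MQ)
    have "pl ?v * (?w * ?R) \<in> ideal_power Od (4 + (4 + (4 * N - 9)))"
      by (intro ideal_power_mult plv w R)
    then show "pl ?v * (?w * ?R) \<in> ideal_power Od (4 * N - 1)" using N3 by simp
  qed simp
  have 2: "pl ?v * pl ?w * (mi ?u * ?R) \<in> J"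
    by (intro distinct_weights_J[OF _ _ ne(1) pw(1,2)] pl_B Mi Cv Cw ideal_power_scale RQ)
  have 3: "pl ?v * (mi ?u * mi ?w) * ?R \<in> J"
    by (intro distinct_weights_J[OF _ _ ne(2) pw(1,3)] pl_B mi_mi_B Mi Cu Cv Cw RQ)
  have "pl ?v * ((pl ?u + mi ?u) * ((pl ?w + mi ?w) * ?R))
     = pl ?u * (pl ?v * ((pl ?w + mi ?w) * ?R)) + (pl ?v * pl ?w * (mi ?u * ?R) + pl ?v * (mi ?u * mi ?w) * ?R)"
    by (simp add: algebra_simps)
  then have "pl ?v * (?u * (?w * ?R)) = pl ?u * (pl ?v * (?w * ?R)) + (pl ?v * pl ?w * (mi ?u * ?R) + pl ?v * (mi ?u * mi ?w) * ?R)"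
    unfolding pl_plus_mi .
  then show ?thesis unfolding P using 1 2 3 by (simp add: ideal_power_add)
qed

text \<open>Flipping a suitable \<open>V\<close> raises \<open>card Q\<close> by \<open>4\<close>.
  If the two four-element sets violate the second weight condition, they are interchanged: a
  violation both ways would give \<open>(t x * t y) ^ 2 = 1\<close>, so \<open>t x * t y = 1\<close>
  as \<open>r\<close> is odd, and the two products of weights would agree.\<close>

lemma nonconstant_step:
  assumes ij: "i \<in> D" "j \<in> D" "t i \<noteq> t j" and Q: "Q \<subseteq> D" "1 \<le> card Q" "card Q + 9 \<le> card D"
    and *: "\<And>Q'. Q' \<subseteq> D \<Longrightarrow> card Q' = card Q + 4 \<Longrightarrow> good a Q'"
  shows "good a Q"
proof -
  have "2 * Suc 3 \<le> card D" using D N3 by simp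
  from exists_disjoint_prods_neq[OF D(1) this tr r(1) ij]
  obtain V0 V0' where V0: "V0 \<subseteq> D" "V0' \<subseteq> D" "V0 \<inter> V0' = {}" "card V0 = 4" "card V0' = 4" "prod t V0 \<noteq> prod t V0'"
    by auto
  have fin: "finite V0" "finite V0'" using V0 by (auto intro: card_ge_0_finite)
  have "card (D - (V0 \<union> V0')) = card D - 8"
    using V0 fin by (subst card_Diff_subset) (auto simp: card_Un_disjoint)
  then have "2 \<le> card (D - (V0 \<union> V0'))" using D N3 by simp
  then obtain E where E: "E \<subseteq> D - (V0 \<union> V0')" "card E = 2" by (metis obtain_subset_with_card_n)
  then obtain x y where "E = {x, y}" "x \<noteq> y" by (auto simp: card_2_iff)
  then have xy: "x \<in> D" "y \<in> D" "x \<noteq> y" "x \<notin> V0" "x \<notin> V0'" "y \<notin> V0" "y \<notin> V0'" using E by auto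
  have "\<exists>V V'. V \<subseteq> D \<and> V' \<subseteq> D \<and> V \<inter> V' = {} \<and> card V = 4 \<and> card V' = 4 \<and> V \<union> V' = V0 \<union> V0' \<and>
      prod t V \<noteq> prod t V' \<and> prod t V \<noteq> t x * t y * prod t V'"
  proof (cases "prod t V0 = t x * t y * prod t V0'")
    case False
    then show ?thesis using V0 by blast
  next
    case True
    have "prod t V0' \<noteq> t x * t y * prod t V0"
    proof
      assume eq: "prod t V0' = t x * t y * prod t V0"
      let ?u = "t x * t y"
      have nz: "prod t V0 \<noteq> 0" using prod_t_power[OF V0(1)] r by (auto simp: power_0_left)
      have "prod t V0 = ?u * (?u * prod t V0)" using True eq by (simp add: mult.assoc)
      then have u2: "?u ^ 2 = 1" using nz by (simp add: power2_eq_square mult.assoc[symmetric])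
      have "?u ^ r = 1" using tr xy by (simp add: power_mult_distrib)
      moreover have "?u ^ r = ?u" using r(1) u2 by (auto elim!: oddE simp: power_add power_mult)
      ultimately have "?u = 1" by simp
      then show False using True V0(6) by (simp add: mult.assoc)
    qed
    then show ?thesis using V0 True by (intro exI[of _ V0'] exI[of _ V0]) auto
  qed
  then obtain V V' where V: "V \<subseteq> D" "V' \<subseteq> D" "V \<inter> V' = {}" "card V = 4" "card V' = 4" "V \<union> V' = V0 \<union> V0'"
    and ne: "prod t V \<noteq> prod t V'" "prod t V \<noteq> t x * t y * prod t V'" by blast
  have xy': "x \<notin> V" "x \<notin> V'" "y \<notin> V" "y \<notin> V'" using xy V(6) by auto
  have finV: "finite V" "finite V'" using V by (auto intro: card_ge_0_finite)
  have cU: "card ({x, y} \<union> (V \<union> V')) = 10"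
    using V(1-5) finV xy(3) xy' by (simp add: card_Un_disjoint)
  have "card (D - ({x, y} \<union> (V \<union> V'))) = card D - 10"
    using V finV xy cU by (subst card_Diff_subset) auto
  then have "card Q - 1 \<le> card (D - ({x, y} \<union> (V \<union> V')))" using Q by simp
  then obtain Y where Y: "Y \<subseteq> D - ({x, y} \<union> (V \<union> V'))" "card Y = card Q - 1" by (metis obtain_subset_with_card_n)
  let ?Q = "insert x Y"
  have fY: "finite Y" using Y D finite_subset by blast
  have cX: "card ?Q = card Q" using Y fY Q by (subst card_insert_disjoint) auto
  have "good a ?Q"
  proof (rule flip_cases[of V])
    have "(?Q - V) \<union> (V - ?Q) = ?Q \<union> V" using Y xy' by auto
    moreover have "card (?Q \<union> V) = card ?Q + card V" using fY finV Y xy' by (intro card_Un_disjoint) auto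
    ultimately show "good a ((?Q - V) \<union> (V - ?Q))" using * [of "?Q \<union> V"] cX V(1,4) xy(1) Y(1) by auto
    fix f assume f: "fam a ?Q f"
    have "pl (prod f V) * prod f (D - V) \<in> J"
      by (rule nonconstant_core[OF f, of x y V V']) (use V xy xy' Y ne in auto)
    then show "pl (prod f V) * prod f (D - V) \<in> J \<or> mi (prod f V) * prod f (D - V) \<in> J" ..
  qed (use V in auto)
  then show ?thesis using good_card[of Q ?Q] Q cX Y xy by auto
qed

text \<open>Four pairs of opposite sign have products in \<open>Mi\<close>. A term containing the
  \<open>pl\<close> part of one of them falls under \<open>MQ_Od_J\<close>, so only the product of
  the four \<open>mi\<close> parts matters; taken two by two, these are invariants of different
  weights.\<close>

lemma nonconstant_middle_core:
  assumes f: "fam a Q f" and V: "{x1, y1, x2, y2} \<subseteq> D" "{x3, y3, x4, y4} \<subseteq> D"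
    and dist: "distinct [x1, y1, x2, y2, x3, y3, x4, y4]"
    and Q: "x1 \<in> Q" "x2 \<in> Q" "x3 \<in> Q" "x4 \<in> Q" "y1 \<notin> Q" "y2 \<notin> Q" "y3 \<notin> Q" "y4 \<notin> Q"
    and ne: "prod t {x1, y1, x2, y2} \<noteq> prod t {x3, y3, x4, y4}"
  shows "prod f D \<in> J"
proof -
  let ?E = "{x1, y1, x2, y2, x3, y3, x4, y4}"
  let ?u1 = "f x1 * f y1" and ?u2 = "f x2 * f y2" and ?u3 = "f x3 * f y3" and ?u4 = "f x4 * f y4"
    and ?R = "prod f (D - ?E)"
  have "prod f D = ?R * prod f ?E" using V D by (intro prod.subset_diff) auto
  also have "prod f ?E = ?u1 * (?u2 * (?u3 * ?u4))" using dist by (simp add: mult_ac)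
  finally have P: "prod f D = ?u1 * (?u2 * (?u3 * (?u4 * ?R)))" by (simp add: mult_ac)
  have "card (D - ?E) = card D - card ?E" using V by (intro card_Diff_subset) auto
  then have cR: "card (D - ?E) = 4 * N - 7" using D dist by simp
  have R: "?R \<in> ideal_power Od (4 * N - 7)" using fam_prod_Od[OF f, of "D - ?E"] cR by auto
  then have RQ: "?R \<in> ideal_power MQ (N - 3)" using N3 by (intro Od_MQ) auto
  have Mi: "?u1 \<in> Mi" "?u2 \<in> Mi" "?u3 \<in> Mi" "?u4 \<in> Mi" using fam_pair_Mi[OF f] V Q by auto
  have pairs: "f x * f y \<in> ideal_power Od 2" "mi (f x * f y) \<in> ideal_power Od 2"
    if "x \<in> D" "y \<in> D" "x \<noteq> y" for x y
    using that fam_prod_Od[OF f, of "{x, y}"] fam_mi_Od[OF f, of "{x, y}"] by (auto simp: numeral_2_eq_2)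
  have Od: "?u1 \<in> ideal_power Od 2" "?u2 \<in> ideal_power Od 2" "?u3 \<in> ideal_power Od 2" "?u4 \<in> ideal_power Od 2"
     "mi ?u1 \<in> ideal_power Od 2" "mi ?u2 \<in> ideal_power Od 2" "mi ?u3 \<in> ideal_power Od 2"
    using V dist by (auto intro!: pairs)
  \<comment> \<open>Three pairs and the remaining \<open>4 * N - 7\<close> factors make up the
    \<open>4 * N - 1\<close> odd factors required.\<close>
  have key: "pl p * (x * (y * (z * ?R))) \<in> J"
    if "p \<in> Mi" "x \<in> ideal_power Od 2" "y \<in> ideal_power Od 2" "z \<in> ideal_power Od 2" for p x y z
  proof (rule MQ_Od_J[OF pl_MQ[OF that(1)]])
    have "x * (y * (z * ?R)) \<in> ideal_power Od (2 + (2 + (2 + (4 * N - 7))))"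
      by (intro ideal_power_mult that R)
    moreover have "2 + (2 + (2 + (4 * N - 7))) = 4 * N - 1" using N3 by arith
    ultimately show "x * (y * (z * ?R)) \<in> ideal_power Od (4 * N - 1)" by (simp only:)
  qed simp
  have Cp: "C (f x * f y) = sc (t x * t y) * (f x * f y)" if "x \<in> D" "y \<in> D" for x y
    using fam_pair_C[OF f that] .
  have "mi ?u1 * mi ?u2 \<in> B ((t x1 * t y1) * (t x2 * t y2))" "mi ?u3 * mi ?u4 \<in> B ((t x3 * t y3) * (t x4 * t y4))"
    using V by (auto intro!: mi_mi_B Mi Cp)
  moreover have "prod t {x1, y1, x2, y2} = (t x1 * t y1) * (t x2 * t y2)"
    "prod t {x3, y3, x4, y4} = (t x3 * t y3) * (t x4 * t y4)"
    using dist by (simp_all add: mult.assoc)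
  ultimately have last: "(mi ?u1 * mi ?u2) * (mi ?u3 * mi ?u4) * ?R \<in> J"
    using distinct_weights_J[OF _ _ ne _ _ RQ] prod_t_power[OF V(1)] prod_t_power[OF V(2)] by metis
  have split: "y * (u * z) \<in> J" if "pl u * (y * z) \<in> J" "y * (mi u * z) \<in> J" for u y z
  proof -
    have "y * ((pl u + mi u) * z) = pl u * (y * z) + y * (mi u * z)" by (simp add: algebra_simps)
    then show ?thesis using ideal_power_add[OF that] unfolding pl_plus_mi by simp
  qed
  have "mi ?u1 * (mi ?u2 * (mi ?u3 * (?u4 * ?R))) \<in> J"
    using split[of ?u4 "mi ?u1 * (mi ?u2 * mi ?u3)" ?R] key[OF Mi(4) Od(5,6,7)] last by (simp add: mult.assoc)
  then have "mi ?u1 * (mi ?u2 * (?u3 * (?u4 * ?R))) \<in> J"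
    using split[of ?u3 "mi ?u1 * mi ?u2" "?u4 * ?R"] key[OF Mi(3) Od(5,6,4)] by (simp add: mult.assoc)
  then have "mi ?u1 * (?u2 * (?u3 * (?u4 * ?R))) \<in> J"
    using split[of ?u2 "mi ?u1" "?u3 * (?u4 * ?R)"] key[OF Mi(2) Od(5,3,4)] by blast
  then show ?thesis
    unfolding P using split[of ?u1 1 "?u2 * (?u3 * (?u4 * ?R))"] key[OF Mi(1) Od(2,3,4)] by simp
qed

text \<open>\<open>Q\<close> is moved so that it contains exactly two elements of each of
  \<open>V\<close> and \<open>V'\<close>; the size conditions leave room for four elements inside
  and four outside.\<close>

lemma nonconstant_middle:
  assumes ij: "i \<in> D" "j \<in> D" "t i \<noteq> t j" and Q: "Q \<subseteq> D" "4 \<le> card Q" "card Q + 4 \<le> card D"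
  shows "good a Q"
proof -
  have "2 * Suc 3 \<le> card D" using D N3 by simp
  from exists_disjoint_prods_neq[OF D(1) this tr r(1) ij]
  obtain V V' where V: "V \<subseteq> D" "V' \<subseteq> D" "V \<inter> V' = {}" "card V = 4" "card V' = 4" "prod t V \<noteq> prod t V'"
    by auto
  obtain x1 y1 x2 y2 where e: "V = {x1, y1, x2, y2}" "distinct [x1, y1, x2, y2]"
    using V(4) by (auto simp: card_Suc_eq numeral_eq_Suc)
  obtain x3 y3 x4 y4 where e': "V' = {x3, y3, x4, y4}" "distinct [x3, y3, x4, y4]"
    using V(5) by (auto simp: card_Suc_eq numeral_eq_Suc)
  have dist: "distinct [x1, y1, x2, y2, x3, y3, x4, y4]" using e e' V(3) by auto
  have fin: "finite V" "finite V'" using V by (auto intro: card_ge_0_finite)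
  have "card (V \<union> V') = 8" using V fin by (simp add: card_Un_disjoint)
  then have "card (D - (V \<union> V')) = card D - 8" using V fin by (subst card_Diff_subset) auto
  then have "card Q - 4 \<le> card (D - (V \<union> V'))" using Q by simp
  then obtain Y where Y: "Y \<subseteq> D - (V \<union> V')" "card Y = card Q - 4" by (metis obtain_subset_with_card_n)
  let ?Q = "{x1, x2, x3, x4} \<union> Y"
  have fY: "finite Y" using Y D finite_subset by blast
  have "card ?Q = card {x1, x2, x3, x4} + card Y"
    using fY Y e e' by (intro card_Un_disjoint) auto
  then have cX: "card ?Q = card Q" using Y Q dist by simp
  have "good a ?Q" unfolding good_def
  proof (intro allI impI)
    fix f assume f: "fam a ?Q f"
    show "prod f D \<in> J"
      by (rule nonconstant_middle_core[OF f, of x1 y1 x2 y2 x3 y3 x4 y4])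
        (use V e e' dist Y in auto)
  qed
  then show ?thesis using good_card[of Q ?Q] Q cX Y V e e' by auto
qed

end

end

section \<open>Families of constant weight, and families with balanced or equal signs\<close>

context quaternion_cyclic_family
begin

context
  fixes a :: 'k
  assumes a: "a * a = - 1"
begin

lemma split_J: "y * (pl u * z) \<in> J \<Longrightarrow> y * (mi u * z) \<in> J \<Longrightarrow> y * (u * z) \<in> J"
proof -
  assume *: "y * (pl u * z) \<in> J" "y * (mi u * z) \<in> J"
  have "y * ((pl u + mi u) * z) = y * (pl u * z) + y * (mi u * z)" by (simp add: algebra_simps)
  then show ?thesis using ideal_power_add[OF *] unfolding pl_plus_mi by simp
qed

text \<open>Here the product of the six factors on \<open>V\<close>, \<open>x\<close> and \<open>y\<close> yields an invariant of weight \<open>z ^ 6\<close>,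
  while among the remaining factors there is one of weight \<open>z ^ 4\<close>.\<close>

lemma constant_core:
  assumes f: "fam a Q f" and x: "x \<in> Q" "x \<in> D" and y: "y \<in> D" "y \<notin> Q" "y \<notin> V"
    and V: "V \<subseteq> D - Q" "card V = 4" and const: "\<And>i. i \<in> D \<Longrightarrow> t i = z" and z: "z \<noteq> 1"
  shows "mi (prod f V) * prod f (D - V) \<in> J"
proof -
  have zr: "z ^ r = 1" using tr[OF x(2)] const[OF x(2)] by simp
  have z0: "z \<noteq> 0" using zr r by (auto simp: power_0_left)
  have z2: "z ^ 2 \<noteq> 1"
  proof
    assume "z ^ 2 = 1"
    then have "z ^ r = z" using r(1) by (auto elim!: oddE simp: power_add power_mult)
    then show False using zr z by simp
  qed
  \<comment> \<open>These are the weights of the two invariants to be combined; they differ because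
    \<open>z\<close> is not \<open>1\<close> and \<open>r\<close> is odd.\<close>
  have z64: "z ^ 6 \<noteq> z ^ 4"
  proof
    assume "z ^ 6 = z ^ 4"
    then have "z ^ 4 * z ^ 2 = z ^ 4 * 1" by (simp flip: power_add)
    moreover have "z ^ 4 \<noteq> 0" using z0 by simp
    ultimately show False using z2 mult_left_cancel by blast
  qed
  have zpow: "(z ^ n) ^ r = 1" for n
  proof -
    have "(z ^ n) ^ r = (z ^ r) ^ n" by (simp add: mult.commute flip: power_mult)
    then show ?thesis by (simp add: zr)
  qed
  have finV: "finite V" using V by (auto intro: card_ge_0_finite)
  define R where "R = D - V - {x, y}"
  have xy: "x \<noteq> y" "x \<notin> V" using x y V by auto
  have DV: "D - V = {x, y} \<union> R" using x y V R_def by auto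
  have fR: "finite R" using D by (simp add: R_def)
  have "prod f (D - V) = prod f {x, y} * prod f R"
    unfolding DV using fR R_def by (intro prod.union_disjoint) auto
  then have P: "prod f (D - V) = (f x * f y) * prod f R" using xy by simp
  have "card (D - V) = card {x, y} + card R"
    unfolding DV using fR R_def by (intro card_Un_disjoint) auto
  moreover have "card (D - V) = card D - card V" using V finV by (intro card_Diff_subset) auto
  ultimately have cR: "card R = 4 * N - 5" using V D xy by simp
  have RD: "R \<subseteq> D" by (auto simp: R_def)
  \<comment> \<open>Three disjoint pairs of equal sign are taken from the remaining factors; at each
    stage three elements are left, so two of them have the same sign.\<close>
  have ge3: "3 \<le> 4 * N - 5" "3 \<le> 4 * N - 7" "3 \<le> 4 * N - 9" using N3 by arith+
  obtain p1 q1 where 1: "p1 \<in> R" "q1 \<in> R" "p1 \<noteq> q1" "p1 \<in> Q \<longleftrightarrow> q1 \<in> Q"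
    using exists_same_class_pair[of R Q] fR cR ge3(1) by metis
  define R1 where "R1 = R - {p1, q1}"
  have fR1: "finite R1" "card R1 = 4 * N - 7" using 1 fR cR by (auto simp: R1_def card_Diff_subset)
  obtain p2 q2 where 2: "p2 \<in> R1" "q2 \<in> R1" "p2 \<noteq> q2" "p2 \<in> Q \<longleftrightarrow> q2 \<in> Q"
    using exists_same_class_pair[of R1 Q] fR1 ge3(2) by metis
  define R2 where "R2 = R1 - {p2, q2}"
  have fR2: "finite R2" "card R2 = 4 * N - 9" using 2 fR1 by (auto simp: R2_def card_Diff_subset)
  obtain p3 q3 where 3: "p3 \<in> R2" "q3 \<in> R2" "p3 \<noteq> q3" "p3 \<in> Q \<longleftrightarrow> q3 \<in> Q"
    using exists_same_class_pair[of R2 Q] fR2 ge3(3) by metis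
  define R3 where "R3 = R2 - {p3, q3}"
  have fR3: "finite R3" "card R3 = 4 * N - 11" using 3 fR2 by (auto simp: R3_def card_Diff_subset)
  let ?W = "prod f R3"
  have pick: "prod f A = (f p * f q) * prod f (A - {p, q})" if "finite A" "p \<in> A" "q \<in> A" "p \<noteq> q" for A p q
    using prod.subset_diff[of "{p, q}" A f] that by (simp add: mult.commute)
  have PR: "prod f R = (f p1 * f q1) * ((f p2 * f q2) * ((f p3 * f q3) * ?W))"
    using pick[OF fR 1(1-3)] pick[OF fR1(1) 2(1-3)] pick[OF fR2(1) 3(1-3)]
    by (simp add: R1_def R2_def R3_def)
  have W: "?W \<in> ideal_power Od (4 * N - 11)"
    using fam_prod_Od[OF a f, of R3] fR3 RD by (auto simp: R1_def R2_def R3_def)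
  let ?u = "f x * f y" and ?v = "prod f V"
  have Mi: "?u \<in> Mi" "?v \<in> Mi"
    using fam_pair_Mi[OF a f] fam_four_Mi[OF a f] x y V by auto
  have Cu: "C ?u = sc (z ^ 2) * ?u"
    using fam_pair_C[OF a f x(2) y(1)] const x y by (simp add: power2_eq_square)
  have "prod t V = z ^ 4" using V const by (simp add: subset_iff)
  then have Cv: "C ?v = sc (z ^ 4) * ?v" using fam_C[OF a f, of V] V by auto
  have b0: "mi ?v * mi ?u \<in> B (z ^ 6)"
    using mi_mi_B[OF a Mi(2) Cv Mi(1) Cu] by (simp flip: power_add)
  \<comment> \<open>These are elements of weight \<open>z ^ 2\<close> on which \<open>I\<close> acts
    as \<open>- 1\<close> and \<open>T\<close> by the sign \<open>s\<close>. The product of a pair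
    of equal sign is the sum of two of them, so two such parts with the same \<open>s\<close>
    multiply to an invariant of weight \<open>z ^ 4\<close>.\<close>
  define Sg where "Sg s = {g \<in> M. I g = - g \<and> T g = (if s then g else - g) \<and> C g = sc (z ^ 2) * g}" for s
  have same: "g * h \<in> B (z ^ 4)" if "g \<in> Sg s" "h \<in> Sg s" for g h s
  proof -
    have "sc (z ^ 2) * g * (sc (z ^ 2) * h) = (sc (z ^ 2) * sc (z ^ 2)) * (g * h)"
      by (simp add: mult_ac)
    also have "sc (z ^ 2) * sc (z ^ 2) = sc (z ^ 4)" by (simp flip: sc_mult power_add)
    finally show ?thesis
      using that by (auto simp: Sg_def B_def MQ_def M_mult I_simps T_simps C_simps)
  qed
  \<comment> \<open>One element of \<open>Ev\<close> and \<open>4 * N - 11\<close> of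
    \<open>Od\<close> amount to \<open>2 * N - 5\<close> elements of \<open>Ev\<close>, exactly what
    \<open>N - 3\<close> invariants require.\<close>
  have gW: "g * ?W \<in> ideal_power MQ (N - 3)" if "g \<in> Sg s" for g s
  proof (rule Ev_Od_MQ[OF _ W])
    show "g \<in> ideal_power Ev 1" using that by (intro ideal_power_base) (auto simp: Sg_def Ev_def I_simps)
    show "2 * (N - 3) + 1 \<le> 1 + (4 * N - 11) div 2" using N3 by presburger
  qed
  \<comment> \<open>Of three signs two agree. Those two parts form the invariant of weight
    \<open>z ^ 4\<close>, and the third is absorbed into the rest.\<close>
  have signed: "mi ?v * mi ?u * (g1 * (g2 * (g3 * ?W))) \<in> J"
    if g: "g1 \<in> Sg s1" "g2 \<in> Sg s2" "g3 \<in> Sg s3" for g1 g2 g3 s1 s2 s3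
  proof -
    have key: "mi ?v * mi ?u * (g * h) * (g' * ?W) \<in> J" if "g \<in> Sg s" "h \<in> Sg s" "g' \<in> Sg s'" for g h g' s s'
      by (rule distinct_weights_J[OF b0 same[OF that(1,2)] z64 zpow zpow gW[OF that(3)]])
    consider "s1 = s2" | "s1 = s3" | "s2 = s3" by blast
    then show ?thesis
    proof cases
      case 1
      then show ?thesis using key[of g1 s1 g2 g3 s3] g by (simp add: mult_ac)
    next
      case 2
      then show ?thesis using key[of g1 s1 g3 g2 s2] g by (simp add: mult_ac)
    next
      case 3
      then show ?thesis using key[of g2 s2 g3 g1 s1] g by (simp add: mult_ac)
    qed
  qed
  have pair: "pl (f p * f q) \<in> Sg True \<and> mi (f p * f q) \<in> Sg False"
    if "p \<in> D" "q \<in> D" "p \<in> Q \<longleftrightarrow> q \<in> Q" for p q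
  proof -
    define b where "b = (if p \<in> Q then a else - a)"
    have "f p \<in> F (if p \<in> Q then a else - a) (t p)" "f q \<in> F (if q \<in> Q then a else - a) (t q)"
      using f that(1,2) unfolding fam_def by blast+
    then have b: "b = a \<or> b = - a" "f p \<in> F b z" "f q \<in> F b z"
      using that const[OF that(1)] const[OF that(2)] by (simp_all add: b_def)
    have M: "f p * f q \<in> M" using b by (simp add: F_def M_mult)
    have "I (f p * f q) = (sc b * sc b) * (f p * f q)" using b by (simp add: F_def I_simps mult_ac)
    also have "sc b * sc b = - 1" using sign_square[OF a b(1)] by (metis sc_minus sc_mult sc_one)
    finally have Ipq: "I (f p * f q) = - (f p * f q)" by simp
    then have II: "I (I (f p * f q)) = f p * f q" by (simp add: I_simps)
    have "C (f p * f q) = (sc z * sc z) * (f p * f q)" using b by (simp add: F_def C_simps mult_ac)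
    then have Cpq: "C (f p * f q) = sc (z ^ 2) * (f p * f q)" by (simp add: power2_eq_square sc_mult)
    have C_pl: "C (pl g) = sc w * pl g" if "C g = sc w * g" for g w
      using that by (simp add: pl_def C_simps CT T_simps algebra_simps)
    note C_pl[OF Cpq] C_mi[OF a Cpq]
    with pl_M[OF M] show ?thesis
      using pl_M[OF M] mi_M[OF M] T_pl[OF II] T_mi[OF II] I_pl(2)[OF Ipq] I_mi(2)[OF Ipq]
      by (simp add: Sg_def)
  qed
  have inD: "p1 \<in> D" "q1 \<in> D" "p2 \<in> D" "q2 \<in> D" "p3 \<in> D" "q3 \<in> D"
    using 1 2 3 by (auto simp: R_def R1_def R2_def)
  note pr = pair[OF inD(1,2) 1(4)] pair[OF inD(3,4) 2(4)] pair[OF inD(5,6) 3(4)]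
  let ?P1 = "f p1 * f q1" and ?P2 = "f p2 * f q2" and ?P3 = "f p3 * f q3"
  have s3: "mi ?v * mi ?u * (g1 * (g2 * (?P3 * ?W))) \<in> J" if "g1 \<in> Sg s1" "g2 \<in> Sg s2" for g1 g2 s1 s2
  proof -
    have "mi ?v * mi ?u * (g1 * (g2 * (pl ?P3 * ?W))) \<in> J" "mi ?v * mi ?u * (g1 * (g2 * (mi ?P3 * ?W))) \<in> J"
      using signed[OF that] pr(3) by blast+
    then show ?thesis using split_J[of "mi ?v * mi ?u * (g1 * g2)" ?P3 ?W] by (simp only: mult.assoc)
  qed
  have s2: "mi ?v * mi ?u * (g1 * (?P2 * (?P3 * ?W))) \<in> J" if "g1 \<in> Sg s1" for g1 s1
  proof -
    have "mi ?v * mi ?u * (g1 * (pl ?P2 * (?P3 * ?W))) \<in> J" "mi ?v * mi ?u * (g1 * (mi ?P2 * (?P3 * ?W))) \<in> J"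
      using s3[OF that] pr(2) by blast+
    then show ?thesis using split_J[of "mi ?v * mi ?u * g1" ?P2 "?P3 * ?W"] by (simp only: mult.assoc)
  qed
  have s1: "mi ?v * mi ?u * (?P1 * (?P2 * (?P3 * ?W))) \<in> J"
    using split_J[of "mi ?v * mi ?u" ?P1 "?P2 * (?P3 * ?W)"] s2 pr(1) by blast
  have m: "mi ?v * (mi ?u * prod f R) \<in> J" using s1 unfolding PR by (simp add: mult.assoc)
  have R: "prod f R \<in> ideal_power Od (4 * N - 5)" using fam_prod_Od[OF a f RD] cR by simp
  have "mi ?v \<in> ideal_power Od 4" using fam_mi_Od[OF a f, of V] V by auto
  then have "mi ?v * prod f R \<in> ideal_power Od (4 + (4 * N - 5))" using R by (intro ideal_power_mult)
  then have "pl ?u * (mi ?v * prod f R) \<in> J" by (rule MQ_Od_J[OF pl_MQ[OF Mi(1)]]) simp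
  then have p: "mi ?v * (pl ?u * prod f R) \<in> J" by (simp add: mult_ac)
  show ?thesis unfolding P by (rule split_J[OF p m])
qed

lemma constant_step:
  assumes const: "\<And>i. i \<in> D \<Longrightarrow> t i = z" and z: "z \<noteq> 1"
    and Q: "Q \<subseteq> D" "1 \<le> card Q" "card Q + 5 \<le> card D"
    and *: "\<And>Q'. Q' \<subseteq> D \<Longrightarrow> card Q' = card Q + 4 \<Longrightarrow> good a Q'"
  shows "good a Q"
proof -
  have fin: "finite Q" using Q D finite_subset by blast
  obtain x where x: "x \<in> Q" using Q by (metis card.empty equals0I not_one_le_zero)
  have "card (D - Q) = card D - card Q" using Q fin by (intro card_Diff_subset)
  then have c: "5 \<le> card (D - Q)" using Q by simp
  then obtain V where V: "V \<subseteq> D - Q" "card V = 4"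
    using obtain_subset_with_card_n[of 4 "D - Q"] by auto
  have finV: "finite V" using V by (auto intro: card_ge_0_finite)
  have "\<not> D - Q \<subseteq> V" using c V finV card_mono[OF finV, of "D - Q"] by auto
  then obtain y where y: "y \<in> D" "y \<notin> Q" "y \<notin> V" by auto
  show ?thesis
  proof (rule flip_cases[OF a, of V])
    have "(Q - V) \<union> (V - Q) = Q \<union> V" using V by auto
    moreover have "card (Q \<union> V) = card Q + card V" using fin finV V by (intro card_Un_disjoint) auto
    ultimately show "good a ((Q - V) \<union> (V - Q))" using *[of "Q \<union> V"] Q V by auto
    fix f assume f: "fam a Q f"
    have "mi (prod f V) * prod f (D - V) \<in> J"
      by (rule constant_core[OF f, of x y V z]) (use x y Q V const z in auto)
    then show "pl (prod f V) * prod f (D - V) \<in> J \<or> mi (prod f V) * prod f (D - V) \<in> J" ..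
  qed (use V in auto)
qed

lemma prod_pairs_MQ:
  assumes f: "fam a Q f" and A: "A \<subseteq> D \<inter> Q" "A' \<subseteq> D - Q" "card A = 2 * s" "card A' = 2 * s"
  shows "prod f A * prod f A' \<in> ideal_power MQ s"
proof -
  have fin: "finite A" "finite A'" using A D by (auto intro: finite_subset)
  obtain h where h: "bij_betw h A A'"
    using finite_same_card_bij[OF fin] A by auto
  have "prod f A' = (\<Prod>x\<in>A. f (h x))" using prod.reindex_bij_betw[OF h, of f] by simp
  then have "prod f A * prod f A' = (\<Prod>x\<in>A. f x * f (h x))" by (simp add: prod.distrib)
  also have "\<dots> \<in> ideal_power Mi (2 * s)"
  proof (rule ideal_power_prod[OF fin(1) A(3)])
    fix x assume x: "x \<in> A"
    then have "h x \<in> A'" using h by (auto simp: bij_betw_def)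
    then have "h x \<in> D" "h x \<notin> Q" "x \<in> Q" "x \<in> D" using A(1,2) x by auto
    then show "f x * f (h x) \<in> Mi" using fam_pair_Mi[OF a f] by blast
  qed
  finally show ?thesis using ideal_power_Mi by blast
qed

text \<open>\<open>2 * N\<close> pairs of opposite sign give as many elements of \<open>Mi\<close>,
  hence \<open>N\<close> invariants; one factor is left over.\<close>

lemma balanced:
  assumes Q: "Q \<subseteq> D" "card Q = 2 * N"
  shows "good a Q"
  unfolding good_def
proof (intro allI impI)
  fix f assume f: "fam a Q f"
  have fin: "finite Q" using Q D finite_subset by blast
  have "card (D - Q) = 2 * N + 1" using Q fin D by (simp add: card_Diff_subset)
  then obtain A where A: "A \<subseteq> D - Q" "card A = 2 * N"
    using obtain_subset_with_card_n[of "2 * N" "D - Q"] by auto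
  have "prod f Q * prod f A \<in> J"
    using Q A by (intro MQ_J prod_pairs_MQ[OF f]) auto
  moreover have "prod f D = prod f (D - (Q \<union> A)) * prod f (Q \<union> A)"
    using Q A D by (intro prod.subset_diff) auto
  moreover have "prod f (Q \<union> A) = prod f Q * prod f A"
    using fin A D by (intro prod.union_disjoint) (auto intro: finite_subset)
  ultimately show "prod f D \<in> J" by (simp add: ideal_power_scale)
qed

text \<open>Four factors of the larger class form \<open>V\<close>, and \<open>pl (prod f V)\<close>
  is one invariant. Of the others, all but one form \<open>2 * (N - 1)\<close> pairs of opposite
  sign, giving \<open>N - 1\<close> more. The \<open>mi\<close> part is
  \<open>constant_core\<close>.\<close>

lemma constant_almost_balanced:
  assumes const: "\<And>i. i \<in> D \<Longrightarrow> t i = z" and z: "z \<noteq> 1" and Q: "Q \<subseteq> D" "card Q = 2 * N - 1"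
  shows "good a Q"
  unfolding good_def
proof (intro allI impI)
  fix f assume f: "fam a Q f"
  have fin: "finite Q" using Q D finite_subset by blast
  have "card Q \<noteq> 0" using Q N3 by simp
  then obtain x where x: "x \<in> Q" by (metis card.empty equals0I)
  have c: "card (D - Q) = 2 * N + 2" using Q fin D N3 by (simp add: card_Diff_subset)
  then obtain V where V: "V \<subseteq> D - Q" "card V = 4"
    using obtain_subset_with_card_n[of 4 "D - Q"] N3 by auto
  have finV: "finite V" using V by (auto intro: card_ge_0_finite)
  define A where "A = D - Q - V"
  have fA: "finite A" using D by (simp add: A_def)
  have cA: "card A = 2 * (N - 1)" using V c finV by (simp add: A_def card_Diff_subset)
  then have "card A \<noteq> 0" using N3 by simp
  then obtain y where y: "y \<in> A" by (metis card.empty equals0I)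
  have m: "mi (prod f V) * prod f (D - V) \<in> J"
    by (rule constant_core[OF f, of x y V z]) (use x y Q V const z A_def in auto)
  have D_eq: "D - V = {x} \<union> ((Q - {x}) \<union> A)" using x Q V A_def by auto
  have "prod f (D - V) = f x * prod f ((Q - {x}) \<union> A)"
    unfolding D_eq using fin fA x by (subst prod.union_disjoint) (auto simp: A_def)
  also have "prod f ((Q - {x}) \<union> A) = prod f (Q - {x}) * prod f A"
    using fin fA by (intro prod.union_disjoint) (auto simp: A_def)
  finally have P: "prod f (D - V) = f x * (prod f (Q - {x}) * prod f A)" .
  have "prod f (Q - {x}) * prod f A \<in> ideal_power MQ (N - 1)"
    using Q x fin cA by (intro prod_pairs_MQ[OF f]) (auto simp: A_def)
  moreover have "pl (prod f V) \<in> ideal_power MQ 1"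
    using fam_four_Mi[OF a f] V by (intro ideal_power_base pl_MQ) auto
  ultimately have "pl (prod f V) * (prod f (Q - {x}) * prod f A) \<in> ideal_power MQ (1 + (N - 1))"
    by (rule ideal_power_mult[rotated])
  then have "pl (prod f V) * (prod f (Q - {x}) * prod f A) \<in> J" using N3 by (intro MQ_J) simp
  then have "f x * (pl (prod f V) * (prod f (Q - {x}) * prod f A)) \<in> J" by (rule ideal_power_scale)
  then have p: "pl (prod f V) * prod f (D - V) \<in> J" unfolding P by (simp add: mult_ac)
  have "1 * (prod f V * prod f (D - V)) \<in> J" by (rule split_J) (use p m in simp_all)
  moreover have "prod f D = prod f (D - V) * prod f V" using V D by (intro prod.subset_diff) auto
  ultimately show "prod f D \<in> J" by (simp add: mult.commute)
qed

text \<open>When all signs agree there is no pair of opposite sign. Instead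
  \<open>prod_plus_T_prod\<close> applied to \<open>4 * N\<close> of the factors replaces their
  product by minus its image under \<open>T\<close>, which is the sign pattern
  \<open>D - {x}\<close>.\<close>

lemma good_empty:
  assumes x: "x \<in> D" and *: "good a (D - {x})"
  shows "good a {}"
  unfolding good_def
proof (intro allI impI)
  fix f assume f: "fam a {} f"
  let ?K = "D - {x}"
  have "(- a) * (- a) = - 1" using a by simp
  moreover have "card ?K = 4 * N" using x D by simp
  moreover have "f i \<in> M \<and> I (f i) = sc (- a) * f i" if "i \<in> ?K" for i
    using f that by (auto simp: fam_def F_def)
  ultimately have "prod f ?K + T (prod f ?K) \<in> ideal_power MQ N"
    using prod_plus_T_prod[of "- a" ?K N f] D by auto
  then have 1: "f x * (prod f ?K + T (prod f ?K)) \<in> J" by (intro ideal_power_scale MQ_J)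
  have "fam a (({} - ?K) \<union> (?K - {})) (flip_at ?K f)" by (rule fam_flip[OF a f]) auto
  then have "prod (flip_at ?K f) D \<in> J" using * by (simp add: good_def)
  moreover have "prod (flip_at ?K f) D = f x * T (prod f ?K)"
  proof -
    have "prod (flip_at ?K f) D = flip_at ?K f x * prod (flip_at ?K f) ?K"
      using D x by (simp add: prod.remove)
    also have "prod (flip_at ?K f) ?K = T (prod f ?K)"
      by (auto simp: flip_at_def[OF a] endo_prod[OF endoT] intro!: prod.cong)
    finally show ?thesis by (simp add: flip_at_def[OF a])
  qed
  ultimately have "f x * (prod f ?K + T (prod f ?K)) - f x * T (prod f ?K) \<in> J"
    using 1 by (intro ideal_power_diff) simp_all
  moreover have "prod f D = f x * prod f ?K" using D x by (simp add: prod.remove)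
  ultimately show "prod f D \<in> J" by (simp add: algebra_simps)
qed

end

lemma good_nonconstant_pos:
  assumes a: "a * a = - 1" and ij: "i \<in> D" "j \<in> D" "t i \<noteq> t j" and Q: "Q \<subseteq> D" "1 \<le> card Q" "card Q \<le> 2 * N"
  shows "good a Q"
proof (cases "4 \<le> card Q")
  case True
  then show ?thesis using nonconstant_middle[OF a ij Q(1)] Q D N3 by simp
next
  case False
  show ?thesis
  proof (rule nonconstant_step[OF a ij Q(1,2)])
    fix Q' assume "Q' \<subseteq> D" "card Q' = card Q + 4"
    then show "good a Q'" using nonconstant_middle[OF a ij, of Q'] D N3 False by simp
  qed (use False D N3 in simp)
qed

text \<open>\<open>constant_step\<close> moves upwards in steps of four. It can overshoot
  \<open>2 * N\<close> only to \<open>2 * N + 1\<close> or \<open>2 * N + 2\<close>, whose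
  complements have the sizes \<open>2 * N\<close> and \<open>2 * N - 1\<close> settled
  directly.\<close>

lemma good_constant_pos:
  assumes a: "a * a = - 1" and const: "\<And>i. i \<in> D \<Longrightarrow> t i = z" and z: "z \<noteq> 1"
    and Q: "Q \<subseteq> D" "1 \<le> card Q" "card Q \<le> 2 * N"
  shows "good a Q"
  using Q
proof (induction "2 * N - card Q" arbitrary: Q rule: less_induct)
  case less
  consider "card Q = 2 * N" | "card Q = 2 * N - 1" | "card Q + 2 \<le> 2 * N" using less.prems by linarith
  then show ?case
  proof cases
    case 1
    then show ?thesis using balanced[OF a] less.prems by blast
  next
    case 2
    then show ?thesis using constant_almost_balanced[OF a const z] less.prems by blast
  next
    case 3
    show ?thesis
    proof (rule constant_step[OF a const z less.prems(1,2)])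
      fix Q' assume Q': "Q' \<subseteq> D" "card Q' = card Q + 4"
      show "good a Q'"
      proof (cases "card Q' \<le> 2 * N")
        case True
        then show ?thesis using Q' less.prems by (intro less.hyps) auto
      next
        case False
        have a': "(- a) * (- a) = - 1" using a by simp
        have "card (D - Q') = card D - card Q'"
          using Q' D finite_subset by (intro card_Diff_subset) auto
        then consider "card (D - Q') = 2 * N" | "card (D - Q') = 2 * N - 1"
          using False Q' 3 D by linarith
        then have "good (- a) (D - Q')"
          using balanced[OF a', of "D - Q'"] constant_almost_balanced[OF a' const z, of "D - Q'"]
          by cases blast+
        then show ?thesis using good_complement[of a Q'] by blast
      qed
    next
      show "card Q + 5 \<le> card D" using 3 D(2) N3 by linarith
    qed
  qed
qed

text \<open>Replacing \<open>a\<close> by \<open>- a\<close> exchanges \<open>Q\<close> with its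
  complement, so sizes up to \<open>2 * N\<close> suffice. The empty set is reduced to
  \<open>D - {x}\<close>, the complement of a singleton.\<close>

lemma good_all:
  assumes a: "a * a = - 1" and Q: "Q \<subseteq> D" and not_one: "\<not> (\<forall>i\<in>D. t i = 1)"
  shows "good a Q"
proof -
  have pos: "good b A" if "b * b = - 1" "A \<subseteq> D" "1 \<le> card A" "card A \<le> 2 * N" for b A
  proof (cases "\<exists>i\<in>D. \<exists>j\<in>D. t i \<noteq> t j")
    case True
    then show ?thesis using good_nonconstant_pos[OF that(1) _ _ _ that(2-4)] by blast
  next
    case False
    obtain l where l: "l \<in> D" "t l \<noteq> 1" using not_one by blast
    then have "\<And>i. i \<in> D \<Longrightarrow> t i = t l" using False by blast
    then show ?thesis using good_constant_pos[OF that(1) _ l(2) that(2-4)] by blast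
  qed
  have le: "good b A" if b: "b * b = - 1" and A: "A \<subseteq> D" "card A \<le> 2 * N" for b A
  proof (cases "A = {}")
    case True
    obtain x where x: "x \<in> D" using not_one by blast
    have "good (- b) {x}" using b x N3 by (intro pos) auto
    then have "good b (D - {x})"
      unfolding good_complement[of b] using x by (simp add: double_diff)
    then show ?thesis using good_empty[OF b x] True by simp
  next
    case False
    then have "card A \<noteq> 0" using A D finite_subset by (metis card_0_eq)
    then show ?thesis using pos[OF b A(1)] A by simp
  qed
  show ?thesis
  proof (cases "card Q \<le> 2 * N")
    case True
    then show ?thesis using le a Q by blast
  next
    case False
    have "card (D - Q) = card D - card Q" using Q D finite_subset by (intro card_Diff_subset) auto
    then have "good (- a) (D - Q)" using a False D by (intro le) auto
    then show ?thesis using good_complement[of a Q] by blast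
  qed
qed

end

section \<open>The ideal power bound for the product with a cyclic group\<close>

context quaternion_cyclic_ops
begin

lemma quaternion_ops_fixed: "quaternion_ops sc {f \<in> M. C f = f} I T"
proof unfold_locales
  show "linear_closed sc {f \<in> M. C f = f}" by (rule linear_closed_fixed[OF endoC M_lin])
qed (auto simp: two endoI endoT M_mult C_simps M_I M_T TT IT I4 CI CT)

text \<open>Serves the case that all weights are \<open>1\<close>, where no two invariants differ in
  weight. The factors are then fixed by \<open>C\<close> already, and the plain quaternion bound
  yields more than enough invariants of the whole group.\<close>

lemma fixed_ideal_power: "ideal_power {f \<in> M. C f = f} (4 * s + 2) \<subseteq> ideal_power MH s"
proof -
  interpret M0: quaternion_ops sc "{f \<in> M. C f = f}" I T by (rule quaternion_ops_fixed)
  have "M0.MQ = MH" by (auto simp: M0.MQ_def MH_def MQ_def)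
  then show ?thesis using M0.quaternion_ideal_power by simp
qed

text \<open>As \<open>I\<close> squared is \<open>- 1\<close> on \<open>Od\<close>, the element
  \<open>f\<close> is half the sum of \<open>f - sc a * I f\<close> and
  \<open>f + sc a * I f\<close>, which are eigenvectors for \<open>a\<close> and \<open>- a\<close>;
  these are decomposed further under \<open>C\<close>.\<close>

lemma Od_span:
  assumes a: "a * a = - 1"
  shows "Od \<subseteq> ideal.span (\<Union>b\<in>{a, - a}. \<Union>z\<in>{z. z ^ r = 1}. {f \<in> M. I f = sc b * f \<and> C f = sc z * f})"
    (is "_ \<subseteq> ideal.span ?W")
proof
  fix f assume f: "f \<in> Od"
  have eigen: "g \<in> ideal.span ?W" if g: "g \<in> M" "I g = sc b * g" "b \<in> {a, - a}" for g b
  proof -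
    let ?S = "{f \<in> M. I f = sc b * f}"
    have "?S \<subseteq> ideal.span {f \<in> ?S. \<exists>z. z ^ r = 1 \<and> C f = sc z * f}"
    proof (rule eigen_decomposition[OF endoC linear_closed_eigenspace[OF endoI M_lin] _ Cr r(3) \<omega>])
      fix x assume x: "x \<in> ?S"
      then have "I (C x) = C (sc b * x)" by (simp flip: CI)
      then show "C x \<in> ?S" using x by (simp add: C_simps M_C)
    qed
    also have "\<dots> \<subseteq> ideal.span ?W" using g(3) by (intro ideal.span_mono) blast
    finally show ?thesis using g by blast
  qed
  let ?g = "f - sc a * I f" and ?h = "f + sc a * I f"
  have "sc a * sc a = - 1" using a by (metis sc_minus sc_mult sc_one)
  then have aa: "sc a * (sc a * x) = - x" for x by (simp add: mult.assoc[symmetric])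
  have fM: "f \<in> M" "I (I f) = - f" using f by (auto simp: Od_def)
  have "?g \<in> M" "I ?g = sc a * ?g" "?h \<in> M" "I ?h = sc (- a) * ?h"
    using fM by (auto intro!: M_add M_diff M_sc M_I simp: I_simps sc_minus aa right_diff_distrib distrib_left)
  then have "?g \<in> ideal.span ?W" "?h \<in> ideal.span ?W"
    using eigen[of ?g a] eigen[of ?h "- a"] by blast+
  then have "sc (1 / 2) * ?g + sc (1 / 2) * ?h \<in> ideal.span ?W"
    by (rule ideal.span_add[OF ideal.span_scale ideal.span_scale])
  moreover have "sc (1 / 2) * ?g + sc (1 / 2) * ?h = f" using half[of f] by (simp add: algebra_simps)
  ultimately show "f \<in> ideal.span ?W" by simp
qed

text \<open>A single factor from \<open>Ev\<close> already lifts the count in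
  \<open>prod_split_MQ\<close> to \<open>2 * (r * k) + 1\<close>. The delicate case is therefore a
  product of odd joint eigenvectors, to which the families apply unless all weights are
  \<open>1\<close>.\<close>

theorem quaternion_cyclic_ideal_power:
  assumes a: "a * a = (- 1 :: 'k)"
  shows "ideal_power M (4 * (r * k) + 1) \<subseteq> ideal_power MH k"
proof (cases "k = 0")
  case False
  let ?N = "r * k"
  let ?D = "{..<4 * ?N + 1}"
  let ?W = "\<Union>b\<in>{a, - a}. \<Union>z\<in>{z. z ^ r = 1}. {f \<in> M. I f = sc b * f \<and> C f = sc z * f}"
  have W_Od: "?W \<subseteq> Od"
  proof clarify
    fix f b z assume b: "b \<in> {a, - a}" and f: "f \<in> M" "I f = sc b * f"
    have "I (I f) = (sc b * sc b) * f" using f by (simp add: I_simps mult.assoc)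
    also have "sc b * sc b = - 1" using a b by (auto simp: sc_minus simp flip: sc_mult)
    finally show "f \<in> Od" using f by (simp add: Od_def)
  qed
  have "Ev \<union> Od \<subseteq> ideal.span (Ev \<union> ?W)"
    using Od_span[OF a] ideal.span_mono[of ?W "Ev \<union> ?W"] ideal.span_superset[of "Ev \<union> ?W"] by blast
  then have "ideal.span (Ev \<union> Od) \<subseteq> ideal.span (Ev \<union> ?W)" by (intro ideal.span_minimal) auto
  then have "M \<subseteq> ideal.span (Ev \<union> ?W)" using M_split by blast
  then have "ideal_power M (4 * ?N + 1) \<subseteq> ideal_power (Ev \<union> ?W) (4 * ?N + 1)"
    by (rule ideal_power_mono_span)
  also have "\<dots> \<subseteq> ideal_power MH k"
  proof (rule ideal_power_least[OF ideal_power_subspace])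
    fix f assume "\<And>i. i < 4 * ?N + 1 \<Longrightarrow> f i \<in> Ev \<union> ?W"
    then have f: "\<And>i. i \<in> ?D \<Longrightarrow> f i \<in> Ev \<union> ?W" by blast
    show "prod f ?D \<in> ideal_power MH k"
    proof (cases "\<exists>i\<in>?D. f i \<in> Ev")
      case True
      let ?E = "{i \<in> ?D. f i \<in> Ev}" and ?O = "{i \<in> ?D. f i \<notin> Ev}"
      have "card ?E \<noteq> 0" using True by auto
      moreover have "card ?E + card ?O = card (?E \<union> ?O)" by (subst card_Un_disjoint) auto
      moreover have "?E \<union> ?O = ?D" by auto
      ultimately have "card ?E \<noteq> 0" "card ?E + card ?O = 4 * ?N + 1" by simp_all
      moreover have "2 * n + 1 \<le> e + d div 2" if "e \<noteq> 0" "e + d = 4 * n + 1" for e d n :: nat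
        using that by linarith
      ultimately have "2 * ?N + 1 \<le> card ?E + card ?O div 2" by blast
      then have "prod f ?D \<in> ideal_power MQ ?N"
        using f W_Od by (intro prod_split_MQ) blast+
      then show ?thesis using MQ_power_MH by blast
    next
      case False
      have "\<forall>i\<in>?D. \<exists>p. (fst p = a \<or> fst p = - a) \<and> snd p ^ r = 1 \<and>
          f i \<in> {f \<in> M. I f = sc (fst p) * f \<and> C f = sc (snd p) * f}"
      proof
        fix i assume i: "i \<in> ?D"
        then have "f i \<in> ?W" using f False by blast
        then obtain b z where "b = a \<or> b = - a" "z ^ r = 1" "f i \<in> {f \<in> M. I f = sc b * f \<and> C f = sc z * f}"
          by blast
        then show "\<exists>p. (fst p = a \<or> fst p = - a) \<and> snd p ^ r = 1 \<and>
          f i \<in> {f \<in> M. I f = sc (fst p) * f \<and> C f = sc (snd p) * f}"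
          by (intro exI[of _ "(b, z)"]) simp
      qed
      from bchoice[OF this] obtain p where p: "\<forall>i\<in>?D. (fst (p i) = a \<or> fst (p i) = - a) \<and> snd (p i) ^ r = 1 \<and>
          f i \<in> {f \<in> M. I f = sc (fst (p i)) * f \<and> C f = sc (snd (p i)) * f}" ..
      define b t where "b i = fst (p i)" and "t i = snd (p i)" for i
      have bt: "(b i = a \<or> b i = - a) \<and> t i ^ r = 1 \<and> f i \<in> {f \<in> M. I f = sc (b i) * f \<and> C f = sc (t i) * f}"
        if "i \<in> ?D" for i
        using p that by (simp add: b_def t_def)
      interpret fam: quaternion_cyclic_family sc M I T C r \<omega> k ?N ?D t
        by unfold_locales (use False \<open>k \<noteq> 0\<close> bt in auto)
      let ?Q = "{i \<in> ?D. b i = a}"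
      have fam: "fam.fam a ?Q f"
        unfolding fam.fam_def fam.F_def
      proof
        fix i assume "i \<in> ?D"
        then show "f i \<in> {f \<in> M. I f = sc (if i \<in> ?Q then a else - a) * f \<and> C f = sc (t i) * f}"
          using bt[of i] by auto
      qed
      show ?thesis
      proof (cases "\<forall>i\<in>?D. t i = 1")
        case True
        then have "prod f ?D \<in> ideal_power {f \<in> M. C f = f} (4 * ?N + 1)"
          using bt by (intro ideal_power_prod) auto
        moreover have "4 * (?N - 1) + 2 \<le> 4 * ?N + 1" using fam.N3 by simp
        ultimately have "prod f ?D \<in> ideal_power {f \<in> M. C f = f} (4 * (?N - 1) + 2)"
          using ideal_power_antimono by blast
        then have "prod f ?D \<in> ideal_power MH (?N - 1)" using fixed_ideal_power by blast
        moreover have "k \<le> ?N - 1"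
        proof -
          have "2 * k \<le> r * k" using r by (intro mult_le_mono1) simp
          then show ?thesis using \<open>k \<noteq> 0\<close> by linarith
        qed
        ultimately show ?thesis using ideal_power_antimono by blast
      next
        case False
        have "fam.good a ?Q" by (rule fam.good_all[OF a _ False]) auto
        then show ?thesis using fam unfolding fam.good_def by blast
      qed
    qed
  qed
  finally show ?thesis .
qed (simp add: ideal_power_0)

end

hide_const (open) Polynomial.order Polynomial.degree

section \<open>Finite groups acting on commutative algebras\<close>

locale ring_action = group G + scalars sc
  for G :: "('g, 'b) monoid_scheme" (structure) and sc :: "'k::field \<Rightarrow> 'r::comm_ring_1" +
  fixes act :: "'g \<Rightarrow> 'r \<Rightarrow> 'r" and M :: "'r set"
  assumes finite_G: "finite (carrier G)" and order_ne_0: "of_nat (order G) \<noteq> (0::'k)"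
    and act_endo: "\<And>g. g \<in> carrier G \<Longrightarrow> algebra_endo sc (act g)"
    and act_mult: "\<And>g h x. g \<in> carrier G \<Longrightarrow> h \<in> carrier G \<Longrightarrow> act (g \<otimes> h) x = act g (act h x)"
    and act_one: "\<And>x. act \<one> x = x"
    and M_lin: "linear_closed sc M" and M_mult: "\<And>x y. x \<in> M \<Longrightarrow> y \<in> M \<Longrightarrow> x * y \<in> M"
    and M_act: "\<And>g x. g \<in> carrier G \<Longrightarrow> x \<in> M \<Longrightarrow> act g x \<in> M"
begin

definition fixed :: "'g set \<Rightarrow> 'r set" where "fixed H = {f \<in> M. \<forall>h\<in>H. act h f = f}"

lemma act_pow: "g \<in> carrier G \<Longrightarrow> (act g ^^ n) x = act (g [^] n) x"
proof (induction n)
  case (Suc n)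
  then have "(act g ^^ Suc n) x = act (g \<otimes> g [^] n) x" by (simp add: act_mult)
  then show ?case using Suc.prems by (simp only: nat_pow_Suc2)
qed (simp add: act_one)

lemma act_sum_carrier:
  assumes g: "g \<in> carrier G"
  shows "act g (\<Sum>h\<in>carrier G. act h f) = (\<Sum>h\<in>carrier G. act h f)"
proof -
  have "act g (\<Sum>h\<in>carrier G. act h f) = (\<Sum>h\<in>carrier G. act (g \<otimes> h) f)"
    using g by (simp add: endo_sum[OF act_endo] act_mult)
  also have "\<dots> = (\<Sum>h\<in>carrier G. act h f)"
  proof (rule sum.reindex_bij_betw)
    show "bij_betw ((\<otimes>) g) (carrier G) (carrier G)"
      using g inj_on_cmult surj_const_mult by (auto simp: bij_betw_def)
  qed
  finally show ?thesis .
qed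

lemma sum_act_fixed: "f \<in> M \<Longrightarrow> (\<Sum>h\<in>carrier G. act h f) \<in> fixed (carrier G)"
  by (auto simp: fixed_def act_sum_carrier intro!: linear_closed_sum[OF M_lin] M_act)

text \<open>Benson's argument. For a coset representative \<open>c i\<close> with \<open>h (c i) \<in> H\<close> the \<open>i\<close>-th factor of
  \<open>\<Prod>\<^sub>i (act (h (c i)) (f i) - f i)\<close> vanishes; expand this product and sum over \<open>h\<close>.\<close>

theorem ideal_power_subgroup_index:
  assumes H: "subgroup H G"
  shows "ideal_power (fixed H) (card (rcosets H)) \<subseteq> ideal_power (fixed (carrier G)) 1"
proof (rule ideal_power_least[OF ideal_power_subspace])
  let ?n = "card (rcosets H)" and ?J = "ideal_power (fixed (carrier G)) 1"
  fix f assume f: "\<And>i. i < ?n \<Longrightarrow> f i \<in> fixed H"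
  have fin: "finite (rcosets H)"
    using finite_G H by (auto simp: RCOSETS_def)
  obtain e where e: "bij_betw e {..<?n} (rcosets H)"
    using ex_bij_betw_nat_finite[OF fin] by (auto simp: atLeast0LessThan)
  have "\<exists>a. a \<in> carrier G \<and> e i = H #> a" if "i < ?n" for i
  proof -
    have "e i \<in> rcosets H" using e that by (auto simp: bij_betw_def)
    then show ?thesis by (auto simp: RCOSETS_def)
  qed
  then obtain a where a: "\<And>i. i < ?n \<Longrightarrow> a i \<in> carrier G \<and> e i = H #> a i" by metis
  define c where "c i = inv (a i)" for i
  have c: "c i \<in> carrier G" if "i < ?n" for i using a[OF that] by (simp add: c_def)
  have HG: "H \<subseteq> carrier G" using H by (rule subgroup.subset)
  have hit: "\<exists>i<?n. h \<otimes> c i \<in> H" if h: "h \<in> carrier G" for h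
  proof -
    have "H #> h \<in> rcosets H" using h by (auto simp: RCOSETS_def)
    then have "H #> h \<in> e ` {..<?n}" using e unfolding bij_betw_def by blast
    then obtain i where i: "i < ?n" "e i = H #> h" by auto
    then have "a i \<in> H #> h" using a[OF i(1)] rcos_self[OF _ H] by auto
    then obtain h' where h': "h' \<in> H" "a i = h' \<otimes> h" by (auto simp: r_coset_def)
    have "h' \<in> carrier G" using h' HG by auto
    then have "h \<otimes> c i = inv h'"
      unfolding c_def h'(2) using h by (simp add: inv_mult_group m_assoc[symmetric])
    then show ?thesis using i h'(1) subgroup.m_inv_closed[OF H] by auto
  qed
  define F where "F S h = (\<Prod>i\<in>S. act (h \<otimes> c i) (f i)) * (\<Prod>i\<in>{..<?n} - S. - f i)" for S h
  have "(\<Prod>i<?n. act (h \<otimes> c i) (f i) + - f i) = 0" if h: "h \<in> carrier G" for h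
  proof -
    obtain i where i: "i < ?n" "h \<otimes> c i \<in> H" using hit[OF h] by blast
    then have "act (h \<otimes> c i) (f i) + - f i = 0" using f[OF i(1)] by (simp add: fixed_def)
    then show ?thesis using i by (intro prod_zero) auto
  qed
  moreover have "(\<Prod>i<?n. act (h \<otimes> c i) (f i) + - f i) = (\<Sum>S\<in>Pow {..<?n}. F S h)" for h
    unfolding F_def by (rule prod_add) simp
  ultimately have "(\<Sum>h\<in>carrier G. \<Sum>S\<in>Pow {..<?n}. F S h) = 0" by simp
  then have "(\<Sum>S\<in>Pow {..<?n}. \<Sum>h\<in>carrier G. F S h) = 0" by (subst sum.swap)
  moreover have "(\<Sum>S\<in>Pow {..<?n}. \<Sum>h\<in>carrier G. F S h)
      = (\<Sum>h\<in>carrier G. F {} h) + (\<Sum>S\<in>Pow {..<?n} - {{}}. \<Sum>h\<in>carrier G. F S h)"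
    by (subst sum.remove[of _ "{}"]) auto
  \<comment> \<open>For nonempty \<open>S\<close> the sum over \<open>h\<close> is the trace of an
    element of \<open>M\<close> times a factor independent of \<open>h\<close>, so it lies in the
    ideal. The term for empty \<open>S\<close> is, up to sign, \<open>order G\<close> times the
    product in question, and \<open>order G\<close> is invertible.\<close>
  moreover have "(\<Sum>S\<in>Pow {..<?n} - {{}}. \<Sum>h\<in>carrier G. F S h) \<in> ?J"
  proof (rule ideal_power_sum)
    fix S assume S: "S \<in> Pow {..<?n} - {{}}"
    then have fS: "finite S" "S \<noteq> {}" "\<And>i. i \<in> S \<Longrightarrow> i < ?n" by (auto intro: finite_subset)
    let ?g = "\<Prod>i\<in>S. act (c i) (f i)"
    have "?g \<in> M"
    proof (rule prod_in_mult_closed[OF fS(1,2) _ M_mult])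
      fix i assume "i \<in> S"
      then show "act (c i) (f i) \<in> M" using fS(3) c f by (intro M_act) (auto simp: fixed_def)
    qed
    have "(\<Sum>h\<in>carrier G. F S h) = (\<Sum>h\<in>carrier G. act h ?g) * (\<Prod>i\<in>{..<?n} - S. - f i)"
      using fS(3) c by (simp add: F_def sum_distrib_right endo_prod[OF act_endo] act_mult)
    then show "(\<Sum>h\<in>carrier G. F S h) \<in> ?J"
      using sum_act_fixed[OF \<open>?g \<in> M\<close>] by (simp add: ideal_power_scale2 ideal_power_base del: One_nat_def)
  qed
  ultimately have "(\<Sum>h\<in>carrier G. F {} h) \<in> ?J"
    by (metis add_eq_0_iff2 ideal_power_uminus)
  moreover have "(\<Sum>h\<in>carrier G. F {} h) = of_nat (order G) * (\<Prod>i<?n. - f i)"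
    by (simp add: F_def Coset.order_def)
  moreover have "(\<Prod>i<?n. - f i) = (- 1) ^ ?n * (\<Prod>i<?n. f i)"
    using prod.distrib[of "\<lambda>_. - 1" f "{..<?n}"] by simp
  ultimately have "of_nat (order G) * ((- 1) ^ ?n * (\<Prod>i<?n. f i)) \<in> ?J" by simp
  then have "sc (1 / of_nat (order G)) * ((- 1) ^ ?n * (of_nat (order G) * ((- 1) ^ ?n * (\<Prod>i<?n. f i)))) \<in> ?J"
    by (rule ideal_power_scale[OF ideal_power_scale])
  moreover have "sc (1 / of_nat (order G)) * ((- 1) ^ ?n * (of_nat (order G) * ((- 1) ^ ?n * (\<Prod>i<?n. f i))))
     = (sc (1 / of_nat (order G)) * of_nat (order G)) * (((- 1) ^ ?n * (- 1) ^ ?n) * (\<Prod>i<?n. f i))"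
    by (simp add: mult_ac)
  moreover have "(- 1) ^ ?n * (- 1) ^ ?n = (1::'r)" by (simp flip: power_mult_distrib)
  moreover have "sc (1 / of_nat (order G)) * of_nat (order G) = 1"
  proof -
    have "sc (of_nat m) = of_nat m" for m by (induction m) (simp_all add: sc_add)
    then have "sc (1 / of_nat (order G)) * of_nat (order G) = sc (1 / of_nat (order G) * of_nat (order G))"
      by (simp only: sc_mult)
    then show ?thesis using order_ne_0 by simp
  qed
  ultimately show "(\<Prod>i<?n. f i) \<in> ?J" by simp
qed

lemma fixed_generate:
  assumes "S \<subseteq> carrier G" "f \<in> fixed S"
  shows "f \<in> fixed (generate G S)"
proof -
  have "subgroup {g \<in> carrier G. act g f = f} G"
  proof (rule subgroupI)
    fix g assume g: "g \<in> {g \<in> carrier G. act g f = f}"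
    then have "act (inv g \<otimes> g) f = act (inv g) (act g f)" by (intro act_mult) auto
    then have "act (inv g) f = act (inv g \<otimes> g) f" using g by simp
    then show "inv g \<in> {g \<in> carrier G. act g f = f}" using g by (simp add: act_one)
  qed (auto simp: act_mult intro: exI[of _ \<one>] act_one)
  then have "generate G S \<subseteq> {g \<in> carrier G. act g f = f}"
    using assms by (intro generate_subgroup_incl) (auto simp: fixed_def)
  then show ?thesis using assms by (auto simp: fixed_def)
qed

lemma order_index_bound:
  assumes "subgroup H G" "m \<le> card H"
  shows "m * card (rcosets H) \<le> order G"
proof -
  have "m * card (rcosets H) \<le> card H * card (rcosets H)" using assms(2) by (rule mult_le_mono1)
  also have "\<dots> = order G" using lagrange[OF assms(1)] by (simp only: mult.commute)
  finally show ?thesis .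
qed

lemma ideal_power_via_subgroup:
  assumes H: "subgroup H G" and le: "ideal_power M d \<subseteq> ideal_power (fixed H) (card (rcosets H))" and "d \<le> d'"
  shows "ideal_power M d' \<subseteq> ideal_power (fixed (carrier G)) 1"
  using ideal_power_antimono[OF assms(3), of M] le ideal_power_subgroup_index[OF H] by blast

end

text \<open>The products \<open>g [^] i \<otimes> h [^] j\<close> with \<open>i, j < q\<close> are
  distinct: a coincidence would put some \<open>h [^] d\<close> with \<open>0 < d < q\<close>, and
  hence \<open>h\<close> itself since \<open>q\<close> is prime, into the subgroup generated by
  \<open>g\<close>.\<close>

lemma (in group) card_generate_pair:
  assumes fin: "finite (carrier G)" and q: "Factorial_Ring.prime (q::nat)" and g: "g \<in> carrier G" "g [^] q = \<one>" "g \<noteq> \<one>"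
    and h: "h \<in> carrier G" "h [^] q = \<one>" "h \<notin> generate G {g}"
  shows "q * q \<le> card (generate G {g, h})"
proof -
  have K: "subgroup (generate G {g}) G" using g by (intro generate_is_subgroup) auto
  have ordg: "group.ord G g = q"
  proof -
    have "group.ord G g dvd q" using pow_eq_id g by blast
    moreover have "group.ord G g \<noteq> 1" using g ord_eq_1 by simp
    ultimately show ?thesis using q by (auto simp: prime_nat_iff)
  qed
  have gpow: "g [^] (i::nat) \<in> generate G {g}" for i
    using generate_pow_on_finite_carrier[OF fin g(1)] by blast
  have hpow: "h [^] d \<notin> generate G {g}" if d: "0 < d" "d < q" for d :: nat
  proof
    assume hd: "h [^] d \<in> generate G {g}"
    have "coprime d q" using q d prime_imp_coprime[of q d] coprime_commute nat_dvd_not_less by blast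
    then obtain u v where uv: "d * u = Suc (q * v)"
      using d coprime_bezout_strong[of d q] prime_gt_1_nat[OF q] by (metis Suc_eq_plus1 less_irrefl)
    have pow_in: "x [^] (n::nat) \<in> generate G {g}" if "x \<in> generate G {g}" for x n
      using that K by (induction n) (auto simp: subgroup.one_closed subgroup.m_closed)
    have "(h [^] d) [^] u = h [^] (q * v + 1)" using h uv by (simp add: nat_pow_pow)
    also have "\<dots> = h" using h by (simp add: nat_pow_mult[symmetric] nat_pow_pow[symmetric])
    finally show False using pow_in[OF hd, of u] h(3) by simp
  qed
  let ?f = "\<lambda>(i::nat, j::nat). g [^] i \<otimes> h [^] j"
  have step: False if eq: "g [^] i \<otimes> h [^] j = g [^] i' \<otimes> h [^] j'" and j: "j < j'" "j' < q" for i j i' j' :: nat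
  proof -
    have "h [^] j' = h [^] (j' - j) \<otimes> h [^] j" using j h by (simp add: nat_pow_mult)
    then have "g [^] i \<otimes> h [^] j = (g [^] i' \<otimes> h [^] (j' - j)) \<otimes> h [^] j"
      using eq g h by (simp add: m_assoc)
    then have "g [^] i = g [^] i' \<otimes> h [^] (j' - j)" using g h by (simp add: r_cancel)
    then have "h [^] (j' - j) = inv (g [^] i') \<otimes> g [^] i" using g h by (simp add: inv_solve_left)
    also have "\<dots> \<in> generate G {g}" using gpow K by (auto intro: subgroup.m_closed subgroup.m_inv_closed)
    finally show False using hpow[of "j' - j"] j by auto
  qed
  have inj: "inj_on ?f ({..<q} \<times> {..<q})"
  proof (rule inj_onI, clarify)
    fix i j i' j' :: nat assume lt: "i < q" "j < q" "i' < q" "j' < q" and eq: "g [^] i \<otimes> h [^] j = g [^] i' \<otimes> h [^] j'"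
    have "j = j'" using step[OF eq] step[OF eq[symmetric]] lt by (meson linorder_neqE_nat)
    then have "g [^] i \<otimes> h [^] j = g [^] i' \<otimes> h [^] j" using eq by simp
    then have "g [^] i = g [^] i'" by (subst (asm) r_cancel) (use g h in auto)
    moreover have "inj_on (\<lambda>x. g [^] x) {0..group.ord G g - 1}" using g by (intro ord_inj)
    ultimately show "i = i' \<and> j = j'" using lt ordg \<open>j = j'\<close> by (auto simp: inj_on_def)
  qed
  have E: "subgroup (generate G {g, h}) G" using g h by (intro generate_is_subgroup) auto
  have gen: "x [^] (n::nat) \<in> generate G {g, h}" if "x \<in> {g, h}" for x n
  proof -
    have "x \<in> generate G {g, h}" using that by (rule generate.incl)
    then show ?thesis by (induction n) (simp_all add: subgroup.one_closed[OF E] subgroup.m_closed[OF E])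
  qed
  have "?f ` ({..<q} \<times> {..<q}) \<subseteq> generate G {g, h}"
    using gen E by (auto intro!: subgroup.m_closed)
  moreover have "finite (generate G {g, h})" using subgroup.subset[OF E] fin finite_subset by blast
  ultimately have "card (?f ` ({..<q} \<times> {..<q})) \<le> card (generate G {g, h})" by (intro card_mono)
  then show ?thesis using card_image[OF inj] by (simp add: card_cartesian_product)
qed

text \<open>\<open>i \<otimes> c\<close> has order at least \<open>4 * r\<close> because
  \<open>4\<close> and \<open>r\<close> are coprime. As \<open>j\<close> does not commute with it,
  the coset of \<open>j\<close> doubles the subgroup it generates. With \<open>c = \<one>\<close>
  and \<open>r = 1\<close> this covers the quaternion group itself.\<close>

lemma (in group) card_generate_quaternion_cyclic:
  assumes fin: "finite (carrier G)"
    and i: "i \<in> carrier G" "i [^] (4::nat) = \<one>" "i [^] (2::nat) \<noteq> \<one>"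
    and j: "j \<in> carrier G" "i \<otimes> j = j \<otimes> i [^] (3::nat)"
    and c: "c \<in> carrier G" "c \<otimes> i = i \<otimes> c" "c \<otimes> j = j \<otimes> c" "group.ord G c = r" and r: "odd r"
  shows "8 * r \<le> card (generate G {i, j, c})"
proof -
  let ?y = "i \<otimes> c" and ?E = "generate G {i, j, c}" and ?K = "generate G {i \<otimes> c}"
  have y: "?y \<in> carrier G" using i c by simp
  define n where "n = group.ord G ?y"
  have n0: "n > 0" using ord_ge_1[OF fin y] by (simp add: n_def)
  have ypow: "?y [^] m = i [^] m \<otimes> c [^] m" for m :: nat
    using c i by (intro pow_mult_distrib) auto
  have yn: "i [^] n \<otimes> c [^] n = \<one>" using pow_eq_id[OF y, of n] by (simp add: n_def ypow)
  have ic: "i [^] (n * m) \<otimes> c [^] (n * m) = \<one>" for m :: nat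
    using ypow[of "n * m"] y yn by (simp add: nat_pow_pow[symmetric] ypow[symmetric])
  have cr: "c [^] r = \<one>" using c pow_eq_id[of c r] by simp
  have ordi: "group.ord G i = 4"
  proof -
    have "group.ord G i dvd 4" using i pow_eq_id[of i 4] by simp
    then have "group.ord G i \<le> 4" by (simp add: dvd_imp_le)
    moreover have "\<not> group.ord G i dvd 2" using i pow_eq_id[of i 2] by simp
    moreover have "d = 4" if "d dvd 4" "d \<le> 4" "\<not> d dvd 2" for d :: nat
    proof -
      have "d = 0 \<or> d = 1 \<or> d = 2 \<or> d = 3 \<or> d = 4" using that by linarith
      then show ?thesis using that by (elim disjE) simp_all
    qed
    ultimately show ?thesis using \<open>group.ord G i dvd 4\<close> by blast
  qed
  have "i [^] (n * r) = \<one>"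
  proof -
    have "c [^] (n * r) = \<one>" using cr c by (simp add: mult.commute[of n r] nat_pow_pow[symmetric])
    then show ?thesis using ic[of r] i by simp
  qed
  then have "4 dvd n * r" using pow_eq_id[OF i(1)] ordi by simp
  moreover have "coprime (2 ^ 2) r" using r by (simp del: power_numeral)
  then have "coprime 4 r" by simp
  ultimately have 4: "4 dvd n" by (simp add: coprime_dvd_mult_left_iff)
  have "c [^] (n * 4) = \<one>"
  proof -
    have "i [^] (n * 4) = \<one>" using i by (simp add: mult.commute[of n 4] nat_pow_pow[symmetric])
    then show ?thesis using ic[of 4] c by simp
  qed
  then have "r dvd n * 4" using pow_eq_id[OF c(1)] c(4) by simp
  then have "r dvd n" using \<open>coprime 4 r\<close> by (simp add: coprime_dvd_mult_left_iff coprime_commute)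
  with 4 have "4 * r dvd n" using \<open>coprime 4 r\<close> by (rule divides_mult)
  then have nr: "4 * r \<le> n" using n0 by (rule dvd_imp_le)
  have K: "subgroup ?K G" and E: "subgroup ?E G" using i j c by (auto intro!: generate_is_subgroup)
  have cK: "card ?K = n" using generate_pow_card[OF y] by (simp add: n_def)
  have jK: "j \<notin> ?K"
  proof
    assume "j \<in> ?K"
    then obtain m :: nat where m: "j = ?y [^] m" using generate_pow_on_finite_carrier[OF fin y] by blast
    have "?y \<otimes> j = j \<otimes> ?y" unfolding m using y by (metis nat_pow_Suc nat_pow_Suc2)
    have "(i \<otimes> j) \<otimes> c = i \<otimes> (c \<otimes> j)" unfolding c(3) using i(1) j(1) c(1) by (rule m_assoc)
    also have "\<dots> = ?y \<otimes> j" using i(1) j(1) c(1) by (simp add: m_assoc)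
    also have "\<dots> = (j \<otimes> i) \<otimes> c" using \<open>?y \<otimes> j = j \<otimes> ?y\<close> i(1) j(1) c(1) by (simp add: m_assoc)
    finally have "i \<otimes> j = j \<otimes> i" using i(1) j(1) c(1) by simp
    then have "j \<otimes> i [^] (3::nat) = j \<otimes> i" using j(2) by simp
    then have "i [^] (3::nat) = i" using i(1) j(1) by simp
    then have "i [^] (2::nat) \<otimes> i = \<one> \<otimes> i" using i by (simp add: numeral_eq_Suc)
    then have "i [^] (2::nat) = \<one>" using i by (simp add: r_cancel del: l_one)
    then show False using i by simp
  qed
  have inE: "i \<in> ?E" "j \<in> ?E" "c \<in> ?E" by (auto intro: generate.incl)
  have KE: "?K \<subseteq> ?E" using subgroup.m_closed[OF E inE(1,3)] E by (intro generate_subgroup_incl) auto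
  have "?K #> j \<subseteq> ?E" using KE subgroup.m_closed[OF E _ inE(2)] by (auto simp: r_coset_def)
  have disj: "?K \<inter> (?K #> j) = {}"
  proof (rule ccontr)
    assume "?K \<inter> (?K #> j) \<noteq> {}"
    then obtain k k' where k: "k \<in> ?K" "k' \<in> ?K" "k = k' \<otimes> j" by (auto simp: r_coset_def)
    have kG: "k \<in> carrier G" "k' \<in> carrier G" using k K subgroup.subset by blast+
    have "j = inv k' \<otimes> k" using k(3) kG j by (simp add: inv_solve_left)
    moreover have "inv k' \<otimes> k \<in> ?K"
      using subgroup.m_closed[OF K subgroup.m_inv_closed[OF K k(2)] k(1)] .
    ultimately show False using jK by simp
  qed
  have fE: "finite ?E" using subgroup.subset[OF E] fin finite_subset by blast
  have "card (?K #> j) = card ?K"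
  proof -
    have "?K #> j \<in> rcosets ?K" using j by (auto simp: RCOSETS_def)
    then obtain b where "bij_betw b ?K (?K #> j)" using card_cosets_equal subgroup.subset[OF K] by blast
    then show ?thesis using bij_betw_same_card by metis
  qed
  then have "2 * n = card (?K \<union> (?K #> j))"
    using disj cK fE KE \<open>?K #> j \<subseteq> ?E\<close> by (subst card_Un_disjoint) (auto intro: finite_subset)
  also have "\<dots> \<le> card ?E" using KE \<open>?K #> j \<subseteq> ?E\<close> fE by (intro card_mono) auto
  finally show ?thesis using nr by linarith
qed

section \<open>Bounds from the three kinds of subgroups\<close>

context ring_action
begin

text \<open>With \<open>k\<close> the index of the subgroup, whose order is at least
  \<open>q * q\<close>, the number \<open>k * q\<close> is at most \<open>order G div q\<close>. The
  two theorems below have the same arithmetic with orders \<open>8\<close> and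
  \<open>8 * r\<close>.\<close>

theorem rank_two_bound:
  assumes q: "Factorial_Ring.prime (q::nat)" "of_nat q \<noteq> (0::'k)" and w: "\<omega> ^ q = (1::'k)" "\<omega> \<noteq> 1"
    and g: "g \<in> carrier G" "g [^] q = \<one>" "g \<noteq> \<one>"
    and h: "h \<in> carrier G" "h [^] q = \<one>" "h \<notin> generate G {g}" and comm: "g \<otimes> h = h \<otimes> g"
  shows "ideal_power M (order G div q + q - 1) \<subseteq> ideal_power (fixed (carrier G)) 1"
proof (rule ideal_power_via_subgroup)
  let ?H = "generate G {g, h}"
  let ?k = "card (rcosets ?H)"
  show H: "subgroup ?H G" using g h by (intro generate_is_subgroup) auto
  have "ideal_power M (?k * q + q - 1) \<subseteq> ideal_power {f \<in> M. act g f = f \<and> act h f = f} ?k"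
    by (rule ideal_power_commuting_pair[OF act_endo act_endo M_lin M_mult M_act M_act _ _ _ q w])
      (simp_all add: g h act_pow act_one comm flip: act_mult)
  also have "\<dots> \<subseteq> ideal_power (fixed ?H) ?k"
    using g h by (intro ideal_power_mono subsetI fixed_generate) (auto simp: fixed_def)
  finally show "ideal_power M (?k * q + q - 1) \<subseteq> ideal_power (fixed ?H) ?k" .
  have "(q * q) * ?k \<le> order G"
    by (rule order_index_bound[OF H card_generate_pair[OF finite_G q(1) g h]])
  then have "(q * q) * ?k div q \<le> order G div q" by (rule div_le_mono)
  moreover have "(q * q) * ?k div q = ?k * q" using prime_gt_0_nat[OF q(1)] by (simp add: mult.assoc)
  ultimately show "?k * q + q - 1 \<le> order G div q + q - 1" by simp
qed

lemma quaternion_ops_act: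
  assumes "(2::'k) \<noteq> 0" and i: "i \<in> carrier G" "i [^] (4::nat) = \<one>"
    and j: "j \<in> carrier G" "i \<otimes> j = j \<otimes> i [^] (3::nat)" "j \<otimes> j = i \<otimes> i"
  shows "quaternion_ops sc M (act i) (act j)"
proof (unfold_locales)
  fix x
  have i3: "i [^] (3::nat) = i \<otimes> (i \<otimes> i)" using i by (simp add: numeral_eq_Suc m_assoc)
  have i4: "i \<otimes> (i \<otimes> (i \<otimes> i)) = \<one>" using i by (simp add: numeral_eq_Suc m_assoc)
  show "act j (act j x) = act i (act i x)" using i j by (simp flip: act_mult)
  show "act i (act j x) = act j (act i (act i (act i x)))" using i j i3 by (simp flip: act_mult)
  show "act i (act i (act i (act i x))) = x" using i i4 by (simp add: act_one flip: act_mult)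
qed (use assms in \<open>simp_all add: act_endo M_lin M_mult M_act\<close>)

theorem quaternion_bound:
  assumes two: "(2::'k) \<noteq> 0" and i: "i \<in> carrier G" "i [^] (4::nat) = \<one>" "i [^] (2::nat) \<noteq> \<one>"
    and j: "j \<in> carrier G" "i \<otimes> j = j \<otimes> i [^] (3::nat)" "j \<otimes> j = i \<otimes> i"
  shows "ideal_power M (order G div 2 + 2) \<subseteq> ideal_power (fixed (carrier G)) 1"
proof (rule ideal_power_via_subgroup)
  let ?H = "generate G {i, j, \<one>}"
  let ?k = "card (rcosets ?H)"
  show H: "subgroup ?H G" using i j by (intro generate_is_subgroup) auto
  interpret Q: quaternion_ops sc M "act i" "act j" using assms by (intro quaternion_ops_act)
  have "Q.MQ \<subseteq> fixed ?H"
    using i j by (intro subsetI fixed_generate) (auto simp: Q.MQ_def fixed_def act_one)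
  then have "ideal_power Q.MQ ?k \<subseteq> ideal_power (fixed ?H) ?k" by (rule ideal_power_mono)
  then show "ideal_power M (4 * ?k + 2) \<subseteq> ideal_power (fixed ?H) ?k"
    using Q.quaternion_ideal_power by blast
  have "8 * 1 \<le> card ?H"
    using i j by (intro card_generate_quaternion_cyclic finite_G) auto
  from order_index_bound[OF H this] show "4 * ?k + 2 \<le> order G div 2 + 2" by simp
qed

theorem quaternion_cyclic_bound:
  assumes two: "(2::'k) \<noteq> 0" and i: "i \<in> carrier G" "i [^] (4::nat) = \<one>" "i [^] (2::nat) \<noteq> \<one>"
    and j: "j \<in> carrier G" "i \<otimes> j = j \<otimes> i [^] (3::nat)" "j \<otimes> j = i \<otimes> i"
    and c: "c \<in> carrier G" "c \<otimes> i = i \<otimes> c" "c \<otimes> j = j \<otimes> c" "c [^] r = \<one>" "c \<noteq> \<one>"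
    and r: "Factorial_Ring.prime (r::nat)" "odd r" "of_nat r \<noteq> (0::'k)"
    and w: "\<omega> ^ r = (1::'k)" "\<omega> \<noteq> 1" and a: "a * a = (- 1 :: 'k)"
  shows "ideal_power M (order G div 2 + 1) \<subseteq> ideal_power (fixed (carrier G)) 1"
proof (rule ideal_power_via_subgroup)
  let ?H = "generate G {i, j, c}"
  let ?k = "card (rcosets ?H)"
  show H: "subgroup ?H G" using i j c by (intro generate_is_subgroup) auto
  interpret Q: quaternion_ops sc M "act i" "act j" using two i j by (intro quaternion_ops_act)
  interpret Q: quaternion_cyclic_ops sc M "act i" "act j" "act c" r \<omega>
  proof unfold_locales
    show "act c (act i x) = act i (act c x)" "act c (act j x) = act j (act c x)" for x
      using i j c by (simp_all flip: act_mult)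
    show "(act c ^^ r) x = x" for x using c by (simp add: act_pow act_one)
    show "1 < r" using r(1) by (rule prime_gt_1_nat)
    show "\<omega> ^ l \<noteq> 1" if "0 < l" "l < r" for l using primitive_root_prime[OF r(1) w that] .
  qed (use c r w in \<open>simp_all add: act_endo M_act\<close>)
  have "Q.MH \<subseteq> fixed ?H"
    using i j c by (intro subsetI fixed_generate) (auto simp: Q.MH_def Q.MQ_def fixed_def)
  then have "ideal_power Q.MH ?k \<subseteq> ideal_power (fixed ?H) ?k" by (rule ideal_power_mono)
  then show "ideal_power M (4 * (r * ?k) + 1) \<subseteq> ideal_power (fixed ?H) ?k"
    using Q.quaternion_cyclic_ideal_power[OF a] by blast
  have "group.ord G c = r"
  proof -
    have "group.ord G c dvd r" using pow_eq_id c by blast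
    moreover have "group.ord G c \<noteq> 1" using c ord_eq_1 by simp
    ultimately show ?thesis using r(1) by (auto simp: prime_nat_iff)
  qed
  then have "8 * r \<le> card ?H"
    using i j c r by (intro card_generate_quaternion_cyclic finite_G) auto
  from order_index_bound[OF H this] have "2 * (4 * (r * ?k)) \<le> order G" by (simp add: mult.assoc)
  then show "4 * (r * ?k) + 1 \<le> order G div 2 + 1" by simp
qed

end

section \<open>Evaluation homomorphisms of polynomial rings\<close>

abbreviation lk :: "('a \<Rightarrow>\<^sub>0 'b::zero) \<Rightarrow> 'a \<Rightarrow> 'b" where "lk \<equiv> Poly_Mapping.lookup"
abbreviation ks :: "('a \<Rightarrow>\<^sub>0 'b::zero) \<Rightarrow> 'a set" where "ks \<equiv> Poly_Mapping.keys"
abbreviation sgl :: "'a \<Rightarrow> 'b::zero \<Rightarrow> ('a \<Rightarrow>\<^sub>0 'b)" where "sgl \<equiv> Poly_Mapping.single"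

definition monom_eval :: "(nat \<Rightarrow> 'r::comm_ring_1) \<Rightarrow> (nat \<Rightarrow>\<^sub>0 nat) \<Rightarrow> 'r" where
  "monom_eval \<sigma> m = (\<Prod>i\<in>ks m. \<sigma> i ^ lk m i)"

text \<open>One map for several purposes: with \<open>h = mconst\<close> it is substitution, with
  \<open>to_ac\<close> it is evaluation at a point over the closure, and with \<open>mconst\<close>
  after \<open>to_ac\<close> it extends scalars.\<close>

definition poly_eval :: "('a::zero \<Rightarrow> 'r::comm_ring_1) \<Rightarrow> (nat \<Rightarrow> 'r) \<Rightarrow> ((nat \<Rightarrow>\<^sub>0 nat) \<Rightarrow>\<^sub>0 'a) \<Rightarrow> 'r" where
  "poly_eval h \<sigma> f = (\<Sum>m\<in>ks f. h (lk f m) * monom_eval \<sigma> m)"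

definition exp_degree :: "(nat \<Rightarrow>\<^sub>0 nat) \<Rightarrow> nat" where
  "exp_degree m = (\<Sum>i\<in>ks m. lk m i)"

lemma poly_mapping_sum_single: "(\<Sum>m\<in>ks f. sgl m (lk f m)) = f"
proof (rule poly_mapping_eqI)
  fix m
  have "lk (\<Sum>m\<in>ks f. sgl m (lk f m)) m = (\<Sum>m'\<in>ks f. if m' = m then lk f m else 0)"
    by (simp add: lookup_sum lookup_single when_def)
  then show "lk (\<Sum>m\<in>ks f. sgl m (lk f m)) m = lk f m"
    by (simp add: in_keys_iff)
qed

lemma keys_add_nat: "ks (m + m' :: nat \<Rightarrow>\<^sub>0 nat) = ks m \<union> ks m'"
  by (auto simp: in_keys_iff lookup_add)

lemma monom_eval_superset: "finite A \<Longrightarrow> ks m \<subseteq> A \<Longrightarrow> monom_eval \<sigma> m = (\<Prod>i\<in>A. \<sigma> i ^ lk m i)"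
  unfolding monom_eval_def by (intro prod.mono_neutral_left) (auto simp: in_keys_iff)

lemma exp_degree_superset: "finite A \<Longrightarrow> ks m \<subseteq> A \<Longrightarrow> exp_degree m = (\<Sum>i\<in>A. lk m i)"
  unfolding exp_degree_def by (intro sum.mono_neutral_left) (auto simp: in_keys_iff)

lemma monom_eval_add: "monom_eval \<sigma> (m + m') = monom_eval \<sigma> m * monom_eval \<sigma> m'"
  using monom_eval_superset[of "ks m \<union> ks m'" m \<sigma>] monom_eval_superset[of "ks m \<union> ks m'" m' \<sigma>]
    monom_eval_superset[of "ks m \<union> ks m'" "m + m'" \<sigma>]
  by (simp add: keys_add_nat lookup_add power_add prod.distrib)

lemma exp_degree_add: "exp_degree (m + m') = exp_degree m + exp_degree m'"
  using exp_degree_superset[of "ks m \<union> ks m'" m] exp_degree_superset[of "ks m \<union> ks m'" m']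
    exp_degree_superset[of "ks m \<union> ks m'" "m + m'"]
  by (simp add: keys_add_nat lookup_add sum.distrib)

lemma exp_degree_0 [simp]: "exp_degree 0 = 0" by (simp add: exp_degree_def)
lemma exp_degree_single [simp]: "exp_degree (sgl i c) = c" by (simp add: exp_degree_def)
lemma monom_eval_0 [simp]: "monom_eval \<sigma> 0 = 1" by (simp add: monom_eval_def)
lemma monom_eval_single [simp]: "monom_eval \<sigma> (sgl i c) = \<sigma> i ^ c" by (simp add: monom_eval_def)

lemma total_degree_le_iff: "total_degree f \<le> s \<longleftrightarrow> (\<forall>m\<in>ks f. exp_degree m \<le> s)"
  by (simp add: total_degree_def exp_degree_def)

lemma mconst_scalars: "scalars (mconst :: 'a::field \<Rightarrow> 'a mpolynomial)"
  by unfold_locales (simp_all add: mconst_def single_add mult_single)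

interpretation mc: scalars "mconst :: 'a::field \<Rightarrow> 'a mpolynomial" by (rule mconst_scalars)

lemma mvar_power: "(mvar i :: 'a::comm_ring_1 mpolynomial) ^ c = sgl (sgl i c) 1"
  by (induction c) (simp_all add: mvar_def mult_single single_add[symmetric])

lemma prod_single_one: "(\<Prod>i\<in>A. sgl (g i) (1::'a::comm_ring_1)) = sgl (\<Sum>i\<in>A. g i) 1"
  by (induction A rule: infinite_finite_induct) (simp_all add: mult_single)

lemma monom_eval_mvar: "monom_eval mvar m = sgl m (1::'a::comm_ring_1)"
  by (simp add: monom_eval_def mvar_power prod_single_one poly_mapping_sum_single)

context scalars
begin

lemma poly_eval_superset:
  "finite A \<Longrightarrow> ks f \<subseteq> A \<Longrightarrow> poly_eval sc \<sigma> f = (\<Sum>m\<in>A. sc (lk f m) * monom_eval \<sigma> m)"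
  unfolding poly_eval_def by (intro sum.mono_neutral_left) (auto simp: in_keys_iff)

lemma poly_eval_zero [simp]: "poly_eval sc \<sigma> 0 = 0" by (simp add: poly_eval_def)

lemma poly_eval_single: "poly_eval sc \<sigma> (sgl m c) = sc c * monom_eval \<sigma> m"
  by (simp add: poly_eval_def)

lemma poly_eval_add: "poly_eval sc \<sigma> (f + g) = poly_eval sc \<sigma> f + poly_eval sc \<sigma> g"
  using poly_eval_superset[of "ks f \<union> ks g" f \<sigma>] poly_eval_superset[of "ks f \<union> ks g" g \<sigma>]
    poly_eval_superset[of "ks f \<union> ks g" "f + g" \<sigma>] keys_add[of f g]
  by (simp add: lookup_add sc_add distrib_right sum.distrib)

lemma poly_eval_sum: "poly_eval sc \<sigma> (sum f A) = (\<Sum>i\<in>A. poly_eval sc \<sigma> (f i))"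
  by (induction A rule: infinite_finite_induct) (simp_all add: poly_eval_add)

lemma poly_eval_mult: "poly_eval sc \<sigma> (f * g) = poly_eval sc \<sigma> f * poly_eval sc \<sigma> g"
proof -
  have "f * g = (\<Sum>m\<in>ks f. sgl m (lk f m)) * (\<Sum>m\<in>ks g. sgl m (lk g m))"
    by (simp only: poly_mapping_sum_single)
  also have "\<dots> = (\<Sum>m\<in>ks f. \<Sum>m'\<in>ks g. sgl (m + m') (lk f m * lk g m'))"
    by (simp add: sum_product mult_single)
  finally have "poly_eval sc \<sigma> (f * g)
      = (\<Sum>m\<in>ks f. \<Sum>m'\<in>ks g. (sc (lk f m) * monom_eval \<sigma> m) * (sc (lk g m') * monom_eval \<sigma> m'))"
    by (simp add: poly_eval_sum poly_eval_single sc_mult monom_eval_add mult_ac)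
  then show ?thesis by (simp add: poly_eval_def sum_product)
qed

lemma poly_eval_mconst: "poly_eval sc \<sigma> (mconst c) = sc c"
  by (simp add: mconst_def poly_eval_single)

lemma poly_eval_mvar: "poly_eval sc \<sigma> (mvar i) = \<sigma> i"
  by (simp add: mvar_def poly_eval_single)

lemma poly_eval_one: "poly_eval sc \<sigma> 1 = 1"
  using poly_eval_mconst[of \<sigma> 1] by simp

lemma poly_eval_prod: "poly_eval sc \<sigma> (prod f A) = (\<Prod>i\<in>A. poly_eval sc \<sigma> (f i))"
  by (induction A rule: infinite_finite_induct) (simp_all add: poly_eval_mult poly_eval_one)

lemma poly_eval_power: "poly_eval sc \<sigma> (f ^ c) = poly_eval sc \<sigma> f ^ c"
  by (induction c) (simp_all add: poly_eval_mult poly_eval_one)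

lemma poly_eval_monom_eval: "poly_eval sc \<sigma> (monom_eval \<tau> m) = monom_eval (\<lambda>i. poly_eval sc \<sigma> (\<tau> i)) m"
  by (simp add: monom_eval_def poly_eval_prod poly_eval_power)

lemma poly_eval_poly_eval_mconst:
  "poly_eval sc \<sigma> (poly_eval mconst \<tau> f) = poly_eval sc (\<lambda>i. poly_eval sc \<sigma> (\<tau> i)) f"
  by (simp add: poly_eval_def[of mconst] poly_eval_sum poly_eval_mult poly_eval_mconst
      poly_eval_monom_eval poly_eval_def[of sc "\<lambda>i. poly_eval sc \<sigma> (\<tau> i)"])

end

lemma poly_eval_cong: "(\<And>m i. m \<in> ks f \<Longrightarrow> i \<in> ks m \<Longrightarrow> \<sigma> i = \<tau> i) \<Longrightarrow> poly_eval h \<sigma> f = poly_eval h \<tau> f"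
  unfolding poly_eval_def monom_eval_def by (intro sum.cong prod.cong arg_cong2[of _ _ _ _ "(*)"] HOL.refl) simp

lemma poly_eval_mconst_mvar: "poly_eval mconst mvar f = (f :: 'a::field mpolynomial)"
  by (simp add: poly_eval_def monom_eval_mvar mconst_def mult_single poly_mapping_sum_single)

lemma poly_subst_eq: "poly_subst \<sigma> = poly_eval mconst \<sigma>"
  by (simp add: fun_eq_iff poly_subst_def poly_eval_def monom_eval_def)

section \<open>The action on polynomials\<close>

definition homogeneous :: "nat \<Rightarrow> nat \<Rightarrow> 'a::zero mpolynomial set" where
  "homogeneous n b = {f. \<forall>m\<in>ks f. exp_degree m = b \<and> ks m \<subseteq> {..<n}}"

text \<open>Monomials involving variables from \<open>n\<close> on are discarded as well, since the
  coefficients in an ideal membership come from the polynomial ring in all variables. The projection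
  remains compatible with products, as a product of monomials avoids those variables only if both
  factors do.\<close>

definition component :: "nat \<Rightarrow> nat \<Rightarrow> 'a::comm_monoid_add mpolynomial \<Rightarrow> 'a mpolynomial" where
  "component n b f = (\<Sum>m\<in>ks f. if exp_degree m = b \<and> ks m \<subseteq> {..<n} then sgl m (lk f m) else 0)"

lemma lookup_component:
  "lk (component n b f) m = (if exp_degree m = b \<and> ks m \<subseteq> {..<n} then lk f m else 0)"
proof -
  have "lk (component n b f) m =
      (\<Sum>m'\<in>ks f. if m' = m then (if exp_degree m = b \<and> ks m \<subseteq> {..<n} then lk f m else 0) else 0)"
    unfolding component_def lookup_sum by (rule sum.cong) (auto simp: lookup_single)
  then show ?thesis by (auto simp: in_keys_iff)
qed

lemma component_add: "component n b (f + g) = component n b f + component n b g"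
  by (rule poly_mapping_eqI) (simp add: lookup_component lookup_add)

lemma component_sum: "component n b (sum f A) = (\<Sum>i\<in>A. component n b (f i))"
proof (induction A rule: infinite_finite_induct)
  case (insert x F)
  then show ?case by (simp add: component_add)
qed (simp_all add: component_def)

lemma component_homogeneous: "f \<in> homogeneous n b \<Longrightarrow> component n b' f = (if b' = b then f else 0)"
  by (rule poly_mapping_eqI) (auto simp: lookup_component homogeneous_def in_keys_iff)

lemma component_in_homogeneous: "component n b f \<in> homogeneous n b"
  unfolding homogeneous_def
proof clarify
  fix m assume "m \<in> ks (component n b f)"
  then have "lk (component n b f) m \<noteq> 0" by (simp add: lookup_not_eq_zero_eq_in_keys)
  then show "exp_degree m = b \<and> ks m \<subseteq> {..<n}" using lookup_component[of n b f m] by metis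
qed

lemma component_single:
  "component n b (sgl m c) = (if exp_degree m = b \<and> ks m \<subseteq> {..<n} then sgl m c else 0)"
  by (rule poly_mapping_eqI) (auto simp: lookup_component lookup_single when_def)

lemma component_mult:
  "component n d (f * g) = (\<Sum>b\<le>d. component n (d - b) f * component n b (g :: 'a::comm_ring_1 mpolynomial))"
proof -
  have single: "component n d (sgl m c * sgl m' c') = (\<Sum>b\<le>d. component n (d - b) (sgl m c) * component n b (sgl m' c'))"
    for m m' and c c' :: 'a
  proof -
    have "(\<Sum>b\<le>d. component n (d - b) (sgl m c) * component n b (sgl m' c'))
      = (\<Sum>b\<le>d. if b = exp_degree m' then component n (d - b) (sgl m c) * component n b (sgl m' c') else 0)"
      by (rule sum.cong) (auto simp: component_single)
    then show ?thesis
      by (auto simp: component_single mult_single exp_degree_add keys_add_nat)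
  qed
  have "component n d (f * g) = component n d ((\<Sum>m\<in>ks f. sgl m (lk f m)) * (\<Sum>m\<in>ks g. sgl m (lk g m)))"
    by (simp only: poly_mapping_sum_single)
  also have "\<dots> = (\<Sum>m\<in>ks f. \<Sum>m'\<in>ks g. \<Sum>b\<le>d. component n (d - b) (sgl m (lk f m)) * component n b (sgl m' (lk g m')))"
    by (simp add: sum_product component_sum single)
  also have "\<dots> = (\<Sum>m\<in>ks f. \<Sum>b\<le>d. \<Sum>m'\<in>ks g. component n (d - b) (sgl m (lk f m)) * component n b (sgl m' (lk g m')))"
    by (intro sum.cong HOL.refl) (rule sum.swap)
  also have "\<dots> = (\<Sum>b\<le>d. \<Sum>m\<in>ks f. \<Sum>m'\<in>ks g. component n (d - b) (sgl m (lk f m)) * component n b (sgl m' (lk g m')))"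
    by (rule sum.swap)
  also have "\<dots> = (\<Sum>b\<le>d. component n (d - b) (\<Sum>m\<in>ks f. sgl m (lk f m)) * component n b (\<Sum>m\<in>ks g. sgl m (lk g m)))"
    by (simp add: sum_product component_sum)
  finally show ?thesis by (simp only: poly_mapping_sum_single)
qed

lemma homogeneous_add: "f \<in> homogeneous n b \<Longrightarrow> g \<in> homogeneous n b \<Longrightarrow> f + g \<in> homogeneous n b"
  using keys_add[of f g] by (auto simp: homogeneous_def)

lemma homogeneous_zero [simp]: "0 \<in> homogeneous n b" by (simp add: homogeneous_def)

lemma homogeneous_sum: "(\<And>i. i \<in> A \<Longrightarrow> f i \<in> homogeneous n b) \<Longrightarrow> sum f A \<in> homogeneous n b"
  by (induction A rule: infinite_finite_induct) (auto intro: homogeneous_add)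

lemma homogeneous_mult:
  assumes "f \<in> homogeneous n a" "g \<in> homogeneous n b"
  shows "f * g \<in> homogeneous n (a + b)"
  unfolding homogeneous_def
proof clarify
  fix m assume "m \<in> ks (f * g)"
  then obtain x y where "m = x + y" "x \<in> ks f" "y \<in> ks g" using keys_mult[of f g] by blast
  then show "exp_degree m = a + b \<and> ks m \<subseteq> {..<n}"
    using assms by (auto simp: homogeneous_def exp_degree_add keys_add_nat)
qed

lemma homogeneous_mconst: "mconst c \<in> homogeneous n 0"
  by (simp add: homogeneous_def mconst_def)

lemma homogeneous_one: "1 \<in> homogeneous n 0"
  by (simp add: homogeneous_def)

lemma homogeneous_mvar: "i < n \<Longrightarrow> mvar i \<in> homogeneous n 1"
  by (simp add: homogeneous_def mvar_def)

lemma homogeneous_scale: "f \<in> homogeneous n b \<Longrightarrow> mconst c * f \<in> homogeneous n b"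
  using homogeneous_mult[OF homogeneous_mconst, of f n b c] by simp

lemma homogeneous_power: "f \<in> homogeneous n a \<Longrightarrow> f ^ c \<in> homogeneous n (a * c)"
proof (induction c)
  case 0
  then show ?case by (simp add: homogeneous_one)
next
  case (Suc c)
  then show ?case using homogeneous_mult[of f n a "f ^ c" "a * c"] by simp
qed

lemma homogeneous_monom_eval:
  assumes "\<And>i. i \<in> ks m \<Longrightarrow> \<sigma> i \<in> homogeneous n 1"
  shows "monom_eval \<sigma> m \<in> homogeneous n (exp_degree m)"
proof -
  have "(\<Prod>i\<in>A. \<sigma> i ^ lk m i) \<in> homogeneous n (\<Sum>i\<in>A. lk m i)" if "finite A" "A \<subseteq> ks m" for A
    using that
  proof (induction A rule: finite_induct)
    case empty
    then show ?case by (simp add: homogeneous_one)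
  next
    case (insert x F)
    then show ?case using homogeneous_mult[OF homogeneous_power[of "\<sigma> x" n 1 "lk m x"]] assms by simp
  qed
  then show ?thesis by (simp add: monom_eval_def exp_degree_def)
qed

definition pos_poly :: "nat \<Rightarrow> 'a::zero mpolynomial set" where
  "pos_poly n = {f. \<forall>m\<in>ks f. ks m \<subseteq> {..<n} \<and> 0 < exp_degree m}"

lemma pos_poly_add: "f \<in> pos_poly n \<Longrightarrow> g \<in> pos_poly n \<Longrightarrow> f + g \<in> pos_poly n"
  using keys_add[of f g] by (fastforce simp: pos_poly_def)

lemma pos_poly_mult: "f \<in> pos_poly n \<Longrightarrow> g \<in> pos_poly n \<Longrightarrow> f * g \<in> pos_poly n"
  using keys_mult[of f g] by (fastforce simp: pos_poly_def keys_add_nat exp_degree_add)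

lemma pos_poly_scale: "f \<in> pos_poly n \<Longrightarrow> mconst c * f \<in> pos_poly n"
  using keys_mult[of "mconst c" f] by (fastforce simp: pos_poly_def mconst_def split: if_splits)

lemma pos_poly_sum: "(\<And>i. i \<in> A \<Longrightarrow> f i \<in> pos_poly n) \<Longrightarrow> sum f A \<in> pos_poly n"
proof (induction A rule: infinite_finite_induct)
  case (insert x F)
  then show ?case by (simp add: pos_poly_add)
qed (simp_all add: pos_poly_def)

lemma poly_algebra_add: "f \<in> poly_algebra n \<Longrightarrow> g \<in> poly_algebra n \<Longrightarrow> f + g \<in> poly_algebra n"
  using keys_add[of f g] by (auto simp: poly_algebra_def)

lemma poly_algebra_sum: "(\<And>i. i \<in> A \<Longrightarrow> f i \<in> poly_algebra n) \<Longrightarrow> sum f A \<in> poly_algebra n"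
proof (induction A rule: infinite_finite_induct)
  case (insert x F)
  then show ?case by (simp add: poly_algebra_add)
qed (simp_all add: poly_algebra_def)

lemma poly_algebra_mult: "f \<in> poly_algebra n \<Longrightarrow> g \<in> poly_algebra n \<Longrightarrow> f * g \<in> poly_algebra n"
  using keys_mult[of f g] by (fastforce simp: poly_algebra_def keys_add_nat)

lemma homogeneous_poly_algebra: "f \<in> homogeneous n b \<Longrightarrow> f \<in> poly_algebra n"
  by (auto simp: homogeneous_def poly_algebra_def)

text \<open>\<open>e\<close> embeds the field of the matrices into the field of the polynomials. It
  is instantiated both by the identity and by the embedding into the algebraic closure, so that the
  two actions can be compared.\<close>

locale mpoly_rep = group G for G :: "('g, 'b) monoid_scheme" (structure) +
  fixes n :: nat and \<rho> :: "'g \<Rightarrow> 'k::field mat" and e :: "'k \<Rightarrow> 'f::field"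
  assumes rep: "\<rho> \<in> representations G n" and e_hom: "scalars e"
    and finite_G: "finite (carrier G)" and order_ne_0: "of_nat (order G) \<noteq> (0::'f)"
begin

interpretation e: scalars e by (rule e_hom)

text \<open>Variables from \<open>n\<close> on are left alone, because \<open>ring_action\<close>
  requires the neutral element to act as the identity on the whole polynomial ring.\<close>

definition coords :: "'g \<Rightarrow> nat \<Rightarrow> 'f mpolynomial" where
  "coords g i = (if i < n then \<Sum>j<n. mconst (e (\<rho> (inv g) $$ (i, j))) * mvar j else mvar i)"

definition act :: "'g \<Rightarrow> 'f mpolynomial \<Rightarrow> 'f mpolynomial" where
  "act g = poly_eval mconst (coords g)"

lemma rep_carrier: "g \<in> carrier G \<Longrightarrow> \<rho> g \<in> carrier_mat n n"
  using rep by (auto simp: representations_def hom_def units_of_def Units_def ring_mat_def)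

lemma rep_mult: "g \<in> carrier G \<Longrightarrow> h \<in> carrier G \<Longrightarrow> \<rho> (g \<otimes> h) = \<rho> g * \<rho> h"
  using rep by (auto simp: representations_def hom_def units_of_def ring_mat_def)

lemma rep_one: "\<rho> \<one> = 1\<^sub>m n"
proof -
  interpret R: ring "ring_mat TYPE('k) n ()" by (rule ring_mat)
  have "group (units_of (ring_mat TYPE('k) n ()))" by (rule R.units_group)
  then have "group_hom G (units_of (ring_mat TYPE('k) n ())) \<rho>"
    using rep is_group by (simp add: group_hom_def group_hom_axioms_def representations_def)
  then have "\<rho> \<one> = \<one>\<^bsub>units_of (ring_mat TYPE('k) n ())\<^esub>" by (rule group_hom.hom_one)
  then show ?thesis by (simp add: units_of_def ring_mat_def)
qed

lemma coords_one: "coords \<one> i = mvar i"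
proof (cases "i < n")
  case True
  have "mconst (e (1\<^sub>m n $$ (i, j))) * mvar j = (if j = i then mvar j else 0)" if "j < n" for j
    using True that by (cases "j = i") auto
  then have "coords \<one> i = (\<Sum>j<n. if j = i then mvar j else 0)"
    using True by (simp add: coords_def rep_one)
  then show ?thesis using True by simp
qed (simp add: coords_def)

lemma coords_mult:
  assumes g: "g \<in> carrier G" and h: "h \<in> carrier G"
  shows "coords (g \<otimes> h) i = poly_eval mconst (coords g) (coords h i)"
proof (cases "i < n")
  case True
  have A: "\<rho> (inv h) \<in> carrier_mat n n" "\<rho> (inv g) \<in> carrier_mat n n" using g h by (simp_all add: rep_carrier)
  have m: "\<rho> (inv (g \<otimes> h)) = \<rho> (inv h) * \<rho> (inv g)" using g h by (simp add: inv_mult_group rep_mult)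
  have entry: "(\<rho> (inv h) * \<rho> (inv g)) $$ (i, l) = (\<Sum>j<n. \<rho> (inv h) $$ (i, j) * \<rho> (inv g) $$ (j, l))" if "l < n" for l
    using A True that by (simp add: scalar_prod_def atLeast0LessThan)
  have "poly_eval mconst (coords g) (coords h i)
      = (\<Sum>j<n. mconst (e (\<rho> (inv h) $$ (i, j))) * (\<Sum>l<n. mconst (e (\<rho> (inv g) $$ (j, l))) * mvar l))"
    using True by (simp add: coords_def[of h] mc.poly_eval_sum mc.poly_eval_mult mc.poly_eval_mconst mc.poly_eval_mvar)
      (simp add: coords_def)
  also have "\<dots> = (\<Sum>l<n. \<Sum>j<n. mconst (e (\<rho> (inv h) $$ (i, j))) * (mconst (e (\<rho> (inv g) $$ (j, l))) * mvar l))"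
    unfolding sum_distrib_left by (rule sum.swap)
  also have "\<dots> = (\<Sum>l<n. mconst (e ((\<rho> (inv h) * \<rho> (inv g)) $$ (i, l))) * mvar l)"
    by (intro sum.cong HOL.refl) (simp add: entry e.sc_sum e.sc_mult mc.sc_sum mc.sc_mult sum_distrib_right mult.assoc del: index_mult_mat)
  finally show ?thesis using True by (simp add: coords_def m)
qed (simp add: coords_def mc.poly_eval_mvar)

lemma coords_homogeneous: "i < n \<Longrightarrow> coords g i \<in> homogeneous n 1"
  by (auto simp: coords_def intro!: homogeneous_sum homogeneous_scale homogeneous_mvar[unfolded One_nat_def])

lemma act_single_homogeneous: "ks m \<subseteq> {..<n} \<Longrightarrow> act g (sgl m c) \<in> homogeneous n (exp_degree m)"
  unfolding act_def mc.poly_eval_single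
  by (intro homogeneous_scale homogeneous_monom_eval coords_homogeneous) auto

lemma act_sum: "act g (sum f A) = (\<Sum>i\<in>A. act g (f i))"
  by (simp add: act_def mc.poly_eval_sum)

lemma act_expand: "act g f = (\<Sum>m\<in>ks f. act g (sgl m (lk f m)))"
  using act_sum[of g "\<lambda>m. sgl m (lk f m)" "ks f"] by (simp only: poly_mapping_sum_single)

lemma act_poly_algebra: "f \<in> poly_algebra n \<Longrightarrow> act g f \<in> poly_algebra n"
  unfolding act_expand[of g f]
  by (rule poly_algebra_sum, rule homogeneous_poly_algebra, rule act_single_homogeneous)
    (auto simp: poly_algebra_def)

lemma component_act: "f \<in> poly_algebra n \<Longrightarrow> component n b (act g f) = act g (component n b f)"
proof -
  assume f: "f \<in> poly_algebra n"
  have "component n b (act g (sgl m c)) = act g (component n b (sgl m c))" if "ks m \<subseteq> {..<n}" for m c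
    using that component_homogeneous[OF act_single_homogeneous[OF that], of b g c]
    by (auto simp: component_single act_def)
  then have "(\<Sum>m\<in>ks f. component n b (act g (sgl m (lk f m)))) = (\<Sum>m\<in>ks f. act g (component n b (sgl m (lk f m))))"
    using f by (intro sum.cong) (auto simp: poly_algebra_def)
  then have "component n b (act g (\<Sum>m\<in>ks f. sgl m (lk f m))) = act g (component n b (\<Sum>m\<in>ks f. sgl m (lk f m)))"
    by (simp only: component_sum act_sum)
  then show ?thesis by (simp only: poly_mapping_sum_single)
qed

sublocale ring_action G "mconst :: 'f \<Rightarrow> 'f mpolynomial" act "pos_poly n"
proof unfold_locales
  fix g assume g: "g \<in> carrier G"
  show "algebra_endo mconst (act g)"
    by (simp add: algebra_endo_def act_def mc.poly_eval_add mc.poly_eval_mult mc.poly_eval_mconst)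
  show "act (g \<otimes> h) x = act g (act h x)" if "h \<in> carrier G" for h x
    unfolding act_def mc.poly_eval_poly_eval_mconst
    by (rule arg_cong[where f = "\<lambda>\<sigma>. poly_eval mconst \<sigma> x"]) (simp add: fun_eq_iff coords_mult[OF g that])
  show "act g x \<in> pos_poly n" if x: "x \<in> pos_poly n" for x
  proof -
    have single: "act g (sgl m c) \<in> pos_poly n" if "ks m \<subseteq> {..<n}" "0 < exp_degree m" for m c
      using act_single_homogeneous[OF that(1), of g c] that(2) by (auto simp: homogeneous_def pos_poly_def)
    have "act g (sgl m (lk x m)) \<in> pos_poly n" if "m \<in> ks x" for m
      using x that by (intro single) (auto simp: pos_poly_def)
    then show ?thesis unfolding act_expand[of g x] by (rule pos_poly_sum)
  qed
next
  show "act \<one> x = x" for x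
    using poly_eval_mconst_mvar[of x] by (simp add: act_def coords_one[abs_def])
  show "linear_closed mconst (pos_poly n)"
    by (simp add: linear_closed_def pos_poly_add pos_poly_scale) (simp add: pos_poly_def)
  show "x * y \<in> pos_poly n" if "x \<in> pos_poly n" "y \<in> pos_poly n" for x y
    using that by (rule pos_poly_mult)
qed (use finite_G order_ne_0 in simp_all)

end

section \<open>Degree bounds for generators of the invariants\<close>

lemma ideal_power_1: "ideal_power S 1 \<subseteq> ideal.span S"
  by (rule ideal_power_least) (auto intro: ideal.span_base)

lemma exponent_split:
  assumes "d \<le> exp_degree m"
  shows "\<exists>m1 m2. m = m1 + m2 \<and> exp_degree m1 = d"
  using assms
proof (induction d)
  case 0
  show ?case by (rule exI[of _ 0], rule exI[of _ m]) simp
next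
  case (Suc d)
  then obtain m1 m2 where m: "m = m1 + m2" "exp_degree m1 = d" by auto
  then have "exp_degree m2 \<noteq> 0" using Suc.prems by (simp add: exp_degree_add)
  then obtain i where i: "i \<in> ks m2" by (auto simp: exp_degree_def)
  define m3 where "m3 = m2 - sgl i 1"
  have "m2 = sgl i 1 + m3"
  proof (rule poly_mapping_eqI)
    fix j
    show "lk m2 j = lk (sgl i 1 + m3) j"
      using i by (cases "j = i") (auto simp: m3_def lookup_add lookup_minus lookup_single in_keys_iff)
  qed
  then have "m = (m1 + sgl i 1) + m3" using m by (simp add: add.assoc)
  moreover have "exp_degree (m1 + sgl i 1) = Suc d" using m by (simp add: exp_degree_add)
  ultimately show ?case by blast
qed

lemma monomial_in_ideal_power:
  assumes "ks m \<subseteq> {..<n}"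
  shows "sgl m (1::'a::comm_ring_1) \<in> ideal_power (pos_poly n) (exp_degree m)"
proof -
  have "(\<Prod>i\<in>A. mvar i ^ lk m i) \<in> ideal_power (pos_poly n :: 'a mpolynomial set) (\<Sum>i\<in>A. lk m i)"
    if "finite A" "A \<subseteq> ks m" for A
    using that
  proof (induction A rule: finite_induct)
    case empty
    then show ?case by (simp add: ideal_power_0)
  next
    case (insert x F)
    then have "(mvar x :: 'a mpolynomial) \<in> pos_poly n" using assms by (auto simp: pos_poly_def mvar_def)
    then have "(\<Prod>j<lk m x. mvar x :: 'a mpolynomial) \<in> ideal_power (pos_poly n) (lk m x)"
      by (intro ideal_power_prod) auto
    then have "mvar x ^ lk m x * (\<Prod>i\<in>F. mvar i ^ lk m i) \<in> ideal_power (pos_poly n :: 'a mpolynomial set) (lk m x + (\<Sum>i\<in>F. lk m i))"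
      using insert by (intro ideal_power_mult) auto
    then show ?case using insert by simp
  qed
  then have "monom_eval mvar m \<in> ideal_power (pos_poly n :: 'a mpolynomial set) (exp_degree m)"
    by (simp add: monom_eval_def exp_degree_def)
  then show ?thesis by (simp add: monom_eval_mvar)
qed

lemma lookup_mconst_mult: "lk (mconst c * f) m = c * lk f m"
proof -
  have "mconst c * f = mconst c * (\<Sum>m\<in>ks f. sgl m (lk f m))" by (simp only: poly_mapping_sum_single)
  also have "\<dots> = (\<Sum>m\<in>ks f. sgl m (c * lk f m))"
    by (simp add: sum_distrib_left mconst_def mult_single)
  finally have "lk (mconst c * f) m = (\<Sum>m'\<in>ks f. if m' = m then c * lk f m' else 0)"
    by (simp add: lookup_sum lookup_single when_def)
  then show ?thesis by (auto simp: in_keys_iff)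
qed

lemma poly_algebra_mconst: "mconst c \<in> poly_algebra n"
  by (simp add: poly_algebra_def mconst_def)

lemma (in scalars) poly_eval_poly_eval:
  assumes "scalars e"
  shows "poly_eval sc \<sigma> (poly_eval (\<lambda>c. mconst (e c)) \<tau> f) = poly_eval (\<lambda>c. sc (e c)) (\<lambda>i. poly_eval sc \<sigma> (\<tau> i)) f"
  by (simp add: poly_eval_def[of "\<lambda>c. mconst (e c)"] poly_eval_sum poly_eval_mult poly_eval_mconst
      poly_eval_monom_eval poly_eval_def[of "\<lambda>c. sc (e c)"])

lemma (in mpoly_rep) act_on_poly_algebra:
  assumes "f \<in> poly_algebra n"
  shows "poly_eval mconst (\<lambda>i. \<Sum>j<n. mconst (e (\<rho> (inv g) $$ (i, j))) * mvar j) f = act g f"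
  unfolding act_def using assms
  by (intro poly_eval_cong) (auto simp: coords_def poly_algebra_def subset_iff)

section \<open>Descent from the algebraic closure to the field\<close>

lemma scalars_to_ac: "scalars (to_ac :: 'k::field \<Rightarrow> 'k alg_closure)"
  by unfold_locales simp_all

text \<open>The closure is a vector space over the field; extend \<open>{1}\<close> to a basis and
  take the coordinate at \<open>1\<close>.\<close>

lemma exists_retraction_to_ac:
  "\<exists>\<phi> :: 'k::field alg_closure \<Rightarrow> 'k. (\<forall>x y. \<phi> (x + y) = \<phi> x + \<phi> y) \<and>
     (\<forall>c x. \<phi> (x * to_ac c) = \<phi> x * c) \<and> \<phi> 1 = 1"
proof -
  interpret V: vector_space "\<lambda>(c::'k) x. to_ac c * x"
    by unfold_locales (simp_all add: algebra_simps)
  have ind: "V.independent {1}" by simp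
  let ?B = "V.extend_basis {1}"
  have B: "V.independent ?B" "1 \<in> ?B" "V.span ?B = UNIV"
    using V.independent_extend_basis[OF ind] V.extend_basis_superset[OF ind] V.span_extend_basis[OF ind] by auto
  define \<phi> where "\<phi> x = V.representation ?B x 1" for x
  have "\<phi> (x + y) = \<phi> x + \<phi> y" for x y
    using B by (simp add: \<phi>_def V.representation_add)
  moreover have "\<phi> (x * to_ac c) = \<phi> x * c" for c x
  proof -
    have "\<phi> (to_ac c * x) = c * \<phi> x" using B by (simp add: \<phi>_def V.representation_scale)
    then show ?thesis by (simp add: mult.commute)
  qed
  moreover have "\<phi> 1 = 1" using B by (simp add: \<phi>_def V.representation_basis)
  ultimately show ?thesis by blast
qed

definition extend_scalars :: "'k::field mpolynomial \<Rightarrow> 'k alg_closure mpolynomial" where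
  "extend_scalars = poly_eval (\<lambda>c. mconst (to_ac c)) mvar"

lemma scalars_mconst_to_ac: "scalars (\<lambda>c::'k::field. mconst (to_ac c) :: 'k alg_closure mpolynomial)"
  by unfold_locales (simp_all add: mc.sc_add mc.sc_mult)

interpretation ext: scalars "\<lambda>c::'k::field. mconst (to_ac c) :: 'k alg_closure mpolynomial"
  by (rule scalars_mconst_to_ac)

lemma extend_scalars_single: "extend_scalars (sgl m c) = mconst (to_ac c) * sgl m 1"
  by (simp add: extend_scalars_def ext.poly_eval_single monom_eval_mvar)

lemma extend_scalars_mult: "extend_scalars (f * g) = extend_scalars f * extend_scalars g"
  and extend_scalars_sum: "extend_scalars (sum h A) = (\<Sum>i\<in>A. extend_scalars (h i))"
  by (simp_all add: extend_scalars_def ext.poly_eval_mult ext.poly_eval_sum)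

lemma lookup_extend_scalars: "lk (extend_scalars f) m = to_ac (lk f m)"
proof -
  have "extend_scalars f = (\<Sum>m\<in>ks f. mconst (to_ac (lk f m)) * sgl m 1)"
    by (simp add: extend_scalars_def poly_eval_def monom_eval_mvar)
  then have "lk (extend_scalars f) m = (\<Sum>m'\<in>ks f. if m' = m then to_ac (lk f m') else 0)"
    by (simp add: lookup_sum lookup_mconst_mult lookup_single when_def if_distrib cong: if_cong)
  then show ?thesis by (auto simp: in_keys_iff)
qed

lemma extend_scalars_poly_algebra: "f \<in> poly_algebra n \<Longrightarrow> extend_scalars f \<in> poly_algebra n"
  by (auto simp: poly_algebra_def in_keys_iff[of _ "extend_scalars f"] lookup_extend_scalars)
    (auto simp: in_keys_iff subset_iff)

text \<open>The linear span, over the closure, of the images of \<open>S\<close>. There is no rule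
  for zero, which arises from the coefficient \<open>c = 0\<close>.\<close>

inductive_set scalar_span :: "'k::field mpolynomial set \<Rightarrow> 'k alg_closure mpolynomial set" for S where
  base: "P \<in> S \<Longrightarrow> mconst c * extend_scalars P \<in> scalar_span S"
| add: "F \<in> scalar_span S \<Longrightarrow> F' \<in> scalar_span S \<Longrightarrow> F + F' \<in> scalar_span S"

lemma scalar_span_scale: "F \<in> scalar_span S \<Longrightarrow> mconst c * F \<in> scalar_span S"
proof (induction rule: scalar_span.induct)
  case (base P c')
  then show ?case using scalar_span.base[of P S "c * c'"] by (simp add: mc.sc_mult mult.assoc)
next
  case (add F F')
  then show ?case using scalar_span.add by (simp add: distrib_left)
qed

lemma scalar_span_mult:
  assumes S: "\<And>P Q. P \<in> S \<Longrightarrow> Q \<in> S \<Longrightarrow> P * Q \<in> S" and F: "F \<in> scalar_span S" "F' \<in> scalar_span S"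
  shows "F * F' \<in> scalar_span S"
  using F(1)
proof (induction rule: scalar_span.induct)
  case (base P c)
  show ?case using F(2)
  proof (induction rule: scalar_span.induct)
    case (base P' c')
    then show ?case using scalar_span.base[OF S[OF \<open>P \<in> S\<close> base], of "c * c'"]
      by (simp add: mc.sc_mult extend_scalars_mult mult_ac)
  next
    case (add F F')
    then show ?case using scalar_span.add by (simp add: distrib_left)
  qed
next
  case (add F F')
  then show ?case using scalar_span.add by (simp add: distrib_right)
qed

lemma scalar_span_sum:
  assumes "S \<noteq> {}" "\<And>i. i \<in> A \<Longrightarrow> f i \<in> scalar_span S"
  shows "sum f A \<in> scalar_span S"
proof -
  obtain P where "P \<in> S" using assms(1) by blast
  then have "mconst 0 * extend_scalars P \<in> scalar_span S" by (rule scalar_span.base)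
  then have "0 \<in> scalar_span S" by simp
  then show ?thesis using assms(2)
    by (induction A rule: infinite_finite_induct) (auto intro: scalar_span.add)
qed

text \<open>Applying the retraction to all coefficients turns
  \<open>mconst c * extend_scalars P\<close> into \<open>mconst (\<phi> c) * P\<close>, so it maps
  the span into \<open>S\<close>; and it sends \<open>extend_scalars f\<close> back to
  \<open>f\<close>.\<close>

lemma scalar_span_descent:
  assumes S: "\<And>P Q. P \<in> S \<Longrightarrow> Q \<in> S \<Longrightarrow> P + Q \<in> S" "\<And>c P. P \<in> S \<Longrightarrow> mconst c * P \<in> S"
    and f: "extend_scalars f \<in> scalar_span S"
  shows "f \<in> S"
proof -
  obtain \<phi> :: "'a alg_closure \<Rightarrow> 'a" where \<phi>: "\<And>x y. \<phi> (x + y) = \<phi> x + \<phi> y" "\<And>c x. \<phi> (x * to_ac c) = \<phi> x * c" "\<phi> 1 = 1"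
    using exists_retraction_to_ac by blast
  have "\<exists>P\<in>S. \<forall>m. lk P m = \<phi> (lk F m)" if "F \<in> scalar_span S" for F
    using that
  proof (induction rule: scalar_span.induct)
    case (base P c)
    then show ?case using S(2)[of P "\<phi> c"]
      by (intro bexI[of _ "mconst (\<phi> c) * P"]) (auto simp: lookup_mconst_mult lookup_extend_scalars \<phi>)
  next
    case (add F F')
    then obtain P P' where "P \<in> S" "P' \<in> S" "\<forall>m. lk P m = \<phi> (lk F m)" "\<forall>m. lk P' m = \<phi> (lk F' m)" by blast
    then show ?case using S(1)[of P P'] by (intro bexI[of _ "P + P'"]) (auto simp: lookup_add \<phi>)
  qed
  then obtain P where P: "P \<in> S" "\<And>m. lk P m = \<phi> (lk (extend_scalars f) m)" using f by blast
  have "\<phi> (to_ac c) = c" for c using \<phi>(2)[of 1 c] \<phi>(3) by simp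
  then have "P = f" using P(2) by (intro poly_mapping_eqI) (simp add: lookup_extend_scalars)
  then show ?thesis using P by simp
qed

section \<open>Averages over the group and generators of the invariants\<close>

locale closure_rep = mpoly_rep G n \<rho> "to_ac :: 'k::field \<Rightarrow> 'k alg_closure"
  for G :: "('g, 'b) monoid_scheme" (structure) and n and \<rho> :: "'g \<Rightarrow> 'k::field mat"
begin

lemma order_ne_0_base: "of_nat (order G) \<noteq> (0::'k)"
  using order_ne_0 to_ac_of_nat[where ?'a = 'k, of "order G"] by (metis to_ac_0)

sublocale base: mpoly_rep G n \<rho> "\<lambda>x::'k. x"
  by unfold_locales (use rep finite_G order_ne_0_base in simp_all)

lemma extend_coords: "extend_scalars (base.coords g i) = coords g i"
  by (simp add: coords_def base.coords_def extend_scalars_def ext.poly_eval_sum ext.poly_eval_mult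
      ext.poly_eval_mconst ext.poly_eval_mvar)

lemma extend_act: "extend_scalars (base.act g f) = act g (extend_scalars f)"
proof -
  have "extend_scalars (base.act g f) = poly_eval (\<lambda>c. mconst (to_ac c)) (coords g) f"
    by (simp add: base.act_def extend_scalars_def ext.poly_eval_poly_eval_mconst)
      (simp add: extend_coords flip: extend_scalars_def)
  also have "\<dots> = act g (extend_scalars f)"
    by (simp add: act_def extend_scalars_def mc.poly_eval_poly_eval[OF scalars_to_ac] mc.poly_eval_mvar)
  finally show ?thesis .
qed

lemma poly_action_eq: "f \<in> poly_algebra n \<Longrightarrow> poly_action G n \<rho> g f = base.act g f"
  using base.act_on_poly_algebra[of f g] by (simp add: poly_action_def poly_subst_eq)

lemma invariants_eq: "invariants G n \<rho> = {f \<in> poly_algebra n. \<forall>g\<in>carrier G. base.act g f = f}"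
  by (auto simp: invariants_def poly_action_eq)

text \<open>The Reynolds operator without the factor \<open>1 / order G\<close>.\<close>

definition average_sum :: "'k alg_closure mpolynomial \<Rightarrow> 'k alg_closure mpolynomial" where
  "average_sum f = (\<Sum>g\<in>carrier G. act g f)"

lemma act_hom: "act g (f + h) = act g f + act g h" "act g (f * h) = act g f * act g h" "act g (mconst c) = mconst c"
  by (simp_all add: act_def mc.poly_eval_add mc.poly_eval_mult mc.poly_eval_mconst)

lemma average_sum_sum: "average_sum (sum f A) = (\<Sum>i\<in>A. average_sum (f i))"
  unfolding average_sum_def act_sum by (rule sum.swap)

lemma average_sum_scale: "average_sum (mconst c * f) = mconst c * average_sum f"
  by (simp add: average_sum_def act_hom sum_distrib_left)

lemma average_sum_mult_invariant:
  "(\<And>g. g \<in> carrier G \<Longrightarrow> act g u = u) \<Longrightarrow> average_sum (f * u) = average_sum f * u"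
  by (simp add: average_sum_def act_hom sum_distrib_right)

lemma invariant_eq_average:
  "(\<And>g. g \<in> carrier G \<Longrightarrow> act g u = u) \<Longrightarrow> u = mconst (1 / of_nat (order G)) * average_sum u"
proof -
  assume u: "\<And>g. g \<in> carrier G \<Longrightarrow> act g u = u"
  have "mconst (of_nat m) = (of_nat m :: 'k alg_closure mpolynomial)" for m
    by (induction m) (simp_all add: mc.sc_add)
  then have "average_sum u = mconst (of_nat (order G)) * u"
    using u by (simp add: average_sum_def Coset.order_def)
  then have "mconst (1 / of_nat (order G)) * average_sum u = mconst (1 / of_nat (order G) * of_nat (order G)) * u"
    by (simp only: mc.sc_mult mult.assoc)
  then show ?thesis using order_ne_0 by simp
qed

lemma average_linear_extension:
  assumes S: "S \<noteq> {}" and f: "f \<in> poly_algebra n"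
    and *: "\<And>m. m \<in> ks f \<Longrightarrow> ks m \<subseteq> {..<n} \<Longrightarrow> average_sum (sgl m 1) \<in> scalar_span S"
  shows "average_sum f \<in> scalar_span S"
proof -
  have "f = (\<Sum>m\<in>ks f. mconst (lk f m) * sgl m 1)"
    by (simp add: mconst_def mult_single poly_mapping_sum_single)
  then have "average_sum f = (\<Sum>m\<in>ks f. mconst (lk f m) * average_sum (sgl m 1))"
    by (metis (no_types, lifting) average_sum_scale average_sum_sum sum.cong)
  also have "\<dots> \<in> scalar_span S"
    using f by (intro scalar_span_sum[OF S] scalar_span_scale *) (auto simp: poly_algebra_def)
  finally show ?thesis .
qed

lemma invariants_closed:
  "mconst c \<in> invariants G n \<rho>"
  "f \<in> invariants G n \<rho> \<Longrightarrow> h \<in> invariants G n \<rho> \<Longrightarrow> f + h \<in> invariants G n \<rho>"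
  "f \<in> invariants G n \<rho> \<Longrightarrow> h \<in> invariants G n \<rho> \<Longrightarrow> f * h \<in> invariants G n \<rho>"
  by (auto simp: invariants_eq poly_algebra_mconst poly_algebra_add poly_algebra_mult base.act_def
      mc.poly_eval_add mc.poly_eval_mult mc.poly_eval_mconst)

text \<open>An invariant is a multiple of its average, so by linearity it suffices to treat averages
  of monomials, by induction on the degree. A monomial of degree above \<open>d\<close> has a factor
  of degree \<open>d\<close>, which is a combination of invariants without constant term; an
  invariant factor can be pulled out of an average, and what remains has smaller degree.\<close>

theorem invariants_generated:
  assumes le: "ideal_power (pos_poly n) d \<subseteq> ideal_power (fixed (carrier G)) 1"
  shows "subalgebra_generated {f \<in> invariants G n \<rho>. total_degree f \<le> d} = invariants G n \<rho>"
proof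
  let ?S = "subalgebra_generated {f \<in> invariants G n \<rho>. total_degree f \<le> d}"
  show "?S \<subseteq> invariants G n \<rho>"
  proof
    fix f assume "f \<in> ?S"
    then show "f \<in> invariants G n \<rho>"
      by (induction rule: subalgebra_generated.induct) (auto intro: invariants_closed)
  qed
  have S: "P + Q \<in> ?S" "P * Q \<in> ?S" if "P \<in> ?S" "Q \<in> ?S" for P Q
    using that by (auto intro: subalgebra_generated.intros)
  have S_const: "mconst c \<in> ?S" for c by (rule subalgebra_generated.const)
  then have Sne: "?S \<noteq> {}" by blast
  have monomials: "average_sum (sgl m 1) \<in> scalar_span ?S" if "ks m \<subseteq> {..<n}" for m
    using that
  proof (induction "exp_degree m" arbitrary: m rule: less_induct)
    case less
    show ?case
    proof (cases "exp_degree m \<le> d")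
      case True
      \<comment> \<open>The average of a monomial is defined over the base field, so up to degree
        \<open>d\<close> it is the image of one of the permitted generators.\<close>
      let ?P = "\<Sum>g\<in>carrier G. base.act g (sgl m 1)"
      have hom: "base.act g (sgl m 1) \<in> homogeneous n (exp_degree m)" for g
        using less.prems by (rule base.act_single_homogeneous)
      then have P: "?P \<in> homogeneous n (exp_degree m)" by (rule homogeneous_sum)
      then have "total_degree ?P \<le> d" using True by (auto simp: total_degree_le_iff homogeneous_def)
      moreover have "?P \<in> invariants G n \<rho>"
        using homogeneous_poly_algebra[OF P] by (simp add: invariants_eq base.act_sum_carrier)
      ultimately have "?P \<in> ?S" by (intro subalgebra_generated.gen) simp
      then have "mconst 1 * extend_scalars ?P \<in> scalar_span ?S" by (rule scalar_span.base)
      moreover have "extend_scalars ?P = average_sum (sgl m 1)"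
        by (simp add: extend_scalars_sum extend_act average_sum_def extend_scalars_single)
      ultimately show ?thesis by simp
    next
      case False
      then obtain m1 m2 where m: "m = m1 + m2" "exp_degree m1 = d" using exponent_split[of d m] by auto
      have sub: "ks m1 \<subseteq> {..<n}" "ks m2 \<subseteq> {..<n}" using less.prems m by (auto simp: keys_add_nat)
      have deg: "exp_degree m = d + exp_degree m2" using m by (simp add: exp_degree_add)
      have "sgl m1 1 \<in> ideal.span (fixed (carrier G))"
        using monomial_in_ideal_power[OF sub(1), where ?'a = "'k alg_closure"] le ideal_power_1 m(2) by blast
      then obtain A r where A: "finite A" "A \<subseteq> fixed (carrier G)" "sgl m1 1 = (\<Sum>a\<in>A. r a * a)"
        unfolding ideal.span_explicit by blast
      have "sgl m1 1 = component n d (sgl m1 (1::'k alg_closure))"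
        using m sub by (simp add: component_single)
      also have "\<dots> = (\<Sum>a\<in>A. \<Sum>b\<le>d. component n (d - b) (r a) * component n b a)"
        unfolding A(3) component_sum component_mult ..
      finally have E: "sgl m1 1 = (\<Sum>a\<in>A. \<Sum>b\<le>d. component n (d - b) (r a) * component n b a)" .
      have "sgl m 1 = sgl m1 1 * sgl m2 (1 :: 'k alg_closure)" by (simp add: m(1) mult_single)
      also have "\<dots> = (\<Sum>a\<in>A. \<Sum>b\<le>d. component n (d - b) (r a) * component n b a) * sgl m2 1"
        by (simp only: E)
      also have "\<dots> = (\<Sum>a\<in>A. \<Sum>b\<le>d. (component n (d - b) (r a) * sgl m2 1) * component n b a)"
        unfolding sum_distrib_right by (intro sum.cong HOL.refl) (simp add: mult_ac)
      finally have "average_sum (sgl m 1)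
        = (\<Sum>a\<in>A. \<Sum>b\<le>d. average_sum ((component n (d - b) (r a) * sgl m2 1) * component n b a))"
        by (simp only: average_sum_sum)
      also have "\<dots> \<in> scalar_span ?S"
      proof (intro scalar_span_sum[OF Sne])
        fix a b assume a: "a \<in> A" and b: "b \<in> {..d}"
        let ?f = "component n (d - b) (r a) * sgl m2 1" and ?u = "component n b a"
        have aM: "a \<in> pos_poly n" and inv: "\<And>g. g \<in> carrier G \<Longrightarrow> act g a = a"
          using a A(2) by (auto simp: fixed_def)
        have aP: "a \<in> poly_algebra n" using aM by (auto simp: pos_poly_def poly_algebra_def)
        show "average_sum (?f * ?u) \<in> scalar_span ?S"
        \<comment> \<open>For \<open>b = 0\<close> the coefficient would keep its full degree, but
          then the component vanishes because \<open>a\<close> has no constant term.\<close>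
        proof (cases "b = 0")
          case True
          have "k \<notin> ks a" if "exp_degree k = 0" for k using aM that by (auto simp: pos_poly_def)
          then have "?u = 0" using True
            by (intro poly_mapping_eqI) (simp add: lookup_component in_keys_iff)
          moreover have "average_sum 0 = 0" using average_sum_scale[of 0 0] by simp
          ultimately have "average_sum (?f * ?u) = 0" by simp
          then show ?thesis using scalar_span_sum[OF Sne, of "{}" "\<lambda>_. 0"] by simp
        next
          case False
          have smaller: "average_sum h \<in> scalar_span ?S" if "h \<in> homogeneous n l" "l < exp_degree m" for h l
          proof (rule average_linear_extension[OF Sne homogeneous_poly_algebra[OF that(1)]])
            fix m' assume "m' \<in> ks h" "ks m' \<subseteq> {..<n}"
            then show "average_sum (sgl m' 1) \<in> scalar_span ?S"
              using that by (intro less.hyps) (auto simp: homogeneous_def)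
          qed
          have "sgl m2 1 \<in> homogeneous n (exp_degree m2)" using sub by (simp add: homogeneous_def)
          then have "?f \<in> homogeneous n (d - b + exp_degree m2)"
            by (intro homogeneous_mult component_in_homogeneous)
          moreover have "d - b + exp_degree m2 < exp_degree m" using False b deg by auto
          ultimately have 1: "average_sum ?f \<in> scalar_span ?S" by (rule smaller)
          \<comment> \<open>The invariant component has degree \<open>b \<le> d\<close> and is
            itself a multiple of its average, so the induction hypothesis applies to it too.\<close>
          have "b < exp_degree m" using b \<open>\<not> exp_degree m \<le> d\<close> by simp
          then have 2: "average_sum ?u \<in> scalar_span ?S" by (rule smaller[OF component_in_homogeneous])
          have u_inv: "act g ?u = ?u" if "g \<in> carrier G" for g
            using component_act[OF aP, of b g] inv[OF that] by simp
          have "?u \<in> scalar_span ?S"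
            using scalar_span_scale[OF 2, of "1 / of_nat (order G)"] invariant_eq_average[OF u_inv] by simp
          then have "average_sum ?f * ?u \<in> scalar_span ?S" by (intro scalar_span_mult[OF S(2)] 1)
          then show ?thesis using average_sum_mult_invariant[OF u_inv, of ?f] by simp
        qed
      qed
      finally show ?thesis .
    qed
  qed
  show "invariants G n \<rho> \<subseteq> ?S"
  proof
    fix f assume f: "f \<in> invariants G n \<rho>"
    then have "extend_scalars f \<in> poly_algebra n" by (simp add: invariants_eq extend_scalars_poly_algebra)
    then have "average_sum (extend_scalars f) \<in> scalar_span ?S"
      by (rule average_linear_extension[OF Sne]) (rule monomials)
    moreover have "act g (extend_scalars f) = extend_scalars f" if "g \<in> carrier G" for g
      using f that by (simp add: invariants_eq flip: extend_act)
    ultimately have "extend_scalars f \<in> scalar_span ?S"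
      using scalar_span_scale[of "average_sum (extend_scalars f)" ?S "1 / of_nat (order G)"]
        invariant_eq_average[of "extend_scalars f"] by simp
    then show "f \<in> ?S" by (rule scalar_span_descent[rotated 2]) (use S S_const in blast)+
  qed
qed

lemma noether_number_rep_le:
  assumes "ideal_power (pos_poly n) d \<subseteq> ideal_power (fixed (carrier G)) 1"
  shows "noether_number_rep G n \<rho> \<le> enat d"
  unfolding noether_number_rep_def using invariants_generated[OF assms] by (intro Inf_lower) blast

end

section \<open>Roots of unity in an algebraically closed field\<close>

lemma exists_root_alg_closed:
  assumes "q > 0"
  shows "\<exists>x::'a::alg_closed_field. x ^ q = c"
proof -
  obtain x :: 'a where "(\<Sum>k\<le>q. (if k = 0 then - c else if k = q then 1 else 0) * x ^ k) = 0"
    using alg_closed[of q "\<lambda>k. if k = 0 then - c else if k = q then 1 else 0"] assms by auto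
  moreover have "(\<Sum>k\<le>q. (if k = 0 then - c else if k = q then 1 else 0) * x ^ k)
      = (\<Sum>k\<le>q. if k = 0 then - c else 0) + (\<Sum>k\<le>q. if k = q then x ^ q else 0)"
    unfolding sum.distrib[symmetric] using assms by (intro sum.cong) auto
  ultimately have "x ^ q = c" by simp
  then show ?thesis ..
qed

text \<open>A root of \<open>1 + x + ... + x ^ (q - 1)\<close> is taken; it is not \<open>1\<close>,
  where the value is \<open>q\<close>.\<close>

lemma exists_nontrivial_root_of_unity:
  assumes "q > 1" "of_nat q \<noteq> (0::'a::alg_closed_field)"
  shows "\<exists>x::'a. x ^ q = 1 \<and> x \<noteq> 1"
proof -
  obtain x :: 'a where x: "(\<Sum>k\<le>q - 1. 1 * x ^ k) = 0"
    using alg_closed[of "q - 1" "\<lambda>_. 1"] assms by auto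
  have eq: "{..q - 1} = {..<q}" using assms(1) by auto
  have "x \<noteq> 1" using x assms unfolding eq by auto
  moreover have "x ^ q = 1" using x power_diff_1_eq[of x q] unfolding eq by simp
  ultimately show ?thesis by blast
qed

section \<open>Nilpotent groups without elementary abelian subgroups of rank 2\<close>

lemma sum_powers_eq: "\<exists>w. (\<Sum>l<q. Suc t ^ l) = q + t * w"
proof (induction q)
  case (Suc q)
  then obtain w where w: "(\<Sum>l<q. Suc t ^ l) = q + t * w" by (rule exE)
  have "\<exists>v. Suc t ^ q = 1 + t * v"
  proof (induction q)
    case (Suc q)
    then obtain v where v: "Suc t ^ q = 1 + t * v" by (rule exE)
    have "Suc t ^ Suc q = 1 + t * (1 + v + t * v)" by (simp add: v algebra_simps)
    then show ?case by (rule exI)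
  qed simp
  then obtain v where v: "Suc t ^ q = 1 + t * v" by (rule exE)
  have "(\<Sum>l<Suc q. Suc t ^ l) = Suc q + t * (w + v)" by (simp add: w v algebra_simps)
  then show ?case by (rule exI)
qed simp

lemma dvd_sum_powers_minus: "t dvd (\<Sum>l<q. Suc t ^ l) - q" "q \<le> (\<Sum>l<q. Suc t ^ l)"
proof -
  obtain w where "(\<Sum>l<q. Suc t ^ l) = q + t * w" using sum_powers_eq by (rule exE)
  then show "t dvd (\<Sum>l<q. Suc t ^ l) - q" "q \<le> (\<Sum>l<q. Suc t ^ l)" by simp_all
qed

text \<open>Modulo \<open>q * q\<close> the \<open>l\<close>-th term is \<open>1 + l * t\<close>, so
  the sum is \<open>q\<close> plus \<open>t\<close> times \<open>q * (q - 1) / 2\<close>; for odd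
  \<open>q\<close> the second summand vanishes because \<open>q\<close> divides
  \<open>t\<close>.\<close>

lemma odd_prime_sum_powers:
  fixes q t :: nat
  assumes q: "Factorial_Ring.prime q" "odd q" and t: "q dvd t"
  shows "\<not> q * q dvd (\<Sum>l<q. Suc t ^ l)"
proof
  assume dvd: "q * q dvd (\<Sum>l<q. Suc t ^ l)"
  have step: "[Suc t ^ l = 1 + l * t] (mod q * q)" for l
  proof (induction l)
    case (Suc l)
    have "[Suc t ^ l * Suc t = (1 + l * t) * Suc t] (mod q * q)" using Suc by (rule cong_scalar_right)
    moreover have "(1 + l * t) * Suc t = 1 + Suc l * t + l * (t * t)" by (simp add: algebra_simps)
    moreover have "[1 + Suc l * t + l * (t * t) = 1 + Suc l * t + 0] (mod q * q)"
      using t by (intro cong_add cong_refl) (simp add: cong_0_iff mult_dvd_mono)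
    ultimately show ?case by (metis add.right_neutral cong_trans mult.commute power_Suc)
  qed simp
  have "[(\<Sum>l<q. Suc t ^ l) = (\<Sum>l<q. 1 + l * t)] (mod q * q)" by (intro cong_sum step)
  also have "(\<Sum>l<q. 1 + l * t) = q + (\<Sum>l<q. l) * t" by (simp only: sum.distrib sum_distrib_right) simp
  also have "[q + (\<Sum>l<q. l) * t = q + 0] (mod q * q)"
  proof (intro cong_add cong_refl)
    obtain u where u: "q = Suc (2 * u)" using q(2) by (auto elim!: oddE)
    have "(\<Sum>l<q. l) = q * u"
      by (metis u Sum_Ico_nat atLeast0LessThan diff_Suc_1 diff_zero mult.assoc mult.commute mult_0 nonzero_mult_div_cancel_left numeral_2_eq_2 zero_neq_numeral)
    then have "q * q dvd (\<Sum>l<q. l) * t" using t by (simp add: mult_dvd_mono)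
    then show "[(\<Sum>l<q. l) * t = 0] (mod q * q)" by (simp add: cong_0_iff)
  qed
  finally have "q * q dvd q" using dvd by (simp add: cong_dvd_iff)
  then show False using q(1) by (metis dvd_imp_le mult_le_cancel1 mult.right_neutral not_le prime_gt_0_nat prime_gt_1_nat)
qed

lemma eq_prime_if_only_prime_divisor:
  fixes g q :: nat
  assumes "q dvd g" "\<not> q * q dvd g" "g > 0" "\<And>l. Factorial_Ring.prime l \<Longrightarrow> l dvd g \<Longrightarrow> l = q"
  shows "g = q"
proof -
  obtain t where t: "g = q * t" using assms(1) by (rule dvdE)
  have "t = 1"
  proof (rule ccontr)
    assume "t \<noteq> 1"
    from prime_factor_nat[OF this] obtain l where l: "Factorial_Ring.prime l" "l dvd t" by (elim exE conjE)
    then have "l = q" using assms(4)[of l] t by simp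
    then show False using l assms(2) t by (simp add: mult_dvd_mono)
  qed
  then show ?thesis using t by simp
qed

lemma coprime_if_only_prime_2:
  fixes g m :: nat
  assumes "\<And>l. Factorial_Ring.prime l \<Longrightarrow> l dvd g \<Longrightarrow> l = 2" "odd m"
  shows "coprime g m"
proof (rule ccontr)
  assume "\<not> coprime g m"
  then have "gcd g m \<noteq> 1" by (subst (asm) coprime_iff_gcd_eq_1)
  from prime_factor_nat[OF this] obtain l where l: "Factorial_Ring.prime l" "l dvd gcd g m" by (elim exE conjE)
  have "l = 2" by (rule assms(1)[OF l(1)]) (rule dvd_trans[OF l(2) gcd_dvd1])
  moreover have "l dvd m" by (rule dvd_trans[OF l(2) gcd_dvd2])
  ultimately show False using assms(2) by simp
qed

text \<open>Here \<open>a\<close> generates a self-centralizing normal subgroup of order \<open>n\<close>, and \<open>x\<close> is an element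
  outside with \<open>x ^ q = a ^ j\<close> and \<open>x a x\<^sup>-\<^sup>1 = a ^ (t + 1)\<close>; the last hypothesis says that no
  \<open>a ^ i x\<close> has order \<open>q\<close>.\<close>

lemma quaternion_arithmetic:
  fixes n q t j :: nat
  assumes n: "n > 0" and q: "Factorial_Ring.prime q"
    and F1: "n dvd t * (\<Sum>l<q. Suc t ^ l)" and F2: "n dvd j * t"
    and F3: "\<And>l. Factorial_Ring.prime l \<Longrightarrow> l dvd n \<Longrightarrow> l dvd t" and F4: "\<not> n dvd t"
    and F5: "q dvd n \<Longrightarrow> \<not> (\<exists>i. n dvd i * (\<Sum>l<q. Suc t ^ l) + j)"
  shows "q = 2 \<and> (\<exists>m D. n = m * D \<and> odd m \<and> 4 dvd D \<and> (\<forall>l. Factorial_Ring.prime l \<longrightarrow> l dvd D \<longrightarrow> l = 2) \<and>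
      D dvd t + 2 \<and> m dvd t \<and> D div 2 dvd j \<and> \<not> D dvd j)"
proof -
  define \<sigma> where "\<sigma> = (\<Sum>l<q. Suc t ^ l)"
  have q1: "q > 1" using q by (rule prime_gt_1_nat)
  have s0: "\<sigma> > 0" using dvd_sum_powers_minus(2)[of q t] q1 by (simp add: \<sigma>_def)
  define d where "d = gcd t n"
  obtain n' where n': "n = d * n'" using gcd_dvd2[of t n] unfolding d_def by (rule dvdE)
  obtain t' where t': "t = d * t'" using gcd_dvd1[of t n] unfolding d_def by (rule dvdE)
  have d0: "d > 0" using n n' by (cases d) auto
  have n'0: "n' > 0" using n n' by (cases n') auto
  have cop: "coprime n' t'"
  proof -
    have "gcd t n = d * gcd t' n'" using t' n' by (simp add: gcd_mult_distrib_nat)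
    then have "d * gcd t' n' = d * 1" using d_def by (simp only: mult_1_right)
    then have "gcd t' n' = 1" using d0 by (simp only: nat_mult_eq_cancel1)
    then have "coprime t' n'" by (subst coprime_iff_gcd_eq_1)
    then show ?thesis by (rule coprime_commute[THEN iffD1])
  qed
  have n'1: "n' \<noteq> 1" using F4 n' t' by auto
  have n'_sigma: "n' dvd \<sigma>"
  proof -
    have "d * n' dvd d * (t' * \<sigma>)" using F1 by (simp add: n' t' \<sigma>_def mult.assoc)
    then have "n' dvd t' * \<sigma>" using d0 by simp
    then show ?thesis using coprime_dvd_mult_right_iff[OF cop] by (rule iffD1[rotated])
  qed
  have n'_j: "n' dvd j"
  proof -
    have "d * n' dvd d * (t' * j)" using F2 by (simp add: n' t' mult_ac)
    then have "n' dvd t' * j" using d0 by simp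
    then show ?thesis using coprime_dvd_mult_right_iff[OF cop] by (rule iffD1[rotated])
  qed
  \<comment> \<open>The sum is congruent to \<open>q\<close> modulo \<open>t\<close>, and a prime
    divisor of \<open>n\<close> divides \<open>t\<close>; if it also divides the sum, it divides
    \<open>q\<close>.\<close>
  have only_q: "l = q" if l: "Factorial_Ring.prime l" "l dvd n" "l dvd \<sigma>" for l
  proof -
    have "l dvd t" using F3[OF l(1,2)] .
    then have "l dvd \<sigma> - q" unfolding \<sigma>_def by (rule dvd_trans[OF _ dvd_sum_powers_minus(1)])
    moreover have "\<sigma> = (\<sigma> - q) + q" using dvd_sum_powers_minus(2)[of q t] unfolding \<sigma>_def by simp
    ultimately have "l dvd q" using l(3) dvd_add_right_iff[of l "\<sigma> - q" q] by simp
    then show ?thesis using primes_dvd_imp_eq[OF l(1) q] by simp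
  qed
  have n'_n: "n' dvd n" using n' by simp
  from prime_factor_nat[OF n'1] obtain l where l: "Factorial_Ring.prime l" "l dvd n'" by (elim exE conjE)
  have qn': "q dvd n'" using only_q[OF l(1) dvd_trans[OF l(2) n'_n] dvd_trans[OF l(2) n'_sigma]] l(2) by simp
  have qn: "q dvd n" by (rule dvd_trans[OF qn' n'_n])
  have qt: "q dvd t" by (rule F3[OF q qn])
  define g where "g = gcd \<sigma> n"
  have g0: "g > 0" using n by (simp add: g_def)
  have n'_g: "n' dvd g" using n'_sigma n'_n by (simp add: g_def)
  have g_only: "l = q" if "Factorial_Ring.prime l" "l dvd g" for l
    using only_q[OF that(1)] that(2) by (simp add: g_def)
  have qg: "q dvd g" by (rule dvd_trans[OF qn' n'_g])
  \<comment> \<open>Otherwise Bezout's identity would solve \<open>i * \<sigma> + j = 0\<close>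
    modulo \<open>n\<close>, which \<open>F5\<close> excludes. The factor \<open>n - 1\<close> in
    the witness stands for \<open>- 1\<close>.\<close>
  have gj: "\<not> g dvd j"
  proof
    assume "g dvd j"
    then obtain w where w: "j = g * w" by (rule dvdE)
    obtain u v where uv: "\<sigma> * u = n * v + g" using bezout_nat[of \<sigma> n] s0 by (auto simp: g_def)
    have "(n - 1) * w * u * \<sigma> + j = (n - 1) * w * (\<sigma> * u) + g * w" by (simp add: w mult_ac)
    also have "\<dots> = n * ((n - 1) * w * v) + ((n - 1) + 1) * (g * w)"
      unfolding uv by (simp add: algebra_simps)
    also have "\<dots> = n * ((n - 1) * w * v + g * w)" using n by (simp add: algebra_simps)
    finally have "n dvd (n - 1) * w * u * \<sigma> + j" by simp
    then show False using F5[OF qn] unfolding \<sigma>_def by (auto simp only: not_ex)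
  qed
  \<comment> \<open>Otherwise \<open>g = q\<close>, which divides \<open>n'\<close> and therefore
    \<open>j\<close>, contrary to \<open>gj\<close>.\<close>
  have sq: "q * q dvd g"
  proof (rule ccontr)
    assume "\<not> q * q dvd g"
    from eq_prime_if_only_prime_divisor[OF qg this g0 g_only] have "g = q" .
    then have "g dvd j" using dvd_trans[OF qn' n'_j] by simp
    with gj show False ..
  qed
  have q2: "q = 2"
  proof (rule ccontr)
    assume "q \<noteq> 2"
    then have "odd q" using primes_dvd_imp_eq[OF two_is_prime_nat q] by (cases "even q") auto
    from odd_prime_sum_powers[OF q this qt] show False
      using sq dvd_trans[of "q * q" g \<sigma>] by (simp add: \<sigma>_def g_def)
  qed
  \<comment> \<open>For \<open>q = 2\<close> the sum is \<open>t + 2\<close>, now divisible by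
    \<open>4\<close>. Hence \<open>t\<close> and \<open>d\<close> are even but not divisible by
    \<open>4\<close>, so \<open>d\<close> is twice an odd number.\<close>
  have sig: "\<sigma> = t + 2" by (simp add: \<sigma>_def q2 numeral_2_eq_2)
  have "4 dvd t + 2" using sq q2 sig dvd_trans[of 4 g \<sigma>] by (simp add: g_def)
  then have t4: "\<not> 4 dvd t" by presburger
  have "2 dvd d" using qt qn q2 by (simp add: d_def)
  then obtain m where m: "d = 2 * m" by (rule dvdE)
  have "\<not> 4 dvd d" using t4 t' by auto
  then have m_odd: "odd m" using m by presburger
  \<comment> \<open>In terms of divisibility \<open>g\<close> lies between \<open>n'\<close> and
    \<open>2 * n'\<close> and differs from \<open>n'\<close>, because \<open>n'\<close> divides
    \<open>j\<close> and \<open>g\<close> does not. So \<open>g\<close> will turn out to be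
    \<open>D\<close>.\<close>
  define D where "D = 2 * n'"
  have nD: "n = m * D" using n' m by (simp add: D_def)
  have D_only: "l = 2" if "Factorial_Ring.prime l" "l dvd D" for l
  proof -
    have "l dvd 2 \<or> l dvd n'" using that(2) prime_dvd_mult_iff[OF that(1), of 2 n'] by (simp add: D_def)
    then show ?thesis
    proof
      assume "l dvd 2" then show ?thesis by (rule primes_dvd_imp_eq[OF that(1) two_is_prime_nat])
    next
      assume "l dvd n'" then show ?thesis
        using only_q[OF that(1) dvd_trans[OF _ n'_n] dvd_trans[OF _ n'_sigma]] q2 by simp
    qed
  qed
  have "g dvd m * D" using nD g_def by simp
  moreover have "coprime g m" using coprime_if_only_prime_2[OF _ m_odd] g_only q2 by simp
  ultimately have gD: "g dvd D" using coprime_dvd_mult_right_iff[of g m D] by simp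
  obtain w where w: "g = n' * w" using n'_g by (rule dvdE)
  have "n' * w dvd n' * 2" using gD w by (simp add: D_def mult.commute)
  then have "w dvd 2" using n'0 by simp
  moreover have "w \<noteq> 1" using gj n'_j w by auto
  ultimately have "w = 2" using two_is_prime_nat unfolding prime_nat_iff by blast
  then have gD': "g = D" using w by (simp add: D_def)
  have "4 dvd D" using qn' q2 by (auto simp: D_def)
  moreover have "D dvd t + 2" using gD' sig by (metis g_def gcd_dvd1)
  moreover have "m dvd t" using t' m by simp
  moreover have "D div 2 dvd j" using n'_j by (simp add: D_def)
  moreover have "\<not> D dvd j" using gj gD' by simp
  ultimately show ?thesis using q2 nD m_odd D_only by (intro conjI exI[of _ m] exI[of _ D] allI impI)
qed

text \<open>\<open>i\<close> is the product of the primes dividing \<open>n\<close> but not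
  \<open>j\<close>. Then every prime divisor of \<open>n\<close> divides exactly one of
  \<open>j\<close> and \<open>q * i\<close>.\<close>

lemma exists_add_mult_coprime:
  fixes j q n :: nat
  assumes n: "n > 0" and q: "Factorial_Ring.prime q" "q dvd n \<Longrightarrow> \<not> q dvd j"
  shows "\<exists>i. coprime (j + q * i) n"
proof -
  define i where "i = \<Prod>{l. Factorial_Ring.prime l \<and> l dvd n \<and> \<not> l dvd j}"
  have fin: "finite {l. Factorial_Ring.prime l \<and> l dvd n \<and> \<not> l dvd j}"
    by (rule finite_subset[of _ "{..n}"]) (use n in \<open>auto dest: dvd_imp_le\<close>)
  have "gcd (j + q * i) n = 1"
  proof (rule ccontr)
    assume "gcd (j + q * i) n \<noteq> 1"
    from prime_factor_nat[OF this] obtain l where l: "Factorial_Ring.prime l" "l dvd gcd (j + q * i) n"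
      by (elim exE conjE)
    have l1: "l dvd j + q * i" by (rule dvd_trans[OF l(2) gcd_dvd1])
    have l2: "l dvd n" by (rule dvd_trans[OF l(2) gcd_dvd2])
    show False
    proof (cases "l dvd j")
      case False
      then have "l dvd i" unfolding i_def using fin l(1) l2 by (intro dvd_prodI) simp_all
      then have "l dvd q * i" by simp
      then show False using l1 False by (simp add: dvd_add_left_iff)
    next
      case True
      then have "l dvd q * i" using l1 by (simp add: dvd_add_right_iff)
      then consider "l dvd q" | "l dvd i" using l(1) by (auto simp: prime_dvd_mult_iff)
      then show False
      proof cases
        case 1
        then have "l = q" by (rule primes_dvd_imp_eq[OF l(1) q(1)])
        then show False using q(2) l2 True by simp
      next
        case 2
        then obtain l' where l': "Factorial_Ring.prime l'" "\<not> l' dvd j" "l dvd l'"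
          using l(1) prime_dvd_prod_iff[OF fin l(1)] by (auto simp: i_def)
        then show False using primes_dvd_imp_eq[OF l(1) l'(1) l'(3)] l'(2) True by simp
      qed
    qed
  qed
  then show ?thesis by (intro exI[of _ i]) (simp only: coprime_iff_gcd_eq_1)
qed

section \<open>Cyclicity of abelian subgroups\<close>

context group
begin

lemma ord_pos: "finite (carrier G) \<Longrightarrow> x \<in> carrier G \<Longrightarrow> ord x > 0"
  using ord_ge_1[of x] by simp

lemma generate_singleton_nat:
  "finite (carrier G) \<Longrightarrow> b \<in> carrier G \<Longrightarrow> generate G {b} = {b [^] k |k::nat. True}"
  using generate_pow_nat[of b] ord_pos[of b] by simp

lemma pow_cong:
  assumes "a \<in> carrier G" "a [^] (n::nat) = \<one>" "[u = v] (mod n)"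
  shows "a [^] u = a [^] v"
proof -
  have *: "a [^] (n * w + k) = a [^] k" for w k
    using assms(1,2) by (simp add: nat_pow_mult[symmetric] nat_pow_pow[symmetric])
  have "a [^] w = a [^] (w mod n)" for w
    using *[of "w div n" "w mod n"] by (simp only: mult_div_mod_eq)
  from this[of u] this[of v] show ?thesis using assms(3) by (simp add: cong_def)
qed

text \<open>Prime factors of \<open>m\<close> are removed one at a time until the power leaves
  \<open>S\<close>.\<close>

lemma exists_prime_pow_in:
  assumes "y \<in> carrier G" "y \<notin> S" "m > 0" "y [^] (m::nat) \<in> S"
  shows "\<exists>(q::nat) (u::nat). Factorial_Ring.prime q \<and> y [^] u \<notin> S \<and> (y [^] u) [^] q \<in> S"
  using assms(3,4)
proof (induction m rule: less_induct)
  case (less m)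
  have "m \<noteq> 1" using less.prems assms(1,2) by auto
  from prime_factor_nat[OF this] obtain q where q: "Factorial_Ring.prime q" "q dvd m"
    by (elim exE conjE)
  obtain u where u: "m = q * u" using q(2) by (rule dvdE)
  show ?case
  proof (cases "y [^] u \<in> S")
    case True
    have "u < m" "u > 0" using u less.prems(1) prime_gt_1_nat[OF q(1)] by auto
    from less.IH[OF this True] show ?thesis .
  next
    case False
    have "(y [^] u) [^] q \<in> S" using less.prems(2) assms(1) by (simp add: nat_pow_pow u mult.commute)
    then show ?thesis using q(1) False by (intro exI[of _ q] exI[of _ u] conjI)
  qed
qed

lemma pow_commute_pow:
  assumes "y \<in> carrier G" "a \<in> carrier G" "y \<otimes> a = a \<otimes> y"
  shows "y \<otimes> a [^] (i::nat) = a [^] i \<otimes> y"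
proof (induction i)
  case (Suc i)
  have "y \<otimes> a [^] Suc i = (y \<otimes> a [^] i) \<otimes> a" using assms by (simp add: m_assoc)
  also have "\<dots> = a [^] i \<otimes> (y \<otimes> a)" using assms(1,2) by (simp add: Suc m_assoc)
  also have "\<dots> = a [^] Suc i \<otimes> y" using assms(1,2) by (simp add: assms(3) m_assoc)
  finally show ?case .
qed (use assms in simp)

lemma pow_of_commute_mult:
  assumes "y \<in> carrier G" "a \<in> carrier G" "y \<otimes> a = a \<otimes> y" "y [^] (q::nat) = a [^] (j::nat)"
  shows "(y \<otimes> a [^] i) [^] q = a [^] (j + i * q)"
proof -
  have "y \<otimes> a [^] i = a [^] i \<otimes> y" by (rule pow_commute_pow[OF assms(1-3)])
  then have "(y \<otimes> a [^] i) [^] q = y [^] q \<otimes> (a [^] i) [^] q"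
    using assms by (intro pow_mult_distrib) auto
  then show ?thesis using assms(2) by (simp add: assms(4) nat_pow_pow nat_pow_mult)
qed

text \<open>Excludes subgroups C_q x C_q with \<open>q\<close> prime.\<close>

definition rank_two_free :: bool where
  "rank_two_free \<longleftrightarrow> (\<forall>(q::nat) g h. Factorial_Ring.prime q \<longrightarrow> g \<in> carrier G \<longrightarrow> h \<in> carrier G \<longrightarrow>
     g [^] q = \<one> \<longrightarrow> g \<noteq> \<one> \<longrightarrow> h [^] q = \<one> \<longrightarrow> g \<otimes> h = h \<otimes> g \<longrightarrow> h \<in> generate G {g})"

lemma rank_two_freeD:
  "rank_two_free \<Longrightarrow> Factorial_Ring.prime q \<Longrightarrow> g \<in> carrier G \<Longrightarrow> h \<in> carrier G \<Longrightarrow>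
    g [^] (q::nat) = \<one> \<Longrightarrow> g \<noteq> \<one> \<Longrightarrow> h [^] q = \<one> \<Longrightarrow> g \<otimes> h = h \<otimes> g \<Longrightarrow> h \<in> generate G {g}"
  unfolding rank_two_free_def by simp

lemma pow_in_subgroup: "subgroup A G \<Longrightarrow> a \<in> A \<Longrightarrow> a [^] (i::nat) \<in> A"
proof (induction i)
  case (Suc i)
  then show ?case unfolding nat_pow_Suc by (intro subgroup.m_closed)
qed (simp add: subgroup.one_closed)

text \<open>Let \<open>a\<close> have maximal order in \<open>A\<close>, and let \<open>z\<close>
  lie outside its powers with \<open>z [^] q = a [^] j\<close>. If \<open>q\<close> divides both
  \<open>j\<close> and the order of \<open>a\<close>, some \<open>z \<otimes> a [^] i\<close> has
  \<open>q\<close>-th power \<open>\<one>\<close> and lies outside the powers of \<open>a\<close>,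
  contradicting \<open>rank_two_free\<close>. Otherwise \<open>i\<close> can be chosen such that the
  \<open>q\<close>-th power of \<open>z \<otimes> a [^] i\<close> generates the powers of
  \<open>a\<close>, contradicting maximality.\<close>

lemma abelian_cyclic_if_rank_two_free:
  assumes fin: "finite (carrier G)" and A: "subgroup A G"
    and comm: "\<And>x y. x \<in> A \<Longrightarrow> y \<in> A \<Longrightarrow> x \<otimes> y = y \<otimes> x" and free: rank_two_free
  shows "\<exists>a\<in>A. \<forall>y\<in>A. \<exists>k::nat. y = a [^] k"
proof -
  have AG: "A \<subseteq> carrier G" using A by (rule subgroup.subset)
  have "\<exists>a. a \<in> A \<and> (\<forall>b. b \<in> A \<longrightarrow> card (generate G {b}) \<le> card (generate G {a}))"
  proof (rule ex_has_greatest_nat)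
    show "\<one> \<in> A" using A by (rule subgroup.one_closed)
    show "\<forall>b. b \<in> A \<longrightarrow> card (generate G {b}) < Suc (card (carrier G))"
    proof (intro allI impI)
      fix b assume "b \<in> A"
      then have "generate G {b} \<subseteq> carrier G" using AG by (intro generate_incl) auto
      then show "card (generate G {b}) < Suc (card (carrier G))"
        unfolding less_Suc_eq_le by (rule card_mono[OF fin])
    qed
  qed
  then obtain a where a: "a \<in> A" and max: "\<And>b. b \<in> A \<Longrightarrow> card (generate G {b}) \<le> card (generate G {a})"
    by auto
  have aG: "a \<in> carrier G" using a AG by auto
  have gen: "generate G {b} = {b [^] k |k::nat. True}" if "b \<in> carrier G" for b
    by (rule generate_singleton_nat[OF fin that])
  have "\<exists>k::nat. y = a [^] k" if y: "y \<in> A" for y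
  proof (rule ccontr)
    assume no: "\<not> (\<exists>k::nat. y = a [^] k)"
    define S where "S = generate G {a}"
    have S: "S = {a [^] k |k::nat. True}" unfolding S_def by (rule gen[OF aG])
    have yG: "y \<in> carrier G" using y AG by auto
    have yS: "y \<notin> S" using no by (simp add: S)
    have "y [^] ord y \<in> S" using yG unfolding S_def by (simp add: generate.one)
    from exists_prime_pow_in[OF yG yS ord_pos[OF fin yG] this]
    obtain q u :: nat where q: "Factorial_Ring.prime q" "y [^] u \<notin> S" "(y [^] u) [^] q \<in> S"
      by (elim exE conjE)
    define z where "z = y [^] u"
    have zA: "z \<in> A" unfolding z_def by (rule pow_in_subgroup[OF A y])
    have zG: "z \<in> carrier G" using zA AG by auto
    obtain j where j: "z [^] q = a [^] (j::nat)" using q(3) by (auto simp: S z_def)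
    have za: "z \<otimes> a = a \<otimes> z" using comm zA a by simp
    define n where "n = ord a"
    have n: "n > 0" unfolding n_def by (rule ord_pos[OF fin aG])
    have an: "a [^] n = \<one>" using aG by (simp add: n_def)
    have notS: "z \<otimes> a [^] i \<notin> S" for i :: nat
    proof
      assume "z \<otimes> a [^] i \<in> S"
      moreover have "inv (a [^] i) \<in> S"
        unfolding S_def using aG by (intro subgroup.m_inv_closed[OF generate_is_subgroup]) (auto simp: gen)
      ultimately have "(z \<otimes> a [^] i) \<otimes> inv (a [^] i) \<in> S"
        unfolding S_def using aG by (intro subgroup.m_closed[OF generate_is_subgroup, of "{a}" "z \<otimes> a [^] i"]) auto
      then show False using q(2) zG aG by (simp add: m_assoc z_def)
    qed
    have powq: "(z \<otimes> a [^] i) [^] q = a [^] (j + i * q)" for i :: nat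
      by (rule pow_of_commute_mult[OF zG aG za j])
    show False
    proof (cases "q dvd n \<and> q dvd j")
      case True
      then obtain n' j' where n': "n = q * n'" "j = q * j'" by (auto elim!: dvdE)
      \<comment> \<open>The factor \<open>n - 1\<close> stands for \<open>- 1\<close> modulo
        \<open>n\<close>, so that the \<open>q\<close>-th power of \<open>h\<close> is
        \<open>a [^] (j - j' * q) = \<one>\<close>.\<close>
      define h where "h = z \<otimes> a [^] (j' * (n - 1))"
      have hG: "h \<in> carrier G" using zG aG by (simp add: h_def)
      have "j + j' * (n - 1) * q = n * j" using n n' by (cases n) (auto simp: algebra_simps)
      then have "h [^] q = a [^] (n * j)" using powq by (simp add: h_def)
      then have hq: "h [^] q = \<one>" using an aG by (simp add: nat_pow_pow[symmetric])
      define g where "g = a [^] n'"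
      have gG: "g \<in> carrier G" using aG by (simp add: g_def)
      have gq: "g [^] q = \<one>" using aG an by (simp add: g_def nat_pow_pow n' mult.commute)
      have "\<not> n dvd n'"
        using n n' prime_gt_1_nat[OF q(1)] by (auto dest!: dvd_imp_le)
      then have g1: "g \<noteq> \<one>" using aG by (simp add: g_def pow_eq_id n_def)
      have "h \<in> A" unfolding h_def using A zA a by (intro subgroup.m_closed[OF A] pow_in_subgroup[OF A])
      moreover have "g \<in> A" unfolding g_def by (rule pow_in_subgroup[OF A a])
      ultimately have "g \<otimes> h = h \<otimes> g" by (intro comm)
      with free q(1) gG hG gq g1 hq have "h \<in> generate G {g}" by (rule rank_two_freeD)
      then obtain k :: nat where "h = g [^] k" by (auto simp: gen[OF gG])
      then have "h \<in> S" using aG by (auto simp: S g_def nat_pow_pow)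
      then show False using notS by (simp add: h_def)
    next
      case False
      then have "\<exists>i. coprime (j + q * i) n" by (intro exists_add_mult_coprime[OF n q(1)]) simp
      then obtain i where i: "coprime (j + q * i) n" by (elim exE)
      define b where "b = z \<otimes> a [^] i"
      have bA: "b \<in> A" unfolding b_def using zA a by (intro subgroup.m_closed[OF A] pow_in_subgroup[OF A])
      have bG: "b \<in> carrier G" using bA AG by auto
      obtain v where v: "[(j + q * i) * v = 1] (mod n)" using cong_solve_coprime_nat[OF i] by auto
      have "b [^] (q * v) = a [^] ((j + q * i) * v)"
        using aG bG by (simp add: nat_pow_pow[symmetric] powq b_def mult.commute[of i])
      also have "\<dots> = a" using pow_cong[OF aG an v] aG by simp
      finally have "a = b [^] (q * v)" ..
      then have sub: "S \<subseteq> generate G {b}" using bG by (auto simp: S gen nat_pow_pow)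
      moreover have "b \<in> generate G {b}" by (intro generate.incl) simp
      moreover have "finite (generate G {b})" using finite_subset[OF generate_incl fin] bG by auto
      ultimately have "card S < card (generate G {b})"
        using notS[of i] by (intro psubset_card_mono) (auto simp: b_def)
      then show False using max[OF bA] by (simp add: S_def)
    qed
  qed
  then show ?thesis using a by blast
qed

end

lemma cong_mult_add: "[n * k + u = u] (mod (n::nat))"
  by (simp add: cong_def)

section \<open>Maximal abelian normal subgroups and conjugation exponents\<close>

context group
begin

lemma l_inv_cancel: "g \<in> carrier G \<Longrightarrow> z \<in> carrier G \<Longrightarrow> inv g \<otimes> (g \<otimes> z) = z"
  and l_inv_cancel': "g \<in> carrier G \<Longrightarrow> z \<in> carrier G \<Longrightarrow> g \<otimes> (inv g \<otimes> z) = z"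
  by (simp_all add: m_assoc[symmetric])

lemma commute_inv:
  assumes "x \<in> carrier G" "a \<in> carrier G" "x \<otimes> a = a \<otimes> x"
  shows "inv x \<otimes> a = a \<otimes> inv x"
proof -
  have "inv x \<otimes> a = inv x \<otimes> (a \<otimes> x) \<otimes> inv x" using assms(1,2) by (simp add: m_assoc)
  also have "\<dots> = inv x \<otimes> (x \<otimes> a) \<otimes> inv x" by (simp only: assms(3))
  also have "\<dots> = a \<otimes> inv x" using assms(1,2) by (simp add: l_inv_cancel)
  finally show ?thesis .
qed

lemma centralizer_subgroup:
  assumes S: "S \<subseteq> carrier G"
  shows "subgroup {x \<in> carrier G. \<forall>a\<in>S. x \<otimes> a = a \<otimes> x} G"
proof (rule subgroupI)
  show "{x \<in> carrier G. \<forall>a\<in>S. x \<otimes> a = a \<otimes> x} \<noteq> {}" using S by (auto intro!: exI[of _ \<one>])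
next
  fix x assume "x \<in> {x \<in> carrier G. \<forall>a\<in>S. x \<otimes> a = a \<otimes> x}"
  then show "inv x \<in> {x \<in> carrier G. \<forall>a\<in>S. x \<otimes> a = a \<otimes> x}" using S by (auto intro!: commute_inv)
next
  fix x y assume x: "x \<in> {x \<in> carrier G. \<forall>a\<in>S. x \<otimes> a = a \<otimes> x}"
    and y: "y \<in> {x \<in> carrier G. \<forall>a\<in>S. x \<otimes> a = a \<otimes> x}"
  have "(x \<otimes> y) \<otimes> a = a \<otimes> (x \<otimes> y)" if a: "a \<in> S" for a
  proof -
    have G: "x \<in> carrier G" "y \<in> carrier G" "a \<in> carrier G" using x y a S by auto
    have xa: "x \<otimes> a = a \<otimes> x" and ya: "y \<otimes> a = a \<otimes> y" using x y a by auto
    have "(x \<otimes> y) \<otimes> a = x \<otimes> (y \<otimes> a)" using G by (simp add: m_assoc)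
    also have "\<dots> = (x \<otimes> a) \<otimes> y" using G by (simp add: ya m_assoc)
    also have "\<dots> = a \<otimes> (x \<otimes> y)" using G by (simp add: xa m_assoc)
    finally show ?thesis .
  qed
  then show "x \<otimes> y \<in> {x \<in> carrier G. \<forall>a\<in>S. x \<otimes> a = a \<otimes> x}" using x y by simp
qed auto

lemma generate_commute:
  assumes S: "S \<subseteq> carrier G" and comm: "\<And>x y. x \<in> S \<Longrightarrow> y \<in> S \<Longrightarrow> x \<otimes> y = y \<otimes> x"
    and "x \<in> generate G S" "y \<in> generate G S"
  shows "x \<otimes> y = y \<otimes> x"
proof -
  have gS: "generate G S \<subseteq> carrier G" using S by (rule generate_incl)
  have 1: "generate G S \<subseteq> {x \<in> carrier G. \<forall>a\<in>S. x \<otimes> a = a \<otimes> x}"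
    by (rule generate_subgroup_incl[OF _ centralizer_subgroup[OF S]]) (use S comm in auto)
  have 2: "generate G S \<subseteq> {x \<in> carrier G. \<forall>a\<in>generate G S. x \<otimes> a = a \<otimes> x}"
  proof (rule generate_subgroup_incl[OF _ centralizer_subgroup[OF gS]], rule subsetI)
    fix s assume s: "s \<in> S"
    have "s \<otimes> z = z \<otimes> s" if "z \<in> generate G S" for z
      using subsetD[OF 1 that] s by auto
    then show "s \<in> {x \<in> carrier G. \<forall>a\<in>generate G S. x \<otimes> a = a \<otimes> x}" using s S by auto
  qed
  from subsetD[OF 2 assms(3)] assms(4) show ?thesis by simp
qed

text \<open>Let \<open>A\<close> be an abelian normal subgroup of maximal order and \<open>C\<close>
  its centralizer. If \<open>C\<close> exceeds \<open>A\<close>, some \<open>x\<close> in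
  \<open>C - A\<close> is central modulo \<open>A\<close>: otherwise commutators lead from each
  element of \<open>C - A\<close> to another one deeper in the lower central series, which ends at
  \<open>\<one>\<close>. Then \<open>A\<close> and \<open>x\<close> generate a larger abelian normal
  subgroup.\<close>

lemma exists_self_centralizing_normal:
  assumes fin: "finite (carrier G)" and lc: "lower_central G c = {\<one>}"
  shows "\<exists>A. A \<lhd> G \<and> (\<forall>x\<in>A. \<forall>y\<in>A. x \<otimes> y = y \<otimes> x) \<and>
    (\<forall>x\<in>carrier G. (\<forall>a\<in>A. x \<otimes> a = a \<otimes> x) \<longrightarrow> x \<in> A)"
proof -
  define P where "P A \<longleftrightarrow> A \<lhd> G \<and> (\<forall>x\<in>A. \<forall>y\<in>A. x \<otimes> y = y \<otimes> x)" for A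
  have PG: "A \<subseteq> carrier G" if "P A" for A
    using that subgroup.subset[OF normal_imp_subgroup[of A G]] by (simp add: P_def)
  have "\<exists>A. P A \<and> (\<forall>B. P B \<longrightarrow> card B \<le> card A)"
  proof (rule ex_has_greatest_nat)
    show "P {\<one>}" by (simp add: P_def one_is_normal)
    show "\<forall>B. P B \<longrightarrow> card B < Suc (card (carrier G))"
      using PG card_mono[OF fin] by (auto simp: less_Suc_eq_le)
  qed
  then obtain A where PA: "P A" and max: "\<And>B. P B \<Longrightarrow> card B \<le> card A" by auto
  have A: "A \<lhd> G" "\<And>x y. x \<in> A \<Longrightarrow> y \<in> A \<Longrightarrow> x \<otimes> y = y \<otimes> x" using PA by (auto simp: P_def)
  have sub: "subgroup A G" using A(1) by (rule normal_imp_subgroup)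
  have AG: "A \<subseteq> carrier G" by (rule PG[OF PA])
  have conjA: "g \<otimes> h \<otimes> inv g \<in> A" if "g \<in> carrier G" "h \<in> A" for g h
    by (rule normal.inv_op_closed2[OF A(1) that])
  define C where "C = {x \<in> carrier G. \<forall>a\<in>A. x \<otimes> a = a \<otimes> x}"
  have subC: "subgroup C G" unfolding C_def by (rule centralizer_subgroup[OF AG])
  have CG: "C \<subseteq> carrier G" by (auto simp: C_def)
  have conjC: "g \<otimes> x \<otimes> inv g \<in> C" if g: "g \<in> carrier G" and x: "x \<in> C" for g x
  proof -
    have xG: "x \<in> carrier G" using x CG by auto
    have "(g \<otimes> x \<otimes> inv g) \<otimes> a = a \<otimes> (g \<otimes> x \<otimes> inv g)" if a: "a \<in> A" for a
    proof -
      define a' where "a' = inv g \<otimes> a \<otimes> g"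
      have a': "a' \<in> A" unfolding a'_def by (rule normal.inv_op_closed1[OF A(1) g a])
      have aG: "a \<in> carrier G" "a' \<in> carrier G" using a a' AG by auto
      have eq: "a = g \<otimes> a' \<otimes> inv g" using g aG(1) by (simp add: a'_def m_assoc l_inv_cancel')
      have "(g \<otimes> x \<otimes> inv g) \<otimes> a = g \<otimes> (x \<otimes> a') \<otimes> inv g"
        unfolding eq using g xG aG by (simp add: m_assoc l_inv_cancel)
      also have "x \<otimes> a' = a' \<otimes> x" using x a' by (simp add: C_def)
      also have "g \<otimes> (a' \<otimes> x) \<otimes> inv g = a \<otimes> (g \<otimes> x \<otimes> inv g)"
        unfolding eq using g xG aG by (simp add: m_assoc l_inv_cancel)
      finally show ?thesis .
    qed
    then show ?thesis using g xG by (simp add: C_def)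
  qed
  have "C \<subseteq> A"
  proof (rule ccontr)
    assume nsub: "\<not> C \<subseteq> A"
    have "\<exists>x\<in>C - A. \<forall>g\<in>carrier G. x \<otimes> g \<otimes> inv x \<otimes> inv g \<in> A"
    proof (rule ccontr)
      assume no: "\<not> (\<exists>x\<in>C - A. \<forall>g\<in>carrier G. x \<otimes> g \<otimes> inv x \<otimes> inv g \<in> A)"
      have "\<exists>x. x \<in> C - A \<and> x \<in> lower_central G i" for i
      proof (induction i)
        case 0
        then show ?case using nsub CG by auto
      next
        case (Suc i)
        then obtain x where x: "x \<in> C - A" "x \<in> lower_central G i" by (elim exE conjE)
        then obtain g where g: "g \<in> carrier G" "x \<otimes> g \<otimes> inv x \<otimes> inv g \<notin> A" using no by auto
        have xG: "x \<in> carrier G" using x(1) CG by auto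
        have "x \<otimes> (g \<otimes> inv x \<otimes> inv g) \<in> C"
          using x(1) by (intro subgroup.m_closed[OF subC] conjC[OF g(1)] subgroup.m_inv_closed[OF subC]) auto
        then have "x \<otimes> g \<otimes> inv x \<otimes> inv g \<in> C" using xG g(1) by (simp add: m_assoc)
        moreover have "x \<otimes> g \<otimes> inv x \<otimes> inv g \<in> lower_central G (Suc i)"
          unfolding lower_central.simps using x(2) g(1) by (intro generate.incl) auto
        ultimately show ?case using g(2) by (intro exI[of _ "x \<otimes> g \<otimes> inv x \<otimes> inv g"]) simp
      qed
      from this[of c] show False using subgroup.one_closed[OF sub] by (simp add: lc)
    qed
    then obtain x where x: "x \<in> C" "x \<notin> A"
      and cx: "\<And>g. g \<in> carrier G \<Longrightarrow> x \<otimes> g \<otimes> inv x \<otimes> inv g \<in> A" by auto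
    have xG: "x \<in> carrier G" using x(1) CG by auto
    \<comment> \<open>\<open>H\<close> is only a set stable under conjugation, as needed to see that
      the subgroup it generates is normal.\<close>
    define H where "H = A \<union> (\<lambda>a. a \<otimes> x) ` A"
    have HG: "H \<subseteq> carrier G" using AG xG by (auto simp: H_def)
    have conjH: "g \<otimes> h \<otimes> inv g \<in> H" if h: "h \<in> H" and g: "g \<in> carrier G" for g h
    proof (cases "h \<in> A")
      case True
      then show ?thesis using conjA[OF g] by (simp add: H_def)
    next
      case False
      then obtain a where a: "a \<in> A" "h = a \<otimes> x" using h by (auto simp: H_def)
      have aG: "a \<in> carrier G" using a AG by auto
      have "g \<otimes> h \<otimes> inv g = ((g \<otimes> a \<otimes> inv g) \<otimes> inv (x \<otimes> g \<otimes> inv x \<otimes> inv g)) \<otimes> x"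
        using g aG xG by (simp add: a(2) inv_mult_group m_assoc l_inv_cancel)
      moreover have "(g \<otimes> a \<otimes> inv g) \<otimes> inv (x \<otimes> g \<otimes> inv x \<otimes> inv g) \<in> A"
        by (intro subgroup.m_closed[OF sub] subgroup.m_inv_closed[OF sub] conjA cx g a(1))
      ultimately show ?thesis by (simp add: H_def)
    qed
    have insG: "insert x A \<subseteq> carrier G" using xG AG by auto
    have "H \<subseteq> generate G (insert x A)"
    proof
      fix h assume "h \<in> H"
      then consider "h \<in> A" | a where "a \<in> A" "h = a \<otimes> x" by (auto simp: H_def)
      then show "h \<in> generate G (insert x A)"
      proof cases
        case 1
        then show ?thesis by (intro generate.incl) simp
      next
        case 2
        then show ?thesis unfolding 2(2) by (intro generate.eng generate.incl) simp_all
      qed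
    qed
    moreover have "u \<otimes> v = v \<otimes> u" if "u \<in> generate G (insert x A)" "v \<in> generate G (insert x A)" for u v
    proof (rule generate_commute[OF insG _ that])
      fix u v assume "u \<in> insert x A" "v \<in> insert x A"
      then show "u \<otimes> v = v \<otimes> u" using A(2) x(1) by (auto simp: C_def)
    qed
    ultimately have commH: "u \<otimes> v = v \<otimes> u" if "u \<in> H" "v \<in> H" for u v using that by blast
    have "P (generate G H)"
      unfolding P_def
    proof (intro conjI ballI)
      show "generate G H \<lhd> G" by (rule normal_generateI[OF HG conjH])
      fix u v assume uv: "u \<in> generate G H" "v \<in> generate G H"
      show "u \<otimes> v = v \<otimes> u" by (rule generate_commute[OF HG _ uv]) (rule commH)
    qed
    then have "card (generate G H) \<le> card A" by (rule max)
    moreover have "A \<subset> generate G H"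
    proof -
      have "x \<in> H" using subgroup.one_closed[OF sub] xG by (auto simp: H_def image_iff intro!: bexI[of _ \<one>])
      then have "x \<in> generate G H" by (rule generate.incl)
      moreover have "A \<subseteq> generate G H" by (auto simp: H_def intro: generate.incl)
      ultimately show ?thesis using x(2) by auto
    qed
    ultimately show False
      using psubset_card_mono[OF finite_subset[OF generate_incl[OF HG] fin], of A] by simp
  qed
  then show ?thesis using A by (intro exI[of _ A]) (auto simp: C_def)
qed

lemma twist_pow:
  assumes "x \<in> carrier G" "a \<in> carrier G" "x \<otimes> a = a [^] (s::nat) \<otimes> x"
  shows "x [^] (k::nat) \<otimes> a [^] (i::nat) = a [^] (s ^ k * i) \<otimes> x [^] k"
proof -
  have *: "x \<otimes> a [^] i = a [^] (s * i) \<otimes> x" for i :: nat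
  proof (induction i)
    case (Suc i)
    have "x \<otimes> a [^] Suc i = (x \<otimes> a [^] i) \<otimes> a" using assms by (simp add: m_assoc)
    also have "\<dots> = a [^] (s * i) \<otimes> (x \<otimes> a)" using assms(1,2) by (simp add: Suc m_assoc)
    also have "\<dots> = (a [^] (s * i) \<otimes> a [^] s) \<otimes> x" using assms(1,2) by (simp add: assms(3) m_assoc)
    also have "\<dots> = a [^] (s * Suc i) \<otimes> x" using assms(2) by (simp add: nat_pow_mult add.commute)
    finally show ?case .
  qed (use assms in simp)
  show ?thesis
  proof (induction k arbitrary: i)
    case (Suc k)
    have "x [^] Suc k \<otimes> a [^] i = x [^] k \<otimes> (x \<otimes> a [^] i)" using assms(1,2) by (simp add: m_assoc)
    also have "\<dots> = (x [^] k \<otimes> a [^] (s * i)) \<otimes> x" using assms(1,2) by (simp add: * m_assoc)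
    also have "\<dots> = a [^] (s ^ k * (s * i)) \<otimes> x [^] Suc k" using assms(1,2) by (simp add: Suc m_assoc)
    finally show ?case by (simp add: mult_ac)
  qed (use assms in simp)
qed

lemma twist_mult_pow:
  assumes "x \<in> carrier G" "a \<in> carrier G" "x \<otimes> a = a [^] (s::nat) \<otimes> x"
  shows "(a [^] (i::nat) \<otimes> x) [^] (k::nat) = a [^] (i * (\<Sum>l<k. s ^ l)) \<otimes> x [^] k"
proof (induction k)
  case (Suc k)
  have "(a [^] i \<otimes> x) [^] Suc k = a [^] (i * (\<Sum>l<k. s ^ l)) \<otimes> (x [^] k \<otimes> a [^] i) \<otimes> x"
    using assms(1,2) by (simp add: Suc m_assoc)
  also have "\<dots> = (a [^] (i * (\<Sum>l<k. s ^ l)) \<otimes> a [^] (s ^ k * i)) \<otimes> x [^] Suc k"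
    using assms(1,2) by (simp add: twist_pow[OF assms] m_assoc)
  also have "\<dots> = a [^] (i * (\<Sum>l<Suc k. s ^ l)) \<otimes> x [^] Suc k"
    using assms(2) by (simp add: nat_pow_mult algebra_simps)
  finally show ?case .
qed (use assms in simp)

text \<open>The commutator of \<open>a [^] k\<close> and \<open>x\<close> is the inverse of
  \<open>a [^] (t * k)\<close>. In a nilpotent group the order of \<open>a\<close> thus divides a
  power of \<open>t\<close>, so each of its prime divisors divides \<open>t\<close>.\<close>

lemma lower_central_twist:
  assumes x: "x \<in> carrier G" and a: "a \<in> carrier G" and xa: "x \<otimes> a = a [^] Suc t \<otimes> x"
  shows "a [^] (t ^ i) \<in> lower_central G i"
proof (induction i)
  case (Suc i)
  define k where "k = t ^ i"
  have "inv (a [^] k \<otimes> x \<otimes> inv (a [^] k) \<otimes> inv x) = (x \<otimes> a [^] k) \<otimes> inv x \<otimes> inv (a [^] k)"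
    using x a by (simp add: inv_mult_group m_assoc)
  also have "x \<otimes> a [^] k = a [^] (t * k) \<otimes> a [^] k \<otimes> x"
    using twist_pow[OF x a xa, of 1 k] x a by (simp add: nat_pow_mult add.commute)
  also have "\<dots> \<otimes> inv x \<otimes> inv (a [^] k) = a [^] (t * k)" using x a by (simp add: m_assoc)
  finally have "a [^] (t * k) = inv (a [^] k \<otimes> x \<otimes> inv (a [^] k) \<otimes> inv x)" ..
  also have "\<dots> \<in> lower_central G (Suc i)"
    unfolding lower_central.simps using Suc x unfolding k_def[symmetric] by (intro generate.inv) auto
  finally show ?case by (simp add: k_def)
qed (use a in simp)

end

text \<open>The relations and the normal forms pass to every quotient of the dicyclic group; the
  order excludes proper quotients.\<close>

definition (in group) dicyclic_generators :: "nat \<Rightarrow> 'a \<Rightarrow> 'a \<Rightarrow> bool" where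
  "dicyclic_generators N a b \<longleftrightarrow> a \<in> carrier G \<and> b \<in> carrier G \<and> a [^] (2 * N) = \<one> \<and> b \<otimes> b = a [^] N \<and>
     b \<otimes> a \<otimes> inv b = inv a \<and> (\<forall>y\<in>carrier G. \<exists>k::nat. y = a [^] k \<or> y = a [^] k \<otimes> b) \<and> order G = 4 * N"

locale self_centralizing_cyclic = group G for G (structure) +
  fixes a and c :: nat
  assumes fin: "finite (carrier G)" and a_in: "a \<in> carrier G"
    and conj_a: "\<And>x. x \<in> carrier G \<Longrightarrow> \<exists>k::nat. x \<otimes> a \<otimes> inv x = a [^] k"
    and self_centralizing: "\<And>x. x \<in> carrier G \<Longrightarrow> x \<otimes> a = a \<otimes> x \<Longrightarrow> \<exists>k::nat. x = a [^] k"
    and lower_central_c: "lower_central G c = {\<one>}" and free: "rank_two_free"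
begin

definition cyc where "cyc = {a [^] k |k::nat. True}"

abbreviation (input) n where "n \<equiv> ord a"

lemma n_pos: "n > 0" by (rule ord_pos[OF fin a_in])

lemma a_n: "a [^] n = \<one>" using a_in by simp

lemma cyc_eq: "cyc = generate G {a}" unfolding cyc_def by (rule generate_singleton_nat[OF fin a_in, symmetric])

lemma subgroup_cyc: "subgroup cyc G" unfolding cyc_eq using a_in by (intro generate_is_subgroup) auto

lemma exponent:
  assumes x: "x \<in> carrier G"
  shows "\<exists>t. x \<otimes> a = a [^] Suc t \<otimes> x"
proof -
  obtain k :: nat where k: "x \<otimes> a \<otimes> inv x = a [^] k" using conj_a[OF x] by (elim exE)
  \<comment> \<open>The exponent is raised by \<open>n\<close>, so that it has the form
    \<open>Suc t\<close> even for \<open>k = 0\<close>.\<close>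
  have "a [^] k = a [^] Suc (k + n - 1)" using n_pos a_in a_n by (simp add: nat_pow_mult[symmetric] del: nat_pow_Suc)
  moreover have "x \<otimes> a = (x \<otimes> a \<otimes> inv x) \<otimes> x" using x a_in by (simp add: m_assoc)
  ultimately have "x \<otimes> a = a [^] Suc (k + n - 1) \<otimes> x" using k by simp
  then show ?thesis by (rule exI)
qed

lemma prime_step:
  assumes x: "x \<in> carrier G" "x \<notin> cyc" and xa: "x \<otimes> a = a [^] Suc t \<otimes> x"
    and q: "Factorial_Ring.prime q" and xq: "x [^] (q::nat) = a [^] (j::nat)"
  shows "q = 2 \<and> (\<exists>m D. n = m * D \<and> odd m \<and> 4 dvd D \<and> (\<forall>l. Factorial_Ring.prime l \<longrightarrow> l dvd D \<longrightarrow> l = 2) \<and>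
      D dvd t + 2 \<and> m dvd t \<and> D div 2 dvd j \<and> \<not> D dvd j)"
proof (rule quaternion_arithmetic[OF n_pos q])
  have cancel: "n dvd v" if "a [^] (u + v) = a [^] u" for u v :: nat
  proof -
    have "a [^] u \<otimes> a [^] v = a [^] u \<otimes> \<one>" using that a_in by (simp add: nat_pow_mult)
    then have "a [^] v = \<one>" using a_in by (subst (asm) l_cancel) auto
    then show ?thesis using a_in by (simp add: pow_eq_id)
  qed
  show "n dvd t * (\<Sum>l<q. Suc t ^ l)"
  proof -
    have geo: "Suc t ^ k = 1 + t * (\<Sum>l<k. Suc t ^ l)" for k by (induction k) (simp_all add: algebra_simps)
    have "a [^] (Suc t ^ q * 1) \<otimes> x [^] q = x [^] q \<otimes> a [^] (1::nat)"
      by (rule twist_pow[OF x(1) a_in xa, symmetric])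
    also have "\<dots> = a [^] (1::nat) \<otimes> x [^] q" unfolding xq using a_in by (intro nat_pow_comm)
    finally have "a [^] (Suc t ^ q * 1) = a [^] (1::nat)" using a_in x(1) by (subst (asm) r_cancel) auto
    then have "a [^] (1 + t * (\<Sum>l<q. Suc t ^ l)) = a [^] (1::nat)" by (simp only: geo[of q] mult_1_right)
    then show ?thesis by (rule cancel)
  qed
  show "n dvd j * t"
  proof -
    have "a [^] (Suc t ^ 1 * j) \<otimes> x [^] (1::nat) = x [^] (1::nat) \<otimes> a [^] j"
      by (rule twist_pow[OF x(1) a_in xa, symmetric])
    also have "\<dots> = a [^] j \<otimes> x [^] (1::nat)" unfolding xq[symmetric] using x(1) by (intro nat_pow_comm)
    finally have "a [^] (Suc t ^ 1 * j) = a [^] j" using a_in x(1) by (subst (asm) r_cancel) auto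
    then have "a [^] (j + j * t) = a [^] j" by (simp add: mult.commute)
    then show ?thesis by (rule cancel)
  qed
  show prime_t: "l dvd t" if l: "Factorial_Ring.prime l" "l dvd n" for l
  proof -
    have "a [^] (t ^ c) = \<one>" using lower_central_twist[OF x(1) a_in xa, of c] lower_central_c by simp
    then have "n dvd t ^ c" using a_in by (simp add: pow_eq_id)
    then have "l dvd t ^ c" by (rule dvd_trans[OF l(2)])
    then show ?thesis by (rule prime_dvd_power[OF l(1)])
  qed
  show "\<not> n dvd t"
  proof
    assume "n dvd t"
    then have "a [^] t = \<one>" using a_in by (simp add: pow_eq_id)
    then have "x \<otimes> a = a \<otimes> x" using xa a_in by simp
    then show False using self_centralizing[OF x(1)] x(2) by (simp add: cyc_def)
  qed
  \<comment> \<open>Such an \<open>i\<close> would make \<open>h = a [^] i \<otimes> x\<close> an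
    element of order \<open>q\<close> outside \<open>cyc\<close>. It commutes with an element of
    order \<open>q\<close> in \<open>cyc\<close> because \<open>q\<close> divides \<open>t\<close>,
    contradicting \<open>rank_two_free\<close>.\<close>
  show "\<not> (\<exists>i. n dvd i * (\<Sum>l<q. Suc t ^ l) + j)" if qn: "q dvd n"
  proof
    assume "\<exists>i. n dvd i * (\<Sum>l<q. Suc t ^ l) + j"
    then obtain i where i: "n dvd i * (\<Sum>l<q. Suc t ^ l) + j" by (elim exE)
    define h where "h = a [^] i \<otimes> x"
    have hG: "h \<in> carrier G" using a_in x(1) by (simp add: h_def)
    have "h [^] q = a [^] (i * (\<Sum>l<q. Suc t ^ l)) \<otimes> a [^] j"
      unfolding h_def xq[symmetric] by (rule twist_mult_pow[OF x(1) a_in xa])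
    then have hq: "h [^] q = \<one>" using i a_in by (simp add: nat_pow_mult pow_eq_id)
    obtain n' where n': "n = q * n'" using qn by (rule dvdE)
    obtain t' where t': "t = q * t'" using prime_t[OF q qn] by (rule dvdE)
    define g where "g = a [^] n'"
    have gG: "g \<in> carrier G" using a_in by (simp add: g_def)
    have gq: "g [^] q = \<one>" using a_in by (simp add: g_def nat_pow_pow pow_eq_id n' mult.commute)
    have "n' > 0" using n_pos n' by (cases n') simp_all
    then have "\<not> n dvd n'" using n' prime_gt_1_nat[OF q] by (auto dest!: dvd_imp_le)
    then have g1: "g \<noteq> \<one>" using a_in by (simp add: g_def pow_eq_id)
    have "x \<otimes> g = a [^] (Suc t * n') \<otimes> x"
      using twist_pow[OF x(1) a_in xa, of 1 n'] x(1) a_in by (simp add: g_def)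
    also have "a [^] (Suc t * n') = g"
    proof (unfold g_def, rule pow_cong[OF a_in a_n])
      have "Suc t * n' = n * t' + n'" unfolding n' t' by (simp add: algebra_simps)
      then show "[Suc t * n' = n'] (mod n)" by (simp only: cong_mult_add)
    qed
    finally have xg: "x \<otimes> g = g \<otimes> x" .
    have "g \<otimes> h = (g \<otimes> a [^] i) \<otimes> x" using gG a_in x(1) by (simp add: h_def m_assoc)
    also have "g \<otimes> a [^] i = a [^] i \<otimes> g" unfolding g_def using a_in by (rule nat_pow_comm)
    also have "a [^] i \<otimes> g \<otimes> x = h \<otimes> g" using gG a_in x(1) by (simp add: h_def m_assoc xg)
    finally have "g \<otimes> h = h \<otimes> g" .
    with free q gG hG gq g1 hq have "h \<in> generate G {g}" by (rule rank_two_freeD)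
    moreover have "generate G {g} \<subseteq> cyc"
      by (rule generate_subgroup_incl[OF _ subgroup_cyc]) (auto simp: g_def cyc_def)
    ultimately have "h \<in> cyc" by auto
    then have "inv (a [^] i) \<otimes> h \<in> cyc"
      by (intro subgroup.m_closed[OF subgroup_cyc] subgroup.m_inv_closed[OF subgroup_cyc]) (auto simp: cyc_def)
    then show False using x a_in by (simp add: h_def l_inv_cancel)
  qed
qed

text \<open>Otherwise some power \<open>y [^] (2 * u)\<close> satisfies \<open>prime_step\<close>,
  so its conjugation exponent is \<open>- 1\<close> modulo \<open>4\<close>. But this exponent is a
  square, namely that of \<open>Suc t ^ u\<close>.\<close>

lemma square_in_cyc:
  assumes y: "y \<in> carrier G"
  shows "y [^] (2::nat) \<in> cyc"
proof (rule ccontr)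
  define z where "z = y [^] (2::nat)"
  have zG: "z \<in> carrier G" using y by (simp add: z_def)
  assume "y [^] (2::nat) \<notin> cyc"
  then have z: "z \<notin> cyc" by (simp add: z_def)
  have "z [^] ord z \<in> cyc" using zG subgroup.one_closed[OF subgroup_cyc] by simp
  from exists_prime_pow_in[OF zG z ord_pos[OF fin zG] this]
  obtain q u :: nat where q: "Factorial_Ring.prime q" "z [^] u \<notin> cyc" "(z [^] u) [^] q \<in> cyc"
    by (elim exE conjE)
  obtain j :: nat where j: "(z [^] u) [^] q = a [^] j" using q(3) unfolding cyc_def by auto
  obtain t where t: "y \<otimes> a = a [^] Suc t \<otimes> y" using exponent[OF y] by (elim exE)
  define t' where "t' = Suc t ^ (2 * u) - 1"
  have t': "Suc t' = Suc t ^ (2 * u)" by (simp add: t'_def)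
  have "z [^] u = y [^] (2 * u)" using y by (simp add: z_def nat_pow_pow)
  then have "z [^] u \<otimes> a = a [^] Suc t' \<otimes> z [^] u"
    unfolding t' using twist_pow[OF y a_in t, of "2 * u" 1] a_in by simp
  from prime_step[OF _ q(2) this q(1) j] zG obtain D where "4 dvd D" "D dvd t' + 2" by auto
  then have "4 dvd t' + 2" by (rule dvd_trans)
  moreover have "t' + 2 = Suc t ^ u * Suc t ^ u + 1"
    using t' by (simp add: mult_2 power_add)
  ultimately have "(Suc t ^ u * Suc t ^ u + 1) mod 4 = 0" by simp
  moreover have not4: "(v * v + 1) mod 4 \<noteq> 0" for v :: nat
  proof (cases "even v")
    case True
    then obtain w where "v = 2 * w" by (rule evenE)
    then have "v * v + 1 = 4 * (w * w) + 1" by simp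
    then show ?thesis by presburger
  next
    case False
    then obtain w where "v = 2 * w + 1" by (rule oddE)
    then have "v * v + 1 = 4 * (w * w + w) + 2" by (simp add: algebra_simps)
    then show ?thesis by presburger
  qed
  ultimately show False using not4[of "Suc t ^ u"] by simp
qed

lemma inverts:
  assumes "y \<in> carrier G" "y \<otimes> a = a [^] Suc t \<otimes> y" "n dvd t + 2"
  shows "y \<otimes> a = inv a \<otimes> y"
proof -
  have "a [^] Suc t \<otimes> a = a [^] (t + 2)" by simp
  also have "\<dots> = \<one>" using assms(3) a_in pow_eq_id by blast
  finally have "inv a = a [^] Suc t" using a_in by (intro inv_equality) simp_all
  then show ?thesis using assms(2) by simp
qed

text \<open>In the factorization \<open>n = m * D\<close> conjugation by \<open>x\<close> inverts
  the part of order \<open>D\<close> of \<open>cyc\<close> and centralizes the part of odd order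
  \<open>m\<close>. The elements \<open>a [^] (n div 4)\<close> and a modification of
  \<open>x\<close> form the quaternion pair. If \<open>m\<close> is not \<open>1\<close>, the odd
  part supplies the commuting element of prime order; if \<open>m = 1\<close>, every element outside
  \<open>cyc\<close> inverts \<open>a\<close>, and the group is dicyclic.\<close>

theorem quaternion_structure:
  assumes "\<exists>x\<in>carrier G. x \<notin> cyc"
  shows "\<exists>I J. I \<in> carrier G \<and> J \<in> carrier G \<and> I [^] (4::nat) = \<one> \<and> I [^] (2::nat) \<noteq> \<one> \<and>
    I \<otimes> J = J \<otimes> I [^] (3::nat) \<and> J \<otimes> J = I \<otimes> I \<and>
    ((\<exists>z (r::nat). Factorial_Ring.prime r \<and> odd r \<and> z \<in> carrier G \<and> z [^] r = \<one> \<and> z \<noteq> \<one> \<and>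
        z \<otimes> I = I \<otimes> z \<and> z \<otimes> J = J \<otimes> z)
     \<or> (\<exists>N>1. \<exists>b. dicyclic_generators N b J))"
proof -
  obtain x where x: "x \<in> carrier G" "x \<notin> cyc" using assms by (elim bexE)
  obtain t where xa: "x \<otimes> a = a [^] Suc t \<otimes> x" using exponent[OF x(1)] by (elim exE)
  obtain j :: nat where j: "x [^] (2::nat) = a [^] j" using square_in_cyc[OF x(1)] unfolding cyc_def by auto
  obtain m D where n: "n = m * D" and m: "odd m" and D: "4 dvd D"
    and D2: "\<And>l. Factorial_Ring.prime l \<Longrightarrow> l dvd D \<Longrightarrow> l = 2"
    and Dt: "D dvd t + 2" and mt: "m dvd t" and jD: "D div 2 dvd j" "\<not> D dvd j"
    using prime_step[OF x xa two_is_prime_nat j] by (elim conjE exE) simp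
  obtain F where F: "D = 4 * F" using D by (rule dvdE)
  obtain tm where tm: "t = m * tm" using mt by (rule dvdE)
  obtain td where td: "t + 2 = D * td" using Dt by (rule dvdE)
  have nF: "n = 4 * (m * F)" by (simp add: n F)
  have mF: "m * F > 0" using n_pos nF by (cases "m * F") simp_all
  obtain w where w: "m = 2 * w + 1" using m by (rule oddE)
  obtain j' where j': "j = 2 * F * j'" using jD(1) by (auto simp: F elim: dvdE)
  have "odd j'"
  proof
    assume "even j'"
    then obtain k where "j' = 2 * k" by (rule evenE)
    then have "j = D * k" by (simp add: j' F)
    then show False using jD(2) by simp
  qed
  then obtain k where k: "j' = 2 * k + 1" by (rule oddE)
  \<comment> \<open>With \<open>m = 2 * w + 1\<close> the square of \<open>J\<close> has exponent
    \<open>j * w * (t + 2) + j\<close>. It vanishes modulo \<open>m\<close>, where \<open>t\<close>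
    is zero, and is \<open>D div 2\<close> modulo \<open>D\<close>, where \<open>t + 2\<close> is
    zero. So \<open>J\<close> squares to the involution in \<open>cyc\<close>.\<close>
  define J where "J = a [^] (j * w) \<otimes> x"
  have JG: "J \<in> carrier G" using a_in x by (simp add: J_def)
  have J_notin: "J \<notin> cyc"
  proof
    assume "J \<in> cyc"
    then have "inv (a [^] (j * w)) \<otimes> J \<in> cyc"
      by (intro subgroup.m_closed[OF subgroup_cyc] subgroup.m_inv_closed[OF subgroup_cyc]) (auto simp: cyc_def)
    then show False using x a_in by (simp add: J_def l_inv_cancel)
  qed
  have Ja: "J \<otimes> a = a [^] Suc t \<otimes> J"
  proof -
    have "J \<otimes> a = (a [^] (j * w) \<otimes> a [^] Suc t) \<otimes> x"
      unfolding J_def using a_in x(1) by (simp add: m_assoc xa del: nat_pow_Suc)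
    also have "a [^] (j * w) \<otimes> a [^] Suc t = a [^] Suc t \<otimes> a [^] (j * w)" by (rule nat_pow_comm[OF a_in])
    also have "\<dots> \<otimes> x = a [^] Suc t \<otimes> J" using a_in x(1) by (simp add: J_def m_assoc del: nat_pow_Suc)
    finally show ?thesis .
  qed
  have Jpow: "J \<otimes> a [^] i = a [^] (Suc t * i) \<otimes> J" for i :: nat
    using twist_pow[OF JG a_in Ja, of 1 i] JG by simp
  have JJ: "J \<otimes> J = a [^] (2 * (m * F))"
  proof -
    have "J [^] (2::nat) = a [^] (j * w * (\<Sum>l<2. Suc t ^ l)) \<otimes> x [^] (2::nat)"
      unfolding J_def by (rule twist_mult_pow[OF x(1) a_in xa])
    also have "(\<Sum>l<2. Suc t ^ l) = t + 2" by (simp add: numeral_2_eq_2)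
    also have "a [^] (j * w * (t + 2)) \<otimes> x [^] (2::nat) = a [^] (j * w * (t + 2) + j)"
      unfolding j using a_in by (rule nat_pow_mult)
    also have "\<dots> = a [^] (2 * (m * F))"
    proof (rule pow_cong[OF a_in a_n])
      have "[j * w * (t + 2) + j = 2 * (m * F)] (mod D)"
      proof -
        have jk: "j = D * k + 2 * F" by (simp add: j' k F algebra_simps)
        have "j * w * (t + 2) + j = D * (j * w * td) + (D * k + 2 * F)"
          unfolding td using jk by (simp add: mult_ac)
        also have "\<dots> = D * (j * w * td + k) + 2 * F" by (simp add: algebra_simps)
        also have "[\<dots> = 2 * F] (mod D)" by (rule cong_mult_add)
        also have "[2 * F = D * w + 2 * F] (mod D)" by (rule cong_sym[OF cong_mult_add])
        also have "D * w + 2 * F = 2 * (m * F)" by (simp add: w F algebra_simps)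
        finally show ?thesis .
      qed
      moreover have "[j * w * (t + 2) + j = 2 * (m * F)] (mod m)"
      proof -
        have "j * w * (t + 2) + j = j * w * t + j * (2 * w + 1)" by (simp add: algebra_simps)
        also have "\<dots> = m * (j * w * tm + j)" unfolding w[symmetric] unfolding tm by (simp add: algebra_simps)
        finally show ?thesis by (simp add: cong_def)
      qed
      moreover have "coprime D m" by (rule coprime_if_only_prime_2[OF D2 m])
      ultimately have "[j * w * (t + 2) + j = 2 * (m * F)] (mod D * m)" by (rule coprime_cong_mult_nat)
      then show "[j * w * (t + 2) + j = 2 * (m * F)] (mod n)" by (simp add: n mult.commute)
    qed
    finally show ?thesis using JG by (simp add: numeral_2_eq_2)
  qed
  define I where "I = a [^] (m * F)"
  have IG: "I \<in> carrier G" using a_in by (simp add: I_def)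
  have I4: "I [^] (4::nat) = \<one>" using a_in by (simp add: I_def nat_pow_pow pow_eq_id nF mult.commute)
  have I2: "I [^] (2::nat) \<noteq> \<one>"
  proof -
    have "\<not> n dvd m * F * 2" using mF nF by (auto dest!: dvd_imp_le)
    then show ?thesis using a_in by (simp add: I_def nat_pow_pow pow_eq_id)
  qed
  have IJ: "I \<otimes> J = J \<otimes> I [^] (3::nat)"
  proof -
    have "J \<otimes> I [^] (3::nat) = a [^] (Suc t * (m * F * 3)) \<otimes> J"
      using a_in by (simp add: I_def nat_pow_pow Jpow)
    also have "a [^] (Suc t * (m * F * 3)) = a [^] (m * F)"
    proof (rule pow_cong[OF a_in a_n])
      have "4 dvd t + 2" by (rule dvd_trans[OF D Dt])
      then obtain v where "t + 2 = 4 * v" by (rule dvdE)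
      then obtain v' where v': "t = 4 * v' + 2" by (cases v) auto
      have "Suc t * (m * F * 3) = n * (3 * v' + 2) + m * F" unfolding v' nF by (simp add: algebra_simps)
      then show "[Suc t * (m * F * 3) = m * F] (mod n)" by (simp only: cong_mult_add)
    qed
    finally show ?thesis by (simp add: I_def)
  qed
  have JI: "J \<otimes> J = I \<otimes> I" using a_in by (simp add: JJ I_def nat_pow_mult mult_2)
  have "(\<exists>z (r::nat). Factorial_Ring.prime r \<and> odd r \<and> z \<in> carrier G \<and> z [^] r = \<one> \<and> z \<noteq> \<one> \<and>
        z \<otimes> I = I \<otimes> z \<and> z \<otimes> J = J \<otimes> z)
     \<or> (\<exists>N>1. \<exists>b. dicyclic_generators N b J)"
  proof (cases "m = 1")
    case False
    from prime_factor_nat[OF this] obtain r where r: "Factorial_Ring.prime r" "r dvd m" by (elim exE conjE)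
    obtain m' where m': "m = r * m'" using r(2) by (rule dvdE)
    have "odd r" using m m' by simp
    define z where "z = a [^] (m' * D)"
    have zG: "z \<in> carrier G" using a_in by (simp add: z_def)
    have "z [^] r = \<one>" using a_in by (simp add: z_def nat_pow_pow pow_eq_id n m' mult_ac)
    moreover have "z \<noteq> \<one>"
    proof -
      have "n = r * (m' * D)" by (simp add: n m' mult_ac)
      moreover have "m' * D > 0" using n_pos by (simp add: n m')
      ultimately have "\<not> n dvd m' * D" using prime_gt_1_nat[OF r(1)] by (auto dest!: dvd_imp_le)
      then show ?thesis using a_in by (simp add: z_def pow_eq_id)
    qed
    moreover have "z \<otimes> I = I \<otimes> z" unfolding z_def I_def by (rule nat_pow_comm[OF a_in])
    moreover have "z \<otimes> J = J \<otimes> z"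
    proof -
      have "J \<otimes> z = a [^] (Suc t * (m' * D)) \<otimes> J" by (simp only: z_def Jpow)
      also have "a [^] (Suc t * (m' * D)) = z"
      proof (unfold z_def, rule pow_cong[OF a_in a_n])
        have "Suc t * (m' * D) = n * (tm * m') + m' * D" unfolding n tm by (simp add: algebra_simps)
        then show "[Suc t * (m' * D) = m' * D] (mod n)" by (simp only: cong_mult_add)
      qed
      finally show ?thesis ..
    qed
    ultimately show ?thesis using r(1) \<open>odd r\<close> zG
      by (intro disjI1 exI[of _ z] exI[of _ r] conjI)
  next
    case True
    define N where "N = 2 * F"
    have nN: "n = 2 * N" by (simp add: nF True N_def)
    have F0: "F > 0" using mF by simp
    have "N > 1" using F0 by (simp add: N_def)
    have Jinv: "J \<otimes> a = inv a \<otimes> J" by (rule inverts[OF JG Ja]) (use Dt n True in simp)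
    have "J \<otimes> a \<otimes> inv J = inv a" using JG a_in by (simp add: Jinv m_assoc)
    \<comment> \<open>An element \<open>y\<close> outside \<open>cyc\<close> inverts
      \<open>a\<close> as well, because its own odd part \<open>m'\<close> must be \<open>1\<close>.
      Hence \<open>y \<otimes> inv J\<close> centralizes \<open>a\<close> and is a power of
      it.\<close>
    moreover have cover: "\<exists>k::nat. y = a [^] k \<or> y = a [^] k \<otimes> J" if y: "y \<in> carrier G" for y
    proof (cases "y \<in> cyc")
      case True
      then show ?thesis by (auto simp: cyc_def)
    next
      case False
      obtain s where ya: "y \<otimes> a = a [^] Suc s \<otimes> y" using exponent[OF y] by (elim exE)
      obtain i :: nat where i: "y [^] (2::nat) = a [^] i" using square_in_cyc[OF y] unfolding cyc_def by auto
      obtain m' D' where n': "n = m' * D'" and m': "odd m'" and D': "D' dvd s + 2"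
        using prime_step[OF y False ya two_is_prime_nat i] by (elim conjE exE) simp
      have "m' = 1"
      proof (rule ccontr)
        assume "m' \<noteq> 1"
        from prime_factor_nat[OF this] obtain l where l: "Factorial_Ring.prime l" "l dvd m'" by (elim exE conjE)
        have "l dvd D" using l(2) n' n \<open>m = 1\<close> by (metis dvd_mult2 mult_1)
        then have "l = 2" by (rule D2[OF l(1)])
        then show False using l(2) m' by simp
      qed
      then have "n dvd s + 2" using n' D' by simp
      with y ya have yinv: "y \<otimes> a = inv a \<otimes> y" by (rule inverts)
      have yi: "y \<otimes> inv a = a \<otimes> y"
      proof -
        have "a \<otimes> y = a \<otimes> (y \<otimes> a) \<otimes> inv a" using y a_in by (simp add: m_assoc)
        then show ?thesis using y a_in by (simp add: yinv l_inv_cancel')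
      qed
      have Ji: "inv J \<otimes> a = inv a \<otimes> inv J"
      proof -
        have "inv (J \<otimes> a) = inv (inv a \<otimes> J)" by (simp only: Jinv)
        then have "inv a \<otimes> inv J = inv J \<otimes> a" using JG a_in by (simp add: inv_mult_group)
        then show ?thesis ..
      qed
      have "(y \<otimes> inv J) \<otimes> a = (y \<otimes> inv a) \<otimes> inv J" using y JG a_in by (simp add: m_assoc Ji)
      also have "\<dots> = a \<otimes> (y \<otimes> inv J)" using y JG a_in by (simp add: m_assoc yi)
      finally obtain k :: nat where "y \<otimes> inv J = a [^] k"
        using self_centralizing[of "y \<otimes> inv J"] y JG by auto
      then have "y = a [^] k \<otimes> J" using y JG a_in by (simp add: inv_solve_right')
      then show ?thesis by auto
    qed
    moreover have "order G = 4 * N"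
    proof -
      have cG: "cyc \<subseteq> carrier G" by (rule subgroup.subset[OF subgroup_cyc])
      have "carrier G = cyc \<union> (\<lambda>z. z \<otimes> J) ` cyc"
        using cover cG JG by (fastforce simp: cyc_def)
      moreover have "cyc \<inter> (\<lambda>z. z \<otimes> J) ` cyc = {}"
      proof -
        have False if u: "u \<in> cyc" "u \<otimes> J \<in> cyc" for u
        proof -
          have "inv u \<otimes> (u \<otimes> J) \<in> cyc"
            by (intro subgroup.m_closed[OF subgroup_cyc] subgroup.m_inv_closed[OF subgroup_cyc] u)
          then show False using J_notin u(1) cG JG by (simp add: l_inv_cancel subset_iff)
        qed
        then show ?thesis by auto
      qed
      moreover have "finite cyc" by (rule finite_subset[OF cG fin])
      moreover have "card cyc = n" unfolding cyc_eq by (rule generate_pow_card[OF a_in, symmetric])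
      moreover have "card ((\<lambda>z. z \<otimes> J) ` cyc) = card cyc"
        using cG JG by (intro card_image inj_onI) (auto simp: subset_iff)
      ultimately show ?thesis unfolding Coset.order_def by (simp add: card_Un_disjoint nN)
    qed
    ultimately have "dicyclic_generators N a J"
      unfolding dicyclic_generators_def using a_in JG a_n nN JJ True by (simp add: N_def)
    then show ?thesis using \<open>N > 1\<close> by (intro disjI2 exI[of _ N] exI[of _ a] conjI)
  qed
  then show ?thesis using IG JG I4 I2 IJ JI by (intro exI[of _ I] exI[of _ J] conjI)
qed

end

theorem (in group) nilpotent_structure:
  assumes fin: "finite (carrier G)" and nilp: "nilpotent_group G" and noncyc: "\<not> cyclic_group G"
    and free: rank_two_free
  shows "\<exists>I J. I \<in> carrier G \<and> J \<in> carrier G \<and> I [^] (4::nat) = \<one> \<and> I [^] (2::nat) \<noteq> \<one> \<and>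
    I \<otimes> J = J \<otimes> I [^] (3::nat) \<and> J \<otimes> J = I \<otimes> I \<and>
    ((\<exists>z (r::nat). Factorial_Ring.prime r \<and> odd r \<and> z \<in> carrier G \<and> z [^] r = \<one> \<and> z \<noteq> \<one> \<and>
        z \<otimes> I = I \<otimes> z \<and> z \<otimes> J = J \<otimes> z)
     \<or> (\<exists>N>1. \<exists>b. dicyclic_generators N b J))"
proof -
  obtain c where c: "lower_central G c = {\<one>}" using nilp by (auto simp: nilpotent_group_def)
  from exists_self_centralizing_normal[OF fin c]
  obtain A where A': "A \<lhd> G \<and> (\<forall>x\<in>A. \<forall>y\<in>A. x \<otimes> y = y \<otimes> x) \<and>
    (\<forall>x\<in>carrier G. (\<forall>a\<in>A. x \<otimes> a = a \<otimes> x) \<longrightarrow> x \<in> A)" by (rule exE)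
  have A: "A \<lhd> G" "\<And>x y. x \<in> A \<Longrightarrow> y \<in> A \<Longrightarrow> x \<otimes> y = y \<otimes> x"
    "\<And>x. x \<in> carrier G \<Longrightarrow> (\<And>a. a \<in> A \<Longrightarrow> x \<otimes> a = a \<otimes> x) \<Longrightarrow> x \<in> A"
    by (rule conjunct1[OF A'], rule bspec[OF bspec[OF conjunct1[OF conjunct2[OF A']]]], assumption+)
      (rule mp[OF bspec[OF conjunct2[OF conjunct2[OF A']]]], assumption, rule ballI)
  have sub: "subgroup A G" using A(1) by (rule normal_imp_subgroup)
  from abelian_cyclic_if_rank_two_free[OF fin sub A(2) free]
  obtain a where a: "a \<in> A" and a_gen: "\<forall>y\<in>A. \<exists>k::nat. y = a [^] k" by (rule bexE)
  have aG: "a \<in> carrier G" using a subgroup.subset[OF sub] by auto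
  interpret self_centralizing_cyclic G a c
  proof unfold_locales
    fix x assume x: "x \<in> carrier G"
    show "\<exists>k::nat. x \<otimes> a \<otimes> inv x = a [^] k"
      by (rule bspec[OF a_gen]) (rule normal.inv_op_closed2[OF A(1) x a])
    assume xa: "x \<otimes> a = a \<otimes> x"
    show "\<exists>k::nat. x = a [^] k"
    proof (rule bspec[OF a_gen], rule A(3)[OF x])
      fix y assume y: "y \<in> A"
      from bspec[OF a_gen y] obtain k :: nat where "y = a [^] k" by (rule exE)
      then show "x \<otimes> y = y \<otimes> x" using pow_commute_pow[OF x aG xa] by simp
    qed
  qed (use fin aG c free in auto)
  have "\<exists>x\<in>carrier G. x \<notin> cyc"
  proof (rule ccontr)
    assume "\<not> (\<exists>x\<in>carrier G. x \<notin> cyc)"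
    then have cc: "carrier G \<subseteq> cyc" by auto
    have "carrier G \<subseteq> range (\<lambda>k::int. a [^] k)"
    proof
      fix y assume "y \<in> carrier G"
      then obtain k :: nat where "y = a [^] k" using cc unfolding cyc_def by auto
      then have "y = a [^] int k" by (simp only: int_pow_int)
      then show "y \<in> range (\<lambda>k::int. a [^] k)" by simp
    qed
    then have "carrier G = range (\<lambda>k::int. a [^] k)" using aG by auto
    then have "cyclic_group G" unfolding cyclic_group by (rule bexI[OF _ aG])
    with noncyc show False ..
  qed
  then show ?thesis by (rule quaternion_structure)
qed

section \<open>Dicyclic groups\<close>

context group
begin

text \<open>As all exponents are natural numbers, \<open>2 * N - 1\<close> stands for
  \<open>- 1\<close>.\<close>

lemma dicyclic_closed:
  fixes N :: nat
  assumes a: "a \<in> carrier G" and b: "b \<in> carrier G" and N: "N > 0" "a [^] (2 * N) = \<one>"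
    and bb: "b \<otimes> b = a [^] N" and ba: "b \<otimes> a \<otimes> inv b = inv a"
  shows "inv a = a [^] (2 * N - 1)" "inv b = a [^] N \<otimes> b"
    "b \<otimes> a [^] (k::nat) = a [^] ((2 * N - 1) * k) \<otimes> b"
proof -
  have "a [^] (2 * N - 1) \<otimes> a = a [^] Suc (2 * N - 1)" by simp
  also have "Suc (2 * N - 1) = 2 * N" using N(1) by simp
  finally show ia: "inv a = a [^] (2 * N - 1)" using a N(2) by (intro inv_equality) simp_all
  have "a [^] N \<otimes> b \<otimes> b = a [^] N \<otimes> a [^] N" using a b by (simp add: m_assoc bb)
  then show "inv b = a [^] N \<otimes> b" using a b N(2) by (intro inv_equality) (simp_all add: nat_pow_mult mult_2)
  have "b \<otimes> a = (b \<otimes> a \<otimes> inv b) \<otimes> b" using a b by (simp add: m_assoc)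
  then have "b \<otimes> a = a [^] (2 * N - 1) \<otimes> b" by (simp only: ba ia)
  from twist_pow[OF b a this, of 1 k] show "b \<otimes> a [^] k = a [^] ((2 * N - 1) * k) \<otimes> b"
    using b by simp
qed

lemma dicyclic_normal_forms:
  fixes N :: nat
  assumes a: "a \<in> carrier G" and b: "b \<in> carrier G" and N: "N > 0" "a [^] (2 * N) = \<one>"
    and bb: "b \<otimes> b = a [^] N" and ba: "b \<otimes> a \<otimes> inv b = inv a"
    and g: "g \<in> {a, inv a, b, inv b}" and y: "\<exists>k::nat. y = a [^] k \<or> y = a [^] k \<otimes> b"
  shows "\<exists>k::nat. g \<otimes> y = a [^] k \<or> g \<otimes> y = a [^] k \<otimes> b"
proof -
  define S where "S = {y. \<exists>k::nat. y = a [^] k \<or> y = a [^] k \<otimes> b}"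
  have yS: "y \<in> S" using y by (simp add: S_def)
  have pow: "a [^] (j::nat) \<otimes> y \<in> S" if y': "y \<in> S" for j y
  proof -
    obtain k :: nat where "y = a [^] k \<or> y = a [^] k \<otimes> b" using y' unfolding S_def by (elim CollectE exE)
    then have "a [^] j \<otimes> y = a [^] (j + k) \<or> a [^] j \<otimes> y = a [^] (j + k) \<otimes> b"
      using a b by (auto simp: nat_pow_mult m_assoc[symmetric])
    then show ?thesis unfolding S_def by (intro CollectI exI[of _ "j + k"])
  qed
  have bS: "b \<otimes> y \<in> S" if y': "y \<in> S" for y
  proof -
    obtain k :: nat where "y = a [^] k \<or> y = a [^] k \<otimes> b" using y' unfolding S_def by (elim CollectE exE)
    then show ?thesis
    proof
      assume "y = a [^] k"
      then have "b \<otimes> y = a [^] ((2 * N - 1) * k) \<otimes> b" by (simp only: dicyclic_closed(3)[OF a b N bb ba])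
      then show ?thesis unfolding S_def by (intro CollectI exI disjI2)
    next
      assume "y = a [^] k \<otimes> b"
      then have "b \<otimes> y = (b \<otimes> a [^] k) \<otimes> b" using a b by (simp add: m_assoc)
      also have "\<dots> = a [^] ((2 * N - 1) * k) \<otimes> (b \<otimes> b)"
        unfolding dicyclic_closed(3)[OF a b N bb ba] using a b by (simp add: m_assoc)
      also have "\<dots> = a [^] ((2 * N - 1) * k + N)" using a by (simp only: bb nat_pow_mult)
      finally show ?thesis unfolding S_def by (intro CollectI exI disjI1)
    qed
  qed
  have SG: "y \<in> carrier G" if "y \<in> S" for y using that a b by (auto simp: S_def)
  have ay: "a \<otimes> y \<in> S" using pow[OF yS, of 1] a by simp
  have "g = a \<or> g = a [^] (2 * N - 1) \<or> g = b \<or> g = a [^] N \<otimes> b"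
    using g a dicyclic_closed(1,2)[OF a b N bb ba] by auto
  then have "g \<otimes> y \<in> S" using ay pow[OF yS] bS[OF yS] pow[OF bS[OF yS]] a b SG[OF yS] by (auto simp: m_assoc)
  then show ?thesis by (simp add: S_def)
qed

end

section \<open>The presentation of the dicyclic groups\<close>

definition dic_relations :: "nat \<Rightarrow> (dic_generator word \<times> dic_generator word) set" where
  "dic_relations n = {(replicate (2 * n) (Dic_a, True), []),
     ([(Dic_b, True), (Dic_b, True)], replicate n (Dic_a, True)),
     ([(Dic_b, True), (Dic_a, True), (Dic_b, False)], [(Dic_a, False)])}"

lemma dicyclic_eq: "dicyclic n = presented_group (dic_relations n)"
  by (simp add: dicyclic_def dic_relations_def Let_def)

abbreviation word_class :: "nat \<Rightarrow> dic_generator word \<Rightarrow> dic_generator word set" where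
  "word_class n u \<equiv> {w. word_eq (dic_relations n) u w}"

lemma word_class_eq_iff: "word_class n u = word_class n v \<longleftrightarrow> word_eq (dic_relations n) u v"
proof
  assume "word_class n u = word_class n v"
  moreover have "v \<in> word_class n v" by (simp add: word_eq.refl)
  ultimately have "v \<in> word_class n u" by (simp only:)
  then show "word_eq (dic_relations n) u v" by (rule CollectD)
next
  assume uv: "word_eq (dic_relations n) u v"
  show "word_class n u = word_class n v"
    using word_eq.trans[OF uv] word_eq.trans[OF word_eq.sym[OF uv]] by (intro Collect_cong iffI)
qed

text \<open>Left multiplication by a letter on the normal forms \<open>a ^ i * b ^ e\<close>, the exponent \<open>i\<close> being
  read modulo \<open>2 * n\<close>.\<close>

fun dic_letter :: "int \<Rightarrow> dic_generator \<times> bool \<Rightarrow> int \<times> bool \<Rightarrow> int \<times> bool" where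
  "dic_letter n (Dic_a, s) (i, e) = (if s then i + 1 else i - 1, e)"
| "dic_letter n (Dic_b, s) (i, e) = (if s = e then n - i else - i, \<not> e)"

definition dic_word :: "nat \<Rightarrow> dic_generator word \<Rightarrow> int \<times> bool \<Rightarrow> int \<times> bool" where
  "dic_word n u = foldr (dic_letter (int n)) u"

definition dic_cong :: "nat \<Rightarrow> int \<times> bool \<Rightarrow> int \<times> bool \<Rightarrow> bool" where
  "dic_cong n p q \<longleftrightarrow> [fst p = fst q] (mod int (2 * n)) \<and> snd p = snd q"

lemma dic_letter_cong: "dic_cong n p q \<Longrightarrow> dic_cong n (dic_letter (int n) l p) (dic_letter (int n) l q)"
proof -
  assume pq: "dic_cong n p q"
  obtain x s where l: "l = (x, s)" by (cases l)
  obtain i e where p: "p = (i, e)" by (cases p)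
  obtain i' where q: "q = (i', e)" using pq by (cases q) (simp add: dic_cong_def p)
  have "[i = i'] (mod int (2 * n))" using pq by (simp add: dic_cong_def p q)
  then show ?thesis
    by (cases x) (auto simp: l p q dic_cong_def intro: cong_add cong_diff cong_minus_minus_iff[THEN iffD2])
qed

lemma dic_word_cong: "dic_cong n p q \<Longrightarrow> dic_cong n (dic_word n u p) (dic_word n u q)"
  by (induction u) (simp_all add: dic_word_def dic_letter_cong)

lemma dic_word_replicate: "dic_word n (replicate k (Dic_a, True)) (i, e) = (i + int k, e)"
  by (induction k) (simp_all add: dic_word_def)

text \<open>The letters act on normal forms compatibly with the relations. This keeps the presented
  group from collapsing: applied to \<open>(0, False)\<close>, the word for a normal form returns
  its exponents, so distinct normal forms are distinct elements.\<close>

lemma dic_word_eq: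
  assumes "word_eq (dic_relations n) u v"
  shows "dic_cong n (dic_word n u p) (dic_word n v p)"
  using assms
proof (induction arbitrary: p rule: word_eq.induct)
  case (relation u v)
  obtain i e where p: "p = (i, e)" by (cases p)
  from relation show ?case
    unfolding dic_relations_def p
    by (elim insertE emptyE Pair_inject; simp only: dic_word_replicate)
      (auto simp: dic_word_def dic_cong_def cong_iff_dvd_diff)
next
  case (cancel x s)
  obtain i e where p: "p = (i, e)" by (cases p)
  show ?case by (cases x) (auto simp: p dic_word_def dic_cong_def)
next
  case (refl u)
  show ?case by (simp add: dic_cong_def)
next
  case (sym u v)
  from sym.IH[of p] show ?case by (simp add: dic_cong_def cong_sym_eq)
next
  case (trans u v w)
  from trans.IH(1)[of p] trans.IH(2)[of p] show ?case by (auto simp: dic_cong_def intro: cong_trans)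
next
  case (append u v u' v')
  have "dic_cong n (dic_word n u (dic_word n u' p)) (dic_word n u (dic_word n v' p))"
    by (rule dic_word_cong) (rule append.IH(2))
  with append.IH(1)[of "dic_word n v' p"] show ?case
    by (auto simp: dic_word_def dic_cong_def intro: cong_trans)
qed

lemma dicyclic_presentation:
  assumes n: "n > 0"
  defines "A \<equiv> word_class n [(Dic_a, True)]" and "B \<equiv> word_class n [(Dic_b, True)]"
  shows "group.dicyclic_generators (dicyclic n) n A B"
proof -
  interpret D: group "dicyclic n" unfolding dicyclic_eq by (rule group_presented_group)
  have mult: "word_class n u \<otimes>\<^bsub>dicyclic n\<^esub> word_class n v = word_class n (u @ v)" for u v
    unfolding dicyclic_eq by (rule presented_group_mult)
  have one: "\<one>\<^bsub>dicyclic n\<^esub> = word_class n []" by (simp add: dicyclic_eq presented_group_def)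
  have carr: "C \<in> carrier (dicyclic n) \<longleftrightarrow> (\<exists>u. C = word_class n u)" for C
    unfolding dicyclic_eq by (rule presented_group_class)
  have in_carr: "word_class n u \<in> carrier (dicyclic n)" for u unfolding carr by (rule exI) (rule HOL.refl)
  have rel: "word_class n u = word_class n v" if "(u, v) \<in> dic_relations n" for u v
    unfolding word_class_eq_iff using that by (rule word_eq.relation)
  have AB: "A \<in> carrier (dicyclic n)" "B \<in> carrier (dicyclic n)"
    unfolding A_def B_def by (rule in_carr)+
  have inv_letter: "inv\<^bsub>dicyclic n\<^esub> word_class n [(x, True)] = word_class n [(x, False)]" for x
  proof (rule D.inv_equality)
    have "word_eq (dic_relations n) [(x, False), (x, \<not> False)] []" by (rule word_eq.cancel)
    then show "word_class n [(x, False)] \<otimes>\<^bsub>dicyclic n\<^esub> word_class n [(x, True)] = \<one>\<^bsub>dicyclic n\<^esub>"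
      unfolding mult one word_class_eq_iff by simp
  qed (rule in_carr)+
  have powA: "A [^]\<^bsub>dicyclic n\<^esub> k = word_class n (replicate k (Dic_a, True))" for k :: nat
  proof (induction k)
    case (Suc k)
    then show ?case by (simp add: A_def mult replicate_append_same)
  qed (simp add: one)
  have A2n: "A [^]\<^bsub>dicyclic n\<^esub> (2 * n) = \<one>\<^bsub>dicyclic n\<^esub>"
    unfolding powA one by (rule rel) (simp add: dic_relations_def)
  have BB: "B \<otimes>\<^bsub>dicyclic n\<^esub> B = A [^]\<^bsub>dicyclic n\<^esub> n"
    unfolding powA unfolding B_def mult by (rule rel) (simp add: dic_relations_def)
  have BA: "B \<otimes>\<^bsub>dicyclic n\<^esub> A \<otimes>\<^bsub>dicyclic n\<^esub> inv\<^bsub>dicyclic n\<^esub> B = inv\<^bsub>dicyclic n\<^esub> A"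
    unfolding A_def B_def inv_letter mult by (rule rel) (simp add: dic_relations_def)
  have cover_word: "\<exists>k::nat. word_class n u = A [^]\<^bsub>dicyclic n\<^esub> k \<or> word_class n u = A [^]\<^bsub>dicyclic n\<^esub> k \<otimes>\<^bsub>dicyclic n\<^esub> B" for u
  proof (induction u)
    case Nil
    show ?case by (intro exI[of _ 0] disjI1) (simp add: one)
  next
    case (Cons l u)
    obtain x s where l: "l = (x, s)" by (cases l)
    have "word_class n [l] \<in> {A, inv\<^bsub>dicyclic n\<^esub> A, B, inv\<^bsub>dicyclic n\<^esub> B}"
      unfolding A_def B_def inv_letter l by (cases x; cases s) simp_all
    from D.dicyclic_normal_forms[OF AB n A2n BB BA this Cons.IH]
    show ?case by (simp only: mult append_Cons append_Nil)
  qed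
  have cover: "\<forall>y\<in>carrier (dicyclic n). \<exists>k::nat. y = A [^]\<^bsub>dicyclic n\<^esub> k \<or> y = A [^]\<^bsub>dicyclic n\<^esub> k \<otimes>\<^bsub>dicyclic n\<^esub> B"
  proof
    fix y assume "y \<in> carrier (dicyclic n)"
    then obtain u where y: "y = word_class n u" unfolding carr by (rule exE)
    show "\<exists>k::nat. y = A [^]\<^bsub>dicyclic n\<^esub> k \<or> y = A [^]\<^bsub>dicyclic n\<^esub> k \<otimes>\<^bsub>dicyclic n\<^esub> B"
      unfolding y by (rule cover_word)
  qed
  define nf where "nf = (\<lambda>(k::nat, e). if e then A [^]\<^bsub>dicyclic n\<^esub> k \<otimes>\<^bsub>dicyclic n\<^esub> B else A [^]\<^bsub>dicyclic n\<^esub> k)"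
  have nf: "nf (k, e) = word_class n (replicate k (Dic_a, True) @ (if e then [(Dic_b, True)] else []))" for k e
    by (simp add: nf_def powA) (simp add: B_def mult)
  have "inj_on nf ({..<2 * n} \<times> UNIV)"
  proof (rule inj_onI, clarify)
    fix k e k' e' assume k: "k < 2 * n" "k' < 2 * n" and eq: "nf (k, e) = nf (k', e')"
    have val: "dic_word n (replicate k (Dic_a, True) @ (if e then [(Dic_b, True)] else [])) (0, False) = (int k, e)" for k e
    proof -
      have "dic_word n (replicate k (Dic_a, True) @ (if e then [(Dic_b, True)] else [])) (0, False)
          = dic_word n (replicate k (Dic_a, True)) (dic_word n (if e then [(Dic_b, True)] else []) (0, False))"
        by (simp add: dic_word_def)
      also have "dic_word n (if e then [(Dic_b, True)] else []) (0, False) = (0, e)"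
        by (simp add: dic_word_def)
      finally show ?thesis by (simp add: dic_word_replicate)
    qed
    have "dic_cong n (int k, e) (int k', e')"
      using dic_word_eq[OF eq[unfolded nf word_class_eq_iff], of "(0, False)"] by (simp only: val)
    then have "[int k = int k'] (mod int (2 * n))" "e = e'" by (simp_all add: dic_cong_def)
    then have "[k = k'] (mod 2 * n)" by (simp only: cong_int_iff)
    then show "k = k' \<and> e = e'" using k \<open>e = e'\<close> by (simp add: cong_def)
  qed
  then have "card (nf ` ({..<2 * n} \<times> UNIV)) = 4 * n" by (simp add: card_image card_cartesian_product)
  moreover have "carrier (dicyclic n) = nf ` ({..<2 * n} \<times> UNIV)"
  proof
    show "nf ` ({..<2 * n} \<times> UNIV) \<subseteq> carrier (dicyclic n)" using AB by (auto simp: nf_def)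
    show "carrier (dicyclic n) \<subseteq> nf ` ({..<2 * n} \<times> UNIV)"
    proof
      fix y assume "y \<in> carrier (dicyclic n)"
      then obtain k :: nat where k: "y = A [^]\<^bsub>dicyclic n\<^esub> k \<or> y = A [^]\<^bsub>dicyclic n\<^esub> k \<otimes>\<^bsub>dicyclic n\<^esub> B"
        using cover by (elim ballE) auto
      have "A [^]\<^bsub>dicyclic n\<^esub> k = A [^]\<^bsub>dicyclic n\<^esub> (k mod (2 * n))"
        by (rule D.pow_cong[OF AB(1) A2n]) (simp add: cong_def)
      then have "y = nf (k mod (2 * n), False) \<or> y = nf (k mod (2 * n), True)" using k by (simp add: nf_def)
      moreover have "k mod (2 * n) < 2 * n" using n by simp
      ultimately show "y \<in> nf ` ({..<2 * n} \<times> UNIV)" by auto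
    qed
  qed
  ultimately have "order (dicyclic n) = 4 * n" by (simp add: Coset.order_def)
  then show ?thesis unfolding D.dicyclic_generators_def
    using AB A2n BB BA cover by (intro conjI)
qed

lemma (in group) dicyclic_generators_if_is_dicyclic:
  assumes "is_dicyclic G"
  shows "\<exists>N a b. N > 1 \<and> dicyclic_generators N a b"
proof -
  obtain n where n: "n > 1" "G \<cong> dicyclic n" using assms by (auto simp: is_dicyclic_def)
  interpret D: group "dicyclic n" unfolding dicyclic_eq by (rule group_presented_group)
  have "dicyclic n \<cong> G" by (rule iso_sym[OF n(2)])
  then obtain h where h: "h \<in> iso (dicyclic n) G" by (auto simp: is_iso_def)
  interpret h: group_hom "dicyclic n" G h
    using h by unfold_locales (simp add: iso_def)
  have bij: "bij_betw h (carrier (dicyclic n)) (carrier G)" using h by (simp add: iso_def)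
  define A where "A = word_class n [(Dic_a, True)]"
  define B where "B = word_class n [(Dic_b, True)]"
  have gen: "D.dicyclic_generators n A B" unfolding A_def B_def using n(1) by (intro dicyclic_presentation) simp
  have AB: "A \<in> carrier (dicyclic n)" "B \<in> carrier (dicyclic n)" using gen by (auto simp: D.dicyclic_generators_def)
  have 1: "h A [^] (2 * n) = \<one>" using gen AB by (simp add: D.dicyclic_generators_def flip: h.hom_nat_pow)
  have 2: "h B \<otimes> h B = h A [^] n"
    using gen AB by (simp add: D.dicyclic_generators_def flip: h.hom_nat_pow h.hom_mult)
  have "h (B \<otimes>\<^bsub>dicyclic n\<^esub> A \<otimes>\<^bsub>dicyclic n\<^esub> inv\<^bsub>dicyclic n\<^esub> B) = h (inv\<^bsub>dicyclic n\<^esub> A)"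
    using gen by (simp add: D.dicyclic_generators_def)
  then have 3: "h B \<otimes> h A \<otimes> inv h B = inv h A" using AB by simp
  have 4: "\<exists>k::nat. y = h A [^] k \<or> y = h A [^] k \<otimes> h B" if y: "y \<in> carrier G" for y
  proof -
    obtain z where z: "z \<in> carrier (dicyclic n)" "y = h z" using y bij by (auto simp: bij_betw_def)
    have "\<forall>y\<in>carrier (dicyclic n). \<exists>k::nat. y = A [^]\<^bsub>dicyclic n\<^esub> k \<or> y = A [^]\<^bsub>dicyclic n\<^esub> k \<otimes>\<^bsub>dicyclic n\<^esub> B"
      using gen unfolding D.dicyclic_generators_def by (elim conjE)
    from bspec[OF this z(1)] obtain k :: nat
      where "z = A [^]\<^bsub>dicyclic n\<^esub> k \<or> z = A [^]\<^bsub>dicyclic n\<^esub> k \<otimes>\<^bsub>dicyclic n\<^esub> B" by (rule exE)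
    then have "y = h A [^] k \<or> y = h A [^] k \<otimes> h B" using z(2) AB by (auto simp: h.hom_nat_pow)
    then show ?thesis by (rule exI)
  qed
  have 5: "order G = 4 * n"
    using gen bij_betw_same_card[OF bij] by (simp add: D.dicyclic_generators_def Coset.order_def)
  have "dicyclic_generators n (h A) (h B)"
    unfolding dicyclic_generators_def using AB 1 2 3 4 5 by simp
  then show ?thesis using n(1) by (intro exI[of _ n] exI[of _ "h A"] exI[of _ "h B"] conjI)
qed

text \<open>Evaluating words respects the relations and so gives a surjective homomorphism from the
  presented group; both orders are \<open>4 * N\<close>, so it is bijective.\<close>

lemma (in group) is_dicyclic_if_dicyclic_generators:
  assumes gen: "dicyclic_generators N a b" and N: "N > 1"
  shows "is_dicyclic G"
proof -
  interpret D: group "dicyclic N" unfolding dicyclic_eq by (rule group_presented_group)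
  have ab: "a \<in> carrier G" "b \<in> carrier G" and a2N: "a [^] (2 * N) = \<one>" and bb: "b \<otimes> b = a [^] N"
    and ba: "b \<otimes> a \<otimes> inv b = inv a" and cover: "\<And>y. y \<in> carrier G \<Longrightarrow> \<exists>k::nat. y = a [^] k \<or> y = a [^] k \<otimes> b"
    and ord: "order G = 4 * N" using gen by (auto simp: dicyclic_generators_def)
  define ev :: "dic_generator \<times> bool \<Rightarrow> 'a" where
    "ev = (\<lambda>(x, s). let g = (case x of Dic_a \<Rightarrow> a | Dic_b \<Rightarrow> b) in if s then g else inv g)"
  have evG: "ev l \<in> carrier G" for l
    using ab by (auto simp: ev_def Let_def split: prod.splits dic_generator.splits)
  define evw where "evw u = foldr (\<lambda>l g. ev l \<otimes> g) u \<one>" for u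
  have evw_Nil: "evw [] = \<one>" and evw_Cons: "\<And>l u. evw (l # u) = ev l \<otimes> evw u" by (simp_all add: evw_def)
  have evwG: "evw u \<in> carrier G" for u by (induction u) (simp_all add: evw_Nil evw_Cons evG)
  have evw_append: "evw (u @ v) = evw u \<otimes> evw v" for u v
    by (induction u) (simp_all add: evw_Nil evw_Cons evG evwG m_assoc)
  have ev_letters: "ev (Dic_a, True) = a" "ev (Dic_b, True) = b" "ev (x, False) = inv (ev (x, True))" for x
    by (simp_all add: ev_def)
  have evw_rep: "evw (replicate k (Dic_a, True)) = a [^] k" for k
  proof (induction k)
    case (Suc k)
    then show ?case using ab(1) by (simp add: evw_Cons ev_letters nat_pow_Suc2[symmetric] del: nat_pow_Suc)
  qed (simp add: evw_Nil)
  have wd: "evw u = evw v" if "word_eq (dic_relations N) u v" for u v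
    using that
  proof (induction rule: word_eq.induct)
    case (relation u v)
    then show ?case unfolding dic_relations_def
      using ab a2N bb ba
      by (elim insertE emptyE Pair_inject; simp add: evw_rep evw_Nil evw_Cons ev_letters m_assoc)
  next
    case (cancel x s)
    then show ?case using evG[of "(x, True)"] by (cases s) (simp_all add: evw_Nil evw_Cons ev_letters(3))
  next
    case (append u v u' v')
    then show ?case by (simp add: evw_append)
  qed simp_all
  define f where "f C = evw (SOME u. u \<in> C)" for C
  have f: "f (word_class N u) = evw u" for u
  proof -
    have "u \<in> word_class N u" by (simp add: word_eq.refl)
    then have "(SOME v. v \<in> word_class N u) \<in> word_class N u" by (rule someI)
    then have "word_eq (dic_relations N) u (SOME v. v \<in> word_class N u)" by (rule CollectD)
    from wd[OF this] show ?thesis unfolding f_def ..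
  qed
  have mult: "word_class N u \<otimes>\<^bsub>dicyclic N\<^esub> word_class N v = word_class N (u @ v)" for u v
    unfolding dicyclic_eq by (rule presented_group_mult)
  have carr: "C \<in> carrier (dicyclic N) \<longleftrightarrow> (\<exists>u. C = word_class N u)" for C
    unfolding dicyclic_eq by (rule presented_group_class)
  have hom: "f \<in> hom (dicyclic N) G"
  proof (rule homI)
    fix C assume "C \<in> carrier (dicyclic N)"
    then obtain u where u: "C = word_class N u" unfolding carr by (rule exE)
    show "f C \<in> carrier G" unfolding u f by (rule evwG)
    fix C' assume "C' \<in> carrier (dicyclic N)"
    then obtain v where v: "C' = word_class N v" unfolding carr by (rule exE)
    show "f (C \<otimes>\<^bsub>dicyclic N\<^esub> C') = f C \<otimes> f C'" unfolding u v mult f by (rule evw_append)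
  qed
  have surj: "f ` carrier (dicyclic N) = carrier G"
  proof
    show "f ` carrier (dicyclic N) \<subseteq> carrier G" using hom by (auto simp: hom_def)
    show "carrier G \<subseteq> f ` carrier (dicyclic N)"
    proof
      fix y assume "y \<in> carrier G"
      then obtain k :: nat where "y = a [^] k \<or> y = a [^] k \<otimes> b" using cover by auto
      then have "y = evw (replicate k (Dic_a, True)) \<or> y = evw (replicate k (Dic_a, True) @ [(Dic_b, True)])"
        using ab by (simp add: evw_append evw_rep evw_Cons evw_Nil ev_letters)
      then obtain u where "y = evw u" by auto
      then have "y = f (word_class N u)" by (simp only: f)
      moreover have "word_class N u \<in> carrier (dicyclic N)" unfolding carr by (rule exI) (rule HOL.refl)
      ultimately show "y \<in> f ` carrier (dicyclic N)" by (rule image_eqI)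
    qed
  qed
  have "order (dicyclic N) = 4 * N"
    using dicyclic_presentation[of N] N by (simp add: D.dicyclic_generators_def)
  then have "card (carrier (dicyclic N)) = card (f ` carrier (dicyclic N))" "finite (carrier (dicyclic N))"
    using ord N unfolding surj by (auto simp: Coset.order_def intro: card_ge_0_finite)
  then have "inj_on f (carrier (dicyclic N))" by (intro eq_card_imp_inj_on) simp_all
  then have "f \<in> iso (dicyclic N) G" using hom surj by (simp add: iso_def bij_betw_def)
  then have "dicyclic N \<cong> G" unfolding is_iso_def by auto
  then have "G \<cong> dicyclic N" by (rule D.iso_sym)
  then show ?thesis unfolding is_dicyclic_def using N by (intro exI[of _ N] conjI)
qed

text \<open>For \<open>M = q * M'\<close> a \<open>q\<close>-th root \<open>x\<close> of a primitive
  \<open>M'\<close>-th root is primitive as soon as \<open>x ^ M'\<close> is not \<open>1\<close>.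
  This is automatic if \<open>q\<close> divides \<open>M'\<close>; otherwise a failing
  \<open>x\<close> is multiplied by a nontrivial \<open>q\<close>-th root of unity.\<close>

lemma exists_primitive_root_of_unity:
  assumes "M > 0" "of_nat M \<noteq> (0::'a::alg_closed_field)"
  shows "\<exists>z::'a. \<forall>j. z ^ j = 1 \<longleftrightarrow> M dvd j"
  using assms
proof (induction M rule: less_induct)
  case (less M)
  show ?case
  proof (cases "M = 1")
    case True
    then show ?thesis by (intro exI[of _ 1]) simp
  next
    case False
    from prime_factor_nat[OF this] obtain q where q: "Factorial_Ring.prime q" "q dvd M" by (elim exE conjE)
    obtain M' where M': "M = q * M'" using q(2) by (rule dvdE)
    have q1: "q > 1" by (rule prime_gt_1_nat[OF q(1)])
    have "M' < M" "M' > 0" using less.prems(1) q1 by (auto simp: M')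
    moreover have q0: "of_nat M' \<noteq> (0::'a)" "of_nat q \<noteq> (0::'a)" using less.prems(2) by (auto simp: M')
    ultimately obtain z :: 'a where z: "\<And>j. z ^ j = 1 \<longleftrightarrow> M' dvd j" using less.IH by blast
    obtain x0 :: 'a where x0: "x0 ^ q = z" using exists_root_alg_closed[of q z] q1 by auto
    obtain w :: 'a where w: "w ^ q = 1" "w \<noteq> 1" using exists_nontrivial_root_of_unity[OF q1 q0(2)] by (elim exE conjE)
    have trivial: "u = 1" if u: "u ^ q = 1" "u ^ i = 1" and i: "\<not> q dvd i" for u :: 'a and i
    proof -
      have "coprime i q" using prime_imp_coprime[OF q(1) i] by (simp add: coprime_commute)
      then obtain c where "[i * c = 1] (mod q)" using cong_solve_coprime_nat[of i q] by auto
      then have "(i * c) mod q = 1" using q1 by (simp add: cong_def)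
      moreover have "q * ((i * c) div q) + (i * c) mod q = i * c" by (rule mult_div_mod_eq)
      ultimately have "i * c = q * ((i * c) div q) + 1" by argo
      then have "u ^ (i * c) = u ^ (q * ((i * c) div q) + 1)" by (rule arg_cong)
      then have "(u ^ i) ^ c = (u ^ q) ^ ((i * c) div q) * u" by (simp only: power_mult power_add power_one_right)
      then show "u = 1" by (simp add: u)
    qed
    have "\<exists>x. x ^ q = z \<and> x ^ M' \<noteq> 1"
    proof (cases "q dvd M'")
      case True
      then obtain i where i: "M' = q * i" by (rule dvdE)
      have "\<not> M' dvd i" using \<open>M' > 0\<close> i q1 by (auto dest!: dvd_imp_le)
      then have "x0 ^ M' \<noteq> 1" using z[of i] by (simp add: i power_mult x0)
      then show ?thesis using x0 by auto
    next
      case False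
      then have "w ^ M' \<noteq> 1" using trivial[OF w(1), of M'] w(2) by auto
      moreover have "(x0 * w) ^ q = z" by (simp add: power_mult_distrib x0 w(1))
      ultimately have "x0 ^ M' = 1 \<Longrightarrow> ?thesis" by (intro exI[of _ "x0 * w"]) (simp add: power_mult_distrib)
      moreover have "x0 ^ M' \<noteq> 1 \<Longrightarrow> ?thesis" using x0 by (intro exI[of _ x0] conjI)
      ultimately show ?thesis by (cases "x0 ^ M' = 1")
    qed
    then obtain x where x: "x ^ q = z" "x ^ M' \<noteq> 1" by (elim exE conjE)
    have "x ^ j = 1 \<longleftrightarrow> M dvd j" for j
    proof
      assume xj: "x ^ j = 1"
      have "z ^ j = (x ^ j) ^ q" by (simp add: x(1)[symmetric] power_mult[symmetric] mult.commute)
      then have "M' dvd j" using xj z by simp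
      then obtain i where i: "j = M' * i" by (rule dvdE)
      have "q dvd i"
      proof (rule ccontr)
        assume ni: "\<not> q dvd i"
        have "(x ^ M') ^ q = z ^ M'" by (simp add: x(1)[symmetric] power_mult[symmetric] mult.commute)
        then have "(x ^ M') ^ q = 1" using z by simp
        moreover have "(x ^ M') ^ i = 1" using xj by (simp add: i power_mult)
        ultimately show False using trivial[OF _ _ ni] x(2) by simp
      qed
      then show "M dvd j" by (simp add: M' i mult.commute mult_dvd_mono)
    next
      assume "M dvd j"
      then obtain i where "j = q * M' * i" unfolding M' by (rule dvdE)
      then have "x ^ j = (z ^ M') ^ i" by (simp add: x(1)[symmetric] power_mult)
      moreover have "z ^ M' = 1" using z[of M'] by simp
      ultimately show "x ^ j = 1" by (simp only: power_one)
    qed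
    then show ?thesis by (intro exI[of _ x] allI)
  qed
qed

section \<open>The regular representation of a dicyclic group\<close>

locale dicyclic_regular = group G for G :: "('g, 'b) monoid_scheme" (structure) +
  fixes N :: nat and a b :: 'g and \<zeta> :: "'k::field alg_closure"
  assumes gen: "dicyclic_generators N a b" and N1: "N > 1" and ord0: "of_nat (order G) \<noteq> (0::'k)"
    and zeta: "\<And>j. \<zeta> ^ j = 1 \<longleftrightarrow> 2 * N dvd j"
begin

lemma a_in: "a \<in> carrier G" and b_in: "b \<in> carrier G" and a_2N: "a [^] (2 * N) = \<one>"
  and bb: "b \<otimes> b = a [^] N" and ba: "b \<otimes> a \<otimes> inv b = inv a"
  and cover: "y \<in> carrier G \<Longrightarrow> \<exists>k::nat. y = a [^] k \<or> y = a [^] k \<otimes> b"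
  and order_eq: "order G = 4 * N"
  using gen by (auto simp: dicyclic_generators_def)

lemma fin: "finite (carrier G)"
  using order_eq N1 by (auto simp: Coset.order_def intro: card_ge_0_finite)

lemma b_pow: "b \<otimes> a [^] (k::nat) = a [^] ((2 * N - 1) * k) \<otimes> b"
  using dicyclic_closed(3)[OF a_in b_in _ a_2N bb ba] N1 by simp

text \<open>Coordinate \<open>0\<close> belongs to the neutral element and coordinate
  \<open>2 * N\<close> to \<open>b\<close>; these two occur in the monomial of the lower
  bound.\<close>

definition enum :: "nat \<Rightarrow> 'g" where
  "enum j = (if j < 2 * N then a [^] j else a [^] (j - 2 * N) \<otimes> b)"

lemma enum_in: "enum j \<in> carrier G" using a_in b_in by (simp add: enum_def)

lemma a_mod: "a [^] (k mod (2 * N)) = a [^] k"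
  by (rule pow_cong[OF a_in a_2N]) (simp add: cong_def)

lemma enum_bij: "bij_betw enum {..<4 * N} (carrier G)"
proof -
  have "carrier G \<subseteq> enum ` {..<4 * N}"
  proof
    fix y assume y: "y \<in> carrier G"
    from cover[OF y] obtain k :: nat where k: "y = a [^] k \<or> y = a [^] k \<otimes> b" by (elim exE)
    have l: "k mod (2 * N) < 2 * N" using N1 by simp
    have "y = enum (k mod (2 * N)) \<or> y = enum (2 * N + k mod (2 * N))"
      using k l by (simp add: enum_def a_mod)
    moreover have "k mod (2 * N) < 4 * N" "2 * N + k mod (2 * N) < 4 * N" using l by simp_all
    ultimately show "y \<in> enum ` {..<4 * N}" by blast
  qed
  then have im: "enum ` {..<4 * N} = carrier G" using enum_in by auto
  then have "card (enum ` {..<4 * N}) = card {..<4 * N}" using order_eq by (simp add: Coset.order_def)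
  then have "inj_on enum {..<4 * N}" by (intro eq_card_imp_inj_on) simp_all
  then show ?thesis using im by (simp add: bij_betw_def)
qed

lemma enum_inj: "i < 4 * N \<Longrightarrow> j < 4 * N \<Longrightarrow> enum i = enum j \<longleftrightarrow> i = j"
  using enum_bij by (auto simp: bij_betw_def inj_on_def)

lemma enum_surj: "g \<in> carrier G \<Longrightarrow> \<exists>j<4 * N. enum j = g"
  using enum_bij by (auto simp: bij_betw_def image_iff) (metis image_iff lessThan_iff)

definition \<rho> :: "'g \<Rightarrow> 'k mat" where
  "\<rho> g = mat (4 * N) (4 * N) (\<lambda>(i, j). if enum i = g \<otimes> enum j then 1 else 0)"

lemma rho_mult:
  assumes "g \<in> carrier G" "h \<in> carrier G"
  shows "\<rho> (g \<otimes> h) = \<rho> g * \<rho> h"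
proof (rule eq_matI)
  fix i j assume "i < dim_row (\<rho> g * \<rho> h)" "j < dim_col (\<rho> g * \<rho> h)"
  then have ij: "i < 4 * N" "j < 4 * N" by (simp_all add: \<rho>_def)
  obtain k0 where k0: "k0 < 4 * N" "enum k0 = h \<otimes> enum j" using enum_surj[of "h \<otimes> enum j"] assms enum_in by auto
  have "(\<rho> g * \<rho> h) $$ (i, j) = (\<Sum>k<4 * N. (if enum i = g \<otimes> enum k then 1 else 0) * (if enum k = h \<otimes> enum j then 1 else 0))"
    using ij by (simp add: \<rho>_def scalar_prod_def atLeast0LessThan)
  also have "\<dots> = (\<Sum>k<4 * N. if k = k0 then (if enum i = g \<otimes> enum k then 1 else 0) else 0)"
    using k0 by (intro sum.cong) (auto simp: enum_inj simp flip: k0(2))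
  also have "\<dots> = (if enum i = g \<otimes> enum k0 then 1 else 0)" using k0(1) by simp
  also have "\<dots> = \<rho> (g \<otimes> h) $$ (i, j)" using ij assms enum_in by (simp add: \<rho>_def k0(2) m_assoc)
  finally show "\<rho> (g \<otimes> h) $$ (i, j) = (\<rho> g * \<rho> h) $$ (i, j)" ..
qed (simp_all add: \<rho>_def)

lemma rho_one: "\<rho> \<one> = 1\<^sub>m (4 * N)"
  by (rule eq_matI) (simp_all add: \<rho>_def enum_in enum_inj)

lemma rho_rep: "\<rho> \<in> representations G (4 * N)"
proof -
  have carr: "\<rho> g \<in> carrier_mat (4 * N) (4 * N)" for g by (simp add: \<rho>_def)
  have "\<rho> g \<in> Units (ring_mat TYPE('k) (4 * N) ())" if g: "g \<in> carrier G" for g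
  proof -
    have "\<rho> (inv g) * \<rho> g = 1\<^sub>m (4 * N)" "\<rho> g * \<rho> (inv g) = 1\<^sub>m (4 * N)"
      using g by (simp_all add: rho_one flip: rho_mult)
    then show ?thesis unfolding Units_def using carr by (auto simp: ring_mat_def intro!: bexI[of _ "\<rho> (inv g)"])
  qed
  then show ?thesis unfolding representations_def
    by (intro homI) (simp_all add: units_of_def rho_mult, simp add: ring_mat_def)
qed

sublocale closure_rep G "4 * N" \<rho>
proof unfold_locales
  have "to_ac (of_nat (order G)) \<noteq> (0 :: 'k alg_closure)" using ord0 by (metis to_ac_0 to_ac_eq_iff)
  then show "of_nat (order G) \<noteq> (0 :: 'k alg_closure)" by simp
qed (use rho_rep scalars_to_ac fin in \<open>simp_all add: scalars_def\<close>)

interpretation ta: scalars "to_ac :: 'k \<Rightarrow> 'k alg_closure" by (rule scalars_to_ac)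

definition ix :: "'g \<Rightarrow> nat" where "ix = the_inv_into {..<4 * N} enum"

lemma ix_enum: "j < 4 * N \<Longrightarrow> ix (enum j) = j"
  unfolding ix_def using enum_bij by (intro the_inv_into_f_f) (auto simp: bij_betw_def)

text \<open>Coordinates of a plane in the regular module: \<open>L x y\<close> takes the value
  \<open>\<zeta> ^ k * x\<close> at \<open>a [^] k\<close> and the inverse of
  \<open>\<zeta> ^ k\<close> times \<open>y\<close> at \<open>a [^] k \<otimes> b\<close>. Left
  translation by \<open>a\<close> multiplies \<open>x\<close> and \<open>y\<close> by
  \<open>\<zeta>\<close> and its inverse, and translation by \<open>b\<close> turns
  \<open>(x, y)\<close> into \<open>(y, - x)\<close>.\<close>

definition L :: "'k alg_closure \<Rightarrow> 'k alg_closure \<Rightarrow> 'g \<Rightarrow> 'k alg_closure" where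
  "L x y g = (if ix g < 2 * N then \<zeta> ^ ix g * x else \<zeta> ^ ((2 * N - 1) * (ix g - 2 * N)) * y)"

lemma zeta_add: "\<zeta> ^ (2 * N * w + k) = \<zeta> ^ k"
  using zeta[of "2 * N * w"] by (simp add: power_add)

lemma zeta_cong: "[u = v] (mod 2 * N) \<Longrightarrow> \<zeta> ^ u = \<zeta> ^ v"
proof -
  have "\<zeta> ^ w = \<zeta> ^ (w mod (2 * N))" for w
    using zeta_add[of "w div (2 * N)" "w mod (2 * N)"] by (simp only: mult_div_mod_eq)
  from this[of u] this[of v] show "[u = v] (mod 2 * N) \<Longrightarrow> \<zeta> ^ u = \<zeta> ^ v" by (simp add: cong_def)
qed

lemma zeta_N: "\<zeta> ^ N = - 1"
proof -
  have "\<not> 2 * N dvd N" using N1 by (auto dest!: dvd_imp_le)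
  then have "\<zeta> ^ N \<noteq> 1" by (simp only: zeta simp_thms)
  moreover have "(\<zeta> ^ N)\<^sup>2 = 1" using zeta[of "N * 2"] by (simp add: power_mult mult.commute)
  ultimately show ?thesis by (simp only: power2_eq_1_iff) simp
qed

lemma L_a: "L x y (a [^] (k::nat)) = \<zeta> ^ k * x"
proof -
  have l: "k mod (2 * N) < 2 * N" using N1 by simp
  have "a [^] k = enum (k mod (2 * N))" using l by (simp add: enum_def a_mod)
  then have "ix (a [^] k) = k mod (2 * N)" using l ix_enum[of "k mod (2 * N)"] by simp
  moreover have "\<zeta> ^ (k mod (2 * N)) = \<zeta> ^ k" by (rule zeta_cong) (simp add: cong_def)
  ultimately show ?thesis using l by (simp add: L_def)
qed

lemma L_ab: "L x y (a [^] (k::nat) \<otimes> b) = \<zeta> ^ ((2 * N - 1) * k) * y"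
proof -
  have l: "k mod (2 * N) < 2 * N" using N1 by simp
  have "a [^] k \<otimes> b = enum (2 * N + k mod (2 * N))" using l by (simp add: enum_def a_mod)
  then have "ix (a [^] k \<otimes> b) = 2 * N + k mod (2 * N)" using l ix_enum[of "2 * N + k mod (2 * N)"] by simp
  moreover have "\<zeta> ^ ((2 * N - 1) * (k mod (2 * N))) = \<zeta> ^ ((2 * N - 1) * k)"
    by (rule zeta_cong) (simp add: cong_def mod_mult_right_eq)
  ultimately show ?thesis by (simp add: L_def)
qed

lemma L_mult_a:
  assumes "g \<in> carrier G"
  shows "L x y (a \<otimes> g) = L (\<zeta> * x) (\<zeta> ^ (2 * N - 1) * y) g"
proof -
  obtain k :: nat where "g = a [^] k \<or> g = a [^] k \<otimes> b" using cover[OF assms] by (elim exE)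
  then show ?thesis
  proof
    assume g: "g = a [^] k"
    have "a \<otimes> g = a [^] Suc k" unfolding g using a_in by (simp only: nat_pow_Suc2)
    then show ?thesis by (simp only: L_a g) (simp add: mult_ac)
  next
    assume g: "g = a [^] k \<otimes> b"
    have "a \<otimes> g = a [^] Suc k \<otimes> b" unfolding g using a_in b_in by (simp only: nat_pow_Suc2) (simp add: m_assoc)
    then have "L x y (a \<otimes> g) = \<zeta> ^ ((2 * N - 1) * Suc k) * y" by (simp only: L_ab)
    also have "\<dots> = \<zeta> ^ ((2 * N - 1) * k) * (\<zeta> ^ (2 * N - 1) * y)"
      unfolding mult_Suc_right power_add by (simp only: mult_ac)
    finally show ?thesis by (simp only: L_ab g)
  qed
qed

lemma zeta_square: "\<zeta> ^ ((2 * N - 1) * ((2 * N - 1) * k)) = \<zeta> ^ k"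
proof -
  obtain N' where N': "N = Suc N'" using N1 by (cases N) simp_all
  have "(2 * N - 1) * ((2 * N - 1) * k) = 2 * N * ((2 * N - 2) * k) + k"
    by (simp add: N' algebra_simps)
  then show ?thesis by (simp only: zeta_add)
qed

lemma L_mult_b:
  assumes "g \<in> carrier G"
  shows "L x y (b \<otimes> g) = L y (- x) g"
proof -
  obtain k :: nat where "g = a [^] k \<or> g = a [^] k \<otimes> b" using cover[OF assms] by (elim exE)
  then show ?thesis
  proof
    assume g: "g = a [^] k"
    show ?thesis unfolding g b_pow L_ab L_a zeta_square ..
  next
    assume g: "g = a [^] k \<otimes> b"
    have "b \<otimes> g = a [^] ((2 * N - 1) * k) \<otimes> b \<otimes> b"
      unfolding g b_pow[symmetric] using a_in b_in by (simp add: m_assoc)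
    also have "\<dots> = a [^] ((2 * N - 1) * k + N)" using a_in b_in by (simp add: m_assoc bb nat_pow_mult)
    finally show ?thesis unfolding g by (simp only: L_a L_ab power_add zeta_N) simp
  qed
qed

text \<open>The restriction of a polynomial on the regular module to the plane given by
  \<open>L\<close>.\<close>

definition Ev :: "'k alg_closure \<Rightarrow> 'k alg_closure \<Rightarrow> 'k mpolynomial \<Rightarrow> 'k alg_closure" where
  "Ev x y = poly_eval to_ac (\<lambda>i. L x y (enum i))"

lemma Ev_act:
  assumes g: "g \<in> carrier G" and f: "f \<in> poly_algebra (4 * N)"
  shows "Ev x y (base.act g f) = poly_eval to_ac (\<lambda>i. L x y (g \<otimes> enum i)) f"
proof -
  have "Ev x y (base.act g f) = poly_eval to_ac (\<lambda>i. Ev x y (base.coords g i)) f"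
    by (simp add: Ev_def base.act_def ta.poly_eval_poly_eval_mconst)
  also have "\<dots> = poly_eval to_ac (\<lambda>i. L x y (g \<otimes> enum i)) f"
  proof (rule poly_eval_cong)
    fix m i assume "m \<in> ks f" "i \<in> ks m"
    then have i: "i < 4 * N" using f by (auto simp: poly_algebra_def)
    obtain j0 where j0: "j0 < 4 * N" "enum j0 = g \<otimes> enum i" using enum_surj[of "g \<otimes> enum i"] g enum_in by auto
    have "Ev x y (base.coords g i) = (\<Sum>j<4 * N. to_ac (\<rho> (inv g) $$ (i, j)) * L x y (enum j))"
      using i by (simp add: Ev_def base.coords_def ta.poly_eval_sum ta.poly_eval_mult ta.poly_eval_mconst ta.poly_eval_mvar)
    also have "\<dots> = (\<Sum>j<4 * N. if j = j0 then L x y (enum j) else 0)"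
    proof (rule sum.cong[OF HOL.refl])
      fix j assume "j \<in> {..<4 * N}"
      then have j: "j < 4 * N" by simp
      have "enum i = inv g \<otimes> enum j \<longleftrightarrow> g \<otimes> enum i = enum j"
        using g enum_in inv_solve_left[of "enum i" g "enum j"] by auto
      also have "\<dots> \<longleftrightarrow> j = j0" using enum_inj[OF j0(1) j] by (auto simp: j0(2))
      finally show "to_ac (\<rho> (inv g) $$ (i, j)) * L x y (enum j) = (if j = j0 then L x y (enum j) else 0)"
        using i j by (simp add: \<rho>_def)
    qed
    also have "\<dots> = L x y (g \<otimes> enum i)" using j0 by simp
    finally show "Ev x y (base.coords g i) = L x y (g \<otimes> enum i)" .
  qed
  finally show ?thesis .
qed

text \<open>The sum of the transforms of \<open>x ^ u * y ^ v\<close> under all \<open>4 * N\<close>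
  elements of the group.\<close>

definition twisted_sum :: "nat \<Rightarrow> nat \<Rightarrow> 'k alg_closure \<Rightarrow> 'k alg_closure \<Rightarrow> 'k alg_closure" where
  "twisted_sum u v x y = (\<Sum>k<2 * N. (\<zeta> ^ k * x) ^ u * (\<zeta> ^ ((2 * N - 1) * k) * y) ^ v
     + (\<zeta> ^ k * y) ^ u * (\<zeta> ^ ((2 * N - 1) * k) * (- x)) ^ v)"

text \<open>The sum over \<open>k\<close> vanishes unless \<open>u\<close> and \<open>v\<close> are
  congruent modulo \<open>2 * N\<close>. Up to degree \<open>2 * N + 1\<close> this leaves
  \<open>u = v\<close>, or one exponent zero and the other an even number; in each case the result
  is symmetric. The exponents \<open>2 * N + 1\<close> and \<open>1\<close> are the first to escape
  this.\<close>

lemma twisted_sum_swap: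
  assumes "u + v \<le> 2 * N + 1"
  shows "twisted_sum u v x y = twisted_sum u v y x"
proof -
  define \<eta> where "\<eta> = \<zeta> ^ (u + (2 * N - 1) * v)"
  have tw: "(\<zeta> ^ k * x) ^ u * (\<zeta> ^ ((2 * N - 1) * k) * y) ^ v = \<eta> ^ k * (x ^ u * y ^ v)" for k x y
  proof -
    have "(\<zeta> ^ k) ^ u * (\<zeta> ^ ((2 * N - 1) * k)) ^ v = \<eta> ^ k"
      unfolding \<eta>_def power_mult[symmetric] power_add[symmetric] by (simp add: algebra_simps)
    then show ?thesis by (simp add: power_mult_distrib mult_ac)
  qed
  have T: "twisted_sum u v x y = (\<Sum>k<2 * N. \<eta> ^ k) * (x ^ u * y ^ v + y ^ u * (- x) ^ v)" for x y
    by (simp only: twisted_sum_def tw sum_distrib_right distrib_left sum.distrib)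
  show ?thesis
  proof (cases "\<eta> = 1")
    case False
    have "\<eta> ^ (2 * N) = \<zeta> ^ (2 * N * (u + (2 * N - 1) * v))"
      unfolding \<eta>_def power_mult[symmetric] by (simp only: mult.commute)
    also have "\<dots> = 1" unfolding zeta by simp
    finally have "(\<Sum>k<2 * N. \<eta> ^ k) = 0" using False by (simp add: sum_gp_strict)
    then show ?thesis by (simp add: T)
  next
    case True
    then have dvd: "2 * N dvd u + (2 * N - 1) * v" by (simp only: \<eta>_def zeta)
    have sub: "(2 * N - 1) * v + v = 2 * N * v" using N1 by (cases N) simp_all
    consider "u = v" | "u < v" | "v < u" by linarith
    then have "x ^ u * y ^ v + y ^ u * (- x) ^ v = y ^ u * x ^ v + x ^ u * (- y) ^ v"
    proof cases
      case 1
      then show ?thesis by (cases "even u") (simp_all add: mult_ac)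
    next
      case 2
      have "2 * N dvd (u + (2 * N - 1) * v) + (v - u)" using sub 2 by simp
      then have "2 * N dvd v - u" using dvd by (simp add: dvd_add_right_iff)
      then obtain w where w: "v - u = 2 * N * w" by (rule dvdE)
      have "w \<noteq> 0" using w 2 by (intro notI) simp
      then have "2 * N \<le> v - u" unfolding w by (cases w) simp_all
      then have "u = 0" using assms 2 by arith
      moreover have "even v" using w \<open>u = 0\<close> by simp
      ultimately show ?thesis by simp
    next
      case 3
      have eq: "u + (2 * N - 1) * v = 2 * N * v + (u - v)" using sub 3 by linarith
      then have "2 * N dvd u - v" using dvd unfolding eq by (simp add: dvd_add_right_iff)
      then obtain w where w: "u - v = 2 * N * w" by (rule dvdE)
      have "w \<noteq> 0" using w 3 by (intro notI) simp
      then have "2 * N \<le> u - v" unfolding w by (cases w) simp_all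
      then have "v = 0" using assms 3 by arith
      then show ?thesis by simp
    qed
    then show ?thesis by (simp add: T)
  qed
qed

lemma monom_eval_L:
  "\<exists>c u v. u + v = exp_degree m \<and> (\<forall>x y. monom_eval (\<lambda>i. L x y (enum i)) m = c * (x ^ u * y ^ v))"
proof -
  define z where "z i = (if i < 2 * N then \<zeta> ^ i else \<zeta> ^ ((2 * N - 1) * (i - 2 * N)))" for i
  have L: "L x y (enum i) = z i * (if i < 2 * N then x else y)" for x y i
    by (simp add: enum_def z_def L_a L_ab)
  let ?u = "\<Sum>i\<in>ks m \<inter> {..<2 * N}. lk m i" and ?v = "\<Sum>i\<in>ks m - {..<2 * N}. lk m i"
  have "monom_eval (\<lambda>i. L x y (enum i)) m = monom_eval z m * (x ^ ?u * y ^ ?v)" for x y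
  proof -
    have "(\<Prod>i\<in>ks m. (if i < 2 * N then x else y) ^ lk m i) = x ^ ?u * y ^ ?v"
      by (subst prod.Int_Diff[of _ _ "{..<2 * N}"]) (auto simp: power_sum intro!: arg_cong2[where f = "(*)"] prod.cong)
    then show ?thesis by (simp add: monom_eval_def L power_mult_distrib prod.distrib)
  qed
  moreover have "?u + ?v = exp_degree m"
    unfolding exp_degree_def by (rule sum.Int_Diff[symmetric]) simp
  ultimately show ?thesis by (intro exI[of _ "monom_eval z m"] exI[of _ ?u] exI[of _ ?v] conjI allI)
qed

text \<open>By invariance, \<open>4 * N\<close> times the restriction is the sum of its transforms
  under the group. So each monomial of the restriction turns into its \<open>twisted_sum\<close>,
  which is symmetric in this degree; finally \<open>4 * N\<close> is cancelled.\<close>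

lemma Ev_swap:
  assumes f: "f \<in> invariants G (4 * N) \<rho>" and deg: "total_degree f \<le> 2 * N + 1"
  shows "Ev x y f = Ev y x f"
proof -
  have fp: "f \<in> poly_algebra (4 * N)" and fa: "\<And>g. g \<in> carrier G \<Longrightarrow> base.act g f = f"
    using f by (auto simp: invariants_eq)
  have step_a: "Ev x y f = Ev (\<zeta> * x) (\<zeta> ^ (2 * N - 1) * y) f" for x y
    using Ev_act[OF a_in fp, of x y] unfolding fa[OF a_in] L_mult_a[OF enum_in] by (simp only: Ev_def)
  have step_b: "Ev x y f = Ev y (- x) f" for x y
    using Ev_act[OF b_in fp, of x y] unfolding fa[OF b_in] L_mult_b[OF enum_in] by (simp only: Ev_def)
  have pow_a: "Ev x y f = Ev (\<zeta> ^ k * x) (\<zeta> ^ ((2 * N - 1) * k) * y) f" for k x y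
  proof (induction k)
    case (Suc k)
    then have "Ev x y f = Ev (\<zeta> * (\<zeta> ^ k * x)) (\<zeta> ^ (2 * N - 1) * (\<zeta> ^ ((2 * N - 1) * k) * y)) f"
      using step_a[of "\<zeta> ^ k * x" "\<zeta> ^ ((2 * N - 1) * k) * y"] by (simp only:)
    then show ?case by (simp only: power_Suc mult_Suc_right power_add mult.assoc)
  qed simp
  have "\<exists>c u v. \<forall>m. u m + v m = exp_degree m \<and> (\<forall>x y. monom_eval (\<lambda>i. L x y (enum i)) m = c m * (x ^ u m * y ^ v m))"
    using monom_eval_L by metis
  then obtain c u v where cuv: "\<And>m. u m + v m = exp_degree m"
    "\<And>m x y. monom_eval (\<lambda>i. L x y (enum i)) m = c m * (x ^ u m * y ^ v m)" by blast
  have Ev: "Ev x y f = (\<Sum>m\<in>ks f. to_ac (lk f m) * c m * (x ^ u m * y ^ v m))" for x y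
    by (simp add: Ev_def poly_eval_def cuv(2) mult.assoc)
  have avg: "of_nat (4 * N) * Ev x y f = (\<Sum>m\<in>ks f. to_ac (lk f m) * c m * twisted_sum (u m) (v m) x y)" for x y
  proof -
    have "of_nat (4 * N) * Ev x y f = (\<Sum>k<2 * N. Ev x y f + Ev x y f)" by simp
    also have "\<dots> = (\<Sum>k<2 * N. Ev (\<zeta> ^ k * x) (\<zeta> ^ ((2 * N - 1) * k) * y) f
        + Ev (\<zeta> ^ k * y) (\<zeta> ^ ((2 * N - 1) * k) * (- x)) f)"
    proof (rule sum.cong[OF HOL.refl])
      fix k
      have "Ev x y f = Ev (\<zeta> ^ k * y) (\<zeta> ^ ((2 * N - 1) * k) * (- x)) f"
        using step_b[of x y] pow_a[of y "- x" k] by (simp only:)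
      then show "Ev x y f + Ev x y f = Ev (\<zeta> ^ k * x) (\<zeta> ^ ((2 * N - 1) * k) * y) f
        + Ev (\<zeta> ^ k * y) (\<zeta> ^ ((2 * N - 1) * k) * (- x)) f"
        using pow_a[of x y k] by (simp only:)
    qed
    also have "\<dots> = (\<Sum>k<2 * N. \<Sum>m\<in>ks f. to_ac (lk f m) * c m *
        ((\<zeta> ^ k * x) ^ u m * (\<zeta> ^ ((2 * N - 1) * k) * y) ^ v m
          + (\<zeta> ^ k * y) ^ u m * (\<zeta> ^ ((2 * N - 1) * k) * (- x)) ^ v m))"
      unfolding Ev sum.distrib[symmetric] distrib_left[symmetric] ..
    also have "\<dots> = (\<Sum>m\<in>ks f. to_ac (lk f m) * c m * twisted_sum (u m) (v m) x y)"
      unfolding twisted_sum_def sum_distrib_left by (rule sum.swap)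
    finally show ?thesis .
  qed
  have "of_nat (4 * N) * Ev x y f = of_nat (4 * N) * Ev y x f"
    unfolding avg
  proof (rule sum.cong[OF HOL.refl])
    fix m assume "m \<in> ks f"
    then have "u m + v m \<le> 2 * N + 1" using deg cuv(1) by (simp add: total_degree_le_iff)
    then show "to_ac (lk f m) * c m * twisted_sum (u m) (v m) x y = to_ac (lk f m) * c m * twisted_sum (u m) (v m) y x"
      using twisted_sum_swap by simp
  qed
  then show ?thesis using order_ne_0 order_eq by simp
qed

lemma Ev_hom: "Ev x y (mconst c) = to_ac c" "Ev x y (f + g) = Ev x y f + Ev x y g" "Ev x y (f * g) = Ev x y f * Ev x y g"
  by (simp_all add: Ev_def ta.poly_eval_mconst ta.poly_eval_add ta.poly_eval_mult)

text \<open>Polynomials with symmetric restriction form a subalgebra, so generators of degree at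
  most \<open>2 * N + 1\<close> produce only such invariants; one invariant with a non-symmetric
  restriction refutes generation.\<close>

theorem noether_number_rep_ge: "enat (2 * N + 2) \<le> noether_number_rep G (4 * N) \<rho>"
  unfolding noether_number_rep_def
proof (rule Inf_greatest, clarify)
  fix s assume eq: "subalgebra_generated {f \<in> invariants G (4 * N) \<rho>. total_degree f \<le> s} = invariants G (4 * N) \<rho>"
  have "2 * N + 2 \<le> s"
  proof (rule ccontr)
    assume "\<not> 2 * N + 2 \<le> s"
    then have s: "s \<le> 2 * N + 1" by simp
    have swap: "Ev x y f = Ev y x f"
      if "f \<in> subalgebra_generated {f \<in> invariants G (4 * N) \<rho>. total_degree f \<le> s}" for x y f
      using that
    proof induction
      case (gen f)
      then show ?case using s by (intro Ev_swap) auto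
    qed (simp_all add: Ev_hom)
    \<comment> \<open>At the plane this monomial becomes \<open>x ^ (2 * N + 1) * y\<close>, and the
      group sum restricts to \<open>2 * N\<close> times
      \<open>x * y * (x ^ (2 * N) - y ^ (2 * N))\<close>.\<close>
    define mono :: "'k mpolynomial" where "mono = mvar 0 ^ (2 * N + 1) * mvar (2 * N)"
    have mono: "mono \<in> poly_algebra (4 * N)"
      unfolding mono_def using N1
      by (intro homogeneous_poly_algebra[OF homogeneous_mult[OF homogeneous_power[OF homogeneous_mvar] homogeneous_mvar]]) simp_all
    define F where "F = (\<Sum>h\<in>carrier G. base.act h mono)"
    have "F \<in> invariants G (4 * N) \<rho>"
      unfolding invariants_eq F_def using base.act_sum_carrier
      by (auto intro!: poly_algebra_sum base.act_poly_algebra mono)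
    then have F_swap: "Ev x y F = Ev y x F" for x y using swap unfolding eq by simp
    have F: "Ev x y F = of_nat (2 * N) * (x ^ (2 * N + 1) * y) - of_nat (2 * N) * (y ^ (2 * N + 1) * x)" for x y
    proof -
      have "Ev x y F = (\<Sum>h\<in>carrier G. Ev x y (base.act h mono))" by (simp add: F_def Ev_def ta.poly_eval_sum)
      also have "\<dots> = (\<Sum>h\<in>carrier G. L x y h ^ (2 * N + 1) * L x y (h \<otimes> b))"
      proof (rule sum.cong[OF HOL.refl])
        fix h assume h: "h \<in> carrier G"
        have "enum 0 = \<one>" "enum (2 * N) = b" using N1 b_in by (simp_all add: enum_def)
        then show "Ev x y (base.act h mono) = L x y h ^ (2 * N + 1) * L x y (h \<otimes> b)"
          using h by (subst Ev_act[OF h mono]) (simp add: mono_def ta.poly_eval_mult ta.poly_eval_power ta.poly_eval_mvar del: power_Suc)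
      qed
      also have "\<dots> = (\<Sum>j<4 * N. L x y (enum j) ^ (2 * N + 1) * L x y (enum j \<otimes> b))"
        by (rule sum.reindex_bij_betw[OF enum_bij, symmetric])
      also have "\<dots> = (\<Sum>j<4 * N. if j < 2 * N then x ^ (2 * N + 1) * y else - (y ^ (2 * N + 1) * x))"
      proof (rule sum.cong[OF HOL.refl])
        fix j
        show "L x y (enum j) ^ (2 * N + 1) * L x y (enum j \<otimes> b) =
            (if j < 2 * N then x ^ (2 * N + 1) * y else - (y ^ (2 * N + 1) * x))"
        proof (cases "j < 2 * N")
          case True
          have "(\<zeta> ^ j) ^ (2 * N + 1) * \<zeta> ^ ((2 * N - 1) * j) = \<zeta> ^ (2 * N * (2 * j) + 0)"
            unfolding power_mult[symmetric] power_add[symmetric] using N1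
            by (intro arg_cong[where f = "\<lambda>i. \<zeta> ^ i"]) (cases N; simp add: algebra_simps)
          then have z: "(\<zeta> ^ j) ^ (2 * N + 1) * \<zeta> ^ ((2 * N - 1) * j) = 1" by (simp only: zeta_add power_0)
          have "L x y (enum j) ^ (2 * N + 1) * L x y (enum j \<otimes> b)
              = ((\<zeta> ^ j) ^ (2 * N + 1) * \<zeta> ^ ((2 * N - 1) * j)) * (x ^ (2 * N + 1) * y)"
            using True by (simp only: enum_def if_True L_a L_ab power_mult_distrib mult_ac)
          then show ?thesis using True by (simp only: z if_True mult_1)
        next
          case False
          define i where "i = j - 2 * N"
          have e: "enum j = a [^] i \<otimes> b" using False by (simp add: enum_def i_def)
          have eb: "enum j \<otimes> b = a [^] (i + N)" using a_in b_in by (simp add: e m_assoc bb nat_pow_mult)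
          have "(\<zeta> ^ ((2 * N - 1) * i)) ^ (2 * N + 1) * \<zeta> ^ i = \<zeta> ^ (2 * N * (2 * N * i) + 0)"
            unfolding power_mult[symmetric] power_add[symmetric] using N1
            by (intro arg_cong[where f = "\<lambda>i. \<zeta> ^ i"]) (cases N; simp add: algebra_simps)
          then have z: "(\<zeta> ^ ((2 * N - 1) * i)) ^ (2 * N + 1) * \<zeta> ^ i = 1" by (simp only: zeta_add power_0)
          have "L x y (enum j) ^ (2 * N + 1) * L x y (enum j \<otimes> b)
              = ((\<zeta> ^ ((2 * N - 1) * i)) ^ (2 * N + 1) * \<zeta> ^ i) * (y ^ (2 * N + 1) * (\<zeta> ^ N * x))"
            unfolding eb unfolding e by (simp only: L_a L_ab power_mult_distrib power_add mult_ac)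
          then show ?thesis using False by (simp only: z zeta_N if_False mult_1) simp
        qed
      qed
      also have "\<dots> = of_nat (2 * N) * (x ^ (2 * N + 1) * y) - of_nat (2 * N) * (y ^ (2 * N + 1) * x)"
      proof -
        have "{..<4 * N} \<inter> {j. j < 2 * N} = {..<2 * N}" "{..<4 * N} \<inter> - {j. j < 2 * N} = {2 * N..<4 * N}" by auto
        then show ?thesis by (simp add: sum.If_cases del: of_nat_mult power_Suc)
      qed
      finally show ?thesis .
    qed
    \<comment> \<open>For \<open>x ^ (2 * N) = - 1\<close> the values at \<open>(x, 1)\<close> and
      \<open>(1, x)\<close> are \<open>- 4 * N * x\<close> and \<open>4 * N * x\<close>, which
      differ because \<open>4 * N\<close> is invertible.\<close>
    obtain x :: "'k alg_closure" where x: "x ^ (2 * N) = - 1"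
      using exists_root_alg_closed[of "2 * N" "- 1 :: 'k alg_closure"] N1 by auto
    have x0: "x \<noteq> 0" using x N1 by (auto simp: power_0_left)
    have p: "x ^ (2 * N + 1) = - x" by (simp only: power_add x power_one_right) simp
    have zero: "of_nat (4 * N) * (2 * x) = 0"
      using F_swap[of x 1] unfolding F p by (simp add: algebra_simps add_eq_0_iff2)
    have n0: "of_nat (4 * N) \<noteq> (0 :: 'k alg_closure)" using order_ne_0 order_eq by simp
    have two: "(2 :: 'k alg_closure) \<noteq> 0"
    proof
      assume "(2 :: 'k alg_closure) = 0"
      moreover have "of_nat (4 * N) = (2 :: 'k alg_closure) * of_nat (2 * N)" by simp
      ultimately show False using n0 by simp
    qed
    show False using zero n0 two x0 by (simp only: mult_eq_0_iff simp_thms)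
  qed
  then show "enat (2 * N + 2) \<le> enat s" by simp
qed

end

section \<open>Bounds for the Noether number\<close>

lemma (in group) prime_dvd_order:
  assumes "Factorial_Ring.prime (q::nat)" "g \<in> carrier G" "g [^] q = \<one>" "g \<noteq> \<one>"
  shows "q dvd order G"
proof -
  have "ord g dvd q" using assms(2,3) by (simp add: pow_eq_id)
  then have "ord g = 1 \<or> ord g = q" using assms(1) by (simp add: prime_nat_iff)
  moreover have "ord g \<noteq> 1" using assms(2,4) ord_eq_1[of g] by simp
  ultimately show ?thesis using ord_dvd_group_order[OF assms(2)] by simp
qed

lemma (in group) closure_rep_of_representation:
  fixes \<rho> :: "'a \<Rightarrow> 'k::field mat"
  assumes "finite (carrier G)" "\<not> CHAR('k) dvd order G" "\<rho> \<in> representations G n"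
  shows "closure_rep G n \<rho>"
proof unfold_locales
  have "of_nat (order G) \<noteq> (0::'k)" using assms(2) by (simp add: of_nat_eq_0_iff_char_dvd)
  then have "to_ac (of_nat (order G)) \<noteq> (0 :: 'k alg_closure)" by (metis to_ac_0 to_ac_eq_iff)
  then show "of_nat (order G) \<noteq> (0 :: 'k alg_closure)" by simp
qed (use assms scalars_to_ac in \<open>simp_all add: scalars_def\<close>)

context closure_rep
begin

lemma of_nat_dvd_ne_0: "q dvd order G \<Longrightarrow> of_nat q \<noteq> (0 :: 'k alg_closure)"
  using order_ne_0 by (auto elim!: dvdE)

lemma rank_two_noether_number:
  assumes q: "Factorial_Ring.prime (q::nat)" and g: "g \<in> carrier G" "g [^] q = \<one>" "g \<noteq> \<one>"
    and h: "h \<in> carrier G" "h [^] q = \<one>" "h \<notin> generate G {g}" and comm: "g \<otimes> h = h \<otimes> g"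
  shows "noether_number_rep G n \<rho> \<le> enat (order G div q + q - 1)"
proof -
  have q0: "of_nat q \<noteq> (0 :: 'k alg_closure)" by (rule of_nat_dvd_ne_0[OF prime_dvd_order[OF q g]])
  obtain w :: "'k alg_closure" where w: "w ^ q = 1" "w \<noteq> 1"
    using exists_nontrivial_root_of_unity[OF prime_gt_1_nat[OF q] q0] by (elim exE conjE)
  show ?thesis by (rule noether_number_rep_le[OF rank_two_bound[OF q q0 w g h comm]])
qed

lemma two_ne_0:
  assumes "i \<in> carrier G" "i [^] (4::nat) = \<one>" "i [^] (2::nat) \<noteq> \<one>"
  shows "(2 :: 'k alg_closure) \<noteq> 0"
proof -
  have "(i [^] (2::nat)) [^] (2::nat) = \<one>" using assms(1,2) by (simp add: nat_pow_pow)
  then have "2 dvd order G" using assms by (intro prime_dvd_order[OF two_is_prime_nat, of "i [^] (2::nat)"]) simp_all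
  from of_nat_dvd_ne_0[OF this] show ?thesis by simp
qed

lemma quaternion_noether_number:
  assumes i: "i \<in> carrier G" "i [^] (4::nat) = \<one>" "i [^] (2::nat) \<noteq> \<one>"
    and j: "j \<in> carrier G" "i \<otimes> j = j \<otimes> i [^] (3::nat)" "j \<otimes> j = i \<otimes> i"
  shows "noether_number_rep G n \<rho> \<le> enat (order G div 2 + 2)"
  by (rule noether_number_rep_le[OF quaternion_bound[OF two_ne_0[OF i] i j]])

lemma quaternion_cyclic_noether_number:
  assumes i: "i \<in> carrier G" "i [^] (4::nat) = \<one>" "i [^] (2::nat) \<noteq> \<one>"
    and j: "j \<in> carrier G" "i \<otimes> j = j \<otimes> i [^] (3::nat)" "j \<otimes> j = i \<otimes> i"
    and c: "c \<in> carrier G" "c \<otimes> i = i \<otimes> c" "c \<otimes> j = j \<otimes> c" "c [^] r = \<one>" "c \<noteq> \<one>"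
    and r: "Factorial_Ring.prime (r::nat)" "odd r"
  shows "noether_number_rep G n \<rho> \<le> enat (order G div 2 + 1)"
proof -
  have r0: "of_nat r \<noteq> (0 :: 'k alg_closure)"
    by (rule of_nat_dvd_ne_0[OF prime_dvd_order[OF r(1) c(1) c(4) c(5)]])
  obtain w :: "'k alg_closure" where w: "w ^ r = 1" "w \<noteq> 1"
    using exists_nontrivial_root_of_unity[OF prime_gt_1_nat[OF r(1)] r0] by (elim exE conjE)
  obtain u :: "'k alg_closure" where "u ^ 2 = - 1"
    using exists_root_alg_closed[of 2 "- 1 :: 'k alg_closure"] by auto
  then have u: "u * u = - 1" by (simp add: power2_eq_square)
  show ?thesis
    by (rule noether_number_rep_le[OF quaternion_cyclic_bound[OF two_ne_0[OF i] i j c r r0 w u]])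
qed

end

lemma noether_number_leI:
  assumes "\<And>n (\<rho> :: 'g \<Rightarrow> 'k::field mat). \<rho> \<in> representations G n \<Longrightarrow> noether_number_rep G n \<rho> \<le> enat d"
  shows "noether_number TYPE('k) G \<le> enat d"
  unfolding noether_number_def using assms by (intro Sup_least) auto

lemma (in group) dicyclic_noether_number_ge:
  assumes "is_dicyclic G" "\<not> CHAR('k::field) dvd order G"
  shows "enat (order G div 2 + 2) \<le> noether_number TYPE('k) G"
proof -
  obtain N a b where N: "N > 1" and gen: "dicyclic_generators N a b"
    using dicyclic_generators_if_is_dicyclic[OF assms(1)] by (elim exE conjE)
  have ord: "order G = 4 * N" using gen by (simp add: dicyclic_generators_def)
  have ord0: "of_nat (order G) \<noteq> (0::'k)" using assms(2) by (simp add: of_nat_eq_0_iff_char_dvd)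
  then have "to_ac (of_nat (order G)) \<noteq> (0 :: 'k alg_closure)" by (metis to_ac_0 to_ac_eq_iff)
  then have "of_nat (2 * (2 * N)) \<noteq> (0 :: 'k alg_closure)" by (simp add: ord)
  moreover have "of_nat (2 * (2 * N)) = (2 :: 'k alg_closure) * of_nat (2 * N)" by simp
  ultimately have "of_nat (2 * N) \<noteq> (0 :: 'k alg_closure)" by (metis mult_zero_right)
  then obtain z :: "'k alg_closure" where z: "\<And>j. z ^ j = 1 \<longleftrightarrow> 2 * N dvd j"
    using exists_primitive_root_of_unity[of "2 * N"] N by auto
  interpret R: dicyclic_regular G N a b z
    by unfold_locales (use gen N ord0 z in simp_all)
  have "enat (order G div 2 + 2) \<le> noether_number_rep G (4 * N) R.\<rho>"
    using R.noether_number_rep_ge by (simp add: ord)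
  also have "\<dots> \<le> noether_number TYPE('k) G"
    unfolding noether_number_def using R.rho_rep by (intro Sup_upper) auto
  finally show ?thesis .
qed

text \<open>For different primes \<open>M = p * q * t\<close>, and the claim is
  \<open>p * t + q \<le> q * t + p\<close>, that is
  \<open>(q - p) * (t - 1) \<ge> 0\<close>.\<close>

lemma prime_divisor_bound_mono:
  fixes p q M :: nat
  assumes "Factorial_Ring.prime p" "Factorial_Ring.prime q" "p dvd M" "q dvd M" "p \<le> q" "M > 0"
  shows "M div q + q - 1 \<le> M div p + p - 1"
proof (cases "p = q")
  case False
  then have "coprime p q" using assms(1,2) primes_coprime by blast
  then have "p * q dvd M" using assms(3,4) by (intro divides_mult)
  then obtain t where t: "M = p * q * t" by (rule dvdE)
  have "t \<noteq> 0" using t assms(6) by (intro notI) simp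
  then obtain s where s: "t = Suc s" by (cases t) simp_all
  obtain e where e: "q = p + e" using assms(5) le_Suc_ex by blast
  have p0: "p > 0" "q > 0" using assms(1,2) prime_gt_0_nat by blast+
  have "M = q * (p * t)" "M = p * (q * t)" by (simp_all add: t)
  then have "M div q = p * t" "M div p = q * t" using p0 by (metis nonzero_mult_div_cancel_left not_gr_zero)+
  moreover have "p * t + q \<le> q * t + p" by (simp add: s e algebra_simps)
  ultimately show ?thesis by simp
qed simp

theorem theorem1p5:
  fixes G :: "('g, 'b) monoid_scheme" and p :: nat
  assumes "group G" and "finite (carrier G)"
    and "\<not> cyclic_group G" and "nilpotent_group G"
    and "Factorial_Ring.prime p" and "p dvd order G"
    and "\<And>q. Factorial_Ring.prime q \<Longrightarrow> q dvd order G \<Longrightarrow> p \<le> q"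
    and "\<not> CHAR('k::field) dvd order G"
  shows "if p = 2 \<and> is_dicyclic G
         then noether_number TYPE('k) G = enat (order G div 2 + 2)
         else noether_number TYPE('k) G \<le> enat (order G div p + p - 1)"
proof -
  interpret group G by (rule assms(1))
  have rep: "closure_rep G n \<rho>" if "\<rho> \<in> representations G n" for n and \<rho> :: "'g \<Rightarrow> 'k mat"
    by (rule closure_rep_of_representation[OF assms(2,8) that])
  have ord0: "order G > 0" using assms(2) by (simp add: order_gt_0_iff_finite)
  \<comment> \<open>Upper bounds only. The first conjunct is what the dicyclic case needs, where
    equality comes from \<open>dicyclic_noether_number_ge\<close>.\<close>
  have "(p = 2 \<longrightarrow> noether_number TYPE('k) G \<le> enat (order G div 2 + 2)) \<and>
    (p = 2 \<and> is_dicyclic G \<or> noether_number TYPE('k) G \<le> enat (order G div p + p - 1))"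
  proof (cases rank_two_free)
    case True
    from nilpotent_structure[OF assms(2,4,3) True] obtain I J where
      I: "I \<in> carrier G" and J: "J \<in> carrier G" and I4: "I [^]\<^bsub>G\<^esub> (4::nat) = \<one>\<^bsub>G\<^esub>" and I2: "I [^]\<^bsub>G\<^esub> (2::nat) \<noteq> \<one>\<^bsub>G\<^esub>"
      and IJ: "I \<otimes>\<^bsub>G\<^esub> J = J \<otimes>\<^bsub>G\<^esub> I [^]\<^bsub>G\<^esub> (3::nat)" and JJ: "J \<otimes>\<^bsub>G\<^esub> J = I \<otimes>\<^bsub>G\<^esub> I"
      and alt: "(\<exists>z (r::nat). Factorial_Ring.prime r \<and> odd r \<and> z \<in> carrier G \<and> z [^]\<^bsub>G\<^esub> r = \<one>\<^bsub>G\<^esub> \<and> z \<noteq> \<one>\<^bsub>G\<^esub> \<and>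
          z \<otimes>\<^bsub>G\<^esub> I = I \<otimes>\<^bsub>G\<^esub> z \<and> z \<otimes>\<^bsub>G\<^esub> J = J \<otimes>\<^bsub>G\<^esub> z)
        \<or> (\<exists>N>1. \<exists>a. dicyclic_generators N a J)" by (elim exE conjE)
    \<comment> \<open>The square of \<open>I\<close> is an involution, so the smallest prime divisor
      of the order must be \<open>2\<close>.\<close>
    have "(I [^]\<^bsub>G\<^esub> (2::nat)) [^]\<^bsub>G\<^esub> (2::nat) = \<one>\<^bsub>G\<^esub>" using I I4 by (simp add: nat_pow_pow)
    then have "2 dvd order G"
      using I I2 by (intro prime_dvd_order[OF two_is_prime_nat, of "I [^]\<^bsub>G\<^esub> (2::nat)"]) simp_all
    then have "p \<le> 2" by (rule assms(7)[OF two_is_prime_nat])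
    then have p: "p = 2" using prime_ge_2_nat[OF assms(5)] by simp
    have "noether_number TYPE('k) G \<le> enat (order G div 2 + 2)"
      by (rule noether_number_leI, rule closure_rep.quaternion_noether_number[OF rep I I4 I2 J IJ JJ])
    moreover have "is_dicyclic G \<or> noether_number TYPE('k) G \<le> enat (order G div 2 + 1)"
      using alt
    proof
      assume "\<exists>N>1. \<exists>a. dicyclic_generators N a J"
      then obtain N a where "N > 1" "dicyclic_generators N a J" by (elim exE conjE)
      then show ?thesis using is_dicyclic_if_dicyclic_generators by (intro disjI1)
    next
      assume "\<exists>z (r::nat). Factorial_Ring.prime r \<and> odd r \<and> z \<in> carrier G \<and> z [^]\<^bsub>G\<^esub> r = \<one>\<^bsub>G\<^esub> \<and> z \<noteq> \<one>\<^bsub>G\<^esub> \<and>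
          z \<otimes>\<^bsub>G\<^esub> I = I \<otimes>\<^bsub>G\<^esub> z \<and> z \<otimes>\<^bsub>G\<^esub> J = J \<otimes>\<^bsub>G\<^esub> z"
      then obtain z and r :: nat where r: "Factorial_Ring.prime r" "odd r" and z: "z \<in> carrier G" "z [^]\<^bsub>G\<^esub> r = \<one>\<^bsub>G\<^esub>" "z \<noteq> \<one>\<^bsub>G\<^esub>"
        "z \<otimes>\<^bsub>G\<^esub> I = I \<otimes>\<^bsub>G\<^esub> z" "z \<otimes>\<^bsub>G\<^esub> J = J \<otimes>\<^bsub>G\<^esub> z" by (elim exE conjE)
      show ?thesis
        by (rule disjI2, rule noether_number_leI,
            rule closure_rep.quaternion_cyclic_noether_number[OF rep I I4 I2 J IJ JJ z(1,4,5,2,3) r])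
    qed
    ultimately show ?thesis by (simp add: p)
  next
    case False
    then obtain q :: nat and g h where q: "Factorial_Ring.prime q" and gh: "g \<in> carrier G" "g [^]\<^bsub>G\<^esub> q = \<one>\<^bsub>G\<^esub>" "g \<noteq> \<one>\<^bsub>G\<^esub>"
      "h \<in> carrier G" "h [^]\<^bsub>G\<^esub> q = \<one>\<^bsub>G\<^esub>" "h \<notin> generate G {g}" "g \<otimes>\<^bsub>G\<^esub> h = h \<otimes>\<^bsub>G\<^esub> g"
      unfolding rank_two_free_def by auto
    have q_dvd: "q dvd order G" by (rule prime_dvd_order[OF q gh(1-3)])
    have "noether_number TYPE('k) G \<le> enat (order G div q + q - 1)"
      by (rule noether_number_leI, rule closure_rep.rank_two_noether_number[OF rep q gh])
    also have "order G div q + q - 1 \<le> order G div p + p - 1"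
      by (rule prime_divisor_bound_mono[OF assms(5) q assms(6) q_dvd assms(7)[OF q q_dvd] ord0])
    finally have le: "noether_number TYPE('k) G \<le> enat (order G div p + p - 1)" by simp
    moreover have "noether_number TYPE('k) G \<le> enat (order G div 2 + 2)" if "p = 2"
      using order_trans[OF le, of "enat (order G div 2 + 2)"] that by simp
    ultimately show ?thesis by simp
  qed
  then show ?thesis using dicyclic_noether_number_ge[OF _ assms(8)] by (auto intro: antisym)
qed

end
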